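(* For each dimension $d\ge 2$ there is an appropriate constant $C_d>0$ depending only on $d$ such that the following holds. Let $0<T\le\infty$, $\alpha,\beta>0$, and set $$K_\beta=C_d\Big[\|b_2\|_{L^1(\mathbb{S}^{d-1})}\Big(\beta^{-d/2}+\frac{1}{d+\gamma_2-1}\Big)+\|b_3\|_{L^1(\mathbb{S}^{2d-1})}\Big(\beta^{-d}+\frac{1}{2d+\gamma_3-1}\Big)\Big]>0 .$$ Then for any initial data $f_0\in\mathcal{M}_{\alpha,\beta}^+$ with $$\|f_0\|_{\mathcal{M}_{\alpha,\beta}}<\frac{\alpha^{1/2}}{48K_\beta\Big(1+\frac{\alpha^{1/4}}{2\sqrt{6K_\beta}}\Big)},$$ the binary-ternary Boltzmann equation $\partial_t f+v\cdot\nabla_x f=Q_2(f,f)+Q_3(f,f,f)$, $f(0)=f_0$, has a unique mild solution $f$ in $[0,T)$ satisfying the bound $$|||f^\#|||_\infty\le \frac{1-\sqrt{1-48K_\beta\alpha^{-1/2}\Big(1+\frac{\alpha^{1/4}}{2\sqrt{6K_\beta}}\Big)\|f_0\|_{\mathcal{M}_{\alpha,\beta}}}}{24K_\beta\alpha^{-1/2}\Big(1+\frac{\alpha^{1/4}}{2\sqrt{6K_\beta}}\Big)} .$$ (Uniqueness is in the class of mild solutions satisfying this bound.)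
   Context: Collision kernels. Fix $d\ge2$, $\gamma_2\in(-d+1,1]$, $\gamma_3\in(-2d+1,1]$. Let $b_2:[-1,1]\to[0,\infty)$ be measurable, even, with $\|b_2\|_{L^1(\mathbb{S}^{d-1})}:=|\mathbb{S}^{d-2}|\int_{-1}^1 b_2(z)(1-z^2)^{\frac{d-3}{2}}dz<\infty$ (this equals $\int_{\mathbb{S}^{d-1}}b_2(e\cdot\omega)\,d\omega$ for any unit vector $e$). Let $b_3:[-1,1]\times[-\frac12,\frac12]\to[0,\infty)$ be measurable, with $b_3(-z,w)=b_3(z,w)$ and $\|b_3\|_{L^1(\mathbb{S}^{2d-1})}:=\sup_{\boldsymbol\nu\in\mathbb{E}^{2d-1}}\int_{\mathbb{S}^{2d-1}}b_3(\boldsymbol\nu\cdot\boldsymbol\omega,\omega_1\cdot\omega_2)\,d\boldsymbol\omega<\infty$, where $\boldsymbol\omega=(\omega_1,\omega_2)\in\mathbb{S}^{2d-1}\subset\mathbb{R}^d\times\mathbb{R}^d$ and $\mathbb{E}^{2d-1}=\{(\nu_1,\nu_2)\in\mathbb{R}^{2d}:|\nu_1|^2+|\nu_2|^2+|\nu_1-\nu_2|^2=1\}$. No normalization of $b_2,b_3$ is imposed; at least one of $b_2,b_3$ is not trivially zero, so that $\|b_2\|_{L^1(\mathbb{S}^{d-1})}+\|b_3\|_{L^1(\mathbb{S}^{2d-1})}>0$. Binary: for $v,v_1\in\mathbb{R}^d$, $\omega\in\mathbb{S}^{d-1}$, put $u=v_1-v$, $\hat u=u/|u|$, $B_2(u,\omega)=|u|^{\gamma_2}b_2(\hat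 u\cdot\omega)$, $v'=v+(\omega\cdot u)\omega$, $v_1'=v_1-(\omega\cdot u)\omega$. Ternary: for $v,v_1,v_2\in\mathbb{R}^d$, $\boldsymbol\omega=(\omega_1,\omega_2)\in\mathbb{S}^{2d-1}$, put $\boldsymbol u=(v_1-v,v_2-v)\in\mathbb{R}^{2d}$, $|\widetilde{\boldsymbol u}|=\sqrt{|v-v_1|^2+|v-v_2|^2+|v_1-v_2|^2}$, $\bar{\boldsymbol u}=\boldsymbol u/|\widetilde{\boldsymbol u}|$, $B_3(\boldsymbol u,\boldsymbol\omega)=|\widetilde{\boldsymbol u}|^{\gamma_3}b_3(\bar{\boldsymbol u}\cdot\boldsymbol\omega,\omega_1\cdot\omega_2)$, and with $c=\frac{\omega_1\cdot(v_1-v)+\omega_2\cdot(v_2-v)}{1+\omega_1\cdot\omega_2}$: $v^*=v+c(\omega_1+\omega_2)$, $v_1^*=v_1-c\,\omega_1$, $v_2^*=v_2-c\,\omega_2$. Operators (functions of $(t,x,v)$; $t,x$ suppressed): $G_2(f,g)(v)=\int_{\mathbb{S}^{d-1}\times\mathbb{R}^d}B_2 f(v')g(v_1')\,d\omega dv_1$, $L_2(f,g)(v)=\int_{\mathbb{S}^{d-1}\times\mathbb{R}^d} B_2 f(v)g(v_1)\,d\omega dv_1$, $G_3(f,g,h)(v)=\int_{\mathbb{S}^{2d-1}\times\mathbb{R}^{2d}}B_3 f(v^* )g(v_1^* )h(v_2^* )\,d\boldsymbol\omega dv_1dv_2$, $L_3(f,g,h)(v)=\int_{\mathbb{S}^{2d-1}\times\mathbb{R}^{2d}}B_3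 f(v)g(v_1)h(v_2)\,d\boldsymbol\omega dv_1dv_2$; $G(f,g,h)=G_2(f,g)+G_3(f,g,h)$, $L(f,g,h)=L_2(f,g)+L_3(f,g,h)$; $Q_2=G_2-L_2$, $Q_3=G_3-L_3$. Function spaces. $F_{x,v}$: measurable functions $\mathbb{R}^d\times\mathbb{R}^d\to\overline{\mathbb{R}}$; $F_{x,v}^+$: those that are a.e. nonnegative; (in)equalities in $F_{x,v}$ are a.e. $L^1_{x,v}=L^1(\mathbb{R}^d\times\mathbb{R}^d)$, $L^{1,+}_{x,v}=L^1_{x,v}\cap F^+_{x,v}$. $M_{\alpha,\beta}(x,v)=e^{-\alpha|x|^2-\beta|v|^2}$, $\|f\|_{\mathcal{M}_{\alpha,\beta}}=\|fM_{\alpha,\beta}^{-1}\|_{L^\infty(\mathbb{R}^d\times\mathbb{R}^d)}$, $\mathcal{M}_{\alpha,\beta}=\{f\in F_{x,v}:\|f\|_{\mathcal{M}_{\alpha,\beta}}<\infty\}$, $\mathcal{M}_{\alpha,\beta}^+=\mathcal{M}_{\alpha,\beta}\cap F_{x,v}^+$. $\mathcal{F}_T=\{f:[0,T)\to F_{x,v}\}$, $\mathcal{F}_T^+=\{f:[0,T)\to F^+_{x,v}\}$. $|||f|||_\infty=\sup_{t\in[0,T)}\|f(t)\|_{\mathcal{M}_{\alpha,\beta}}$ (supremum over all $t$); $L^\infty([0,T),\mathcal{M}_{\alpha,\beta}^+)=\{f\in\mathcal{F}_T^+:|||f|||_\infty<\infty\}$. $C^0([0,T),L^{1,+}_{x,v})$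 and $L^\infty([0,T),L^{1,+}_{x,v})$ are the intersections of $C^0([0,T),L^1_{x,v})$, $L^\infty([0,T),L^1_{x,v})$ with $\mathcal{F}_T^+$. Transport. For $f\in\mathcal{F}_T$, $f^\#(t,x,v)=f(t,x+tv,v)$; $L^\#(f,g,h)=(L(f,g,h))^\#$, $G^\#(f,g,h)=(G(f,g,h))^\#$. Mild solution. For $f_0\in\mathcal{M}_{\alpha,\beta}^+$, a mild solution in $[0,T)$ with initial data $f_0$ is $f\in\mathcal{F}_T^+$ such that (i) $f^\#\in C^0([0,T),L^{1,+}_{x,v})\cap L^\infty([0,T),\mathcal{M}_{\alpha,\beta}^+)$; (ii) $L^\#(f,f,f),G^\#(f,f,f)\in L^\infty([0,T),L^{1,+}_{x,v})$; (iii) $f^\#$ is weakly differentiable in $t$ (as an $L^1_{x,v}$-valued distribution) and $\frac{df^\#}{dt}+L^\#(f,f,f)=G^\#(f,f,f)$, $f^\#(0)=f_0$. *)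

theory Defs
  imports "HOL-Probability.Essential_Supremum"
begin

section \<open>Surface measure\<close>

text \<open>
  Surface measure on the unit sphere, carried by the Borel sets of the whole space: a Borel subset
  \<open>A\<close> of the sphere of \<open>\<real>\<^sup>d\<close> gets the mass \<open>d * |{r *\<^sub>R \<omega> | 0 < r < 1, \<omega> \<in> A}|\<close>
  (polar coordinates; \<open>sgn x = x /\<^sub>R norm x\<close>, and the value at the origin is irrelevant).
\<close>

definition sphere_measure :: "'a::euclidean_space measure" where
  "sphere_measure =
     scale_measure (of_nat DIM('a)) (distr (restrict_space lborel (ball 0 1)) borel sgn)"

lemma emeasure_sphere_measure:
  assumes "A \<in> sets borel"
  shows "emeasure (sphere_measure :: 'a::euclidean_space measure) A =
           of_nat DIM('a) * emeasure lborel {x. norm x < 1 \<and> sgn x \<in> A}"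
proof -
  have [measurable]: "(sgn :: 'a \<Rightarrow> 'a) \<in> borel_measurable borel"
    unfolding sgn_div_norm by measurable
  have [measurable]: "(sgn :: 'a \<Rightarrow> 'a) \<in> measurable (restrict_space lborel (ball 0 1)) borel"
    by (rule measurable_restrict_space1) simp
  have "sgn -` A \<inter> ball 0 1 = {x::'a. norm x < 1 \<and> sgn x \<in> A}"
    by auto
  moreover have "emeasure (restrict_space lborel (ball 0 1)) {x::'a. norm x < 1 \<and> sgn x \<in> A} =
      emeasure lborel {x::'a. norm x < 1 \<and> sgn x \<in> A}"
    by (rule emeasure_restrict_space) auto
  ultimately show ?thesis
    using assms by (simp add: sphere_measure_def emeasure_distr space_restrict_space)
qed

section \<open>Collision kernels\<close>

text \<open>
  The factor \<open>(d - 1) * unit_ball_vol (d - 1)\<close> is the surface area of the unit sphere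
  of \<open>\<real>\<^sup>d\<^sup>-\<^sup>1\<close>; it equals 2 for \<open>d = 2\<close>.
\<close>

definition b2_norm :: "'a::euclidean_space itself \<Rightarrow> (real \<Rightarrow> real) \<Rightarrow> ennreal" where
  "b2_norm _ b = (let d = real DIM('a) in
     ennreal ((d - 1) * unit_ball_vol (d - 1)) *
     (\<integral>\<^sup>+ z \<in> {-1..1}. ennreal (b z * (1 - z\<^sup>2) powr ((d - 3) / 2)) \<partial>lborel))"

definition ellipsoid :: "('a::euclidean_space \<times> 'a) set" where
  "ellipsoid = {(\<nu>1, \<nu>2). (norm \<nu>1)\<^sup>2 + (norm \<nu>2)\<^sup>2 + (norm (\<nu>1 - \<nu>2))\<^sup>2 = 1}"

definition b3_norm :: "'a::euclidean_space itself \<Rightarrow> (real \<times> real \<Rightarrow> real) \<Rightarrow> ennreal" where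
  "b3_norm _ b = (SUP \<nu> \<in> (ellipsoid :: ('a \<times> 'a) set).
     \<integral>\<^sup>+ \<omega>. ennreal (b (\<nu> \<bullet> \<omega>, fst \<omega> \<bullet> snd \<omega>)) \<partial>sphere_measure)"

text \<open>
  The angular kernels are total functions of which only the values on \<open>[-1,1]\<close>, respectively
  \<open>[-1,1] \<times> [-1/2,1/2]\<close>, matter.
\<close>

definition binary_kernel :: "'a::euclidean_space itself \<Rightarrow> real \<Rightarrow> (real \<Rightarrow> real) \<Rightarrow> bool" where
  "binary_kernel _ \<gamma> b \<longleftrightarrow>
     - real DIM('a) + 1 < \<gamma> \<and> \<gamma> \<le> 1 \<and>
     b \<in> borel_measurable (restrict_space borel {-1..1}) \<and>
     (\<forall>z\<in>{-1..1}. 0 \<le> b z \<and> b (- z) = b z) \<and>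
     b2_norm TYPE('a) b < \<infinity>"

definition ternary_kernel :: "'a::euclidean_space itself \<Rightarrow> real \<Rightarrow> (real \<times> real \<Rightarrow> real) \<Rightarrow> bool" where
  "ternary_kernel _ \<gamma> b \<longleftrightarrow>
     - 2 * real DIM('a) + 1 < \<gamma> \<and> \<gamma> \<le> 1 \<and>
     b \<in> borel_measurable (restrict_space borel ({-1..1} \<times> {-1/2..1/2})) \<and>
     (\<forall>z\<in>{-1..1}. \<forall>w\<in>{-1/2..1/2}. 0 \<le> b (z, w) \<and> b (- z, w) = b (z, w)) \<and>
     b3_norm TYPE('a) b < \<infinity>"

definition B2 :: "real \<Rightarrow> (real \<Rightarrow> real) \<Rightarrow> 'a::euclidean_space \<Rightarrow> 'a \<Rightarrow> real" where
  "B2 \<gamma> b u \<omega> = norm u powr \<gamma> * b (sgn u \<bullet> \<omega>)"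

definition unorm :: "'a::euclidean_space \<times> 'a \<Rightarrow> real" where
  "unorm u = sqrt ((norm (fst u))\<^sup>2 + (norm (snd u))\<^sup>2 + (norm (fst u - snd u))\<^sup>2)"

definition B3 :: "real \<Rightarrow> (real \<times> real \<Rightarrow> real) \<Rightarrow> 'a::euclidean_space \<times> 'a \<Rightarrow> 'a \<times> 'a \<Rightarrow> real" where
  "B3 \<gamma> b u \<omega> = unorm u powr \<gamma> * b ((u /\<^sub>R unorm u) \<bullet> \<omega>, fst \<omega> \<bullet> snd \<omega>)"

section \<open>Collision operators\<close>

text \<open>
  The operators act on functions of the velocity that are nonnegative almost everywhere, so that
  their integrals are Lebesgue integrals with values in \<open>[0,\<infinity>]\<close>.
\<close>

definition G2 :: "real \<Rightarrow> (real \<Rightarrow> real) \<Rightarrow> ('a::euclidean_space \<Rightarrow> ereal) \<Rightarrow> ('a \<Rightarrow> ereal) \<Rightarrow> 'a \<Rightarrow> ereal" where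
  "G2 \<gamma> b f g v = enn2ereal (\<integral>\<^sup>+ (\<omega>, v1).
     (let u = v1 - v; v' = v + (\<omega> \<bullet> u) *\<^sub>R \<omega>; v1' = v1 - (\<omega> \<bullet> u) *\<^sub>R \<omega>
      in e2ennreal (ereal (B2 \<gamma> b u \<omega>) * f v' * g v1'))
     \<partial>(sphere_measure \<Otimes>\<^sub>M lborel))"

definition L2 :: "real \<Rightarrow> (real \<Rightarrow> real) \<Rightarrow> ('a::euclidean_space \<Rightarrow> ereal) \<Rightarrow> ('a \<Rightarrow> ereal) \<Rightarrow> 'a \<Rightarrow> ereal" where
  "L2 \<gamma> b f g v = enn2ereal (\<integral>\<^sup>+ (\<omega>, v1).
     e2ennreal (ereal (B2 \<gamma> b (v1 - v) \<omega>) * f v * g v1)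
     \<partial>(sphere_measure \<Otimes>\<^sub>M lborel))"

definition G3 :: "real \<Rightarrow> (real \<times> real \<Rightarrow> real) \<Rightarrow> ('a::euclidean_space \<Rightarrow> ereal) \<Rightarrow> ('a \<Rightarrow> ereal) \<Rightarrow>
    ('a \<Rightarrow> ereal) \<Rightarrow> 'a \<Rightarrow> ereal" where
  "G3 \<gamma> b f g h v = enn2ereal (\<integral>\<^sup>+ ((\<omega>1, \<omega>2), (v1, v2)).
     (let c = (\<omega>1 \<bullet> (v1 - v) + \<omega>2 \<bullet> (v2 - v)) / (1 + \<omega>1 \<bullet> \<omega>2);
          vs = v + c *\<^sub>R (\<omega>1 + \<omega>2); v1s = v1 - c *\<^sub>R \<omega>1; v2s = v2 - c *\<^sub>R \<omega>2
      in e2ennreal (ereal (B3 \<gamma> b (v1 - v, v2 - v) (\<omega>1, \<omega>2)) * f vs * g v1s * h v2s))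
     \<partial>(sphere_measure \<Otimes>\<^sub>M lborel))"

definition L3 :: "real \<Rightarrow> (real \<times> real \<Rightarrow> real) \<Rightarrow> ('a::euclidean_space \<Rightarrow> ereal) \<Rightarrow> ('a \<Rightarrow> ereal) \<Rightarrow>
    ('a \<Rightarrow> ereal) \<Rightarrow> 'a \<Rightarrow> ereal" where
  "L3 \<gamma> b f g h v = enn2ereal (\<integral>\<^sup>+ (\<omega>, (v1, v2)).
     e2ennreal (ereal (B3 \<gamma> b (v1 - v, v2 - v) \<omega>) * f v * g v1 * h v2)
     \<partial>(sphere_measure \<Otimes>\<^sub>M lborel))"

type_synonym 'a phase_fun = "'a \<times> 'a \<Rightarrow> ereal"

definition gain :: "real \<Rightarrow> (real \<Rightarrow> real) \<Rightarrow> real \<Rightarrow> (real \<times> real \<Rightarrow> real) \<Rightarrow>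
    'a::euclidean_space phase_fun \<Rightarrow> 'a phase_fun \<Rightarrow> 'a phase_fun \<Rightarrow> 'a phase_fun" where
  "gain \<gamma>2 b2 \<gamma>3 b3 f g h = (\<lambda>(x, v).
     G2 \<gamma>2 b2 (\<lambda>w. f (x, w)) (\<lambda>w. g (x, w)) v +
     G3 \<gamma>3 b3 (\<lambda>w. f (x, w)) (\<lambda>w. g (x, w)) (\<lambda>w. h (x, w)) v)"

definition loss :: "real \<Rightarrow> (real \<Rightarrow> real) \<Rightarrow> real \<Rightarrow> (real \<times> real \<Rightarrow> real) \<Rightarrow>
    'a::euclidean_space phase_fun \<Rightarrow> 'a phase_fun \<Rightarrow> 'a phase_fun \<Rightarrow> 'a phase_fun" where
  "loss \<gamma>2 b2 \<gamma>3 b3 f g h = (\<lambda>(x, v).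
     L2 \<gamma>2 b2 (\<lambda>w. f (x, w)) (\<lambda>w. g (x, w)) v +
     L3 \<gamma>3 b3 (\<lambda>w. f (x, w)) (\<lambda>w. g (x, w)) (\<lambda>w. h (x, w)) v)"

section \<open>Function spaces\<close>

text \<open>
  Elements of the spaces are Borel representatives; equality and order are understood almost
  everywhere throughout.
\<close>

definition F_xv :: "'a::euclidean_space phase_fun set" where
  "F_xv = borel_measurable lborel"

definition F_xv_pos :: "'a::euclidean_space phase_fun set" where
  "F_xv_pos = {f \<in> F_xv. AE z in lborel. 0 \<le> f z}"

definition L1_norm :: "'a::euclidean_space phase_fun \<Rightarrow> ennreal" where
  "L1_norm f = (\<integral>\<^sup>+ z. e2ennreal \<bar>f z\<bar> \<partial>lborel)"

definition L1_xv :: "'a::euclidean_space phase_fun set" where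
  "L1_xv = {f \<in> F_xv. L1_norm f < \<infinity>}"

definition maxwellian :: "real \<Rightarrow> real \<Rightarrow> 'a::euclidean_space \<times> 'a \<Rightarrow> real" where
  "maxwellian \<alpha> \<beta> = (\<lambda>(x, v). exp (- \<alpha> * (norm x)\<^sup>2 - \<beta> * (norm v)\<^sup>2))"

definition M_norm :: "real \<Rightarrow> real \<Rightarrow> 'a::euclidean_space phase_fun \<Rightarrow> ereal" where
  "M_norm \<alpha> \<beta> f = esssup lborel (\<lambda>z. \<bar>f z / ereal (maxwellian \<alpha> \<beta> z)\<bar>)"

definition M_space :: "real \<Rightarrow> real \<Rightarrow> 'a::euclidean_space phase_fun set" where
  "M_space \<alpha> \<beta> = {f \<in> F_xv. M_norm \<alpha> \<beta> f < \<infinity>}"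

definition M_space_pos :: "real \<Rightarrow> real \<Rightarrow> 'a::euclidean_space phase_fun set" where
  "M_space_pos \<alpha> \<beta> = M_space \<alpha> \<beta> \<inter> F_xv_pos"

section \<open>Time-dependent functions\<close>

definition time_set :: "ereal \<Rightarrow> real set" where
  "time_set T = {t. 0 \<le> t \<and> ereal t < T}"

definition F_T_pos :: "ereal \<Rightarrow> (real \<Rightarrow> 'a::euclidean_space phase_fun) set" where
  "F_T_pos T = {f. \<forall>t\<in>time_set T. f t \<in> F_xv_pos}"

definition sup_norm :: "ereal \<Rightarrow> real \<Rightarrow> real \<Rightarrow> (real \<Rightarrow> 'a::euclidean_space phase_fun) \<Rightarrow> ereal" where
  "sup_norm T \<alpha> \<beta> f = (SUP t \<in> time_set T. M_norm \<alpha> \<beta> (f t))"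

definition Linf_M_pos :: "ereal \<Rightarrow> real \<Rightarrow> real \<Rightarrow> (real \<Rightarrow> 'a::euclidean_space phase_fun) set" where
  "Linf_M_pos T \<alpha> \<beta> = {f \<in> F_T_pos T. sup_norm T \<alpha> \<beta> f < \<infinity>}"

definition C0_L1_pos :: "ereal \<Rightarrow> (real \<Rightarrow> 'a::euclidean_space phase_fun) set" where
  "C0_L1_pos T = {f \<in> F_T_pos T. \<forall>t\<in>time_set T. f t \<in> L1_xv \<and>
     ((\<lambda>s. L1_norm (\<lambda>z. f s z - f t z)) \<longlongrightarrow> 0) (at t within time_set T)}"

text \<open>Bochner measurability and the Bochner integral for functions of time with values in
  \<open>L\<^sup>1(\<real>\<^sup>d \<times> \<real>\<^sup>d)\<close>, by approximation with simple functions.\<close>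

definition L1_simple :: "real set \<Rightarrow> (real \<Rightarrow> 'a::euclidean_space phase_fun) \<Rightarrow> bool" where
  "L1_simple I s \<longleftrightarrow> simple_function (restrict_space lborel I) s \<and> (\<forall>t\<in>I. s t \<in> L1_xv) \<and>
     emeasure lborel {t \<in> I. s t \<noteq> (\<lambda>z. 0)} < \<infinity>"

definition L1_simple_integral :: "real set \<Rightarrow> (real \<Rightarrow> 'a::euclidean_space phase_fun) \<Rightarrow> 'a phase_fun" where
  "L1_simple_integral I s =
     (\<lambda>z. \<Sum>y \<in> s ` I. ereal (measure lborel {t \<in> I. s t = y}) * y z)"

definition L1_strongly_measurable :: "real set \<Rightarrow> (real \<Rightarrow> 'a::euclidean_space phase_fun) \<Rightarrow> bool" where
  "L1_strongly_measurable I f \<longleftrightarrow> (\<exists>s. (\<forall>n::nat. L1_simple I (s n)) \<and>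
     (AE t in lborel. t \<in> I \<longrightarrow> f t \<in> L1_xv \<and> (\<lambda>n. L1_norm (\<lambda>z. f t z - s n t z)) \<longlonglongrightarrow> 0))"

definition has_L1_integral ::
    "real set \<Rightarrow> (real \<Rightarrow> 'a::euclidean_space phase_fun) \<Rightarrow> 'a phase_fun \<Rightarrow> bool" where
  "has_L1_integral I f J \<longleftrightarrow> L1_strongly_measurable I f \<and> J \<in> L1_xv \<and>
     (\<exists>s. (\<forall>n::nat. L1_simple I (s n)) \<and>
       (\<lambda>n. \<integral>\<^sup>+ t \<in> I. L1_norm (\<lambda>z. f t z - s n t z) \<partial>lborel) \<longlonglongrightarrow> 0 \<and>
       (\<lambda>n. L1_norm (\<lambda>z. J z - L1_simple_integral I (s n) z)) \<longlonglongrightarrow> 0)"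

definition Linf_L1_pos :: "ereal \<Rightarrow> (real \<Rightarrow> 'a::euclidean_space phase_fun) set" where
  "Linf_L1_pos T = {f \<in> F_T_pos T. L1_strongly_measurable (time_set T) f \<and>
     (\<exists>C::real. AE t in lborel. t \<in> time_set T \<longrightarrow> L1_norm (f t) \<le> ennreal C)}"

definition test_function :: "ereal \<Rightarrow> (real \<Rightarrow> real) \<Rightarrow> bool" where
  "test_function T \<phi> \<longleftrightarrow> (\<forall>k t. (deriv ^^ k) \<phi> differentiable at t) \<and>
     (\<exists>S. compact S \<and> S \<subseteq> {t. 0 < t \<and> ereal t < T} \<and> (\<forall>t. t \<notin> S \<longrightarrow> \<phi> t = 0))"

text \<open>\<open>h\<close> is the derivative of \<open>f\<close> in the sense of \<open>L\<^sup>1\<close>-valued distributions on \<open>(0,T)\<close>.\<close>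

definition has_weak_time_derivative :: "ereal \<Rightarrow> (real \<Rightarrow> 'a::euclidean_space phase_fun) \<Rightarrow>
    (real \<Rightarrow> 'a phase_fun) \<Rightarrow> bool" where
  "has_weak_time_derivative T f h \<longleftrightarrow> (\<forall>\<phi>. test_function T \<phi> \<longrightarrow>
     (\<exists>J1 J2. has_L1_integral (time_set T) (\<lambda>t z. ereal (deriv \<phi> t) * f t z) J1 \<and>
              has_L1_integral (time_set T) (\<lambda>t z. ereal (\<phi> t) * h t z) J2 \<and>
              (AE z in lborel. J2 z = - J1 z)))"

section \<open>Mild solutions\<close>

definition transport :: "(real \<Rightarrow> 'a::euclidean_space phase_fun) \<Rightarrow> real \<Rightarrow> 'a phase_fun" where
  "transport f = (\<lambda>t (x, v). f t (x + t *\<^sub>R v, v))"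

definition gain_sharp :: "real \<Rightarrow> (real \<Rightarrow> real) \<Rightarrow> real \<Rightarrow> (real \<times> real \<Rightarrow> real) \<Rightarrow>
    (real \<Rightarrow> 'a::euclidean_space phase_fun) \<Rightarrow> real \<Rightarrow> 'a phase_fun" where
  "gain_sharp \<gamma>2 b2 \<gamma>3 b3 f = transport (\<lambda>t. gain \<gamma>2 b2 \<gamma>3 b3 (f t) (f t) (f t))"

definition loss_sharp :: "real \<Rightarrow> (real \<Rightarrow> real) \<Rightarrow> real \<Rightarrow> (real \<times> real \<Rightarrow> real) \<Rightarrow>
    (real \<Rightarrow> 'a::euclidean_space phase_fun) \<Rightarrow> real \<Rightarrow> 'a phase_fun" where
  "loss_sharp \<gamma>2 b2 \<gamma>3 b3 f = transport (\<lambda>t. loss \<gamma>2 b2 \<gamma>3 b3 (f t) (f t) (f t))"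

definition mild_solution :: "real \<Rightarrow> (real \<Rightarrow> real) \<Rightarrow> real \<Rightarrow> (real \<times> real \<Rightarrow> real) \<Rightarrow>
    real \<Rightarrow> real \<Rightarrow> ereal \<Rightarrow> 'a::euclidean_space phase_fun \<Rightarrow> (real \<Rightarrow> 'a phase_fun) \<Rightarrow> bool" where
  "mild_solution \<gamma>2 b2 \<gamma>3 b3 \<alpha> \<beta> T f0 f \<longleftrightarrow>
     f \<in> F_T_pos T \<and>
     transport f \<in> C0_L1_pos T \<inter> Linf_M_pos T \<alpha> \<beta> \<and>
     loss_sharp \<gamma>2 b2 \<gamma>3 b3 f \<in> Linf_L1_pos T \<and>
     gain_sharp \<gamma>2 b2 \<gamma>3 b3 f \<in> Linf_L1_pos T \<and>
     (\<exists>h. has_weak_time_derivative T (transport f) h \<and>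
       (AE t in lborel. t \<in> time_set T \<longrightarrow>
         (AE z in lborel. h t z + loss_sharp \<gamma>2 b2 \<gamma>3 b3 f t z = gain_sharp \<gamma>2 b2 \<gamma>3 b3 f t z))) \<and>
     (AE z in lborel. transport f 0 z = f0 z)"

definition K_const :: "'a::euclidean_space itself \<Rightarrow> real \<Rightarrow> real \<Rightarrow> (real \<Rightarrow> real) \<Rightarrow> real \<Rightarrow>
    (real \<times> real \<Rightarrow> real) \<Rightarrow> real \<Rightarrow> real" where
  "K_const _ C \<gamma>2 b2 \<gamma>3 b3 \<beta> = (let d = real DIM('a) in
     C * (enn2real (b2_norm TYPE('a) b2) * (\<beta> powr (- d / 2) + 1 / (d + \<gamma>2 - 1)) +
          enn2real (b3_norm TYPE('a) b3) * (\<beta> powr (- d) + 1 / (2 * d + \<gamma>3 - 1))))"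

end

theory Submission
  imports Defs "HOL-Probability.Distributions" "HOL-Computational_Algebra.Polynomial"
begin

text \<open>
  In coordinates that move with the free flow the equation is an ordinary differential equation in
  time at each phase point \<open>z = (x, v)\<close>. Its right-hand side, gain minus loss, is estimated in the
  norm weighted by the Maxwellian \<open>M\<close>, and everything rests on one estimate: for densities
  bounded by \<open>R * M\<close> the collision terms, integrated over \<^emph>\<open>all\<close> times at a fixed \<open>z\<close>, are at most
  \<open>R ^ 2 * \<kappa>2 * M z\<close> (binary) and \<open>R ^ 3 * \<kappa>3 * M z\<close> (ternary). The reason, in
  \<open>weight_time_integral\<close>, is that by conservation of momentum and energy the product of the
  Maxwellians at the collision points is \<open>M z\<close> times a Gaussian in the velocities \<open>w\<close> of the partners
  times a Gaussian of the point \<open>x + t *\<^sub>R (v - w)\<close>. Integration in time costs the inverse of the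
  relative speed. The kernel \<open>\<bar>u\<bar> powr \<gamma>\<close> thus becomes \<open>\<bar>u\<bar> powr (\<gamma> - 1)\<close>, and the
  conditions on \<open>\<gamma>\<close> say precisely that this exponent lies above minus the dimension and is not
  positive. A ternary collision is treated like a binary one whose partner has a velocity in twice the
  dimension; the locale \<open>collision\<close> covers gain and loss for both. The surface integral of \<open>b2\<close> is
  computed in \<open>nn_integral_sphere_inner\<close>.

  Existence. By this estimate the right-hand side of the integrated equation is a contraction of the
  functions between 0 and \<open>R * M\<close>, where \<open>R\<close> is the bound of the theorem, the smaller root of a
  quadratic equation (\<open>contraction_radius\<close>). Since the loss term is negative, the positive part of
  the right-hand side is iterated. The positive part is inactive in the limit, because the loss term
  vanishes where the density does (\<open>solution_exists\<close>).

  Uniqueness. A mild solution is merely a continuous curve in \<open>L\<^sup>1\<close> that solves the equation weakly,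
  with Bochner integrals. It has a jointly measurable representative (\<open>joint_representation\<close>), its
  Bochner integrals are pointwise Lebesgue integrals (\<open>has_L1_integral_eq_lebesgue\<close>), and testing
  with smooth approximations of indicators of time intervals gives the integrated equation
  (\<open>weak_solution_integral_form\<close>). The contraction then identifies it with the solution above
  (\<open>solution_unique\<close>). Equality almost everywhere passes through the collision operators because the
  maps to the collision points extend to injective linear maps of all the variables, and so avoid
  null sets (\<open>AE_collision_points\<close>).
\<close>

section \<open>Gaussian integrals and singular kernels\<close>

text \<open>
  Both measures give \<open>c * r ^ k\<close> to the half-line \<open>{..r}\<close> for \<open>r > 0\<close> and 0 otherwise, and
  half-lines generate the Borel sets. The law is applied to the norm of a Euclidean space and to the distance
  from an axis.
\<close>

lemma distr_power_law:
  fixes N :: "'b \<Rightarrow> real"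
  assumes [measurable]: "N \<in> borel_measurable M" and nn: "\<And>x. x \<in> space M \<Longrightarrow> 0 \<le> N x"
    and k: "0 < k" and c: "0 \<le> c"
    and vol: "\<And>r. 0 < r \<Longrightarrow> emeasure M {x \<in> space M. N x \<le> r} = ennreal (c * r ^ k)"
  shows "distr M borel N = density lborel (\<lambda>r. ennreal (indicator {0<..} r * (c * real k * r ^ (k - 1))))"
    (is "?L = density lborel ?f")
proof (rule measure_eqI_generator_eq[where E="range (\<lambda>r::real. {..r})" and \<Omega>=UNIV and A="\<lambda>n. {..real n}"])
  show "Int_stable (range (\<lambda>r::real. {..r}))"
    by (auto simp: Int_stable_def)
  have dens: "emeasure (density lborel ?f) {..r} = ennreal (c * r ^ k)" if "0 < r" for r :: real
  proof -
    have "emeasure (density lborel ?f) {..r} = (\<integral>\<^sup>+ t. ?f t * indicator {..r} t \<partial>lborel)"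
      by (subst emeasure_density) auto
    also have "\<dots> = (\<integral>\<^sup>+ t. ennreal (c * real k * t ^ (k - 1)) * indicator {0..r} t \<partial>lborel)"
      by (intro nn_integral_cong_AE AE_I[of _ _ "{0}"]) (auto simp: indicator_def)
    also have "\<dots> = ennreal (c * r ^ k - c * 0 ^ k)"
      using that k c
      by (intro nn_integral_FTC_Icc) (auto intro!: derivative_eq_intros mult_nonneg_nonneg)
    finally show ?thesis using k by (simp add: zero_power)
  qed
  have law: "emeasure ?L {..r} = ennreal (c * r ^ k)" if "0 < r" for r
    using vol[OF that] by (simp add: emeasure_distr vimage_def Int_def conj_commute)
  have low: "emeasure ?L {..r} = 0 \<and> emeasure (density lborel ?f) {..r} = 0" if "r \<le> 0" for r
  proof -
    have "emeasure ?L {..r} \<le> ennreal (c * e ^ k)" if "0 < e" for e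
      using emeasure_mono[of "{..r}" "{..e}" ?L] law[OF that] \<open>r \<le> 0\<close> that by auto
    have "emeasure ?L {..r} \<le> 0"
    proof (rule tendsto_le[OF _ _ tendsto_const])
      have "((\<lambda>n. c * inverse (real (Suc n)) ^ k) \<longlonglongrightarrow> c * 0 ^ k)"
        by (intro tendsto_intros LIMSEQ_inverse_real_of_nat)
      then show "(\<lambda>n. ennreal (c * inverse (real (Suc n)) ^ k)) \<longlonglongrightarrow> 0"
        using k by (auto simp: zero_power dest: tendsto_ennrealI)
      show "\<forall>\<^sub>F n in sequentially. emeasure ?L {..r} \<le> ennreal (c * inverse (real (Suc n)) ^ k)"
        using \<open>\<And>e. 0 < e \<Longrightarrow> emeasure ?L {..r} \<le> ennreal (c * e ^ k)\<close> by (intro always_eventually) auto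
    qed simp
    moreover have "emeasure (density lborel ?f) {..r} = 0"
      using that by (subst emeasure_density) (auto simp: nn_integral_0_iff_AE indicator_def)
    ultimately show ?thesis by simp
  qed
  show "emeasure ?L X = emeasure (density lborel ?f) X" if "X \<in> range (\<lambda>r::real. {..r})" for X
  proof -
    from that obtain r where "X = {..r}" by auto
    then show ?thesis using law[of r] dens[of r] low[of r] by (cases "0 < r") auto
  qed
  show "sets ?L = sigma_sets UNIV (range (\<lambda>r. {..r}))"
    by (simp add: borel_eq_atMost)
  show "sets (density lborel ?f) = sigma_sets UNIV (range (\<lambda>r. {..r}))"
    by (simp add: borel_eq_atMost)
  show "emeasure ?L {..real n} \<noteq> \<infinity>" for n
    using law[of "real n"] low[of "real n"] by (cases "n = 0") auto
qed (auto intro: real_arch_simple)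

lemma nn_integral_radial:
  fixes g :: "real \<Rightarrow> ennreal"
  assumes [measurable]: "g \<in> borel_measurable borel"
  shows "(\<integral>\<^sup>+ x. g (norm (x::'a::euclidean_space)) \<partial>lborel) =
    (\<integral>\<^sup>+ r. ennreal (indicator {0<..} r * (unit_ball_vol DIM('a) * DIM('a) * r ^ (DIM('a) - 1))) * g r \<partial>lborel)"
proof -
  have "distr lborel borel (norm :: 'a \<Rightarrow> real) =
      density lborel (\<lambda>r. ennreal (indicator {0<..} r * (unit_ball_vol DIM('a) * real DIM('a) * r ^ (DIM('a) - 1))))"
  proof (rule distr_power_law)
    show "emeasure lborel {x \<in> space lborel. norm (x::'a) \<le> r} = ennreal (unit_ball_vol DIM('a) * r ^ DIM('a))" if "0 < r" for r
      using emeasure_cball[of r "0::'a"] that by (simp add: cball_def dist_norm)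
  qed auto
  then have "(\<integral>\<^sup>+ x. g x \<partial>(distr lborel borel (norm :: 'a \<Rightarrow> real))) =
      (\<integral>\<^sup>+ r. ennreal (indicator {0<..} r * (unit_ball_vol DIM('a) * DIM('a) * r ^ (DIM('a) - 1))) * g r \<partial>lborel)"
    by (simp only:) (subst nn_integral_density, auto)
  then show ?thesis
    by (subst (asm) nn_integral_distr) auto
qed

text \<open>
  In polar coordinates the condition \<open>- d < s\<close> is the integrability of \<open>r powr (d
  - 1 + s)\<close> at 0.
\<close>

lemma nn_integral_ball_powr:
  fixes s :: real
  assumes s: "- real DIM('a) < s"
  shows "(\<integral>\<^sup>+ y. ennreal (norm (y::'a::euclidean_space) powr s * indicator {..1} (norm y)) \<partial>lborel) =
    ennreal (unit_ball_vol DIM('a) * DIM('a) / (DIM('a) + s))"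
proof -
  let ?d = "DIM('a)" and ?c = "unit_ball_vol DIM('a) * DIM('a)"
  have c: "0 \<le> ?c" by simp
  have e: "0 < ?d + s" using s by simp
  have "(\<integral>\<^sup>+ y. ennreal (norm (y::'a) powr s * indicator {..1} (norm y)) \<partial>lborel) =
    (\<integral>\<^sup>+ r. ennreal (indicator {0<..} r * (?c * r ^ (?d - 1))) * ennreal (r powr s * indicator {..1} r) \<partial>lborel)"
    by (rule nn_integral_radial) simp
  also have "\<dots> = (\<integral>\<^sup>+ r. ennreal ?c * ennreal (indicator {0..1} r * r powr (?d + s - 1)) \<partial>lborel)"
  proof (intro nn_integral_cong_AE AE_I[of _ _ "{0}"] subsetI)
    fix r :: real
    assume a: "r \<in> {r \<in> space lborel. \<not> ennreal (indicator {0<..} r * (?c * r ^ (?d - 1))) * ennreal (r powr s * indicator {..1} r)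
         = ennreal ?c * ennreal (indicator {0..1} r * r powr (?d + s - 1))}"
    have "r ^ (?d - 1) * r powr s = r powr (?d + s - 1)" if "0 < r"
      using that DIM_positive[where 'a='a] by (simp add: powr_realpow[symmetric] powr_add[symmetric] of_nat_diff algebra_simps Suc_leI)
    then have "ennreal (indicator {0<..} r * (?c * r ^ (?d - 1))) * ennreal (r powr s * indicator {..1} r)
         = ennreal ?c * ennreal (indicator {0..1} r * r powr (?d + s - 1))" if "r \<noteq> 0"
      using that c by (auto simp: indicator_def ennreal_mult'[symmetric] mult.assoc)
    with a show "r \<in> {0}" by auto
  qed auto
  also have "\<dots> = ennreal ?c * (\<integral>\<^sup>+ r. ennreal (indicator {0..1} r * r powr (?d + s - 1)) \<partial>lborel)"
    by (rule nn_integral_cmult) simp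
  also have "(\<integral>\<^sup>+ r. ennreal (indicator {0..1} r * r powr (?d + s - 1)) \<partial>lborel) = ennreal (1 / (?d + s))"
  proof -
    have "((\<lambda>r. r powr (?d + s - 1)) has_integral (1 powr (?d + s - 1 + 1) / (?d + s - 1 + 1))) {0..1}"
      using e by (intro has_integral_powr_from_0) auto
    then have "((\<lambda>r. r powr (?d + s - 1)) has_integral (1 / (?d + s))) {0..1}" by simp
    from nn_integral_has_integral_lebesgue[OF _ this]
    show ?thesis by (simp add: mult.commute nn_integral_set_ennreal ennreal_mult' ennreal_indicator)
  qed
  also have "ennreal ?c * ennreal (1 / (?d + s)) = ennreal (?c / (?d + s))"
    using c by (subst ennreal_mult'[symmetric]) auto
  finally show ?thesis .
qed

lemma nn_integral_gaussian_line:
  assumes "0 < (a::real)"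
  shows "(\<integral>\<^sup>+ r. ennreal (exp (- a * r\<^sup>2)) \<partial>lborel) = ennreal (sqrt (pi / a))"
proof -
  have "(\<integral>\<^sup>+ r. ennreal (exp (- a * r\<^sup>2)) \<partial>lborel) =
      (\<integral>\<^sup>+ r. ennreal (sqrt (pi / a)) * ennreal (normal_density 0 (1 / sqrt (2 * a)) r) \<partial>lborel)"
    using assms
    by (intro nn_integral_cong)
      (auto simp: normal_density_def ennreal_mult'[symmetric] real_sqrt_divide power_divide field_simps)
  also have "\<dots> = ennreal (sqrt (pi / a)) * 1"
    using assms integral_normal_density[of "1 / sqrt (2 * a)" 0]
      prob_space.emeasure_space_1[OF prob_space_normal_density[of "1 / sqrt (2 * a)" 0]]
    by (subst nn_integral_cmult) (auto simp: emeasure_density)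
  finally show ?thesis by simp
qed

lemma nn_integral_gaussian:
  assumes "0 < (a::real)"
  shows "(\<integral>\<^sup>+ x. ennreal (exp (- a * (norm (x::'a::euclidean_space))\<^sup>2)) \<partial>lborel) =
     ennreal (pi powr (DIM('a) / 2) * a powr (- real DIM('a) / 2))"
proof -
  have "(\<integral>\<^sup>+ x. ennreal (exp (- a * (norm (x::'a))\<^sup>2)) \<partial>lborel) =
      (\<integral>\<^sup>+ x. (\<Prod>b\<in>Basis. ennreal (exp (- a * (x \<bullet> b)\<^sup>2))) \<partial>(lborel::'a measure))"
    by (intro nn_integral_cong)
      (simp add: prod_ennreal exp_sum[symmetric] sum_distrib_left[symmetric] sum_negf norm_eq_sqrt_inner
        euclidean_inner[of x x for x] power2_eq_square[symmetric] sum_nonneg)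
  also have "\<dots> = (\<Prod>b\<in>(Basis::'a set). (\<integral>\<^sup>+ r. ennreal (exp (- a * r\<^sup>2)) \<partial>lborel))"
    by (rule nn_integral_lborel_prod) auto
  also have "\<dots> = ennreal (sqrt (pi / a) ^ DIM('a))"
    using assms nn_integral_gaussian_line[of a] by (simp add: ennreal_power)
  also have "sqrt (pi / a) ^ DIM('a) = (pi / a) powr (DIM('a) / 2)"
    using assms by (simp add: powr_half_sqrt[symmetric] powr_powr powr_realpow[symmetric])
  also have "\<dots> = pi powr (DIM('a) / 2) * a powr (- real DIM('a) / 2)"
    using assms by (simp add: powr_divide powr_minus_divide)
  finally show ?thesis .
qed

text \<open>
  Within distance 1 of the singularity \<open>v\<close> the Gaussian is at most 1; farther away the
  power is at most 1, because \<open>s \<le> 0\<close>. Hence a bound that is uniform in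
  \<open>v\<close>.
\<close>

lemma nn_integral_singular_gaussian:
  fixes v :: "'a::euclidean_space" and s b :: real
  assumes s: "- real DIM('a) < s" "s \<le> 0" and b: "0 < b"
  shows "(\<integral>\<^sup>+ w. ennreal (norm (w - v) powr s * exp (- b * (norm w)\<^sup>2)) \<partial>lborel) \<le>
    ennreal (unit_ball_vol DIM('a) * real DIM('a) / (real DIM('a) + s) + pi powr (DIM('a) / 2) * b powr (- real DIM('a) / 2))"
proof -
  have "(\<integral>\<^sup>+ w. ennreal (norm (w - v) powr s * exp (- b * (norm w)\<^sup>2)) \<partial>lborel) \<le>
     (\<integral>\<^sup>+ w. ennreal (norm (w - v) powr s * indicator {..1} (norm (w - v))) + ennreal (exp (- b * (norm w)\<^sup>2)) \<partial>lborel)"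
  proof (rule nn_integral_mono)
    fix w :: 'a
    have "norm (w - v) powr s * exp (- b * (norm w)\<^sup>2) \<le>
        norm (w - v) powr s * indicator {..1} (norm (w - v)) + exp (- b * (norm w)\<^sup>2)"
    proof (cases "norm (w - v) \<le> 1")
      case True
      have "exp (- b * (norm w)\<^sup>2) \<le> 1" using b by simp
      then have "norm (w - v) powr s * exp (- b * (norm w)\<^sup>2) \<le> norm (w - v) powr s * 1"
        by (intro mult_left_mono) auto
      then show ?thesis using True by (simp add: add_increasing2)
    next
      case False
      then have "norm (w - v) powr s \<le> 1"
        using s powr_mono[of s 0 "norm (w - v)"] by (auto split: if_splits)
      then have "norm (w - v) powr s * exp (- b * (norm w)\<^sup>2) \<le> 1 * exp (- b * (norm w)\<^sup>2)"
        by (intro mult_right_mono) auto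
      then show ?thesis using False by simp
    qed
    then show "ennreal (norm (w - v) powr s * exp (- b * (norm w)\<^sup>2)) \<le>
        ennreal (norm (w - v) powr s * indicator {..1} (norm (w - v))) + ennreal (exp (- b * (norm w)\<^sup>2))"
      by (subst ennreal_plus[symmetric]) (auto intro!: ennreal_leI simp del: ennreal_plus)
  qed
  also have "\<dots> = (\<integral>\<^sup>+ w. ennreal (norm (w - v) powr s * indicator {..1} (norm (w - v))) \<partial>lborel) +
      (\<integral>\<^sup>+ w. ennreal (exp (- b * (norm (w::'a))\<^sup>2)) \<partial>lborel)"
    by (rule nn_integral_add) auto
  also have "(\<integral>\<^sup>+ w. ennreal (norm (w - v) powr s * indicator {..1} (norm (w - v))) \<partial>lborel) =
      (\<integral>\<^sup>+ w. ennreal (norm (w - v) powr s * indicator {..1} (norm (w - v))) \<partial>(distr lborel borel (\<lambda>y. v + y)))"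
    by (simp add: lborel_distr_plus)
  also have "\<dots> = (\<integral>\<^sup>+ y. ennreal (norm (y::'a) powr s * indicator {..1} (norm y)) \<partial>lborel)"
    by (subst nn_integral_distr) auto
  also have "\<dots> = ennreal (unit_ball_vol DIM('a) * DIM('a) / (DIM('a) + s))"
    by (rule nn_integral_ball_powr[OF s(1)])
  also have "(\<integral>\<^sup>+ w. ennreal (exp (- b * (norm (w::'a))\<^sup>2)) \<partial>lborel) = ennreal (pi powr (DIM('a) / 2) * b powr (- real DIM('a) / 2))"
    by (rule nn_integral_gaussian[OF b])
  finally show ?thesis
    using s by (subst ennreal_plus) auto
qed

text \<open>
  By Cauchy-Schwarz the moving point is at least as far from the origin as its projection on the
  direction of \<open>u\<close>, which moves with speed \<open>norm u\<close>. The factor \<open>1 /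
  norm u\<close> is what integration in time gains: it lowers the exponent of a collision kernel by
  one.
\<close>

lemma nn_integral_gaussian_along_line:
  fixes a u :: "'a::euclidean_space"
  assumes "0 < (\<alpha>::real)" "u \<noteq> 0"
  shows "(\<integral>\<^sup>+ t. ennreal (exp (- \<alpha> * (norm (a + t *\<^sub>R u))\<^sup>2)) \<partial>lborel) \<le> ennreal (sqrt (pi / \<alpha>) / norm u)"
proof -
  define n where "n = norm u"
  define c where "c = (a \<bullet> u) / n"
  have n: "n > 0" using assms by (simp add: n_def)
  have "(c + n * t)\<^sup>2 \<le> (norm (a + t *\<^sub>R u))\<^sup>2" for t
  proof -
    have "(a + t *\<^sub>R u) \<bullet> u = n * (c + n * t)"
      using n by (simp add: c_def n_def inner_add_left algebra_simps dot_square_norm power2_eq_square)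
    then have "\<bar>n * (c + n * t)\<bar> \<le> norm (a + t *\<^sub>R u) * n"
      using Cauchy_Schwarz_ineq2[of "a + t *\<^sub>R u" u] by (simp add: n_def)
    then have "\<bar>c + n * t\<bar> \<le> norm (a + t *\<^sub>R u)"
      using n by (simp add: abs_mult mult.commute)
    then show ?thesis by (simp add: abs_le_square_iff[symmetric])
  qed
  then have "(\<integral>\<^sup>+ t. ennreal (exp (- \<alpha> * (norm (a + t *\<^sub>R u))\<^sup>2)) \<partial>lborel) \<le>
      (\<integral>\<^sup>+ t. ennreal (exp (- \<alpha> * (c + n * t)\<^sup>2)) \<partial>lborel)"
    using assms by (intro nn_integral_mono ennreal_leI) auto
  also have "\<dots> = ennreal (1 / n) * (ennreal n * (\<integral>\<^sup>+ t. ennreal (exp (- \<alpha> * (c + n * t)\<^sup>2)) \<partial>lborel))"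
    using n by (simp add: mult.assoc[symmetric] ennreal_mult'[symmetric])
  also have "ennreal n * (\<integral>\<^sup>+ t. ennreal (exp (- \<alpha> * (c + n * t)\<^sup>2)) \<partial>lborel) =
      (\<integral>\<^sup>+ r. ennreal (exp (- \<alpha> * r\<^sup>2)) \<partial>lborel)"
    using n by (subst nn_integral_real_affine[of "\<lambda>r. ennreal (exp (- \<alpha> * r\<^sup>2))" n c]) auto
  also have "\<dots> = ennreal (sqrt (pi / \<alpha>))" by (rule nn_integral_gaussian_line[OF assms(1)])
  also have "ennreal (1 / n) * \<dots> = ennreal (sqrt (pi / \<alpha>) / norm u)"
    using n assms by (simp add: n_def ennreal_mult'[symmetric] del: ennreal_mult')
  finally show ?thesis .
qed

section \<open>Null sets\<close>

lemma fst_borel_measurable [measurable]: "fst \<in> borel_measurable (borel :: ('a::second_countable_topology \<times> 'b::second_countable_topology) measure)"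
  by (intro borel_measurable_continuous_onI continuous_intros)

lemma snd_borel_measurable [measurable]: "snd \<in> borel_measurable (borel :: ('a::second_countable_topology \<times> 'b::second_countable_topology) measure)"
  by (intro borel_measurable_continuous_onI continuous_intros)

text \<open>
  A left inverse of \<open>f\<close> is linear, hence differentiable, and differentiable maps take
  null sets to null sets.
\<close>

lemma AE_lborel_linear_inj:
  fixes f :: "'a::euclidean_space \<Rightarrow> 'a"
  assumes lin: "linear f" and inj: "inj f" and P: "AE x in lborel. P x"
  shows "AE x in lborel. P (f x)"
proof -
  obtain g where g: "linear g" "\<And>x. g (f x) = x"
    using linear_injective_left_inverse[OF lin inj] by (metis comp_apply id_apply)
  from P obtain N where N: "N \<in> null_sets lborel" "{x. \<not> P x} \<subseteq> N"
    by (auto simp: eventually_ae_filter)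
  have "negligible N"
    using N by (simp add: negligible_iff_null_sets null_sets_completionI)
  then have "negligible (g ` N)"
    by (rule negligible_differentiable_image_negligible[OF order_refl])
      (simp add: g linear_imp_differentiable_on)
  moreover have [measurable]: "f \<in> borel_measurable borel"
    using lin by (simp add: borel_measurable_continuous_onI linear_continuous_on linear_conv_bounded_linear)
  moreover have "f -` N \<subseteq> g ` N"
    using g by (auto intro: rev_image_eqI)
  ultimately have "negligible (f -` N)" by (meson negligible_subset)
  moreover have "f -` N \<in> sets borel"
    using measurable_sets[of f borel borel N] N by (auto simp: null_sets_def)
  ultimately have "f -` N \<in> null_sets lborel"
    by (metis negligible_iff_null_sets null_sets_completion_iff sets_lborel)
  then show ?thesis
    using N(2) by (intro AE_I'[of "f -` N"]) auto
qed

lemma AE_lborel_pair_iff: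
  assumes [measurable]: "Measurable.pred borel (\<lambda>z. P z)"
  shows "(AE z in (lborel :: ('a::euclidean_space \<times> 'b::euclidean_space) measure). P z) \<longleftrightarrow>
     (AE x in lborel. AE y in lborel. P (x, y))"
proof -
  have "{x \<in> space (lborel \<Otimes>\<^sub>M lborel). P (fst x, snd x)} \<in> sets ((lborel :: 'a measure) \<Otimes>\<^sub>M (lborel :: 'b measure))"
    using assms unfolding lborel_prod pred_def by simp
  from lborel_pair.AE_pair_iff[OF this] show ?thesis
    unfolding lborel_prod by simp
qed

lemma AE_lborel_commute:
  assumes "{z. P (fst z) (snd z)} \<in> sets (borel :: ('a::euclidean_space \<times> 'b::euclidean_space) measure)"
  shows "(AE x in (lborel :: 'a measure). AE y in (lborel :: 'b measure). P x y) \<longleftrightarrow> (AE y in lborel. AE x in lborel. P x y)"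
proof -
  have "{z \<in> space (lborel \<Otimes>\<^sub>M lborel). P (fst z) (snd z)} \<in> sets ((lborel :: 'a measure) \<Otimes>\<^sub>M (lborel :: 'b measure))"
    using assms unfolding lborel_prod by simp
  then show ?thesis by (rule lborel_pair.AE_commute)
qed

section \<open>A smooth step\<close>

text \<open>
  The function \<open>exp (- 1 / (t (1 - t)))\<close> on \<open>(0,1)\<close>, extended by 0, and
  all its derivatives have this form; this makes smoothness a statement about first derivatives
  only.
\<close>

definition bump :: "real poly \<Rightarrow> nat \<Rightarrow> real \<Rightarrow> real" where
  "bump p k t = (if 0 < t \<and> t < 1
     then poly p t * (1 / (t * (1 - t))) ^ k * exp (- (1 / (t * (1 - t)))) else 0)"

text \<open>
  With \<open>s = 1 / (t (1 - t))\<close>, the exponential series gives \<open>s ^ (k + 2) \<le>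
  fact (k + 2) * exp s\<close>: the exponential beats the pole and leaves two factors to spare. The
  square makes the function differentiable with derivative 0 at the two endpoints.
\<close>

lemma bump_bound:
  obtains C where "\<And>t. \<bar>bump p k t\<bar> \<le> C * (t * (1 - t))\<^sup>2"
proof -
  have "bounded (poly p ` {0..1})"
    by (intro compact_imp_bounded compact_continuous_image continuous_intros compact_Icc)
  then obtain B where "\<forall>t\<in>{0..1}. \<bar>poly p t\<bar> \<le> B"
    by (auto simp: bounded_iff)
  then have B: "\<bar>poly p t\<bar> \<le> B" if "0 \<le> t" "t \<le> 1" for t
    using that by auto
  have B0: "B \<ge> 0" using B[of 0] by simp
  have "\<bar>bump p k t\<bar> \<le> (B * fact (k + 2)) * (t * (1 - t))\<^sup>2" for t
  proof (cases "0 < t \<and> t < 1")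
    case True
    define s where "s = 1 / (t * (1 - t))"
    have s: "s > 0" using True by (simp add: s_def)
    have "s ^ (k + 2) / fact (k + 2) \<le> (\<Sum>n. s ^ n / fact n)"
      using s sum_le_suminf[of "\<lambda>n. s ^ n / fact n" "{k + 2}"] summable_exp[of s]
      by (simp add: field_simps)
    also have "(\<Sum>n. s ^ n / fact n) = exp s" by (simp add: exp_def field_simps)
    finally have "s ^ (k + 2) \<le> exp s * fact (k + 2)"
      by (subst (asm) pos_divide_le_eq) (rule fact_gt_zero)
    then have "s ^ k * s\<^sup>2 \<le> fact (k + 2) * exp s"
      by (simp only: power_add mult.commute)
    then have "s ^ k * exp (- s) \<le> fact (k + 2) / s\<^sup>2"
      using s by (simp add: exp_minus field_simps)
    also have "\<dots> = fact (k + 2) * (t * (1 - t))\<^sup>2" by (simp add: s_def power_divide)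
    finally have *: "s ^ k * exp (- s) \<le> fact (k + 2) * (t * (1 - t))\<^sup>2" .
    have "\<bar>poly p t\<bar> * (s ^ k * exp (- s)) \<le> B * (fact (k + 2) * (t * (1 - t))\<^sup>2)"
      by (rule mult_mono[OF _ *]) (use B[of t] True s B0 in auto)
    then show ?thesis
      using True s by (simp add: bump_def s_def[symmetric] abs_mult mult.assoc)
  qed (use B0 in \<open>auto simp: bump_def\<close>)
  then show ?thesis using that by blast
qed

lemma has_real_derivative_zero_of_quadratic_bound:
  fixes f :: "real \<Rightarrow> real"
  assumes "\<And>t. \<bar>t - c\<bar> < 1 \<Longrightarrow> \<bar>f t\<bar> \<le> C * (t - c)\<^sup>2"
  shows "(f has_real_derivative 0) (at c)"
proof -
  have f0: "f c = 0" using assms[of c] by simp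
  have "((\<lambda>h. (f (c + h) - f c) / h) \<longlongrightarrow> 0) (at 0)"
  proof (rule Lim_null_comparison)
    show "\<forall>\<^sub>F h in at 0. norm ((f (c + h) - f c) / h) \<le> \<bar>C\<bar> * \<bar>h\<bar>"
      unfolding eventually_at
    proof (intro exI[of _ 1] conjI ballI impI)
      fix h :: real assume h: "h \<noteq> 0 \<and> dist h 0 < 1"
      then have "\<bar>f (c + h)\<bar> \<le> C * h\<^sup>2" using assms[of "c + h"] by simp
      also have "\<dots> \<le> \<bar>C\<bar> * h\<^sup>2" by (intro mult_right_mono) auto
      finally show "norm ((f (c + h) - f c) / h) \<le> \<bar>C\<bar> * \<bar>h\<bar>"
        using h by (simp add: f0 field_simps power2_eq_square abs_mult)
    qed simp
    show "((\<lambda>h. \<bar>C\<bar> * \<bar>h\<bar>) \<longlongrightarrow> 0) (at 0)"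
      by (rule tendsto_eq_intros refl | simp)+
  qed
  then show ?thesis by (simp add: DERIV_def)
qed

text \<open>
  The polynomial factor of the derivative of \<open>bump p k\<close> over the denominator \<open>(t
  (1 - t)) ^ (k + 2)\<close>.
\<close>

definition bump_poly_deriv :: "real poly \<Rightarrow> nat \<Rightarrow> real poly" where
  "bump_poly_deriv p k = (let q = [:0, 1, -1:] in
     pderiv p * q ^ 2 - smult (real k) (p * [:1, -2:] * q) + p * [:1, -2:])"

lemma bump_deriv: "(bump p k has_real_derivative bump (bump_poly_deriv p k) (k + 2) t) (at t)"
proof -
  obtain C where C: "\<And>t. \<bar>bump p k t\<bar> \<le> C * (t * (1 - t))\<^sup>2" using bump_bound[of p k] by blast
  have C0: "C \<ge> 0" using order_trans[OF abs_ge_zero C[of "1/2"]] by (simp add: power2_eq_square)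
  have edge: "(bump p k has_real_derivative 0) (at c)" if "c \<in> {0, 1}" for c
  proof (rule has_real_derivative_zero_of_quadratic_bound)
    fix t assume t: "\<bar>t - c\<bar> < 1"
    show "\<bar>bump p k t\<bar> \<le> C * (t - c)\<^sup>2"
    proof (cases "0 < t \<and> t < 1")
      case True
      have "t * (1 - t) \<le> t * 1" "t * (1 - t) \<le> 1 * (1 - t)"
        using True by (intro mult_left_mono mult_right_mono; simp)+
      then have "\<bar>t * (1 - t)\<bar> \<le> \<bar>t - c\<bar>"
        using True that by (auto simp: abs_mult)
      then have "(t * (1 - t))\<^sup>2 \<le> (t - c)\<^sup>2" by (simp add: abs_le_square_iff)
      then have "C * (t * (1 - t))\<^sup>2 \<le> C * (t - c)\<^sup>2" using C0 by (rule mult_left_mono)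
      with C[of t] show ?thesis by linarith
    qed (use C0 in \<open>auto simp: bump_def\<close>)
  qed
  consider "t < 0" | "t = 0" | "0 < t \<and> t < 1" | "t = 1" | "1 < t" by linarith
  then show ?thesis
  proof cases
    case 3
    define s where "s = (\<lambda>t::real. 1 / (t * (1 - t)))"
    have s': "(s has_real_derivative (- (1 - 2 * t) * (s t)\<^sup>2)) (at t)"
      using 3 unfolding s_def
      by (auto intro!: derivative_eq_intros simp: field_simps power2_eq_square)
    have q: "s t \<noteq> 0" "t * (1 - t) = 1 / s t" using 3 by (auto simp: s_def)
    have e: "((\<lambda>t. exp (- s t)) has_real_derivative exp (- s t) * ((1 - 2 * t) * (s t)\<^sup>2)) (at t)"
      by (rule DERIV_cong[OF DERIV_fun_exp[OF DERIV_minus[OF s']]]) (simp add: algebra_simps)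
    have pw: "((\<lambda>t. s t ^ k) has_real_derivative real k * s t ^ (k - 1) * (- (1 - 2 * t) * (s t)\<^sup>2)) (at t)"
      by (rule DERIV_cong[OF DERIV_power[OF s']]) (simp only: One_nat_def mult_ac)
    have "((\<lambda>t. poly p t * s t ^ k * exp (- s t)) has_real_derivative
        (poly (pderiv p) t * s t ^ k * exp (- s t)
         + poly p t * (real k * s t ^ (k - 1) * (- (1 - 2 * t) * (s t)\<^sup>2)) * exp (- s t)
         + poly p t * s t ^ k * (exp (- s t) * ((1 - 2 * t) * (s t)\<^sup>2)))) (at t)"
      by (rule DERIV_cong[OF DERIV_mult[OF DERIV_mult[OF poly_DERIV pw] e]])
        (simp only: distrib_right distrib_left mult.assoc mult.commute[of _ "poly p t"] mult.commute[of "s t ^ k" "poly (pderiv p) t"] add_ac mult.left_commute mult.commute)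
    moreover have "(poly (pderiv p) t * s t ^ k * exp (- s t)
         + poly p t * (real k * s t ^ (k - 1) * (- (1 - 2 * t) * (s t)\<^sup>2)) * exp (- s t)
         + poly p t * s t ^ k * (exp (- s t) * ((1 - 2 * t) * (s t)\<^sup>2))) =
         bump (bump_poly_deriv p k) (k + 2) t"
    proof -
      have pq: "poly [:0, 1, -1:] t = 1 / s t" using q by (simp add: algebra_simps)
      have sk: "real k * s t ^ (k - 1) * (s t)\<^sup>2 = real k * s t ^ (k + 1)"
        by (cases k) (auto simp: power2_eq_square)
      have "poly (bump_poly_deriv p k) t = poly (pderiv p) t * (1 / s t)\<^sup>2
          - real k * (poly p t * (1 - 2 * t) * (1 / s t)) + poly p t * (1 - 2 * t)"
        unfolding bump_poly_deriv_def Let_def poly_add poly_diff poly_mult poly_power poly_smult pq by (simp add: algebra_simps)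
      then have "bump (bump_poly_deriv p k) (k + 2) t =
          (poly (pderiv p) t * (1 / s t)\<^sup>2 - real k * (poly p t * (1 - 2 * t) * (1 / s t)) + poly p t * (1 - 2 * t))
          * s t ^ (k + 2) * exp (- s t)"
        using 3 by (simp add: bump_def s_def)
      also have "\<dots> = (poly (pderiv p) t * s t ^ k - (real k * s t ^ (k + 1)) * (poly p t * (1 - 2 * t))
          + poly p t * (1 - 2 * t) * s t ^ k * (s t)\<^sup>2) * exp (- s t)"
        using q by (simp add: field_simps power_add power2_eq_square)
      also have "\<dots> = (poly (pderiv p) t * s t ^ k - (real k * s t ^ (k - 1) * (s t)\<^sup>2) * (poly p t * (1 - 2 * t))
          + poly p t * (1 - 2 * t) * s t ^ k * (s t)\<^sup>2) * exp (- s t)"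
        by (simp only: sk)
      finally show ?thesis by (simp add: algebra_simps)
    qed
    ultimately have "((\<lambda>t. poly p t * s t ^ k * exp (- s t)) has_real_derivative bump (bump_poly_deriv p k) (k + 2) t) (at t)"
      by simp
    then show ?thesis
      by (rule has_field_derivative_transform_within_open[of _ _ _ "{0<..<1}"])
        (use 3 in \<open>auto simp: s_def bump_def\<close>)
  next
    case 1
    have "((\<lambda>t. 0) has_real_derivative 0) (at t)" by simp
    then show ?thesis
      by (rule has_field_derivative_transform_within_open[of _ _ _ "{..<0}", THEN DERIV_cong])
        (use 1 in \<open>auto simp: bump_def\<close>)
  next
    case 5
    have "((\<lambda>t. 0) has_real_derivative 0) (at t)" by simp
    then show ?thesis
      by (rule has_field_derivative_transform_within_open[of _ _ _ "{1<..}", THEN DERIV_cong])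
        (use 5 in \<open>auto simp: bump_def\<close>)
  qed (use edge in \<open>auto simp: bump_def\<close>)
qed

lemma bump_higher_deriv: "\<exists>p' k'. (deriv ^^ n) (bump p k) = bump p' k'"
proof (induction n)
  case (Suc n)
  then obtain p' k' where "(deriv ^^ n) (bump p k) = bump p' k'" by blast
  then have "(deriv ^^ Suc n) (bump p k) = bump (bump_poly_deriv p' k') (k' + 2)"
    using DERIV_imp_deriv[OF bump_deriv] by (intro ext) simp
  then show ?case by blast
qed auto

lemma higher_deriv_affine:
  fixes f :: "real \<Rightarrow> real"
  assumes "\<And>k t. (deriv ^^ k) f differentiable at t"
  shows "(deriv ^^ k) (\<lambda>t. f (c * t + d)) = (\<lambda>t. c ^ k * (deriv ^^ k) f (c * t + d))"
    and "(deriv ^^ k) (\<lambda>t. f (c * t + d)) differentiable at t"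
proof -
  have D: "((\<lambda>t. c ^ k * (deriv ^^ k) f (c * t + d)) has_real_derivative c ^ Suc k * (deriv ^^ Suc k) f (c * t + d)) (at t)"
    for k t
  proof -
    have "((deriv ^^ k) f has_real_derivative (deriv ^^ Suc k) f (c * t + d)) (at (c * t + d))"
      using assms by (simp add: DERIV_deriv_iff_real_differentiable)
    then have "((\<lambda>t. (deriv ^^ k) f (c * t + d)) has_real_derivative (deriv ^^ Suc k) f (c * t + d) * c) (at t)"
      by (rule DERIV_chain2) (auto intro!: derivative_eq_intros)
    from DERIV_cmult[OF this, of "c ^ k"] show ?thesis by (simp add: mult_ac)
  qed
  show *: "(deriv ^^ k) (\<lambda>t. f (c * t + d)) = (\<lambda>t. c ^ k * (deriv ^^ k) f (c * t + d))" for k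
  proof (induction k)
    case (Suc k)
    then show ?case using DERIV_imp_deriv[OF D[of k]] by (intro ext) simp
  qed simp
  show "(deriv ^^ k) (\<lambda>t. f (c * t + d)) differentiable at t"
    unfolding * using D real_differentiable_def by blast
qed

lemma higher_deriv_diff:
  fixes f g :: "real \<Rightarrow> real"
  assumes f: "\<And>k t. (deriv ^^ k) f differentiable at t" and g: "\<And>k t. (deriv ^^ k) g differentiable at t"
  shows "(deriv ^^ k) (\<lambda>t. f t - g t) = (\<lambda>t. (deriv ^^ k) f t - (deriv ^^ k) g t)"
    and "(deriv ^^ k) (\<lambda>t. f t - g t) differentiable at t"
proof -
  show *: "(deriv ^^ k) (\<lambda>t. f t - g t) = (\<lambda>t. (deriv ^^ k) f t - (deriv ^^ k) g t)" for k
  proof (induction k)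
    case (Suc k)
    have "deriv (\<lambda>t. (deriv ^^ k) f t - (deriv ^^ k) g t) t = (deriv ^^ Suc k) f t - (deriv ^^ Suc k) g t" for t
      using f g by (intro DERIV_imp_deriv) (auto intro!: derivative_intros simp: DERIV_deriv_iff_real_differentiable)
    with Suc show ?case by (intro ext) simp
  qed simp
  show "(deriv ^^ k) (\<lambda>t. f t - g t) differentiable at t"
    unfolding * using f g by (intro differentiable_diff) auto
qed

text \<open>
  The primitive of the bump, divided by its total integral.
\<close>

lemma smooth_step_exists:
  obtains \<Phi> :: "real \<Rightarrow> real"
  where "\<And>k t. (deriv ^^ k) \<Phi> differentiable at t"
    and "\<And>t. t \<le> 0 \<Longrightarrow> \<Phi> t = 0" and "\<And>t. 1 \<le> t \<Longrightarrow> \<Phi> t = 1" and "\<And>t. 0 \<le> \<Phi> t \<and> \<Phi> t \<le> 1"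
    and "\<And>t. 0 \<le> deriv \<Phi> t"
    and "\<And>t. t \<notin> {0..1} \<Longrightarrow> deriv \<Phi> t = 0"
    and "continuous_on UNIV (deriv \<Phi>)"
proof -
  define \<rho> where "\<rho> = bump 1 0"
  have \<rho>_cont: "continuous_on A \<rho>" for A
    unfolding \<rho>_def by (blast intro: continuous_at_imp_continuous_on DERIV_isCont bump_deriv)
  have \<rho>_nn: "0 \<le> \<rho> t" for t by (simp add: \<rho>_def bump_def)
  have \<rho>_pos: "0 < \<rho> t" if "0 < t" "t < 1" for t using that by (simp add: \<rho>_def bump_def)
  have \<rho>_0: "\<rho> t = 0" if "t \<le> 0 \<or> 1 \<le> t" for t using that by (auto simp: \<rho>_def bump_def)
  define c where "c = integral {0..1} \<rho>"
  define P where "P = (\<lambda>t. integral {-1..t} \<rho>)"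
  have int: "\<rho> integrable_on {a..b}" for a b
    by (intro integrable_continuous_real \<rho>_cont)
  have P0: "P t = 0" if "t \<le> 0" for t
  proof -
    have "P t = integral {-1..t} (\<lambda>_. 0)"
      unfolding P_def using that by (intro integral_cong) (auto simp: \<rho>_0)
    then show ?thesis by simp
  qed
  have P1: "P t = c" if "1 \<le> t" for t
  proof -
    have "integral {1..t} \<rho> = integral {1..t} (\<lambda>_. 0)" by (intro integral_cong) (auto simp: \<rho>_0)
    moreover have "integral {-1..0} \<rho> = 0" using P0[of 0] by (simp add: P_def)
    moreover have "integral {-1..0} \<rho> + integral {0..1} \<rho> = integral {-1..1} \<rho>"
      by (intro Henstock_Kurzweil_Integration.integral_combine int) auto
    moreover have "integral {-1..1} \<rho> + integral {1..t} \<rho> = integral {-1..t} \<rho>"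
      using that by (intro Henstock_Kurzweil_Integration.integral_combine int) auto
    ultimately show ?thesis by (simp add: P_def c_def)
  qed
  have P': "(P has_real_derivative \<rho> t) (at t)" for t
  proof (cases "t < 0")
    case True
    have "((\<lambda>t. 0) has_real_derivative 0) (at t)" by simp
    then show ?thesis
      by (rule has_field_derivative_transform_within_open[of _ _ _ "{..<0}", THEN DERIV_cong])
        (use True in \<open>auto simp: P0 \<rho>_0\<close>)
  next
    case False
    have "(P has_real_derivative \<rho> t) (at t within {-1..t + 1})"
      unfolding P_def by (rule integral_has_real_derivative[OF \<rho>_cont]) (use False in auto)
    then show ?thesis
      using False by (subst (asm) at_within_Icc_at) auto
  qed
  have P_mono: "P s \<le> P t" if "s \<le> t" for s t
    by (rule DERIV_nonneg_imp_nondecreasing[OF that]) (use P' \<rho>_nn in blast)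
  have c: "0 < c"
  proof -
    have "P 0 < P 1"
    proof (rule DERIV_pos_imp_increasing_open[of 0 1 P])
      show "\<exists>y. (P has_real_derivative y) (at x) \<and> 0 < y" if "0 < x" "x < 1" for x
        using P' \<rho>_pos that by blast
      show "continuous_on {0..1} P" by (blast intro: continuous_at_imp_continuous_on DERIV_isCont P')
    qed simp
    then show ?thesis by (simp add: P0 P1)
  qed
  define \<Phi> where "\<Phi> = (\<lambda>t. P t / c)"
  have \<Phi>': "(\<Phi> has_real_derivative \<rho> t / c) (at t)" for t
    unfolding \<Phi>_def by (rule DERIV_cdivide[OF P'])
  have d\<Phi>: "deriv \<Phi> = bump [:1 / c:] 0"
    using DERIV_imp_deriv[OF \<Phi>'] by (auto simp: fun_eq_iff \<rho>_def bump_def)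
  show ?thesis
  proof (rule that[of \<Phi>])
    show "(deriv ^^ k) \<Phi> differentiable at t" for k t
    proof (cases k)
      case 0
      then show ?thesis using \<Phi>' real_differentiable_def by auto
    next
      case (Suc m)
      then have "(deriv ^^ k) \<Phi> = (deriv ^^ m) (bump [:1 / c:] 0)" by (simp add: funpow_Suc_right d\<Phi> del: funpow.simps)
      then obtain p' k' where "(deriv ^^ k) \<Phi> = bump p' k'" using bump_higher_deriv[of m "[:1 / c:]" 0] by auto
      then show ?thesis using bump_deriv[of p' k' t] by (auto simp: real_differentiable_def)
    qed
    show "0 \<le> \<Phi> t \<and> \<Phi> t \<le> 1" for t
      using P_mono[of "min t 0" t] P_mono[of t "max t 1"] c by (auto simp: \<Phi>_def P0 P1)
    show "deriv \<Phi> t = 0" if "t \<notin> {0..1}" for t using that by (auto simp: d\<Phi> bump_def)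
    show "0 \<le> deriv \<Phi> t" for t using c by (simp add: d\<Phi> bump_def)
    show "continuous_on UNIV (deriv \<Phi>)"
      unfolding d\<Phi> by (blast intro: continuous_at_imp_continuous_on DERIV_isCont bump_deriv)
  qed (use c in \<open>auto simp: \<Phi>_def P0 P1 d\<Phi> bump_def\<close>)
qed

section \<open>Surface integrals over the sphere\<close>

lemma sgn_measurable [measurable]: "(sgn :: 'a::euclidean_space \<Rightarrow> 'a) \<in> borel_measurable borel"
  unfolding sgn_div_norm by measurable

lemma sets_sphere_measure [simp, measurable_cong]: "sets sphere_measure = sets borel"
  by (simp add: sphere_measure_def)

lemma space_sphere_measure [simp]: "space sphere_measure = UNIV"
  by (simp add: sphere_measure_def space_scale_measure)

lemma nn_integral_sphere_measure:
  fixes g :: "'a::euclidean_space \<Rightarrow> ennreal"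
  assumes [measurable]: "g \<in> borel_measurable borel"
  shows "(\<integral>\<^sup>+ \<omega>. g \<omega> \<partial>sphere_measure) = of_nat DIM('a) * (\<integral>\<^sup>+ x. g (sgn x) * indicator (ball 0 1) x \<partial>lborel)"
proof -
  have [measurable]: "(sgn :: 'a \<Rightarrow> 'a) \<in> measurable (restrict_space lborel (ball 0 1)) borel"
    by (rule measurable_restrict_space1) simp
  show ?thesis
    unfolding sphere_measure_def
    by (subst nn_integral_scale_measure) (auto simp: nn_integral_distr nn_integral_restrict_space)
qed

lemma AE_sphere_measure_norm: "AE \<omega> in (sphere_measure :: 'a::euclidean_space measure). norm \<omega> = 1"
proof (rule AE_I[where N="{\<omega>. norm \<omega> \<noteq> 1}"])
  have "emeasure sphere_measure {\<omega>::'a. norm \<omega> \<noteq> 1} = of_nat DIM('a) * emeasure lborel {x::'a. norm x < 1 \<and> sgn x \<in> {\<omega>. norm \<omega> \<noteq> 1}}"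
    by (rule emeasure_sphere_measure) measurable
  also have "{x::'a. norm x < 1 \<and> sgn x \<in> {\<omega>. norm \<omega> \<noteq> 1}} = {0}"
    by (auto simp: norm_sgn)
  finally show "emeasure sphere_measure {\<omega>::'a. norm \<omega> \<noteq> 1} = 0" by simp
qed auto

lemma finite_measure_sphere_measure: "finite_measure (sphere_measure :: 'a::euclidean_space measure)"
proof
  have "emeasure sphere_measure (UNIV :: 'a set) = of_nat DIM('a) * emeasure lborel (ball (0::'a) 1)"
    by (subst emeasure_sphere_measure) (auto simp: ball_def)
  then show "emeasure sphere_measure (space (sphere_measure :: 'a measure)) \<noteq> \<infinity>"
    by (simp add: emeasure_ball ennreal_mult_eq_top_iff)
qed

interpretation sphere: finite_measure "sphere_measure :: 'a::euclidean_space measure"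
  by (rule finite_measure_sphere_measure)

text \<open>
  Translation invariance suffices: averaging over translations by the points of the unit ball and
  exchanging the order of integration moves \<open>T\<close> from \<open>f\<close> to the ball,
  which \<open>T\<close> preserves.
\<close>

lemma nn_integral_orthogonal:
  fixes T :: "'a::euclidean_space \<Rightarrow> 'a" and f :: "'a \<Rightarrow> ennreal"
  assumes T: "orthogonal_transformation T" and [measurable]: "f \<in> borel_measurable borel"
  shows "(\<integral>\<^sup>+ x. f (T x) \<partial>lborel) = (\<integral>\<^sup>+ x. f x \<partial>lborel)"
proof -
  have [measurable]: "T \<in> borel_measurable borel"
    using orthogonal_transformation_linear[OF T]
    by (simp add: borel_measurable_continuous_onI linear_continuous_on linear_conv_bounded_linear)
  define S where "S = inv T"
  have TS: "T (S y) = y" for y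
    using orthogonal_transformation_surj[OF T] by (simp add: S_def surj_f_inv_f)
  have shift: "(\<integral>\<^sup>+ x. g (c + x) \<partial>lborel) = (\<integral>\<^sup>+ x. g x \<partial>lborel)"
    if [measurable]: "g \<in> borel_measurable borel" for c :: 'a and g :: "'a \<Rightarrow> ennreal"
  proof -
    have "(\<integral>\<^sup>+ x. g x \<partial>(distr lborel borel ((+) c))) = (\<integral>\<^sup>+ x. g (c + x) \<partial>lborel)"
      by (rule nn_integral_distr) auto
    then show ?thesis by (simp add: lborel_distr_plus)
  qed
  define V where "V = emeasure lborel (ball (0::'a) 1)"
  let ?B = "indicator (ball (0::'a) 1) :: 'a \<Rightarrow> ennreal"
  have V: "V \<noteq> 0" "V \<noteq> \<infinity>" 
    using unit_ball_vol_pos[of "real DIM('a)"] by (auto simp: V_def emeasure_ball ennreal_eq_0_iff not_le[symmetric] simp del: unit_ball_vol_pos)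
  have [measurable]: "?B \<in> borel_measurable borel"
    by (rule borel_measurable_indicator) simp
  have "V * (\<integral>\<^sup>+ x. f (T x) \<partial>lborel) = (\<integral>\<^sup>+ y. ?B y * (\<integral>\<^sup>+ x. f (T x) \<partial>lborel) \<partial>lborel)"
    by (subst nn_integral_multc) (auto simp: V_def)
  also have "\<dots> = (\<integral>\<^sup>+ y. \<integral>\<^sup>+ x. ?B y * f (T x + y) \<partial>lborel \<partial>lborel)"
  proof (rule nn_integral_cong)
    fix y
    have "(\<integral>\<^sup>+ x. f (T x) \<partial>lborel) = (\<integral>\<^sup>+ x. f (T (S y + x)) \<partial>lborel)"
      by (rule shift[symmetric]) measurable
    also have "\<dots> = (\<integral>\<^sup>+ x. f (T x + y) \<partial>lborel)"
      using orthogonal_transformation_linear[OF T] by (simp add: linear_add TS add.commute)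
    finally show "?B y * (\<integral>\<^sup>+ x. f (T x) \<partial>lborel) = (\<integral>\<^sup>+ x. ?B y * f (T x + y) \<partial>lborel)"
      by (subst nn_integral_cmult) auto
  qed
  also have "\<dots> = (\<integral>\<^sup>+ x. \<integral>\<^sup>+ y. ?B y * f (T x + y) \<partial>lborel \<partial>lborel)"
    by (rule lborel_pair.Fubini') (simp add: split_beta')
  also have "\<dots> = (\<integral>\<^sup>+ x. \<integral>\<^sup>+ y. ?B (y - T x) * f y \<partial>lborel \<partial>lborel)"
  proof (rule nn_integral_cong)
    fix x
    show "(\<integral>\<^sup>+ y. ?B y * f (T x + y) \<partial>lborel) = (\<integral>\<^sup>+ y. ?B (y - T x) * f y \<partial>lborel)"
      using shift[of "\<lambda>y. ?B (y - T x) * f y" "T x"] by simp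
  qed
  also have "\<dots> = (\<integral>\<^sup>+ y. \<integral>\<^sup>+ x. ?B (y - T x) * f y \<partial>lborel \<partial>lborel)"
    by (rule lborel_pair.Fubini') (simp add: split_beta')
  also have "\<dots> = (\<integral>\<^sup>+ y. V * f y \<partial>lborel)"
  proof (rule nn_integral_cong)
    fix y
    have "?B (y - T (S y + x)) = ?B x" for x
      using T orthogonal_transformation_linear[OF T]
      by (simp add: linear_add TS indicator_def orthogonal_transformation_norm)
    then have "(\<integral>\<^sup>+ x. ?B (y - T x) \<partial>lborel) = V"
      using shift[of "\<lambda>x. ?B (y - T x)" "S y"] by (simp add: V_def)
    then show "(\<integral>\<^sup>+ x. ?B (y - T x) * f y \<partial>lborel) = V * f y"
      by (subst nn_integral_multc) auto
  qed
  also have "\<dots> = V * (\<integral>\<^sup>+ x. f x \<partial>lborel)" by (rule nn_integral_cmult) measurable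
  finally show ?thesis using V by (simp add: ennreal_mult_cancel_left)
qed

text \<open>
  Cylindrical coordinates about the axis \<open>b0\<close>: height \<open>s\<close> and distance
  \<open>r\<close> from the axis, the latter distributed like the norm in dimension \<open>d -
  1\<close>.
\<close>

lemma nn_integral_axial_slices:
  fixes h :: "real \<Rightarrow> real \<Rightarrow> ennreal" and b0 :: "'a::euclidean_space"
  assumes h [measurable]: "(\<lambda>(s, r). h s r) \<in> borel_measurable (borel \<Otimes>\<^sub>M borel)"
    and b0: "b0 \<in> Basis" and d: "DIM('a) \<ge> 2"
  shows "(\<integral>\<^sup>+ x. h (x \<bullet> b0) (sqrt ((norm x)\<^sup>2 - (x \<bullet> b0)\<^sup>2)) \<partial>lborel) =
    (\<integral>\<^sup>+ s. \<integral>\<^sup>+ r. ennreal (indicator {0<..} r * (unit_ball_vol (real (DIM('a) - 1)) * real (DIM('a) - 1) * r ^ (DIM('a) - 2))) * h s r \<partial>lborel \<partial>lborel)"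
proof -
  define A where "A = (Basis :: 'a set) - {b0}"
  interpret product_sigma_finite "\<lambda>_::'a. lborel :: real measure" ..
  have A: "finite A" "b0 \<notin> A" "insert b0 A = Basis" "card A = DIM('a) - 1"
    using b0 by (auto simp: A_def)
  let ?P = "Pi\<^sub>M A (\<lambda>_. lborel :: real measure)"
  define N where "N = (\<lambda>f::'a \<Rightarrow> real. sqrt (\<Sum>b\<in>A. (f b)\<^sup>2))"
  have [measurable]: "N \<in> borel_measurable ?P" unfolding N_def by measurable
  have law: "distr ?P borel N =
      density lborel (\<lambda>r. ennreal (indicator {0<..} r * (unit_ball_vol (card A) * real (card A) * r ^ (card A - 1))))"
  proof (rule distr_power_law)
    fix r :: real assume "0 < r"
    then show "emeasure ?P {x \<in> space ?P. N x \<le> r} = ennreal (unit_ball_vol (card A) * r ^ card A)"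
      using emeasure_cball_aux[OF A(1)] by (simp add: N_def Int_def conj_commute)
  qed (use d A in \<open>auto simp: N_def sum_nonneg\<close>)
  have "(\<integral>\<^sup>+ x. h (x \<bullet> b0) (sqrt ((norm x)\<^sup>2 - (x \<bullet> b0)\<^sup>2)) \<partial>(lborel :: 'a measure)) =
      (\<integral>\<^sup>+ f. h (f b0) (N f) \<partial>(Pi\<^sub>M (insert b0 A) (\<lambda>_. lborel)))"
  proof -
    have "(\<Sum>b\<in>Basis. f b *\<^sub>R b) \<bullet> b0 = f b0" for f :: "'a \<Rightarrow> real"
      using b0 by (simp add: inner_sum_left inner_Basis if_distrib[of "\<lambda>x. _ * x"] cong: if_cong)
    moreover have "(norm (\<Sum>b\<in>Basis. f b *\<^sub>R b))\<^sup>2 = (f b0)\<^sup>2 + (\<Sum>b\<in>A. (f b)\<^sup>2)" for f :: "'a \<Rightarrow> real"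
    proof -
      have "(norm (\<Sum>b\<in>Basis. f b *\<^sub>R b))\<^sup>2 = (\<Sum>b\<in>Basis. (f b)\<^sup>2)"
        unfolding power2_norm_eq_inner by (subst euclidean_inner) (simp add: power2_eq_square)
      then show ?thesis unfolding A(3)[symmetric] using A(1,2) by simp
    qed
    ultimately show ?thesis
      unfolding A(3) by (subst lborel_eq, subst nn_integral_distr) (auto simp: N_def)
  qed
  also have "\<dots> = (\<integral>\<^sup>+ s. \<integral>\<^sup>+ f. h s (N f) \<partial>?P \<partial>lborel)"
  proof -
    have "N (f(b0 := s)) = N f" for f s
      unfolding N_def using A(2) by (intro arg_cong[of _ _ sqrt] sum.cong) auto
    moreover have "(\<lambda>f. h (f b0) (N f)) \<in> borel_measurable (Pi\<^sub>M (insert b0 A) (\<lambda>_. lborel))"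
    proof -
      have [measurable]: "N \<in> borel_measurable (Pi\<^sub>M (insert b0 A) (\<lambda>_. lborel))" unfolding N_def by measurable
      show ?thesis by measurable
    qed
    ultimately show ?thesis
      using A by (subst product_nn_integral_insert_rev) auto
  qed
  also have "\<dots> = (\<integral>\<^sup>+ s. \<integral>\<^sup>+ r. h s r \<partial>(distr ?P borel N) \<partial>lborel)"
    by (intro nn_integral_cong) (subst nn_integral_distr, auto)
  finally show ?thesis
    using A(4) by (simp add: law nn_integral_density numeral_2_eq_2)
qed

text \<open>
  The substitution \<open>s = r * z / sqrt (1 - z\<^sup>2)\<close>: at distance \<open>r\<close>
  from the axis the height \<open>s\<close> is replaced by the cosine \<open>z\<close> of the angle
  with the axis. The cutoff to the unit ball takes the same form in both variables.
\<close>

lemma nn_integral_circle_slice: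
  fixes b :: "real \<Rightarrow> real"
  assumes [measurable]: "b \<in> borel_measurable borel" and b: "\<And>z. 0 \<le> b z" and r: "0 < r"
  shows "(\<integral>\<^sup>+ s. ennreal (b (s / sqrt (s\<^sup>2 + r\<^sup>2)) * indicator {..1} (s\<^sup>2 + r\<^sup>2)) \<partial>lborel) =
     (\<integral>\<^sup>+ z. ennreal (b z * (r * (1 - z\<^sup>2) powr (- 3/2)) * indicator {..1} (z\<^sup>2 + r\<^sup>2)) \<partial>lborel)"
proof (cases "r \<le> 1")
  case False
  then have "1 < r\<^sup>2" by simp
  then have "\<not> s\<^sup>2 + r\<^sup>2 \<le> 1" for s
    using zero_le_power2[of s] by linarith
  then show ?thesis by simp
next
  case True
  define c where "c = sqrt (1 - r\<^sup>2)"
  have r2: "0 < r\<^sup>2" "r\<^sup>2 \<le> 1" using r True by (auto simp: power_le_one)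
  have c: "0 \<le> c" "c\<^sup>2 = 1 - r\<^sup>2" "c < 1" using r2 by (auto simp: c_def real_sqrt_lt_1_iff)
  have cz: "s \<in> {-c..c} \<longleftrightarrow> s\<^sup>2 + r\<^sup>2 \<le> 1" for s
    using c(1,2) abs_le_square_iff[of s c] by auto
  define g where "g = (\<lambda>z. r * z / sqrt (1 - z\<^sup>2))"
  define g' where "g' = (\<lambda>z. r * (1 - z\<^sup>2) powr (- 3/2))"
  have pos: "0 < 1 - z\<^sup>2" if "z \<in> {-c..c}" for z
  proof -
    have "z\<^sup>2 + r\<^sup>2 \<le> 1" using cz that by blast
    then show ?thesis using r2 by linarith
  qed
  have gc: "g c = c" "g (- c) = - c"
    using c(2) r by (simp_all add: g_def)
  have D: "(g has_real_derivative g' z) (at z)" if "z \<in> {-c..c}" for z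
  proof -
    let ?w = "1 - z\<^sup>2"
    have w: "0 < ?w" by (rule pos[OF that])
    have "(g has_real_derivative (r * sqrt ?w - r * z * (- 2 * z * inverse (sqrt ?w) / 2)) / (sqrt ?w * sqrt ?w)) (at z)"
      unfolding g_def using w by (auto intro!: derivative_eq_intros simp: field_simps)
    moreover have "(r * sqrt ?w - r * z * (- 2 * z * inverse (sqrt ?w) / 2)) / (sqrt ?w * sqrt ?w) = g' z"
    proof -
      have "g' z = r / (?w * sqrt ?w)"
      proof -
        have "?w powr (- 3/2) = 1 / (?w powr 1 * ?w powr (1/2))"
          by (simp only: powr_add[symmetric]) (simp add: powr_minus_divide)
        then show ?thesis using w by (simp add: g'_def powr_half_sqrt)
      qed
      moreover have "(r * sqrt ?w - r * z * (- 2 * z * inverse (sqrt ?w) / 2)) = r / sqrt ?w"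
        using w by (simp add: field_simps power2_eq_square)
      ultimately show ?thesis using w by (simp add: field_simps)
    qed
    ultimately show ?thesis by simp
  qed
  have contg': "continuous_on {-c..c} g'"
    unfolding g'_def using pos by (intro continuous_intros) force+
  have "(\<integral>\<^sup>+ s. ennreal (b (s / sqrt (s\<^sup>2 + r\<^sup>2)) * indicator {..1} (s\<^sup>2 + r\<^sup>2)) \<partial>lborel) =
      (\<integral>\<^sup>+ s. ennreal (b (s / sqrt (s\<^sup>2 + r\<^sup>2)) * indicator {g (- c)..g c} s) \<partial>lborel)"
    unfolding gc by (intro nn_integral_cong arg_cong[of _ _ ennreal] arg_cong2[of _ _ _ _ "(*)"] refl)
      (auto simp: indicator_def cz simp del: atLeastAtMost_iff)
  also have "\<dots> = (\<integral>\<^sup>+ z. ennreal (b (g z / sqrt ((g z)\<^sup>2 + r\<^sup>2)) * g' z * indicator {-c..c} z) \<partial>lborel)"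
  proof (rule nn_integral_substitution)
    show "set_borel_measurable borel {g (- c)..g c} (\<lambda>s. b (s / sqrt (s\<^sup>2 + r\<^sup>2)))"
      unfolding set_borel_measurable_def by measurable
    show "0 \<le> g' z" if "z \<in> {-c..c}" for z using r by (simp add: g'_def)
  qed (use D contg' c in auto)
  also have "\<dots> = (\<integral>\<^sup>+ z. ennreal (b z * (r * (1 - z\<^sup>2) powr (- 3/2)) * indicator {..1} (z\<^sup>2 + r\<^sup>2)) \<partial>lborel)"
  proof (intro nn_integral_cong arg_cong[of _ _ ennreal])
    fix z
    show "b (g z / sqrt ((g z)\<^sup>2 + r\<^sup>2)) * g' z * indicator {-c..c} z = b z * (r * (1 - z\<^sup>2) powr (- 3/2)) * indicator {..1} (z\<^sup>2 + r\<^sup>2)"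
    proof (cases "z \<in> {-c..c}")
      case True
      have w: "0 < 1 - z\<^sup>2" by (rule pos[OF True])
      have "(g z)\<^sup>2 + r\<^sup>2 = r\<^sup>2 / (1 - z\<^sup>2)"
        using w by (simp add: g_def power_divide power_mult_distrib field_simps)
      then have "sqrt ((g z)\<^sup>2 + r\<^sup>2) = r / sqrt (1 - z\<^sup>2)"
        using r by (simp add: real_sqrt_divide)
      then have "g z / sqrt ((g z)\<^sup>2 + r\<^sup>2) = z" using r w by (simp add: g_def)
      moreover have "z\<^sup>2 + r\<^sup>2 \<le> 1" using True cz by blast
      ultimately show ?thesis using True by (simp add: g'_def)
    next
      case False
      then have "\<not> z\<^sup>2 + r\<^sup>2 \<le> 1" using cz[of z] by blast
      then show ?thesis using False by simp
    qed
  qed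
  finally show ?thesis .
qed

text \<open>
  The surface measure is \<open>d\<close> times the volume of cones in the unit ball. In cylindrical
  coordinates, with the height replaced by the cosine \<open>z\<close>, the integral over
  \<open>r\<close> from 0 to \<open>sqrt (1 - z\<^sup>2)\<close> turns the Jacobian \<open>(1 -
  z\<^sup>2) powr (- 3/2)\<close> into the weight \<open>(1 - z\<^sup>2) powr ((d - 3) / 2)\<close>.
\<close>

lemma nn_integral_sphere_axis:
  fixes b :: "real \<Rightarrow> real" and b0 :: "'a::euclidean_space"
  assumes [measurable]: "b \<in> borel_measurable borel" and b: "\<And>z. 0 \<le> b z"
    and b0: "b0 \<in> Basis" and d: "DIM('a) \<ge> 2"
  shows "(\<integral>\<^sup>+ \<omega>. ennreal (b (b0 \<bullet> \<omega>)) \<partial>(sphere_measure :: 'a measure)) =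
    ennreal ((real DIM('a) - 1) * unit_ball_vol (real DIM('a) - 1)) *
     (\<integral>\<^sup>+ z \<in> {-1..1}. ennreal (b z * (1 - z\<^sup>2) powr ((real DIM('a) - 3) / 2)) \<partial>lborel)"
proof -
  let ?d = "DIM('a)"
  define c where "c = unit_ball_vol (real (?d - 1)) * real (?d - 1)"
  have c: "0 \<le> c" by (simp add: c_def)
  define h where "h = (\<lambda>s r. ennreal (b (s / sqrt (s\<^sup>2 + r\<^sup>2)) * indicator {..1} (s\<^sup>2 + r\<^sup>2)))"
  have hm [measurable]: "(\<lambda>(s, r). h s r) \<in> borel_measurable (borel \<Otimes>\<^sub>M borel)"
    unfolding h_def by measurable
  have "(\<integral>\<^sup>+ x. ennreal (b (b0 \<bullet> sgn x)) * indicator (ball 0 1) x \<partial>(lborel :: 'a measure)) =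
      (\<integral>\<^sup>+ x. h (x \<bullet> b0) (sqrt ((norm x)\<^sup>2 - (x \<bullet> b0)\<^sup>2)) \<partial>(lborel :: 'a measure))"
  proof (rule nn_integral_cong_AE)
    have "AE x in (lborel :: 'a measure). x \<notin> sphere 0 1"
      by (metis AE_not_in negligible_iff_null_sets negligible_sphere null_sets_completion_iff closed_sphere borel_closed sets_lborel)
    then show "AE x in lborel. ennreal (b (b0 \<bullet> sgn x)) * indicator (ball 0 1) x =
        h (x \<bullet> b0) (sqrt ((norm (x::'a))\<^sup>2 - (x \<bullet> b0)\<^sup>2))"
    proof (rule AE_mp, intro AE_I2 impI)
      fix x :: 'a assume x: "x \<notin> sphere 0 1"
      have "\<bar>x \<bullet> b0\<bar> \<le> norm x" by (rule Basis_le_norm[OF b0])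
      then have "(x \<bullet> b0)\<^sup>2 \<le> (norm x)\<^sup>2" by (simp add: abs_le_square_iff[symmetric])
      then have "(x \<bullet> b0)\<^sup>2 + (sqrt ((norm x)\<^sup>2 - (x \<bullet> b0)\<^sup>2))\<^sup>2 = (norm x)\<^sup>2" by simp
      moreover have "(norm x)\<^sup>2 \<le> 1 \<longleftrightarrow> x \<in> ball 0 1"
        using x power2_le_iff_abs_le[of 1 "norm x"] by auto
      ultimately show "ennreal (b (b0 \<bullet> sgn x)) * indicator (ball 0 1) x = h (x \<bullet> b0) (sqrt ((norm x)\<^sup>2 - (x \<bullet> b0)\<^sup>2))"
        unfolding h_def by (auto simp: sgn_div_norm inner_commute indicator_def divide_inverse mult.commute)
    qed
  qed
  also have "\<dots> = (\<integral>\<^sup>+ s. \<integral>\<^sup>+ r. ennreal (indicator {0<..} r * (c * r ^ (?d - 2))) * h s r \<partial>lborel \<partial>lborel)"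
    unfolding c_def by (rule nn_integral_axial_slices[OF hm b0 d])
  also have "\<dots> = (\<integral>\<^sup>+ r. \<integral>\<^sup>+ s. ennreal (indicator {0<..} r * (c * r ^ (?d - 2))) * h s r \<partial>lborel \<partial>lborel)"
    by (rule lborel_pair.Fubini') (simp add: split_beta')
  also have "\<dots> = (\<integral>\<^sup>+ r. \<integral>\<^sup>+ z. ennreal (indicator {0<..} r * (c * r ^ (?d - 2))) *
      ennreal (b z * (r * (1 - z\<^sup>2) powr (- 3/2)) * indicator {..1} (z\<^sup>2 + r\<^sup>2)) \<partial>lborel \<partial>lborel)"
  proof (rule nn_integral_cong)
    fix r :: real
    show "(\<integral>\<^sup>+ s. ennreal (indicator {0<..} r * (c * r ^ (?d - 2))) * h s r \<partial>lborel) =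
      (\<integral>\<^sup>+ z. ennreal (indicator {0<..} r * (c * r ^ (?d - 2))) *
      ennreal (b z * (r * (1 - z\<^sup>2) powr (- 3/2)) * indicator {..1} (z\<^sup>2 + r\<^sup>2)) \<partial>lborel)"
    proof (cases "0 < r")
      case True
      have "(\<integral>\<^sup>+ s. ennreal (indicator {0<..} r * (c * r ^ (?d - 2))) * h s r \<partial>lborel) =
          ennreal (indicator {0<..} r * (c * r ^ (?d - 2))) * (\<integral>\<^sup>+ s. h s r \<partial>lborel)"
        by (rule nn_integral_cmult) measurable
      also have "(\<integral>\<^sup>+ s. h s r \<partial>lborel) = (\<integral>\<^sup>+ z. ennreal (b z * (r * (1 - z\<^sup>2) powr (- 3/2)) * indicator {..1} (z\<^sup>2 + r\<^sup>2)) \<partial>lborel)"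
        unfolding h_def by (rule nn_integral_circle_slice[OF assms(1) b True])
      also have "ennreal (indicator {0<..} r * (c * r ^ (?d - 2))) * \<dots> =
          (\<integral>\<^sup>+ z. ennreal (indicator {0<..} r * (c * r ^ (?d - 2))) *
           ennreal (b z * (r * (1 - z\<^sup>2) powr (- 3/2)) * indicator {..1} (z\<^sup>2 + r\<^sup>2)) \<partial>lborel)"
        by (rule nn_integral_cmult[symmetric]) measurable
      finally show ?thesis .
    qed simp
  qed
  also have "\<dots> = (\<integral>\<^sup>+ z. \<integral>\<^sup>+ r. ennreal (indicator {0<..} r * (c * r ^ (?d - 2))) *
      ennreal (b z * (r * (1 - z\<^sup>2) powr (- 3/2)) * indicator {..1} (z\<^sup>2 + r\<^sup>2)) \<partial>lborel \<partial>lborel)"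
    by (rule lborel_pair.Fubini') (simp add: split_beta')
  also have "\<dots> = (\<integral>\<^sup>+ z. ennreal (c / ?d) * (ennreal (b z * (1 - z\<^sup>2) powr ((real ?d - 3) / 2)) * indicator {-1..1} z) \<partial>lborel)"
  proof (rule nn_integral_cong_AE)
    have "AE z in (lborel :: real measure). z \<notin> {-1, 1}"
      using AE_lborel_singleton[of "-1"] AE_lborel_singleton[of 1] by eventually_elim auto
    then show "AE z in lborel. (\<integral>\<^sup>+ r. ennreal (indicator {0<..} r * (c * r ^ (?d - 2))) *
      ennreal (b z * (r * (1 - z\<^sup>2) powr (- 3/2)) * indicator {..1} (z\<^sup>2 + r\<^sup>2)) \<partial>lborel) =
      ennreal (c / ?d) * (ennreal (b z * (1 - z\<^sup>2) powr ((real ?d - 3) / 2)) * indicator {-1..1} z)"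
    proof (rule AE_mp, intro AE_I2 impI)
      fix z :: real assume z: "z \<notin> {-1, 1}"
      show "(\<integral>\<^sup>+ r. ennreal (indicator {0<..} r * (c * r ^ (?d - 2))) *
      ennreal (b z * (r * (1 - z\<^sup>2) powr (- 3/2)) * indicator {..1} (z\<^sup>2 + r\<^sup>2)) \<partial>lborel) =
      ennreal (c / ?d) * (ennreal (b z * (1 - z\<^sup>2) powr ((real ?d - 3) / 2)) * indicator {-1..1} z)"
      proof (cases "z \<in> {-1..1}")
        case False
        then have "\<not> z\<^sup>2 \<le> 1" by (simp only: abs_square_le_1) auto
        then have "\<not> z\<^sup>2 + r\<^sup>2 \<le> 1" for r :: real using zero_le_power2[of r] by linarith
        then show ?thesis using False by simp
      next
        case True
        then have "\<bar>z\<bar> < 1" using z by auto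
        then have w: "0 < 1 - z\<^sup>2" by (simp add: abs_square_less_1)
        define w where "w = 1 - z\<^sup>2"
        have w: "0 < w" using w by (simp add: w_def)
        have "(\<integral>\<^sup>+ r. ennreal (indicator {0<..} r * (c * r ^ (?d - 2))) *
          ennreal (b z * (r * w powr (- 3/2)) * indicator {..1} (z\<^sup>2 + r\<^sup>2)) \<partial>lborel) =
          (\<integral>\<^sup>+ r. ennreal (c * b z * w powr (- 3/2)) * (ennreal (r ^ (?d - 1)) * indicator {0..sqrt w} r) \<partial>lborel)"
        proof (intro nn_integral_cong)
          fix r :: real
          have e: "r ^ (?d - 2) * r = r ^ (?d - 1)"
          proof -
            have "?d - 1 = Suc (?d - 2)" using d by simp
            then show ?thesis by simp
          qed
          have i: "z\<^sup>2 + r\<^sup>2 \<le> 1 \<longleftrightarrow> r \<le> sqrt w" if "0 < r"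
            using that real_sqrt_le_iff[of "r\<^sup>2" w] by (auto simp: w_def)
          have z0: "(0::real) ^ (?d - 1) = 0" using d by (simp add: zero_power)
          show "ennreal (indicator {0<..} r * (c * r ^ (?d - 2))) *
            ennreal (b z * (r * w powr (- 3/2)) * indicator {..1} (z\<^sup>2 + r\<^sup>2)) =
            ennreal (c * b z * w powr (- 3/2)) * (ennreal (r ^ (?d - 1)) * indicator {0..sqrt w} r)"
            using i e c b[of z] z0
            by (cases "0 < r"; cases "r = 0") (auto simp: indicator_def ennreal_mult'[symmetric] mult_ac)
        qed
        also have "\<dots> = ennreal (c * b z * w powr (- 3/2)) * (\<integral>\<^sup>+ r. ennreal (r ^ (?d - 1)) * indicator {0..sqrt w} r \<partial>lborel)"
          by (rule nn_integral_cmult) measurable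
        also have "(\<integral>\<^sup>+ r. ennreal (r ^ (?d - 1)) * indicator {0..sqrt w} r \<partial>lborel) = ennreal (sqrt w ^ ?d / ?d - 0 ^ ?d / ?d)"
          using w d by (intro nn_integral_FTC_Icc) (auto intro!: derivative_eq_intros)
        also have "ennreal (c * b z * w powr (- 3/2)) * \<dots> = ennreal (c / ?d) * ennreal (b z * w powr ((real ?d - 3) / 2))"
        proof -
          have "w powr (- 3/2) * sqrt w ^ ?d = w powr ((real ?d - 3) / 2)"
            using w by (simp add: powr_half_sqrt[symmetric] powr_realpow[symmetric] powr_powr powr_add[symmetric] field_simps)
          then have "c * b z * w powr (- 3/2) * (sqrt w ^ ?d / ?d - 0 ^ ?d / ?d) = c / ?d * (b z * w powr ((real ?d - 3) / 2))"
            using d by (simp add: zero_power mult_ac)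
          then show ?thesis
            using c b[of z] d w by (subst (1 2) ennreal_mult[symmetric]) (auto simp: zero_power)
        qed
        finally show ?thesis using True by (simp add: w_def)
      qed
    qed
  qed
  also have "\<dots> = ennreal (c / ?d) * (\<integral>\<^sup>+ z \<in> {-1..1}. ennreal (b z * (1 - z\<^sup>2) powr ((real ?d - 3) / 2)) \<partial>lborel)"
    by (rule nn_integral_cmult) measurable
  finally have *: "(\<integral>\<^sup>+ x. ennreal (b (b0 \<bullet> sgn x)) * indicator (ball 0 1) x \<partial>(lborel :: 'a measure)) =
     ennreal (c / ?d) * (\<integral>\<^sup>+ z \<in> {-1..1}. ennreal (b z * (1 - z\<^sup>2) powr ((real ?d - 3) / 2)) \<partial>lborel)" .
  have "of_nat ?d * ennreal (c / ?d) = ennreal ((real ?d - 1) * unit_ball_vol (real ?d - 1))"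
    using d c by (simp add: ennreal_of_nat_eq_real_of_nat ennreal_mult'[symmetric] c_def of_nat_diff mult.commute)
  then show ?thesis
    by (subst nn_integral_sphere_measure) (simp_all add: * mult.assoc[symmetric])
qed

lemma nn_integral_sphere_inner:
  fixes b :: "real \<Rightarrow> real" and e :: "real^'n::finite"
  assumes [measurable]: "b \<in> borel_measurable borel" and b: "\<And>z. 0 \<le> b z"
    and e: "norm e = 1" and d: "CARD('n) \<ge> 2"
  shows "(\<integral>\<^sup>+ \<omega>. ennreal (b (e \<bullet> \<omega>)) \<partial>sphere_measure) = b2_norm TYPE(real^'n) b"
proof -
  obtain k :: 'n where True by simp
  have "norm (axis k (1::real)) = norm e" using e by simp
  from orthogonal_transformation_exists[OF this]
  obtain T where T: "orthogonal_transformation T" "T (axis k (1::real)) = e" by metis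
  have [measurable]: "T \<in> borel_measurable borel"
    using orthogonal_transformation_linear[OF T(1)]
    by (simp add: borel_measurable_continuous_onI linear_continuous_on linear_conv_bounded_linear)
  have sgnT: "sgn (T x) = T (sgn x)" for x
    using T(1) by (simp add: sgn_div_norm orthogonal_transformation_norm orthogonal_transformation_scaleR)
  have [measurable]: "ball (0::real^'n) 1 \<in> sets borel" by simp
  have inner: "e \<bullet> sgn (T x) = axis k (1::real) \<bullet> sgn x" for x
    using T by (metis sgnT orthogonal_transformation_def)
  have "(\<integral>\<^sup>+ \<omega>. ennreal (b (e \<bullet> \<omega>)) \<partial>sphere_measure) =
      of_nat DIM(real^'n) * (\<integral>\<^sup>+ x. ennreal (b (e \<bullet> sgn x)) * indicator (ball 0 1) x \<partial>lborel)"
    by (rule nn_integral_sphere_measure) measurable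
  also have "(\<integral>\<^sup>+ x. ennreal (b (e \<bullet> sgn x)) * indicator (ball 0 1) x \<partial>lborel) =
      (\<integral>\<^sup>+ x. ennreal (b (e \<bullet> sgn (T x))) * indicator (ball 0 1) (T x) \<partial>lborel)"
    by (rule nn_integral_orthogonal[OF T(1), symmetric]) measurable
  also have "\<dots> = (\<integral>\<^sup>+ x. ennreal (b (axis k (1::real) \<bullet> sgn x)) * indicator (ball 0 1) x \<partial>(lborel :: (real^'n) measure))"
    by (intro nn_integral_cong) (simp add: inner indicator_def orthogonal_transformation_norm[OF T(1)])
  also have "of_nat DIM(real^'n) * \<dots> = (\<integral>\<^sup>+ \<omega>. ennreal (b (axis k (1::real) \<bullet> \<omega>)) \<partial>(sphere_measure :: (real^'n) measure))"
    by (rule nn_integral_sphere_measure[symmetric]) measurable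
  also have "\<dots> = b2_norm TYPE(real^'n) b"
    using nn_integral_sphere_axis[OF assms(1) b, of "axis k 1 :: real^'n"] d by (simp add: b2_norm_def Let_def axis_in_Basis_iff)
  finally show ?thesis .
qed

section \<open>Positive solutions of an integral equation\<close>

text \<open>
  The bounds hold at every point and for all real times, not just almost everywhere: the collision
  term is integrated in time at a fixed phase point.
\<close>

definition weighted_ball :: "real \<Rightarrow> ('z::euclidean_space \<Rightarrow> real) \<Rightarrow> (real \<times> 'z \<Rightarrow> real) set" where
  "weighted_ball R M = {F. F \<in> borel_measurable borel \<and> (\<forall>t z. 0 \<le> F (t, z) \<and> F (t, z) \<le> R * M z)}"

text \<open>
  The equation \<open>F (t, z) = f0 z + \<integral>\<^sub>0\<^sup>t \<Theta> F (s, z) ds\<close>, an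
  ordinary differential equation at each \<open>z\<close> whose right-hand side depends on all of
  \<open>F\<close>. The estimates for \<open>\<Theta>\<close> are integrated over all times at a
  fixed \<open>z\<close>, so that no length of the time interval enters. The condition
  \<open>\<Theta>_quasi_positive\<close> is the one under which such an equation preserves
  positivity.
\<close>

locale evolution =
  fixes M :: "'z::euclidean_space \<Rightarrow> real" and R q m :: real
    and \<Theta> :: "(real \<times> 'z \<Rightarrow> real) \<Rightarrow> real \<times> 'z \<Rightarrow> real" and f0 :: "'z \<Rightarrow> real"
  assumes M_measurable [measurable]: "M \<in> borel_measurable borel"
    and M_pos: "\<And>z. 0 < M z"
    and m: "m \<le> R" and q: "0 \<le> q" "q < 1"
    and \<Theta>_measurable: "\<And>F. F \<in> weighted_ball R M \<Longrightarrow> \<Theta> F \<in> borel_measurable borel"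
    and \<Theta>_bound: "\<And>F z. F \<in> weighted_ball R M \<Longrightarrow>
       (\<integral>\<^sup>+ t. ennreal \<bar>\<Theta> F (t, z)\<bar> \<partial>lborel) \<le> ennreal ((R - m) * M z)"
    and \<Theta>_Lipschitz: "\<And>F G N z. F \<in> weighted_ball R M \<Longrightarrow> G \<in> weighted_ball R M \<Longrightarrow> 0 \<le> N \<Longrightarrow>
       (\<And>t z. \<bar>F (t, z) - G (t, z)\<bar> \<le> N * M z) \<Longrightarrow>
       (\<integral>\<^sup>+ t. ennreal \<bar>\<Theta> F (t, z) - \<Theta> G (t, z)\<bar> \<partial>lborel) \<le> ennreal (q * N * M z)"
    and \<Theta>_cong: "\<And>F G. F \<in> weighted_ball R M \<Longrightarrow> G \<in> weighted_ball R M \<Longrightarrow>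
       (AE t in lborel. AE z in lborel. F (t, z) = G (t, z)) \<Longrightarrow>
       (AE t in lborel. AE z in lborel. \<Theta> F (t, z) = \<Theta> G (t, z))"
    and \<Theta>_quasi_positive: "\<And>F t z. F \<in> weighted_ball R M \<Longrightarrow> F (t, z) = 0 \<Longrightarrow> 0 \<le> \<Theta> F (t, z)"
    and f0_measurable [measurable]: "f0 \<in> borel_measurable borel"
    and f0_bound: "\<And>z. 0 \<le> f0 z \<and> f0 z \<le> m * M z"
begin

lemma m_nonneg: "0 \<le> m"
proof -
  have "0 \<le> m * M undefined" using f0_bound order_trans by blast
  then show ?thesis using M_pos[of undefined] by (simp add: zero_le_mult_iff)
qed

lemma R_nonneg: "0 \<le> R" using m_nonneg m by simp

lemma ball_measurable [measurable_dest]: "F \<in> weighted_ball R M \<Longrightarrow> F \<in> borel_measurable borel"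
  by (simp add: weighted_ball_def)

lemma ball_bounds: "F \<in> weighted_ball R M \<Longrightarrow> 0 \<le> F (t, z)" "F \<in> weighted_ball R M \<Longrightarrow> F (t, z) \<le> R * M z"
  by (auto simp: weighted_ball_def)

lemma \<Theta>_integrable:
  assumes F: "F \<in> weighted_ball R M"
  shows "integrable lborel (\<lambda>t. \<Theta> F (t, z))"
proof (rule integrableI_bounded)
  note [measurable] = \<Theta>_measurable[OF F]
  show "(\<lambda>t. \<Theta> F (t, z)) \<in> borel_measurable lborel" by measurable
  show "(\<integral>\<^sup>+ t. ennreal (norm (\<Theta> F (t, z))) \<partial>lborel) < \<infinity>"
    using \<Theta>_bound[OF F, of z] by (simp add: order_le_less_trans)
qed

definition duhamel :: "(real \<times> 'z \<Rightarrow> real) \<Rightarrow> real \<times> 'z \<Rightarrow> real" where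
  "duhamel F = (\<lambda>(t, z). f0 z + (\<integral>s. indicator {0..t} s * \<Theta> F (s, z) \<partial>lborel))"

lemma integrable_window:
  assumes F: "F \<in> weighted_ball R M"
  shows "integrable lborel (\<lambda>s. indicator {0..t} s * \<Theta> F (s, z))"
  using integrable_mult_indicator[OF _ \<Theta>_integrable[OF F, of z], of "{0..t}"] by simp

lemma duhamel_measurable [measurable]:
  assumes F: "F \<in> weighted_ball R M"
  shows "duhamel F \<in> borel_measurable borel"
proof -
  note [measurable] = \<Theta>_measurable[OF F]
  have *: "{p :: (real \<times> 'z) \<times> real. 0 \<le> snd p \<and> snd p \<le> fst (fst p)} \<in> sets borel"
    by (intro borel_closed closed_Collect_conj closed_Collect_le continuous_intros)
  define K where "K = (\<lambda>(p :: real \<times> 'z) s. indicator {p :: (real \<times> 'z) \<times> real. 0 \<le> snd p \<and> snd p \<le> fst (fst p)} (p, s) * \<Theta> F (s, snd p))"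
  have eq: "duhamel F = (\<lambda>p. f0 (snd p) + (\<integral>s. K p s \<partial>lborel))"
    by (auto simp: duhamel_def K_def fun_eq_iff indicator_def intro!: Bochner_Integration.integral_cong)
  have "(\<lambda>(p, s). K p s) \<in> borel_measurable borel"
    using * unfolding K_def split_beta' by measurable
  then have "(\<lambda>(p, s). K p s) \<in> borel_measurable (borel \<Otimes>\<^sub>M lborel)"
    by (simp cong: measurable_cong_sets add: borel_prod[symmetric])
  then have "(\<lambda>p. \<integral>s. K p s \<partial>lborel) \<in> borel_measurable borel"
    by (rule lborel.borel_measurable_lebesgue_integral)
  then show ?thesis
    unfolding eq by measurable
qed

lemma duhamel_bound:
  assumes F: "F \<in> weighted_ball R M"
  shows "duhamel F (t, z) \<le> R * M z"
proof -
  have "(\<integral>s. indicator {0..t} s * \<Theta> F (s, z) \<partial>lborel) \<le> (\<integral>s. \<bar>\<Theta> F (s, z)\<bar> \<partial>lborel)"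
    by (intro integral_mono integrable_window F integrable_abs \<Theta>_integrable) (auto simp: indicator_def)
  also have "ennreal (\<integral>s. \<bar>\<Theta> F (s, z)\<bar> \<partial>lborel) \<le> ennreal ((R - m) * M z)"
    using \<Theta>_bound[OF F, of z] \<Theta>_integrable[OF F, of z]
    by (subst nn_integral_eq_integral[symmetric]) auto
  then have "(\<integral>s. \<bar>\<Theta> F (s, z)\<bar> \<partial>lborel) \<le> (R - m) * M z"
    using m M_pos[of z] by (subst (asm) ennreal_le_iff) auto
  finally show ?thesis using f0_bound[of z] by (simp add: duhamel_def algebra_simps)
qed

lemma duhamel_diff:
  assumes F: "F \<in> weighted_ball R M" and G: "G \<in> weighted_ball R M"
  shows "ennreal \<bar>duhamel F (t, z) - duhamel G (t, z)\<bar> \<le> (\<integral>\<^sup>+ s. ennreal \<bar>\<Theta> F (s, z) - \<Theta> G (s, z)\<bar> \<partial>lborel)"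
proof -
  have "\<bar>duhamel F (t, z) - duhamel G (t, z)\<bar> =
      \<bar>\<integral>s. indicator {0..t} s * \<Theta> F (s, z) - indicator {0..t} s * \<Theta> G (s, z) \<partial>lborel\<bar>"
    by (simp add: duhamel_def integrable_window F G)
  also have "\<dots> \<le> (\<integral>s. \<bar>indicator {0..t} s * \<Theta> F (s, z) - indicator {0..t} s * \<Theta> G (s, z)\<bar> \<partial>lborel)"
    using integral_norm_bound[of lborel "\<lambda>s. indicator {0..t} s * \<Theta> F (s, z) - indicator {0..t} s * \<Theta> G (s, z)"] by simp
  also have "\<dots> \<le> (\<integral>s. \<bar>\<Theta> F (s, z) - \<Theta> G (s, z)\<bar> \<partial>lborel)"
    by (intro integral_mono integrable_abs Bochner_Integration.integrable_diff integrable_window \<Theta>_integrable F G) (auto simp: indicator_def)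
  finally have "ennreal \<bar>duhamel F (t, z) - duhamel G (t, z)\<bar> \<le> ennreal (\<integral>s. \<bar>\<Theta> F (s, z) - \<Theta> G (s, z)\<bar> \<partial>lborel)"
    by (rule ennreal_leI)
  also have "\<dots> = (\<integral>\<^sup>+ s. ennreal \<bar>\<Theta> F (s, z) - \<Theta> G (s, z)\<bar> \<partial>lborel)"
    by (intro nn_integral_eq_integral[symmetric] integrable_abs Bochner_Integration.integrable_diff \<Theta>_integrable F G) auto
  finally show ?thesis .
qed

text \<open>
  As \<open>\<Theta> F\<close> has no sign, only the positive part of the right-hand side stays in
  the ball.
\<close>

definition step :: "(real \<times> 'z \<Rightarrow> real) \<Rightarrow> real \<times> 'z \<Rightarrow> real" where
  "step F = (\<lambda>p. max 0 (duhamel F p))"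

lemma step_ball: "F \<in> weighted_ball R M \<Longrightarrow> step F \<in> weighted_ball R M"
  using duhamel_bound[of F] R_nonneg M_pos by (auto simp: weighted_ball_def step_def less_imp_le)

lemma step_contraction:
  assumes F: "F \<in> weighted_ball R M" and G: "G \<in> weighted_ball R M" and N: "0 \<le> N"
    and d: "\<And>t z. \<bar>F (t, z) - G (t, z)\<bar> \<le> N * M z"
  shows "\<bar>step F (t, z) - step G (t, z)\<bar> \<le> q * N * M z"
proof -
  have "\<bar>step F (t, z) - step G (t, z)\<bar> \<le> \<bar>duhamel F (t, z) - duhamel G (t, z)\<bar>"
    by (auto simp: step_def)
  also have "ennreal \<dots> \<le> ennreal (q * N * M z)"
    using duhamel_diff[OF F G] \<Theta>_Lipschitz[OF F G N d] by (rule order_trans)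
  then have "\<bar>duhamel F (t, z) - duhamel G (t, z)\<bar> \<le> q * N * M z"
    using q N M_pos[of z] by (subst (asm) ennreal_le_iff) auto
  finally show ?thesis .
qed

text \<open>
  Banach's iteration, started at 0. The weighted supremum norm controls the iterates at every point,
  so the pointwise limit is again in the ball.
\<close>

lemma fixed_point: obtains F where "F \<in> weighted_ball R M" "step F = F"
proof -
  define f where "f = (\<lambda>n. (step ^^ n) (\<lambda>p. 0))"
  have f_ball: "f n \<in> weighted_ball R M" for n
    unfolding f_def by (induction n) (use R_nonneg M_pos step_ball in \<open>auto simp: weighted_ball_def less_imp_le\<close>)
  have fS: "f (Suc n) = step (f n)" for n by (simp add: f_def)
  have step_n: "\<bar>f (Suc n) (t, z) - f n (t, z)\<bar> \<le> q ^ n * R * M z" for n t z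
  proof (induction n arbitrary: t z)
    case 0
    then show ?case using ball_bounds[OF f_ball[of 1], of t z] by (simp add: f_def)
  next
    case (Suc n)
    have "\<bar>step (f (Suc n)) (t, z) - step (f n) (t, z)\<bar> \<le> q * (q ^ n * R) * M z"
      by (rule step_contraction[OF f_ball f_ball]) (use Suc q R_nonneg in auto)
    then show ?case by (simp add: fS mult.assoc)
  qed
  have conv: "summable (\<lambda>n. f (Suc n) p - f n p)" for p
  proof (rule summable_comparison_test)
    show "\<exists>N. \<forall>n\<ge>N. norm (f (Suc n) p - f n p) \<le> q ^ n * R * M (snd p)"
      using step_n[of _ "fst p" "snd p"] by auto
    show "summable (\<lambda>n. q ^ n * R * M (snd p))"
      using q by (intro summable_mult2 summable_geometric) auto
  qed
  define F where "F = (\<lambda>p. lim (\<lambda>n. f n p))"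
  have lim: "(\<lambda>n. f n p) \<longlonglongrightarrow> F p" for p
  proof -
    have "convergent (\<lambda>n. \<Sum>i<n. f (Suc i) p - f i p)"
      using conv by (simp add: summable_iff_convergent)
    then have "convergent (\<lambda>n. f n p)"
      using convergent_diff_const_right_iff[of "\<lambda>n. f n p" "f 0 p"] by (simp add: sum_lessThan_telescope[of "\<lambda>n. f n p"])
    then show ?thesis by (simp add: F_def convergent_LIMSEQ_iff)
  qed
  have tail: "\<bar>F (t, z) - f n (t, z)\<bar> \<le> q ^ n * (R / (1 - q)) * M z" for n t z
  proof -
    have *: "\<bar>f (n + k) (t, z) - f n (t, z)\<bar> \<le> q ^ n * (R / (1 - q)) * M z" for k
    proof -
      have "\<bar>f (n + k) (t, z) - f n (t, z)\<bar> \<le> q ^ n * (R * ((1 - q ^ k) / (1 - q))) * M z"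
      proof (induction k)
        case (Suc k)
        have "\<bar>f (n + Suc k) (t, z) - f n (t, z)\<bar> \<le> q ^ (n + k) * R * M z + q ^ n * (R * ((1 - q ^ k) / (1 - q))) * M z"
          using step_n[of "n + k" t z] Suc by simp
        also have "\<dots> = q ^ n * (R * ((1 - q ^ Suc k) / (1 - q))) * M z"
          using q by (simp add: field_simps power_add)
        finally show ?case .
      qed simp
      also have "\<dots> \<le> q ^ n * (R * (1 / (1 - q))) * M z"
        using q R_nonneg M_pos[of z] by (intro mult_right_mono mult_left_mono divide_right_mono) auto
      finally show ?thesis by simp
    qed
    have "(\<lambda>k. \<bar>f (n + k) (t, z) - f n (t, z)\<bar>) \<longlonglongrightarrow> \<bar>F (t, z) - f n (t, z)\<bar>"
      using LIMSEQ_ignore_initial_segment[OF lim, of n "(t, z)"]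
      by (intro tendsto_intros) (simp add: add.commute)
    then show ?thesis by (rule LIMSEQ_le_const2) (use * in auto)
  qed
  have F_ball: "F \<in> weighted_ball R M"
  proof -
    have "F \<in> borel_measurable borel"
      using lim ball_measurable[OF f_ball] by (rule borel_measurable_LIMSEQ_real)
    moreover have "0 \<le> F (t, z)" "F (t, z) \<le> R * M z" for t z
      using ball_bounds[OF f_ball]
      by (auto intro!: LIMSEQ_le_const[OF lim] LIMSEQ_le_const2[OF lim])
    ultimately show ?thesis by (simp add: weighted_ball_def)
  qed
  have "step F (t, z) = F (t, z)" for t z
  proof -
    have b: "\<bar>step F (t, z) - f (Suc n) (t, z)\<bar> \<le> q ^ n * (q * (R / (1 - q)) * M z)" for n
      using step_contraction[OF F_ball f_ball _ tail, of n t z] q R_nonneg by (simp add: fS mult_ac)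
    have l: "(\<lambda>n. q ^ n * (q * (R / (1 - q)) * M z)) \<longlonglongrightarrow> 0"
      using q by (intro tendsto_mult_left_zero LIMSEQ_realpow_zero) auto
    have "(\<lambda>n. step F (t, z) - f (Suc n) (t, z)) \<longlonglongrightarrow> 0"
      by (rule Lim_null_comparison[OF _ l]) (intro always_eventually allI, simp only: b real_norm_def)
    moreover have "(\<lambda>n. step F (t, z) - f (Suc n) (t, z)) \<longlonglongrightarrow> step F (t, z) - F (t, z)"
      using LIMSEQ_Suc[OF lim] by (intro tendsto_intros)
    ultimately have "0 = step F (t, z) - F (t, z)" by (rule LIMSEQ_unique)
    then show ?thesis by simp
  qed
  then have "step F = F" by auto
  with F_ball show ?thesis by (rule that)
qed

lemma duhamel_increment:
  assumes F: "F \<in> weighted_ball R M" and t: "0 \<le> s" "s \<le> t"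
  shows "duhamel F (t, z) - duhamel F (s, z) = (\<integral>r. indicator {s<..t} r * \<Theta> F (r, z) \<partial>lborel)"
proof -
  have "duhamel F (t, z) - duhamel F (s, z) =
      (\<integral>r. indicator {0..t} r * \<Theta> F (r, z) - indicator {0..s} r * \<Theta> F (r, z) \<partial>lborel)"
    by (simp add: duhamel_def integrable_window F)
  also have "\<dots> = (\<integral>r. indicator {s<..t} r * \<Theta> F (r, z) \<partial>lborel)"
    using t by (intro Bochner_Integration.integral_cong) (auto simp: indicator_def)
  finally show ?thesis .
qed

lemma duhamel_continuous:
  assumes F: "F \<in> weighted_ball R M"
  shows "continuous_on {0..t} (\<lambda>s. duhamel F (s, z))"
proof -
  have "set_integrable lborel {0..s} (\<lambda>r. \<Theta> F (r, z))" for s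
    using integrable_window[OF F] by (simp add: set_integrable_def)
  then have eq: "(\<lambda>r. \<Theta> F (r, z)) integrable_on {0..s}"
      "duhamel F (s, z) = f0 z + integral {0..s} (\<lambda>r. \<Theta> F (r, z))" for s
    using set_borel_integral_eq_integral[of "{0..s}" "\<lambda>r. \<Theta> F (r, z)"]
    by (auto simp: duhamel_def set_lebesgue_integral_def)
  show ?thesis
    unfolding eq(2) using eq(1) by (intro continuous_intros indefinite_integral_continuous_1)
qed

lemma duhamel_zero:
  assumes F: "F \<in> weighted_ball R M"
  shows "duhamel F (0, z) = f0 z"
proof -
  have "(\<integral>s. indicator {0..0} s * \<Theta> F (s, z) \<partial>lborel) = (\<integral>s. 0 \<partial>(lborel::real measure))"
  proof (rule integral_cong_AE[OF borel_measurable_integrable[OF integrable_window[OF F]]])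
    show "AE s in lborel. indicator {0..0::real} s * \<Theta> F (s, z) = 0"
      using AE_lborel_singleton[of 0] by eventually_elim (auto simp: indicator_def)
  qed simp
  then show ?thesis by (simp add: duhamel_def)
qed

text \<open>
  At the fixed point the positive part is inactive. Otherwise take the last time at which the
  right-hand side was nonnegative: from then on the fixed point is 0, hence \<open>\<Theta> F \<ge>
  0\<close> by quasi-positivity, and the right-hand side cannot have decreased.
\<close>

theorem solution_exists:
  obtains F where "F \<in> weighted_ball R M" "\<And>t z. 0 \<le> t \<Longrightarrow> F (t, z) = duhamel F (t, z)"
proof -
  obtain F where F: "F \<in> weighted_ball R M" and fp: "step F = F" by (rule fixed_point)
  have "0 \<le> duhamel F (t, z)" if t: "0 \<le> t" for t z
  proof (rule ccontr)
    assume neg: "\<not> 0 \<le> duhamel F (t, z)"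
    let ?y = "\<lambda>s. duhamel F (s, z)"
    have y0: "?y 0 = f0 z" by (rule duhamel_zero[OF F])
    define A where "A = {0..t} \<inter> ?y -` {0..}"
    have "closed A" unfolding A_def
      by (rule continuous_on_closed_vimage[THEN iffD1, rule_format, OF closed_atLeastAtMost duhamel_continuous[OF F] closed_atLeast, simplified Int_commute])
    moreover have "bounded A" by (rule bounded_subset[of "{0..t}"]) (auto simp: A_def)
    moreover have "0 \<in> A" using t f0_bound[of z] y0 by (simp add: A_def)
    ultimately obtain s where s: "s \<in> A" "\<And>r. r \<in> A \<Longrightarrow> r \<le> s"
      using compact_attains_sup[of A] by (auto simp: compact_eq_bounded_closed)
    have "0 \<le> indicator {s<..t} r * \<Theta> F (r, z)" for r
    proof (cases "r \<in> {s<..t}")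
      case True
      then have "r \<notin> A" using s(2)[of r] by auto
      then have "?y r < 0" using True s(1) by (auto simp: A_def)
      then have "F (r, z) = 0" using fp by (metis step_def max.absorb1 less_imp_le)
      then show ?thesis using \<Theta>_quasi_positive[OF F] by simp
    qed simp
    then have "0 \<le> ?y t - ?y s"
      using s(1) by (subst duhamel_increment[OF F]) (auto simp: A_def)
    then show False using neg s(1) by (simp add: A_def)
  qed
  then have "F (t, z) = duhamel F (t, z)" if "0 \<le> t" for t z
    using fp that by (metis step_def max.absorb2)
  with F show ?thesis by (rule that)
qed

text \<open>
  By induction on \<open>n\<close> the two functions differ by at most \<open>q ^ n * R * M\<close>.
\<close>

theorem solution_unique:
  assumes F: "F \<in> weighted_ball R M" and G: "G \<in> weighted_ball R M"
    and eq: "AE t in lborel. AE z in lborel.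
      ennreal \<bar>G (t, z) - F (t, z)\<bar> \<le> (\<integral>\<^sup>+ s. ennreal \<bar>\<Theta> G (s, z) - \<Theta> F (s, z)\<bar> \<partial>lborel)"
  shows "AE t in lborel. AE z in lborel. G (t, z) = F (t, z)"
proof -
  note [measurable] = \<Theta>_measurable[OF F] \<Theta>_measurable[OF G] ball_measurable[OF F] ball_measurable[OF G]
  have *: "AE t in lborel. AE z in lborel. \<bar>G (t, z) - F (t, z)\<bar> \<le> q ^ n * R * M z" for n
  proof (induction n)
    case 0
    have "\<bar>G (t, z) - F (t, z)\<bar> \<le> R * M z" for t z
      using ball_bounds[OF F, of t z] ball_bounds[OF G, of t z] by auto
    then show ?case by simp
  next
    case (Suc n)
    define N where "N = q ^ n * R"
    have N: "0 \<le> N" using q R_nonneg by (simp add: N_def)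
    \<comment> \<open>The Lipschitz estimate asks for a difference that is bounded everywhere, but it is known to be so only almost everywhere. Truncating G near F changes it on a null set.\<close>
    define H where "H = (\<lambda>p. max (F p - N * M (snd p)) (min (G p) (F p + N * M (snd p))))"
    have NM: "0 \<le> N * M z" for z using N M_pos[of z] by simp
    have [measurable]: "H \<in> borel_measurable borel"
      unfolding H_def by measurable
    have "0 \<le> H (t, z)" "H (t, z) \<le> R * M z" "\<bar>H (t, z) - F (t, z)\<bar> \<le> N * M z" for t z
      using ball_bounds[OF F, of t z] ball_bounds[OF G, of t z] NM[of z] by (auto simp: H_def)
    then have H: "H \<in> weighted_ball R M" and HF: "\<And>t z. \<bar>H (t, z) - F (t, z)\<bar> \<le> N * M z"
      by (auto simp: weighted_ball_def)
    note [measurable] = \<Theta>_measurable[OF H]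
    have "AE t in lborel. AE z in lborel. H (t, z) = G (t, z)"
      using Suc
    proof eventually_elim
      case (elim t)
      then show ?case by eventually_elim (auto simp: H_def N_def)
    qed
    then have "AE t in lborel. AE z in lborel. \<Theta> H (t, z) = \<Theta> G (t, z)"
      by (rule \<Theta>_cong[OF H G])
    then have "AE z in lborel. AE t in lborel. \<Theta> H (t, z) = \<Theta> G (t, z)"
      by (subst (asm) AE_lborel_commute) auto
    then have Z: "AE z in lborel. (\<integral>\<^sup>+ s. ennreal \<bar>\<Theta> G (s, z) - \<Theta> F (s, z)\<bar> \<partial>lborel) \<le> ennreal (q * N * M z)"
    proof (rule AE_mp, intro AE_I2 impI)
      fix z assume "AE t in lborel. \<Theta> H (t, z) = \<Theta> G (t, z)"
      then have "(\<integral>\<^sup>+ s. ennreal \<bar>\<Theta> G (s, z) - \<Theta> F (s, z)\<bar> \<partial>lborel) = (\<integral>\<^sup>+ s. ennreal \<bar>\<Theta> H (s, z) - \<Theta> F (s, z)\<bar> \<partial>lborel)"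
        by (intro nn_integral_cong_AE) auto
      also have "\<dots> \<le> ennreal (q * N * M z)" by (rule \<Theta>_Lipschitz[OF H F N HF])
      finally show "(\<integral>\<^sup>+ s. ennreal \<bar>\<Theta> G (s, z) - \<Theta> F (s, z)\<bar> \<partial>lborel) \<le> ennreal (q * N * M z)" .
    qed
    show ?case
      using eq
    proof eventually_elim
      case (elim t)
      with Z show ?case
      proof eventually_elim
        case (elim z)
        then have "ennreal \<bar>G (t, z) - F (t, z)\<bar> \<le> ennreal (q * N * M z)" by simp
        moreover have "0 \<le> q * N * M z" using N q M_pos[of z] by simp
        ultimately show ?case by (simp add: N_def mult.assoc)
      qed
    qed
  qed
  then have "AE t in lborel. \<forall>n. AE z in lborel. \<bar>G (t, z) - F (t, z)\<bar> \<le> q ^ n * R * M z"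
    by (subst AE_all_countable) auto
  then show ?thesis
  proof eventually_elim
    case (elim t)
    then have "AE z in lborel. \<forall>n. \<bar>G (t, z) - F (t, z)\<bar> \<le> q ^ n * R * M z"
      by (subst AE_all_countable) auto
    then show ?case
    proof eventually_elim
      case (elim z)
      have "(\<lambda>n. q ^ n * R * M z) \<longlonglongrightarrow> 0 * R * M z"
        using q by (intro tendsto_intros) auto
      then have "\<bar>G (t, z) - F (t, z)\<bar> \<le> 0 * R * M z"
        by (rule LIMSEQ_le_const) (use elim in auto)
      then show ?case by simp
    qed
  qed
qed

end

section \<open>Separability of the space of integrable functions\<close>

definition step_fun :: "(real \<times> 'z set) list \<Rightarrow> 'z \<Rightarrow> real" where
  "step_fun xs z = (\<Sum>(c, W) \<leftarrow> xs. c * indicator W z)"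

lemma step_fun_simps [simp]:
  "step_fun [] = (\<lambda>z. 0)"
  "step_fun ((c, W) # xs) z = c * indicator W z + step_fun xs z"
  "step_fun (xs @ ys) z = step_fun xs z + step_fun ys z"
  by (auto simp: step_fun_def fun_eq_iff)

lemma open_approx_finite_union:
  fixes U :: "'z::euclidean_space set"
  assumes B: "countable B" "topological_basis B" and U: "open U" "emeasure lborel U < \<infinity>" and e: "0 < e"
  obtains F where "finite F" "F \<subseteq> B" "\<Union>F \<subseteq> U" "emeasure lborel (U - \<Union>F) < ennreal e"
proof -
  obtain B' where B': "B' \<subseteq> B" "\<Union>B' = U"
    using B(2) U(1) unfolding topological_basis_def by blast
  show ?thesis
  proof (cases "B' = {}")
    case True
    then show ?thesis using B' e that[of "{}"] by auto
  next
    case False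
    have cB': "countable B'" using B' B(1) countable_subset by blast
    define W where "W = (\<lambda>n. \<Union>i\<in>{..n::nat}. from_nat_into B' i)"
    have op: "open X" if "X \<in> B'" for X using that B' B(2) topological_basis_open by blast
    have Wm: "W n \<in> sets borel" for n
      unfolding W_def using op from_nat_into[OF False] by (intro borel_open open_UN) auto
    have UW: "(\<Union>n. W n) = U"
      using B'(2) from_nat_into_surj[OF cB'] from_nat_into[OF False] by (fastforce simp: W_def)
    have "(\<lambda>n. emeasure lborel (U - W n)) \<longlonglongrightarrow> emeasure lborel (\<Inter>n. U - W n)"
    proof (rule Lim_emeasure_decseq)
      show "decseq (\<lambda>n. U - W n)" by (auto simp: decseq_def W_def intro: order_trans)
      show "range (\<lambda>n. U - W n) \<subseteq> sets lborel" using U Wm by auto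
      show "emeasure lborel (U - W n) \<noteq> \<infinity>" for n
        using emeasure_mono[of "U - W n" U lborel] U by (auto simp: top_unique)
    qed
    also have "(\<Inter>n. U - W n) = {}" using UW by blast
    finally have "eventually (\<lambda>n. emeasure lborel (U - W n) < ennreal e) sequentially"
      using e by (auto simp: order_tendsto_iff)
    then obtain n where n: "emeasure lborel (U - W n) < ennreal e" by (auto simp: eventually_sequentially)
    show ?thesis
    proof (rule that)
      show "finite (from_nat_into B' ` {..n})" by simp
      show "from_nat_into B' ` {..n} \<subseteq> B" using from_nat_into[OF False] B' by blast
      show "\<Union>(from_nat_into B' ` {..n}) \<subseteq> U" using UW by (auto simp: W_def)
      show "emeasure lborel (U - \<Union>(from_nat_into B' ` {..n})) < ennreal e" using n by (simp add: W_def)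
    qed
  qed
qed

text \<open>
  Rational combinations of indicators of finite unions of basic open sets. The sequence starts with
  0, which makes 0 a competitor in every choice of a best approximation.
\<close>

lemma L1_countable_dense:
  "\<exists>D :: nat \<Rightarrow> 'z::euclidean_space \<Rightarrow> real. (\<forall>k. integrable lborel (D k)) \<and> D 0 = (\<lambda>z. 0) \<and>
    (\<forall>f e. integrable lborel f \<longrightarrow> 0 < e \<longrightarrow> (\<exists>k. (\<integral>z. \<bar>f z - D k z\<bar> \<partial>lborel) < e))"
proof -
  obtain B :: "'z set set" where B: "countable B" "topological_basis B" using ex_countable_basis by auto
  define U where "U = {W. W \<in> Union ` {F. finite F \<and> F \<subseteq> B} \<and> emeasure lborel W < \<infinity>}"
  have Uopen: "open W" if "W \<in> U" for W
    using that topological_basis_open[OF B(2)] by (auto simp: U_def)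
  have cU: "countable U"
    unfolding U_def using countable_Collect_finite_subset[OF B(1)] by (auto intro: countable_subset[of _ "Union ` {F. finite F \<and> F \<subseteq> B}"])
  define L where "L = lists ((\<rat> :: real set) \<times> U)"
  have cL: "countable L" unfolding L_def using cU by (intro countable_lists countable_SIGMA countable_rat)
  have L0: "[] \<in> L" by (simp add: L_def)
  have int_ind: "integrable lborel (indicator W :: 'z \<Rightarrow> real)" if "W \<in> U" for W
    using that Uopen[OF that] by (auto simp: U_def intro!: integrable_real_indicator)
  have int: "integrable lborel (step_fun xs)" if "xs \<in> L" for xs :: "(real \<times> 'z set) list"
    using that unfolding L_def
  proof (induction xs)
    case (Cons x xs)
    then obtain c W where x: "x = (c, W)" "W \<in> U" by auto
    have "step_fun (x # xs) = (\<lambda>z. c * indicator W z + step_fun xs z)" by (simp add: x fun_eq_iff)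
    then show ?case using Cons int_ind[OF x(2)] by simp
  qed simp
  have dense: "\<forall>e>0. \<exists>xs\<in>L. (\<integral>z. \<bar>f z - step_fun xs z\<bar> \<partial>lborel) < e" if "integrable lborel f" for f
    using that
  proof (induction rule: integrable_induct)
    case (base A c)
    show ?case
    proof (intro allI impI)
      fix e :: real assume e: "0 < e"
      define d where "d = e / (4 * (\<bar>c\<bar> + 1))"
      have d: "0 < d" using e by (simp add: d_def)
      obtain V where V: "open V" "A \<subseteq> V" "emeasure lborel (V - A) < ennreal d"
        using outer_regular_lborel[of A d] base d by (auto simp: less_top)
      have Vfin: "emeasure lborel V < \<infinity>"
      proof -
        have "V = A \<union> (V - A)" using V by auto
        then have "emeasure lborel V \<le> emeasure lborel A + emeasure lborel (V - A)"
          using V base by (metis emeasure_subadditive sets.Diff sets_lborel borel_open)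
        also have "\<dots> < \<infinity>" using base V(3) by (auto simp: less_top ennreal_add_eq_top dest: order.strict_trans[OF _ ennreal_less_top])
        finally show ?thesis .
      qed
      obtain F where F: "finite F" "F \<subseteq> B" "\<Union>F \<subseteq> V" "emeasure lborel (V - \<Union>F) < ennreal d"
        by (rule open_approx_finite_union[OF B V(1) Vfin d])
      define W where "W = \<Union>F"
      have WV: "emeasure lborel W \<le> emeasure lborel V" using F(3) V(1) by (auto simp: W_def intro: emeasure_mono)
      then have "W \<in> U" using F Vfin by (auto simp: U_def W_def)
      note Wo = Uopen[OF this]
      have [measurable]: "W \<in> sets borel" "V \<in> sets borel" "A \<in> sets borel" using Wo V(1) base by auto
      define v where "v = measure lborel V"
      have v: "0 \<le> v" by (simp add: v_def)
      obtain r where r: "r \<in> \<rat>" "c < r" "r < c + e / (4 * (v + 1))"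
        using Rats_dense_in_real[of c "c + e / (4 * (v + 1))"] e v by auto
      have fin: "integrable lborel (indicator X :: 'z \<Rightarrow> real)" if "X \<in> sets borel" "X \<subseteq> V" for X
        using that Vfin emeasure_mono[of X V lborel] by (intro integrable_real_indicator) (auto intro: le_less_trans)
      have "measure lborel X < d" if "emeasure lborel X < ennreal d" for X :: "'z set"
        using that d by (cases "emeasure lborel X") (auto simp: measure_def ennreal_less_iff)
      then have m1: "measure lborel (V - A) < d" "measure lborel (V - W) < d"
        using V(3) F(4) by (auto simp: W_def)
      \<comment> \<open>The error has three parts: A against the open set V, V against W, and c against the rational r.\<close>
      have "(\<integral>z. \<bar>indicator A z *\<^sub>R c - step_fun [(r, W)] z\<bar> \<partial>lborel) \<le>
          (\<integral>z. \<bar>c\<bar> * (indicator (V - A) z + indicator (V - W) z) + (r - c) * indicator V z \<partial>lborel)"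
      proof (rule integral_mono)
        show "integrable lborel (\<lambda>z. \<bar>indicator A z *\<^sub>R c - step_fun [(r, W)] z\<bar>)"
          using fin[of A] fin[of W] V(2) F(3) by (auto simp: W_def[symmetric])
        show "integrable lborel (\<lambda>z. \<bar>c\<bar> * (indicator (V - A) z + indicator (V - W) z) + (r - c) * indicator V z)"
          using fin[of "V - A"] fin[of "V - W"] fin[of V] by auto
        show "\<bar>indicator A z *\<^sub>R c - step_fun [(r, W)] z\<bar> \<le> \<bar>c\<bar> * (indicator (V - A) z + indicator (V - W) z) + (r - c) * indicator V z" for z
          using V(2) F(3) r(2) by (auto simp: indicator_def W_def[symmetric] split: if_splits)
      qed
      also have "\<dots> = \<bar>c\<bar> * (measure lborel (V - A) + measure lborel (V - W)) + (r - c) * v"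
        using fin[of "V - A"] fin[of "V - W"] fin[of V] by (simp add: v_def)
      also have "\<dots> \<le> \<bar>c\<bar> * (d + d) + (e / (4 * (v + 1))) * v"
        using m1 r v by (intro add_mono mult_left_mono mult_right_mono) auto
      also have "\<bar>c\<bar> * (d + d) = (e / 2) * (\<bar>c\<bar> / (\<bar>c\<bar> + 1))"
      proof -
        have "a * (e / (4 * b) + e / (4 * b)) = (e / 2) * (a / b)" for a b
          by (cases "b = 0") (simp_all add: field_simps)
        from this show ?thesis unfolding d_def .
      qed
      also have "\<dots> \<le> (e / 2) * 1" using e by (intro mult_left_mono) auto
      also have "(e / (4 * (v + 1))) * v = (e / 4) * (v / (v + 1))" using v by (simp add: field_simps)
      also have "\<dots> \<le> (e / 4) * 1" using e v by (intro mult_left_mono) auto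
      also have "e / 2 * 1 + e / 4 * 1 < e" using e by simp
      finally have "(\<integral>z. \<bar>indicator A z *\<^sub>R c - step_fun [(r, W)] z\<bar> \<partial>lborel) < e" by simp
      moreover have "[(r, W)] \<in> L" using r \<open>W \<in> U\<close> by (simp add: L_def)
      ultimately show "\<exists>xs\<in>L. (\<integral>z. \<bar>indicator A z *\<^sub>R c - step_fun xs z\<bar> \<partial>lborel) < e" by blast
    qed
  next
    case (add f g)
    show ?case
    proof (intro allI impI)
      fix e :: real assume "0 < e"
      then have "0 < e / 2" by simp
      obtain xs where xs: "xs \<in> L" "(\<integral>z. \<bar>f z - step_fun xs z\<bar> \<partial>lborel) < e / 2" using add \<open>0 < e / 2\<close> by blast
      obtain ys where ys: "ys \<in> L" "(\<integral>z. \<bar>g z - step_fun ys z\<bar> \<partial>lborel) < e / 2" using add \<open>0 < e / 2\<close> by blast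
      have "(\<integral>z. \<bar>f z + g z - step_fun (xs @ ys) z\<bar> \<partial>lborel) \<le>
          (\<integral>z. \<bar>f z - step_fun xs z\<bar> + \<bar>g z - step_fun ys z\<bar> \<partial>lborel)"
        using add int[OF xs(1)] int[OF ys(1)] by (intro integral_mono) auto
      also have "\<dots> = (\<integral>z. \<bar>f z - step_fun xs z\<bar> \<partial>lborel) + (\<integral>z. \<bar>g z - step_fun ys z\<bar> \<partial>lborel)"
        using add int[OF xs(1)] int[OF ys(1)] by (intro Bochner_Integration.integral_add) auto
      finally show "\<exists>zs\<in>L. (\<integral>z. \<bar>f z + g z - step_fun zs z\<bar> \<partial>lborel) < e"
        using xs ys by (intro bexI[of _ "xs @ ys"]) (auto simp: L_def)
    qed
  next
    case (lim f s)
    show ?case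
    proof (intro allI impI)
      fix e :: real assume e: "0 < e"
      have "(\<lambda>i. \<integral>z. \<bar>f z - s i z\<bar> \<partial>lborel) \<longlonglongrightarrow> (\<integral>z. 0 \<partial>(lborel :: 'z measure))"
      proof (rule integral_dominated_convergence[where w="\<lambda>z. 3 * \<bar>f z\<bar>"])
        show "AE z in lborel. (\<lambda>i. \<bar>f z - s i z\<bar>) \<longlonglongrightarrow> 0"
        proof (intro AE_I2)
          fix z :: 'z
          have "(\<lambda>i. \<bar>f z - s i z\<bar>) \<longlonglongrightarrow> \<bar>f z - f z\<bar>" using lim.hyps(2)[of z] by (intro tendsto_intros) auto
          then show "(\<lambda>i. \<bar>f z - s i z\<bar>) \<longlonglongrightarrow> 0" by simp
        qed
        show "AE z in lborel. norm \<bar>f z - s i z\<bar> \<le> 3 * \<bar>f z\<bar>" for i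
        proof (intro AE_I2)
          fix z :: 'z
          show "norm \<bar>f z - s i z\<bar> \<le> 3 * \<bar>f z\<bar>" using lim.hyps(3)[of z i] by auto
        qed
        show "(\<lambda>z. \<bar>f z - s i z\<bar>) \<in> borel_measurable lborel" for i
          using borel_measurable_integrable[OF lim.hyps(1)[of i]] borel_measurable_integrable[OF lim.hyps(4)] by measurable
      qed (use lim in auto)
      then have "eventually (\<lambda>i. (\<integral>z. \<bar>f z - s i z\<bar> \<partial>lborel) < e / 2) sequentially"
        using e by (intro order_tendstoD(2)) auto
      then obtain i where i: "(\<integral>z. \<bar>f z - s i z\<bar> \<partial>lborel) < e / 2" by (auto simp: eventually_sequentially)
      obtain xs where xs: "xs \<in> L" "(\<integral>z. \<bar>s i z - step_fun xs z\<bar> \<partial>lborel) < e / 2" using lim.IH[of i] e by (meson half_gt_zero)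
      have "(\<integral>z. \<bar>f z - step_fun xs z\<bar> \<partial>lborel) \<le> (\<integral>z. \<bar>f z - s i z\<bar> + \<bar>s i z - step_fun xs z\<bar> \<partial>lborel)"
        using lim int[OF xs(1)] by (intro integral_mono) auto
      also have "\<dots> = (\<integral>z. \<bar>f z - s i z\<bar> \<partial>lborel) + (\<integral>z. \<bar>s i z - step_fun xs z\<bar> \<partial>lborel)"
        using lim int[OF xs(1)] by (intro Bochner_Integration.integral_add) auto
      finally show "\<exists>xs\<in>L. (\<integral>z. \<bar>f z - step_fun xs z\<bar> \<partial>lborel) < e" using xs i by (intro bexI[of _ xs]) auto
    qed
  qed
  define D where "D = (\<lambda>k. case k of 0 \<Rightarrow> (\<lambda>z. 0) | Suc n \<Rightarrow> step_fun (from_nat_into L n))"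
  show ?thesis
  proof (intro exI[of _ D] conjI allI impI)
    have "L \<noteq> {}" using L0 by blast
    then have "integrable lborel (step_fun (from_nat_into L n))" for n
      by (intro int from_nat_into)
    then show "integrable lborel (D k)" for k
      by (cases k) (simp_all add: D_def)
    show "D 0 = (\<lambda>z. 0)" by (simp add: D_def)
    show "\<exists>k. (\<integral>z. \<bar>f z - D k z\<bar> \<partial>lborel) < e" if f: "integrable lborel f" and e: "0 < e" for f :: "'z \<Rightarrow> real" and e
    proof -
      obtain xs where xs: "xs \<in> L" "(\<integral>z. \<bar>f z - step_fun xs z\<bar> \<partial>lborel) < e" using dense[OF f] e by auto
      obtain n where "from_nat_into L n = xs" using from_nat_into_surj[OF cL xs(1)] by auto
      then show ?thesis using xs by (intro exI[of _ "Suc n"]) (simp add: D_def)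
    qed
  qed
qed

section \<open>Bochner integrals and pointwise integrals\<close>

lemma nn_integral_lborel_swap:
  fixes f :: "'x::euclidean_space \<times> 'y::euclidean_space \<Rightarrow> ennreal"
  assumes "f \<in> borel_measurable borel"
  shows "(\<integral>\<^sup>+ x. \<integral>\<^sup>+ y. f (x, y) \<partial>lborel \<partial>lborel) = (\<integral>\<^sup>+ y. \<integral>\<^sup>+ x. f (x, y) \<partial>lborel \<partial>lborel)"
proof -
  have "(\<lambda>(x, y). f (x, y)) \<in> borel_measurable (lborel \<Otimes>\<^sub>M lborel)"
    using assms unfolding lborel_prod by (simp add: split_beta')
  then show ?thesis by (rule lborel_pair.Fubini'[symmetric])
qed

lemma L1_norm_ereal: "L1_norm (\<lambda>z. ereal (f z)) = (\<integral>\<^sup>+ z. ennreal \<bar>f z\<bar> \<partial>lborel)"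
  by (simp add: L1_norm_def e2ennreal_ereal)

lemma L1_norm_cong_AE: "AE z in lborel. f z = g z \<Longrightarrow> L1_norm f = L1_norm g"
  unfolding L1_norm_def by (intro nn_integral_cong_AE) auto

lemma L1_xv_real: "f \<in> borel_measurable borel \<Longrightarrow> (\<integral>\<^sup>+ z. ennreal \<bar>f z\<bar> \<partial>lborel) < \<infinity> \<Longrightarrow> (\<lambda>z. ereal (f z)) \<in> L1_xv"
  by (simp add: L1_xv_def F_xv_def L1_norm_ereal)

lemma L1_xv_AE_real:
  assumes "f \<in> L1_xv"
  shows "AE z in lborel. f z = ereal (real_of_ereal (f z))"
proof -
  have [measurable]: "f \<in> borel_measurable lborel" using assms by (simp add: L1_xv_def F_xv_def)
  have "(\<integral>\<^sup>+ z. e2ennreal \<bar>f z\<bar> \<partial>lborel) \<noteq> \<infinity>" using assms by (simp add: L1_xv_def L1_norm_def less_top)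
  then have "AE z in lborel. e2ennreal \<bar>f z\<bar> \<noteq> \<infinity>"
    by (intro nn_integral_PInf_AE) auto
  then show ?thesis
  proof eventually_elim
    case (elim z)
    then show ?case by (cases "f z") auto
  qed
qed

lemma L1_xv_real_integrable:
  assumes "f \<in> L1_xv"
  shows "(\<lambda>z. real_of_ereal (f z)) \<in> borel_measurable borel" "integrable lborel (\<lambda>z. real_of_ereal (f z))"
proof -
  have [measurable]: "f \<in> borel_measurable borel" using assms by (simp add: L1_xv_def F_xv_def)
  show m: "(\<lambda>z. real_of_ereal (f z)) \<in> borel_measurable borel" by measurable
  have "(\<integral>\<^sup>+ z. ennreal \<bar>real_of_ereal (f z)\<bar> \<partial>lborel) = L1_norm f"
    unfolding L1_norm_ereal[symmetric] by (rule L1_norm_cong_AE) (use L1_xv_AE_real[OF assms] in auto)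
  then show "integrable lborel (\<lambda>z. real_of_ereal (f z))"
    using assms m by (intro integrableI_bounded) (auto simp: L1_xv_def)
qed


text \<open>
  A simple function takes finitely many values, each of them finite almost everywhere. So its
  integral, defined by summation over the values, is almost everywhere the Lebesgue integral in time
  at a fixed phase point.
\<close>

lemma L1_simple_lebesgue:
  fixes s :: "real \<Rightarrow> 'a::euclidean_space phase_fun"
  assumes I: "I \<in> sets borel" and s: "L1_simple I s"
  defines "S \<equiv> \<lambda>(t, z). indicator I t * real_of_ereal (s t z)"
  shows "S \<in> borel_measurable borel"
    and "\<And>z. integrable lborel (\<lambda>t. S (t, z))"
    and "AE z in lborel. L1_simple_integral I s z = ereal (\<integral>t. S (t, z) \<partial>lborel)"
    and "\<And>t. t \<in> I \<Longrightarrow> AE z in lborel. s t z = ereal (S (t, z))"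
    and "(\<lambda>z. \<integral>t. S (t, z) \<partial>lborel) \<in> borel_measurable borel"
proof -
  let ?A = "\<lambda>y. {t \<in> I. s t = y}"
  have fin: "finite (s ` I)" and Am: "\<And>y. y \<in> s ` I \<Longrightarrow> ?A y \<in> sets borel"
    and L1: "\<And>t. t \<in> I \<Longrightarrow> s t \<in> L1_xv" and supp: "emeasure lborel {t \<in> I. s t \<noteq> (\<lambda>z. 0)} < \<infinity>"
  proof -
    show "?A y \<in> sets borel" if "y \<in> s ` I" for y
    proof -
      have "s -` {y} \<inter> I \<in> sets (restrict_space lborel I)"
        using s that by (auto simp: L1_simple_def simple_function_def space_restrict_space)
      moreover have "s -` {y} \<inter> I = ?A y" by auto
      ultimately show ?thesis using I by (auto simp: sets_restrict_space_iff)
    qed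
  qed (use s in \<open>auto simp: L1_simple_def simple_function_def space_restrict_space\<close>)
  have Afin: "emeasure lborel (?A y) < \<infinity>" if "y \<in> s ` I" "y \<noteq> (\<lambda>z. 0)" for y
  proof -
    have "{t \<in> I. s t \<noteq> (\<lambda>z. 0)} = (\<Union>y\<in>s ` I - {\<lambda>z. 0}. ?A y)" by auto
    then have "{t \<in> I. s t \<noteq> (\<lambda>z. 0)} \<in> sets borel" using fin Am by auto
    then have "emeasure lborel (?A y) \<le> emeasure lborel {t \<in> I. s t \<noteq> (\<lambda>z. 0)}"
      using that by (intro emeasure_mono) auto
    with supp show ?thesis by simp
  qed
  have Seq: "S (t, z) = (\<Sum>y\<in>s ` I. indicator (?A y) t * real_of_ereal (y z))" for t z
  proof (cases "t \<in> I")
    case True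
    have "(\<Sum>y\<in>s ` I. indicator (?A y) t * real_of_ereal (y z)) = (\<Sum>y\<in>s ` I. if y = s t then real_of_ereal (y z) else 0)"
      using True by (intro sum.cong) (auto simp: indicator_def)
    also have "\<dots> = real_of_ereal (s t z)" using fin True by simp
    finally show ?thesis using True by (simp add: S_def)
  next
    case False
    then show ?thesis by (simp add: S_def sum.neutral)
  qed
  have ym: "(\<lambda>z. real_of_ereal (y z)) \<in> borel_measurable borel" if "y \<in> s ` I" for y
    using that L1 L1_xv_real_integrable(1) by auto
  have "(\<lambda>p. \<Sum>y\<in>s ` I. indicator (?A y) (fst p) * real_of_ereal (y (snd p))) \<in> borel_measurable borel"
  proof (rule borel_measurable_sum)
    fix y assume y: "y \<in> s ` I"
    note [measurable] = ym[OF y] Am[OF y]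
    show "(\<lambda>p. indicator (?A y) (fst p) * real_of_ereal (y (snd p))) \<in> borel_measurable borel"
      by (intro borel_measurable_times measurable_compose[OF fst_borel_measurable, of "indicator (?A y)"]
          measurable_compose[OF snd_borel_measurable, of "\<lambda>z. real_of_ereal (y z)"]) measurable
  qed
  moreover have "(\<lambda>p. \<Sum>y\<in>s ` I. indicator (?A y) (fst p) * real_of_ereal (y (snd p))) = S"
    by (auto simp: fun_eq_iff Seq)
  ultimately show "S \<in> borel_measurable borel" by simp
  have term_int: "has_bochner_integral lborel (\<lambda>t. indicator (?A y) t * real_of_ereal (y z)) (measure lborel (?A y) * real_of_ereal (y z))"
    if y: "y \<in> s ` I" for y z
  proof (cases "y = (\<lambda>z. 0)")
    case True
    then have "(\<lambda>t. indicator (?A y) t * real_of_ereal (y z)) = (\<lambda>t. 0)" by simp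
    then show ?thesis using True by (simp add: has_bochner_integral_zero)
  next
    case False
    have "has_bochner_integral lborel (indicator (?A y)) (measure lborel (?A y))"
      using Am[OF y] Afin[OF y False] by (intro has_bochner_integral_real_indicator) auto
    then show ?thesis by (rule has_bochner_integral_mult_left)
  qed
  have S_int: "has_bochner_integral lborel (\<lambda>t. S (t, z)) (\<Sum>y\<in>s ` I. measure lborel (?A y) * real_of_ereal (y z))" for z
    unfolding Seq by (intro has_bochner_integral_sum term_int)
  then show "integrable lborel (\<lambda>t. S (t, z))" for z by (rule integrable.intros)
  have Sval: "(\<integral>t. S (t, z) \<partial>lborel) = (\<Sum>y\<in>s ` I. measure lborel (?A y) * real_of_ereal (y z))" for z
    by (rule has_bochner_integral_integral_eq[OF S_int])
  show "(\<lambda>z. \<integral>t. S (t, z) \<partial>lborel) \<in> borel_measurable borel"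
    unfolding Sval using ym by (intro borel_measurable_sum borel_measurable_times) auto
  have "AE z in lborel. \<forall>y\<in>s ` I. y z = ereal (real_of_ereal (y z))"
    using fin L1 L1_xv_AE_real by (intro AE_finite_allI) auto
  then show "AE z in lborel. L1_simple_integral I s z = ereal (\<integral>t. S (t, z) \<partial>lborel)"
  proof eventually_elim
    case (elim z)
    have "L1_simple_integral I s z = (\<Sum>y\<in>s ` I. ereal (measure lborel (?A y) * real_of_ereal (y z)))"
      unfolding L1_simple_integral_def
    proof (rule sum.cong[OF refl])
      fix y assume "y \<in> s ` I"
      with elim have "y z = ereal (real_of_ereal (y z))" by blast
      then have e: "ereal (measure lborel (?A y)) * y z = ereal (measure lborel (?A y)) * ereal (real_of_ereal (y z))"
        by (rule arg_cong)
      show "ereal (measure lborel (?A y)) * y z = ereal (measure lborel (?A y) * real_of_ereal (y z))"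
        by (rule e[unfolded times_ereal.simps(1)])
    qed
    then show ?case by (simp add: Sval)
  qed
  show "AE z in lborel. s t z = ereal (S (t, z))" if "t \<in> I" for t
    using L1_xv_AE_real[OF L1[OF that]] that by (simp add: S_def)
qed

text \<open>
  At time \<open>t\<close> take the best approximation of \<open>H (t, _)\<close> among the first
  \<open>n\<close> members of a dense sequence, and 0 if \<open>\<bar>t\<bar> > n\<close>. Since 0
  is among the candidates, the error never exceeds the norm of \<open>H (t, _)\<close>: the
  domination needed for dominated convergence.
\<close>

lemma L1_simple_approximation:
  fixes H :: "real \<times> ('a::euclidean_space \<times> 'a) \<Rightarrow> real"
  assumes I: "I \<in> sets borel" and H [measurable]: "H \<in> borel_measurable borel"
    and int: "\<forall>t\<in>I. integrable lborel (\<lambda>z. H (t, z))"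
  shows "\<exists>s :: nat \<Rightarrow> real \<Rightarrow> 'a phase_fun. (\<forall>n. L1_simple I (s n)) \<and>
    (\<forall>n. \<forall>t\<in>I. L1_norm (\<lambda>z. ereal (H (t, z)) - s n t z) \<le> (\<integral>\<^sup>+ z. ennreal \<bar>H (t, z)\<bar> \<partial>lborel)) \<and>
    (\<forall>t\<in>I. (\<lambda>n. L1_norm (\<lambda>z. ereal (H (t, z)) - s n t z)) \<longlonglongrightarrow> 0)"
proof -
  from L1_countable_dense[where 'z="'a \<times> 'a"]
  obtain D :: "nat \<Rightarrow> 'a \<times> 'a \<Rightarrow> real" where D': "\<forall>k. integrable lborel (D k)" "D 0 = (\<lambda>z. 0)"
    and dense': "\<forall>f e. integrable lborel f \<longrightarrow> 0 < e \<longrightarrow> (\<exists>k. (\<integral>z. \<bar>f z - D k z\<bar> \<partial>lborel) < e)"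
    by (elim exE conjE)
  note D = D'(1)[rule_format] D'(2) and dense = dense'[rule_format]
  have [measurable]: "D k \<in> borel_measurable borel" for k
    using borel_measurable_integrable[OF D(1)[of k]] by simp
  define dd where "dd = (\<lambda>j t. \<integral>\<^sup>+ z. ennreal \<bar>H (t, z) - D j z\<bar> \<partial>lborel)"
  have dm [measurable]: "dd j \<in> borel_measurable borel" for j
    unfolding dd_def by (rule lborel.borel_measurable_nn_integral) measurable
  define k where "k = (\<lambda>n t. if \<bar>t\<bar> \<le> real n then (LEAST j. j \<le> n \<and> (\<forall>i\<in>{..n}. dd j t \<le> dd i t)) else 0)"
  have k_meas: "k n \<in> measurable borel (count_space UNIV)" for n
    unfolding k_def by measurable
  have kmin: "k n t \<le> n \<and> (\<forall>i\<in>{..n}. dd (k n t) t \<le> dd i t)" if "\<bar>t\<bar> \<le> real n" for n t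
  proof -
    have "\<exists>j\<in>{..n}. \<forall>i\<in>{..n}. dd j t \<le> dd i t"
      using ex_min_if_finite[of "(\<lambda>j. dd j t) ` {..n}"] by (auto simp: not_less)
    then obtain j where j: "j \<le> n \<and> (\<forall>i\<in>{..n}. dd j t \<le> dd i t)" by auto
    show ?thesis unfolding k_def using that LeastI[of "\<lambda>j. j \<le> n \<and> (\<forall>i\<in>{..n}. dd j t \<le> dd i t)", OF j] by simp
  qed
  have kle: "k n t \<le> n" for n t
    using kmin[of t n] by (cases "\<bar>t\<bar> \<le> real n") (auto simp: k_def)
  define s :: "nat \<Rightarrow> real \<Rightarrow> 'a phase_fun" where "s = (\<lambda>n t z. ereal (D (k n t) z))"
  have norm_eq: "L1_norm (\<lambda>z. ereal (H (t, z)) - s n t z) = dd (k n t) t" for n t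
    by (simp add: s_def dd_def L1_norm_ereal)
  show ?thesis
  proof (intro exI[of _ s] conjI allI ballI)
    fix n
    have "simple_function (restrict_space lborel I) (\<lambda>t. (\<lambda>j. (\<lambda>z. ereal (D j z)) :: 'a phase_fun) (k n t))"
    proof (rule simple_function_compose1)
      have "k n ` space (restrict_space lborel I) \<subseteq> {..n}" using kle by auto
      then have "finite (k n ` space (restrict_space lborel I))" by (rule finite_subset) simp
      moreover have "k n \<in> measurable (restrict_space lborel I) (count_space UNIV)"
        using k_meas by (intro measurable_restrict_space1) simp
      ultimately show "simple_function (restrict_space lborel I) (k n)"
        by (auto simp: simple_function_def measurable_sets[of "k n" _ "count_space UNIV"])
    qed
    moreover have "s n t \<in> L1_xv" for t
      unfolding s_def using D(1)[of "k n t"]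
      by (intro L1_xv_real) (auto simp: integrable_iff_bounded)
    moreover have "emeasure lborel {t \<in> I. s n t \<noteq> (\<lambda>z. 0)} < \<infinity>"
    proof -
      have "{t \<in> I. s n t \<noteq> (\<lambda>z. 0)} \<subseteq> {- real n..real n}"
        by (auto simp: s_def k_def D(2) zero_ereal_def split: if_splits)
      then have "emeasure lborel {t \<in> I. s n t \<noteq> (\<lambda>z. 0)} \<le> emeasure lborel {- real n..real n}"
        by (intro emeasure_mono) auto
      then show ?thesis by (simp add: order_le_less_trans)
    qed
    ultimately show "L1_simple I (s n)" by (simp add: L1_simple_def s_def)
  next
    fix n t assume "t \<in> I"
    show "L1_norm (\<lambda>z. ereal (H (t, z)) - s n t z) \<le> (\<integral>\<^sup>+ z. ennreal \<bar>H (t, z)\<bar> \<partial>lborel)"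
    proof (cases "\<bar>t\<bar> \<le> real n")
      case True
      then have "dd (k n t) t \<le> dd 0 t" using kmin[of t n] by auto
      then show ?thesis unfolding norm_eq by (simp add: dd_def D(2))
    next
      case False
      then show ?thesis unfolding norm_eq by (simp add: dd_def D(2) k_def)
    qed
  next
    fix t assume t: "t \<in> I"
    show "(\<lambda>n. L1_norm (\<lambda>z. ereal (H (t, z)) - s n t z)) \<longlonglongrightarrow> 0"
      unfolding norm_eq
    proof (rule order_tendstoI)
      fix e :: ennreal assume e: "0 < e"
      obtain r :: real where r: "0 < r" "ennreal r < e"
      proof (cases e)
        case (real x)
        then have "0 < x / 2" "ennreal (x / 2) < e" using e by (auto simp: ennreal_less_iff)
        then show ?thesis by (rule that)
      next
        case top
        then show ?thesis using that[of 1] by simp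
      qed
      obtain j where j: "(\<integral>z. \<bar>H (t, z) - D j z\<bar> \<partial>lborel) < r" using dense[OF int[rule_format, OF t] r(1)] by blast
      have dj: "dd j t < e"
      proof -
        have "dd j t = ennreal (\<integral>z. \<bar>H (t, z) - D j z\<bar> \<partial>lborel)"
          unfolding dd_def using int[rule_format, OF t] D(1)[of j] by (intro nn_integral_eq_integral) auto
        also have "\<dots> \<le> ennreal r" using j by (intro ennreal_leI) simp
        finally show ?thesis using r by simp
      qed
      obtain N :: nat where N: "\<bar>t\<bar> \<le> real N" using real_arch_simple by blast
      have "dd (k n t) t < e" if "n \<ge> max j N" for n
        using kmin[of t n] N that dj by (auto intro: le_less_trans)
      then show "\<forall>\<^sub>F n in sequentially. dd (k n t) t < e"
        by (intro eventually_sequentiallyI[of "max j N"])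
    qed simp
  qed
qed

lemma L1_strongly_measurable_joint:
  fixes H :: "real \<times> ('a::euclidean_space \<times> 'a) \<Rightarrow> real"
  assumes I: "I \<in> sets borel" and H [measurable]: "H \<in> borel_measurable borel"
    and int: "\<And>t. t \<in> I \<Longrightarrow> integrable lborel (\<lambda>z. H (t, z))"
    and h: "\<And>t z. t \<in> I \<Longrightarrow> h t z = ereal (H (t, z))"
  shows "L1_strongly_measurable I h"
proof -
  have "\<forall>t\<in>I. integrable lborel (\<lambda>z. H (t, z))" using int by blast
  from L1_simple_approximation[OF I H this]
  obtain s :: "nat \<Rightarrow> real \<Rightarrow> 'a phase_fun" where s: "\<forall>n. L1_simple I (s n)"
    "\<forall>n. \<forall>t\<in>I. L1_norm (\<lambda>z. ereal (H (t, z)) - s n t z) \<le> (\<integral>\<^sup>+ z. ennreal \<bar>H (t, z)\<bar> \<partial>lborel)"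
    "\<forall>t\<in>I. (\<lambda>n. L1_norm (\<lambda>z. ereal (H (t, z)) - s n t z)) \<longlonglongrightarrow> 0"
    by (elim exE conjE)
  have "h t \<in> L1_xv" if "t \<in> I" for t
  proof -
    have "h t = (\<lambda>z. ereal (H (t, z)))" using h[OF that] by auto
    then show ?thesis using int[OF that] by (auto intro!: L1_xv_real simp: integrable_iff_bounded)
  qed
  moreover have "(\<lambda>n. L1_norm (\<lambda>z. h t z - s n t z)) \<longlonglongrightarrow> 0" if "t \<in> I" for t
    unfolding h[OF that] by (rule s(3)[rule_format, OF that])
  ultimately have "AE t in lborel. t \<in> I \<longrightarrow> h t \<in> L1_xv \<and> (\<lambda>n. L1_norm (\<lambda>z. h t z - s n t z)) \<longlonglongrightarrow> 0"
    by (intro AE_I2 impI conjI)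
  with s(1) show ?thesis
    unfolding L1_strongly_measurable_def by (intro exI[of _ s] conjI)
qed

lemma ennreal_integral_diff_le:
  fixes f g :: "'b \<Rightarrow> real"
  assumes "integrable M f" "integrable M g"
  shows "ennreal \<bar>(\<integral>x. f x \<partial>M) - (\<integral>x. g x \<partial>M)\<bar> \<le> (\<integral>\<^sup>+ x. ennreal \<bar>f x - g x\<bar> \<partial>M)"
proof -
  have "(\<integral>x. f x \<partial>M) - (\<integral>x. g x \<partial>M) = (\<integral>x. f x - g x \<partial>M)" using assms by simp
  then have "\<bar>(\<integral>x. f x \<partial>M) - (\<integral>x. g x \<partial>M)\<bar> \<le> (\<integral>x. \<bar>f x - g x\<bar> \<partial>M)"
    using integral_norm_bound[of M "\<lambda>x. f x - g x"] by simp
  then have "ennreal \<bar>(\<integral>x. f x \<partial>M) - (\<integral>x. g x \<partial>M)\<bar> \<le> ennreal (\<integral>x. \<bar>f x - g x\<bar> \<partial>M)" by (rule ennreal_leI)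
  also have "\<dots> = (\<integral>\<^sup>+ x. ennreal \<bar>f x - g x\<bar> \<partial>M)"
    using assms by (intro nn_integral_eq_integral[symmetric]) auto
  finally show ?thesis .
qed

text \<open>
  Minkowski's inequality for integrals, from the triangle inequality and Tonelli's theorem.
\<close>

lemma L1_norm_time_integrals:
  fixes f g :: "real \<times> 'z::euclidean_space \<Rightarrow> real"
  assumes [measurable]: "f \<in> borel_measurable borel" "g \<in> borel_measurable borel"
    and "\<And>z. integrable lborel (\<lambda>t. f (t, z))" "\<And>z. integrable lborel (\<lambda>t. g (t, z))"
  shows "(\<integral>\<^sup>+ z. ennreal \<bar>(\<integral>t. f (t, z) \<partial>lborel) - (\<integral>t. g (t, z) \<partial>lborel)\<bar> \<partial>lborel) \<le>
    (\<integral>\<^sup>+ t. \<integral>\<^sup>+ z. ennreal \<bar>f (t, z) - g (t, z)\<bar> \<partial>lborel \<partial>lborel)"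
proof -
  have "(\<integral>\<^sup>+ z. ennreal \<bar>(\<integral>t. f (t, z) \<partial>lborel) - (\<integral>t. g (t, z) \<partial>lborel)\<bar> \<partial>lborel) \<le>
     (\<integral>\<^sup>+ z. \<integral>\<^sup>+ t. ennreal \<bar>f (t, z) - g (t, z)\<bar> \<partial>lborel \<partial>lborel)"
    using assms by (intro nn_integral_mono ennreal_integral_diff_le) auto
  also have "\<dots> = (\<integral>\<^sup>+ t. \<integral>\<^sup>+ z. ennreal \<bar>f (t, z) - g (t, z)\<bar> \<partial>lborel \<partial>lborel)"
    using nn_integral_lborel_swap[of "\<lambda>p. ennreal \<bar>f (prod.swap p) - g (prod.swap p)\<bar>"] by (simp add: prod.swap_def)
  finally show ?thesis .
qed

text \<open>
  The simple approximations converge in \<open>L\<^sup>1\<close> of time and space by dominated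
  convergence, and Minkowski's inequality carries this over to their integrals.
\<close>

lemma has_L1_integral_joint:
  fixes H :: "real \<times> ('a::euclidean_space \<times> 'a) \<Rightarrow> real"
  assumes I: "I \<in> sets borel" and H [measurable]: "H \<in> borel_measurable borel"
    and off: "\<And>t z. t \<notin> I \<Longrightarrow> H (t, z) = 0"
    and int_z: "\<And>t. t \<in> I \<Longrightarrow> integrable lborel (\<lambda>z. H (t, z))"
    and int_t: "\<And>z. integrable lborel (\<lambda>t. H (t, z))"
    and fin: "(\<integral>\<^sup>+ t. \<integral>\<^sup>+ z. ennreal \<bar>H (t, z)\<bar> \<partial>lborel \<partial>lborel) < \<infinity>"
    and h: "\<And>t z. t \<in> I \<Longrightarrow> h t z = ereal (H (t, z))"
  shows "has_L1_integral I h (\<lambda>z. ereal (\<integral>t. H (t, z) \<partial>lborel))"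
proof -
  have "\<forall>t\<in>I. integrable lborel (\<lambda>z. H (t, z))" using int_z by blast
  from L1_simple_approximation[OF I H this]
  obtain s :: "nat \<Rightarrow> real \<Rightarrow> 'a phase_fun" where s: "\<forall>n. L1_simple I (s n)"
    "\<forall>n. \<forall>t\<in>I. L1_norm (\<lambda>z. ereal (H (t, z)) - s n t z) \<le> (\<integral>\<^sup>+ z. ennreal \<bar>H (t, z)\<bar> \<partial>lborel)"
    "\<forall>t\<in>I. (\<lambda>n. L1_norm (\<lambda>z. ereal (H (t, z)) - s n t z)) \<longlonglongrightarrow> 0"
    by (elim exE conjE)
  define S where "S = (\<lambda>n (t, z). indicator I t * real_of_ereal (s n t z))"
  have S'1 [measurable]: "S n \<in> borel_measurable borel" for n
    unfolding S_def by (rule L1_simple_lebesgue(1)[OF I s(1)[rule_format]])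
  have S'2: "integrable lborel (\<lambda>t. S n (t, z))" for n z
    unfolding S_def by (rule L1_simple_lebesgue(2)[OF I s(1)[rule_format]])
  have S'3: "AE z in lborel. L1_simple_integral I (s n) z = ereal (\<integral>t. S n (t, z) \<partial>lborel)" for n
    unfolding S_def by (rule L1_simple_lebesgue(3)[OF I s(1)[rule_format]])
  have S'4: "AE z in lborel. s n t z = ereal (S n (t, z))" if "t \<in> I" for n t
    unfolding S_def by (rule L1_simple_lebesgue(4)[OF I s(1)[rule_format] that])
  have S'5 [measurable]: "(\<lambda>z. \<integral>t. S n (t, z) \<partial>lborel) \<in> borel_measurable borel" for n
    unfolding S_def by (rule L1_simple_lebesgue(5)[OF I s(1)[rule_format]])
  have dist: "L1_norm (\<lambda>z. ereal (H (t, z)) - s n t z) = (\<integral>\<^sup>+ z. ennreal \<bar>H (t, z) - S n (t, z)\<bar> \<partial>lborel)" if "t \<in> I" for n t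
    unfolding L1_norm_ereal[symmetric] using S'4[OF that, of n] by (intro L1_norm_cong_AE) auto
  have off': "H (t, z) - S n (t, z) = 0" if "t \<notin> I" for n t z
    using off[OF that] that by (simp add: S_def)
  have lim: "(\<lambda>n. \<integral>\<^sup>+ t. \<integral>\<^sup>+ z. ennreal \<bar>H (t, z) - S n (t, z)\<bar> \<partial>lborel \<partial>lborel) \<longlonglongrightarrow> (\<integral>\<^sup>+ t. 0 \<partial>(lborel :: real measure))"
  proof (rule nn_integral_dominated_convergence[where w="\<lambda>t. \<integral>\<^sup>+ z. ennreal \<bar>H (t, z)\<bar> \<partial>lborel"])
    show "AE t in lborel. (\<integral>\<^sup>+ z. ennreal \<bar>H (t, z) - S n (t, z)\<bar> \<partial>lborel) \<le> (\<integral>\<^sup>+ z. ennreal \<bar>H (t, z)\<bar> \<partial>lborel)" for n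
    proof (rule AE_I2)
      fix t
      show "(\<integral>\<^sup>+ z. ennreal \<bar>H (t, z) - S n (t, z)\<bar> \<partial>lborel) \<le> (\<integral>\<^sup>+ z. ennreal \<bar>H (t, z)\<bar> \<partial>lborel)"
        using s(2)[rule_format, of t n] dist[of t n] off'[of t] by (cases "t \<in> I") auto
    qed
    show "AE t in lborel. (\<lambda>n. \<integral>\<^sup>+ z. ennreal \<bar>H (t, z) - S n (t, z)\<bar> \<partial>lborel) \<longlonglongrightarrow> 0"
    proof (rule AE_I2)
      fix t
      show "(\<lambda>n. \<integral>\<^sup>+ z. ennreal \<bar>H (t, z) - S n (t, z)\<bar> \<partial>lborel) \<longlonglongrightarrow> 0"
        using s(3)[rule_format, of t] dist[of t] off'[of t] by (cases "t \<in> I") auto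
    qed
    show "(\<lambda>t. \<integral>\<^sup>+ z. ennreal \<bar>H (t, z) - S n (t, z)\<bar> \<partial>lborel) \<in> borel_measurable lborel" for n
      by measurable
    show "(\<lambda>t. \<integral>\<^sup>+ z. ennreal \<bar>H (t, z)\<bar> \<partial>lborel) \<in> borel_measurable lborel"
      by measurable
  qed (use fin in auto)
  have lim1: "(\<lambda>n. \<integral>\<^sup>+ t \<in> I. L1_norm (\<lambda>z. h t z - s n t z) \<partial>lborel) \<longlonglongrightarrow> 0"
  proof -
    have "(\<integral>\<^sup>+ t \<in> I. L1_norm (\<lambda>z. h t z - s n t z) \<partial>lborel) = (\<integral>\<^sup>+ t. \<integral>\<^sup>+ z. ennreal \<bar>H (t, z) - S n (t, z)\<bar> \<partial>lborel \<partial>lborel)" for n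
      using dist[of _ n] off'[of _ _ n] h by (intro nn_integral_cong) (auto simp: indicator_def)
    then show ?thesis using lim by simp
  qed
  have J: "(\<lambda>z. \<integral>t. H (t, z) \<partial>lborel) \<in> borel_measurable borel"
    by (rule lborel.borel_measurable_lebesgue_integral) measurable
  have lim2: "(\<lambda>n. L1_norm (\<lambda>z. ereal (\<integral>t. H (t, z) \<partial>lborel) - L1_simple_integral I (s n) z)) \<longlonglongrightarrow> 0"
  proof (rule tendsto_sandwich[OF _ _ tendsto_const])
    show "(\<lambda>n. \<integral>\<^sup>+ t. \<integral>\<^sup>+ z. ennreal \<bar>H (t, z) - S n (t, z)\<bar> \<partial>lborel \<partial>lborel) \<longlonglongrightarrow> 0" using lim by simp
    show "\<forall>\<^sub>F n in sequentially. L1_norm (\<lambda>z. ereal (\<integral>t. H (t, z) \<partial>lborel) - L1_simple_integral I (s n) z)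
      \<le> (\<integral>\<^sup>+ t. \<integral>\<^sup>+ z. ennreal \<bar>H (t, z) - S n (t, z)\<bar> \<partial>lborel \<partial>lborel)"
    proof (intro always_eventually allI)
      fix n
      have "L1_norm (\<lambda>z. ereal (\<integral>t. H (t, z) \<partial>lborel) - L1_simple_integral I (s n) z) =
          (\<integral>\<^sup>+ z. ennreal \<bar>(\<integral>t. H (t, z) \<partial>lborel) - (\<integral>t. S n (t, z) \<partial>lborel)\<bar> \<partial>lborel)"
        unfolding L1_norm_ereal[symmetric] using S'3[of n] by (intro L1_norm_cong_AE) auto
      also have "\<dots> \<le> (\<integral>\<^sup>+ t. \<integral>\<^sup>+ z. ennreal \<bar>H (t, z) - S n (t, z)\<bar> \<partial>lborel \<partial>lborel)"
        by (rule L1_norm_time_integrals[OF H S'1 int_t S'2])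
      finally show "L1_norm (\<lambda>z. ereal (\<integral>t. H (t, z) \<partial>lborel) - L1_simple_integral I (s n) z)
        \<le> (\<integral>\<^sup>+ t. \<integral>\<^sup>+ z. ennreal \<bar>H (t, z) - S n (t, z)\<bar> \<partial>lborel \<partial>lborel)" .
    qed
  qed simp
  have "(\<integral>\<^sup>+ z. ennreal \<bar>\<integral>t. H (t, z) \<partial>lborel\<bar> \<partial>lborel) < \<infinity>"
    using L1_norm_time_integrals[OF H _ int_t, of "\<lambda>_. 0"] fin by (simp add: order_le_less_trans)
  then have "(\<lambda>z. ereal (\<integral>t. H (t, z) \<partial>lborel)) \<in> L1_xv" by (rule L1_xv_real[OF J])
  moreover have "L1_strongly_measurable I h"
    by (rule L1_strongly_measurable_joint[OF I H int_z h])
  ultimately show ?thesis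
    unfolding has_L1_integral_def using s(1) lim1 lim2 by (intro conjI exI[of _ s])
qed

text \<open>
  The converse of the previous lemma: whatever simple functions witness the Bochner integral, their
  integrals also converge to the pointwise time integral of the jointly measurable representative.
\<close>

lemma has_L1_integral_eq_lebesgue:
  fixes H :: "real \<times> ('a::euclidean_space \<times> 'a) \<Rightarrow> real"
  assumes I: "I \<in> sets borel" and H [measurable]: "H \<in> borel_measurable borel"
    and off: "\<And>t z. t \<notin> I \<Longrightarrow> H (t, z) = 0"
    and int_t: "\<And>z. integrable lborel (\<lambda>t. H (t, z))"
    and h: "AE t in lborel. t \<in> I \<longrightarrow> (AE z in lborel. h t z = ereal (H (t, z)))"
    and J: "has_L1_integral I h J"
  shows "AE z in lborel. J z = ereal (\<integral>t. H (t, z) \<partial>lborel)"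
proof -
  from J obtain s where JL: "J \<in> L1_xv" and s: "\<And>n. L1_simple I (s n)"
    and lim1: "(\<lambda>n. \<integral>\<^sup>+ t \<in> I. L1_norm (\<lambda>z. h t z - s n t z) \<partial>lborel) \<longlonglongrightarrow> 0"
    and lim2: "(\<lambda>n. L1_norm (\<lambda>z. J z - L1_simple_integral I (s n) z)) \<longlonglongrightarrow> 0"
    unfolding has_L1_integral_def by blast
  define S where "S = (\<lambda>n (t, z). indicator I t * real_of_ereal (s n t z))"
  have S'1 [measurable]: "S n \<in> borel_measurable borel" for n
    unfolding S_def by (rule L1_simple_lebesgue(1)[OF I s])
  have S'2: "integrable lborel (\<lambda>t. S n (t, z))" for n z
    unfolding S_def by (rule L1_simple_lebesgue(2)[OF I s])
  have S'3: "AE z in lborel. L1_simple_integral I (s n) z = ereal (\<integral>t. S n (t, z) \<partial>lborel)" for n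
    unfolding S_def by (rule L1_simple_lebesgue(3)[OF I s])
  have S'4: "AE z in lborel. s n t z = ereal (S n (t, z))" if "t \<in> I" for n t
    unfolding S_def by (rule L1_simple_lebesgue(4)[OF I s that])
  have S'5 [measurable]: "(\<lambda>z. \<integral>t. S n (t, z) \<partial>lborel) \<in> borel_measurable borel" for n
    unfolding S_def by (rule L1_simple_lebesgue(5)[OF I s])
  have off': "H (t, z) - S n (t, z) = 0" if "t \<notin> I" for n t z
    using off[OF that] that by (simp add: S_def)
  define Jr where "Jr = (\<lambda>z. real_of_ereal (J z))"
  have [measurable]: "Jr \<in> borel_measurable borel" unfolding Jr_def by (rule L1_xv_real_integrable[OF JL])
  have JJr: "AE z in lborel. J z = ereal (Jr z)" unfolding Jr_def by (rule L1_xv_AE_real[OF JL])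
  have [measurable]: "(\<lambda>z. \<integral>t. H (t, z) \<partial>lborel) \<in> borel_measurable borel"
    by (rule lborel.borel_measurable_lebesgue_integral) measurable
  have e1: "(\<integral>\<^sup>+ t. \<integral>\<^sup>+ z. ennreal \<bar>S n (t, z) - H (t, z)\<bar> \<partial>lborel \<partial>lborel) = (\<integral>\<^sup>+ t \<in> I. L1_norm (\<lambda>z. h t z - s n t z) \<partial>lborel)" for n
  proof (rule nn_integral_cong_AE)
    show "AE t in lborel. (\<integral>\<^sup>+ z. ennreal \<bar>S n (t, z) - H (t, z)\<bar> \<partial>lborel) = L1_norm (\<lambda>z. h t z - s n t z) * indicator I t"
      using h
    proof eventually_elim
      case (elim t)
      show ?case
      proof (cases "t \<in> I")
        case True
        with elim have "AE z in lborel. h t z = ereal (H (t, z))" by simp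
        then have "L1_norm (\<lambda>z. h t z - s n t z) = L1_norm (\<lambda>z. ereal (H (t, z) - S n (t, z)))"
          using S'4[OF True, of n] by (intro L1_norm_cong_AE) auto
        then show ?thesis using True by (simp add: L1_norm_ereal abs_minus_commute)
      next
        case False
        then show ?thesis using off'[OF False, of _ n] by (simp add: abs_minus_commute[of "S n _"])
      qed
    qed
  qed
  have e2: "L1_norm (\<lambda>z. J z - L1_simple_integral I (s n) z) = (\<integral>\<^sup>+ z. ennreal \<bar>Jr z - (\<integral>t. S n (t, z) \<partial>lborel)\<bar> \<partial>lborel)" for n
    unfolding L1_norm_ereal[symmetric] using S'3[of n] JJr by (intro L1_norm_cong_AE) auto
  have "(\<integral>\<^sup>+ z. ennreal \<bar>Jr z - (\<integral>t. H (t, z) \<partial>lborel)\<bar> \<partial>lborel) \<le>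
      L1_norm (\<lambda>z. J z - L1_simple_integral I (s n) z) + (\<integral>\<^sup>+ t \<in> I. L1_norm (\<lambda>z. h t z - s n t z) \<partial>lborel)" for n
  proof -
    have "(\<integral>\<^sup>+ z. ennreal \<bar>Jr z - (\<integral>t. H (t, z) \<partial>lborel)\<bar> \<partial>lborel) \<le>
        (\<integral>\<^sup>+ z. ennreal \<bar>Jr z - (\<integral>t. S n (t, z) \<partial>lborel)\<bar> + ennreal \<bar>(\<integral>t. S n (t, z) \<partial>lborel) - (\<integral>t. H (t, z) \<partial>lborel)\<bar> \<partial>lborel)"
      by (intro nn_integral_mono) (auto simp: ennreal_plus[symmetric] simp del: ennreal_plus intro!: ennreal_leI)
    also have "\<dots> = (\<integral>\<^sup>+ z. ennreal \<bar>Jr z - (\<integral>t. S n (t, z) \<partial>lborel)\<bar> \<partial>lborel) +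
        (\<integral>\<^sup>+ z. ennreal \<bar>(\<integral>t. S n (t, z) \<partial>lborel) - (\<integral>t. H (t, z) \<partial>lborel)\<bar> \<partial>lborel)"
      by (rule nn_integral_add) measurable
    also have "\<dots> \<le> (\<integral>\<^sup>+ z. ennreal \<bar>Jr z - (\<integral>t. S n (t, z) \<partial>lborel)\<bar> \<partial>lborel) +
        (\<integral>\<^sup>+ t. \<integral>\<^sup>+ z. ennreal \<bar>S n (t, z) - H (t, z)\<bar> \<partial>lborel \<partial>lborel)"
      by (intro add_left_mono L1_norm_time_integrals S'1 S'2 H int_t)
    finally show ?thesis unfolding e1 e2 .
  qed
  then have "(\<integral>\<^sup>+ z. ennreal \<bar>Jr z - (\<integral>t. H (t, z) \<partial>lborel)\<bar> \<partial>lborel) \<le> 0 + 0"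
    by (intro LIMSEQ_le_const[OF tendsto_add[OF lim2 lim1]]) auto
  then have "(\<integral>\<^sup>+ z. ennreal \<bar>Jr z - (\<integral>t. H (t, z) \<partial>lborel)\<bar> \<partial>lborel) = 0" by simp
  then have "AE z in lborel. ennreal \<bar>Jr z - (\<integral>t. H (t, z) \<partial>lborel)\<bar> = 0"
    by (subst (asm) nn_integral_0_iff_AE) auto
  with JJr show ?thesis
  proof eventually_elim
    case (elim z)
    then have "\<bar>Jr z - (\<integral>t. H (t, z) \<partial>lborel)\<bar> \<le> 0" by (simp only: ennreal_eq_0_iff)
    then have "Jr z = (\<integral>t. H (t, z) \<partial>lborel)" by simp
    then show ?case using elim(1) by simp
  qed
qed

section \<open>Jointly measurable representatives of continuous curves\<close>

lemma tendsto_floor_fraction: "(\<lambda>n. real_of_int \<lfloor>real (Suc n) * t\<rfloor> / real (Suc n)) \<longlonglongrightarrow> t"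
proof (rule real_tendsto_sandwich)
  have 1: "(\<lambda>n. t - 1 / real (Suc n)) \<longlonglongrightarrow> t - 0"
    using LIMSEQ_inverse_real_of_nat by (intro tendsto_intros) (simp add: inverse_eq_divide)
  then show "(\<lambda>n. t - 1 / real (Suc n)) \<longlonglongrightarrow> t" by simp
  show "\<forall>\<^sub>F n in sequentially. t - 1 / real (Suc n) \<le> real_of_int \<lfloor>real (Suc n) * t\<rfloor> / real (Suc n)"
  proof (intro always_eventually allI)
    fix n
    have "real (Suc n) * t - 1 \<le> real_of_int \<lfloor>real (Suc n) * t\<rfloor>" by linarith
    then have "(real (Suc n) * t - 1) / real (Suc n) \<le> real_of_int \<lfloor>real (Suc n) * t\<rfloor> / real (Suc n)"
      by (intro divide_right_mono) auto
    then show "t - 1 / real (Suc n) \<le> real_of_int \<lfloor>real (Suc n) * t\<rfloor> / real (Suc n)"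
      by (simp add: diff_divide_distrib)
  qed
  show "\<forall>\<^sub>F n in sequentially. real_of_int \<lfloor>real (Suc n) * t\<rfloor> / real (Suc n) \<le> t"
  proof (intro always_eventually allI)
    fix n
    have "real_of_int \<lfloor>real (Suc n) * t\<rfloor> / real (Suc n) \<le> real (Suc n) * t / real (Suc n)"
      by (intro divide_right_mono) auto
    then show "real_of_int \<lfloor>real (Suc n) * t\<rfloor> / real (Suc n) \<le> t" by simp
  qed
qed (rule tendsto_const)

text \<open>
  A continuous curve in \<open>L\<^sup>1\<close> consists of unrelated representatives, one for each
  time, so \<open>g\<close> need not be jointly measurable. Freezing time on a grid gives jointly
  measurable functions, which by continuity converge to \<open>g t\<close> in
  \<open>L\<^sup>1\<close> at each time \<open>t\<close>. A finite measure in time makes the errors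
  converge to 0 in the mean, so along a rapidly converging subsequence they are summable at almost
  every \<open>(t, z)\<close>, and the frozen functions converge there.
\<close>

theorem joint_representation:
  fixes g :: "real \<Rightarrow> 'a::euclidean_space phase_fun"
  assumes I: "I \<in> sets borel" "I \<subseteq> {0..}" "\<And>s t. t \<in> I \<Longrightarrow> 0 \<le> s \<Longrightarrow> s \<le> t \<Longrightarrow> s \<in> I"
    and M: "integrable lborel M" "\<And>z. 0 < M z" and R: "0 \<le> R"
    and g_meas: "\<And>t. t \<in> I \<Longrightarrow> g t \<in> borel_measurable borel"
    and g_bound: "\<And>t. t \<in> I \<Longrightarrow> AE z in lborel. 0 \<le> g t z \<and> g t z \<le> ereal (R * M z)"
    and g_cont: "\<And>t. t \<in> I \<Longrightarrow> ((\<lambda>s. L1_norm (\<lambda>z. g s z - g t z)) \<longlongrightarrow> 0) (at t within I)"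
  shows "\<exists>\<Gamma>\<in>weighted_ball R M. AE t in lborel. t \<in> I \<longrightarrow> (AE z in lborel. g t z = ereal (\<Gamma> (t, z)))"
proof -
  have Mm [measurable]: "M \<in> borel_measurable borel" using borel_measurable_integrable[OF M(1)] by simp
  have RM: "0 \<le> R * M z" for z using R M(2)[of z] by simp
  define G where "G = (\<lambda>s z. if s \<in> I then max 0 (min (R * M z) (real_of_ereal (g s z))) else 0)"
  have Gm [measurable]: "G s \<in> borel_measurable borel" for s
  proof (cases "s \<in> I")
    case True
    note [measurable] = g_meas[OF True]
    show ?thesis using True by (simp add: G_def)
  qed (simp add: G_def)
  have Gb: "0 \<le> G s z" "G s z \<le> R * M z" for s z using RM[of z] by (auto simp: G_def)
  have Gg: "AE z in lborel. g t z = ereal (G t z)" if "t \<in> I" for t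
    using g_bound[OF that]
  proof eventually_elim
    case (elim z)
    then show ?case using that by (cases "g t z") (auto simp: G_def)
  qed
  \<comment> \<open>Rounding down keeps the grid points in I.\<close>
  define r where "r = (\<lambda>n t. real_of_int \<lfloor>real (Suc n) * t\<rfloor> / real (Suc n))"
  have rI: "r n t \<in> I" if "t \<in> I" for n t
  proof (rule I(3)[OF that])
    have t: "0 \<le> t" using that I(2) by auto
    then show "0 \<le> r n t" by (simp add: r_def)
    have "real_of_int \<lfloor>real (Suc n) * t\<rfloor> / real (Suc n) \<le> real (Suc n) * t / real (Suc n)"
      by (intro divide_right_mono) auto
    then show "r n t \<le> t" by (simp add: r_def)
  qed
  have r_lim: "(\<lambda>n. r n t) \<longlonglongrightarrow> t" for t unfolding r_def by (rule tendsto_floor_fraction)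
  define \<Gamma>n where "\<Gamma>n = (\<lambda>n p. G (r n (fst p)) (snd p))"
  have \<Gamma>nm [measurable]: "\<Gamma>n n \<in> borel_measurable borel" for n
  proof -
    have "(\<lambda>p. (\<lambda>k p. G (real_of_int k / real (Suc n)) (snd p)) \<lfloor>real (Suc n) * fst p\<rfloor> p) \<in> borel_measurable (borel :: (real \<times> ('a \<times> 'a)) measure)"
    proof (rule measurable_compose_countable[where f="\<lambda>k p. G (real_of_int k / real (Suc n)) (snd p)" and g="\<lambda>p. \<lfloor>real (Suc n) * fst p\<rfloor>"])
      show "(\<lambda>p. G (real_of_int k / real (Suc n)) (snd p)) \<in> borel_measurable (borel :: (real \<times> ('a \<times> 'a)) measure)" for k
        by (rule measurable_compose[OF snd_borel_measurable Gm])
      show "(\<lambda>p. \<lfloor>real (Suc n) * fst p\<rfloor>) \<in> measurable (borel :: (real \<times> ('a \<times> 'a)) measure) (count_space UNIV)"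
        by measurable
    qed
    then show ?thesis by (simp add: \<Gamma>n_def r_def)
  qed
  have int_G: "integrable lborel (G s)" for s
    using Gb[of s] RM by (intro Bochner_Integration.integrable_bound[OF integrable_mult_right[OF M(1), of R]]) auto
  define m where "m = (\<integral>z. R * M z \<partial>lborel)"
  define a where "a = (\<lambda>n t. \<integral>z. \<bar>\<Gamma>n n (t, z) - G t z\<bar> \<partial>lborel)"
  define e where "e = (\<lambda>n k t. \<integral>z. \<bar>\<Gamma>n n (t, z) - \<Gamma>n k (t, z)\<bar> \<partial>lborel)"
  have \<Gamma>n_eq: "\<Gamma>n n (t, z) = G (r n t) z" for n t z by (simp add: \<Gamma>n_def)
  have a_nn: "0 \<le> a n t" for n t by (simp add: a_def)
  have dist_le: "(\<integral>z. \<bar>G s z - G s' z\<bar> \<partial>lborel) \<le> m" for s s'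
    unfolding m_def
  proof (rule integral_mono)
    show "\<bar>G s z - G s' z\<bar> \<le> R * M z" for z using Gb[of s z] Gb[of s' z] by auto
  qed (use int_G M(1) in auto)
  have a_le: "a n t \<le> m" for n t unfolding a_def \<Gamma>n_eq by (rule dist_le)
  have a_lim: "(\<lambda>n. a n t) \<longlonglongrightarrow> 0" if t: "t \<in> I" for t
  proof -
    have eq: "L1_norm (\<lambda>z. g s z - g t z) = ennreal (\<integral>z. \<bar>G s z - G t z\<bar> \<partial>lborel)" if "s \<in> I" for s
    proof -
      have "L1_norm (\<lambda>z. g s z - g t z) = L1_norm (\<lambda>z. ereal (G s z - G t z))"
        using Gg[OF that] Gg[OF t] by (intro L1_norm_cong_AE) auto
      also have "\<dots> = ennreal (\<integral>z. \<bar>G s z - G t z\<bar> \<partial>lborel)"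
        unfolding L1_norm_ereal using int_G by (intro nn_integral_eq_integral) auto
      finally show ?thesis .
    qed
    have "continuous (at t within I) (\<lambda>s. L1_norm (\<lambda>z. g s z - g t z))"
      unfolding continuous_within using g_cont[OF t] eq[OF t] by simp
    then have "(\<lambda>n. L1_norm (\<lambda>z. g (r n t) z - g t z)) \<longlonglongrightarrow> L1_norm (\<lambda>z. g t z - g t z)"
      by (rule continuous_within_tendsto_compose') (use rI t r_lim in auto)
    then have "(\<lambda>n. ennreal (a n t)) \<longlonglongrightarrow> ennreal 0"
      unfolding eq[OF rI[OF t]] eq[OF t] by (simp add: a_def \<Gamma>n_eq)
    then show ?thesis by (subst (asm) tendsto_ennreal_iff) (auto simp: a_nn)
  qed
  have em [measurable]: "e n k \<in> borel_measurable borel" for n k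
    unfolding e_def by (rule lborel.borel_measurable_lebesgue_integral) measurable
  \<comment> \<open>The curve itself need not be measurable in time; the distance to it is a limit of the distances e between frozen curves, which are measurable.\<close>
  have am [measurable]: "(\<lambda>t. indicator I t * a n t) \<in> borel_measurable borel" for n
  proof (rule borel_measurable_LIMSEQ_real)
    fix t :: real
    show "(\<lambda>k. indicator I t * e n k t) \<longlonglongrightarrow> indicator I t * a n t"
    proof (cases "t \<in> I")
      case True
      have "\<bar>e n k t - a n t\<bar> \<le> a k t" for k
      proof -
        have "e n k t - a n t = (\<integral>z. \<bar>\<Gamma>n n (t, z) - \<Gamma>n k (t, z)\<bar> - \<bar>\<Gamma>n n (t, z) - G t z\<bar> \<partial>lborel)"
          unfolding e_def a_def \<Gamma>n_eq using int_G by (intro Bochner_Integration.integral_diff[symmetric]) auto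
        also have "\<bar>\<dots>\<bar> \<le> (\<integral>z. \<bar>\<bar>\<Gamma>n n (t, z) - \<Gamma>n k (t, z)\<bar> - \<bar>\<Gamma>n n (t, z) - G t z\<bar>\<bar> \<partial>lborel)"
          using integral_norm_bound[of lborel "\<lambda>z. \<bar>\<Gamma>n n (t, z) - \<Gamma>n k (t, z)\<bar> - \<bar>\<Gamma>n n (t, z) - G t z\<bar>"] by simp
        also have "\<dots> \<le> a k t"
          unfolding a_def \<Gamma>n_eq using int_G by (intro integral_mono) auto
        finally show ?thesis .
      qed
      then have "(\<lambda>k. e n k t - a n t) \<longlonglongrightarrow> 0"
        by (intro Lim_null_comparison[OF _ a_lim[OF True]]) (intro always_eventually allI, simp only: real_norm_def)
      then show ?thesis using True by (simp add: LIM_zero_iff)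
    qed simp
    show "(\<lambda>t. indicator I t * e n k t) \<in> borel_measurable borel" for k using I(1) by measurable
  qed
  define w where "w = (\<lambda>t::real. exp (- 1 * t\<^sup>2))"
  have w_int: "integrable lborel w"
    unfolding w_def using nn_integral_gaussian_line[of 1] by (intro integrableI_bounded) auto
  have w_pos: "0 < w t" for t by (simp add: w_def)
  have [measurable]: "w \<in> borel_measurable borel" unfolding w_def by measurable
  have m0: "0 \<le> m" using a_le a_nn order_trans by blast
  define A where "A = (\<lambda>n. \<integral>t. indicator I t * a n t * w t \<partial>lborel)"
  have aw_bound: "norm (indicator I t * a n t * w t) \<le> m * w t" for n t
    using a_nn[of n t] a_le[of n t] w_pos[of t] m0 by (auto simp: indicator_def intro!: mult_right_mono)
  have aw_int: "integrable lborel (\<lambda>t. indicator I t * a n t * w t)" for n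
  proof (rule Bochner_Integration.integrable_bound[OF integrable_mult_right[OF w_int, of m]])
    show "AE t in lborel. norm (indicator I t * a n t * w t) \<le> norm (m * w t)"
      using order_trans[OF aw_bound abs_ge_self] by simp
  qed measurable
  have "A \<longlonglongrightarrow> (\<integral>t. 0 \<partial>(lborel :: real measure))"
    unfolding A_def
  proof (rule integral_dominated_convergence[where w="\<lambda>t. m * w t"])
    show "AE t in lborel. (\<lambda>n. indicator I t * a n t * w t) \<longlonglongrightarrow> 0"
    proof (rule AE_I2)
      fix t :: real
      show "(\<lambda>n. indicator I t * a n t * w t) \<longlonglongrightarrow> 0"
        using tendsto_mult_left_zero[OF a_lim[of t], of "w t"] by (cases "t \<in> I") auto
    qed
  qed (use aw_bound w_int aw_int in auto)
  then have A_lim: "A \<longlonglongrightarrow> 0" by simp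
  have "\<exists>n. A n < (1 / 2) ^ k" for k
    using order_tendstoD(2)[OF A_lim, of "(1 / 2) ^ k"] by (auto simp: eventually_sequentially)
  then obtain N where N: "A (N k) < (1 / 2) ^ k" for k by metis
  have "(\<integral>\<^sup>+ t. (\<Sum>k. ennreal (indicator I t * a (N k) t * w t)) \<partial>lborel) = (\<Sum>k. ennreal (A (N k)))"
    unfolding A_def using aw_int a_nn w_pos
    by (subst nn_integral_suminf) (auto intro!: suminf_cong nn_integral_eq_integral mult_nonneg_nonneg less_imp_le[OF w_pos])
  also have "\<dots> \<le> (\<Sum>k. ennreal ((1 / 2) ^ k))"
    using N by (intro suminf_le summableI ennreal_leI less_imp_le) auto
  also have "\<dots> < \<infinity>"
    using summable_geometric[of "1 / 2 :: real"] by (subst suminf_ennreal2) auto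
  finally have "(\<integral>\<^sup>+ t. (\<Sum>k. ennreal (indicator I t * a (N k) t * w t)) \<partial>lborel) \<noteq> \<infinity>" by simp
  then have fin: "AE t in lborel. (\<Sum>k. ennreal (indicator I t * a (N k) t * w t)) \<noteq> \<infinity>"
    by (intro nn_integral_PInf_AE) auto
  define \<Gamma> where "\<Gamma> = (\<lambda>p. max 0 (min (R * M (snd p)) (lim (\<lambda>k. \<Gamma>n (N k) p))))"
  have [measurable]: "(\<lambda>p. lim (\<lambda>k. \<Gamma>n (N k) p)) \<in> borel_measurable borel"
    by (rule borel_measurable_lim_metric) measurable
  have "\<Gamma> \<in> weighted_ball R M"
    using RM by (auto simp: weighted_ball_def \<Gamma>_def)
  moreover have "AE t in lborel. t \<in> I \<longrightarrow> (AE z in lborel. g t z = ereal (\<Gamma> (t, z)))"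
    using fin
  proof eventually_elim
    case (elim t)
    show ?case
    proof
      assume t: "t \<in> I"
      have "ennreal (w t) * (\<Sum>k. ennreal (a (N k) t)) = (\<Sum>k. ennreal (indicator I t * a (N k) t * w t))"
        using t a_nn w_pos[of t] by (subst ennreal_suminf_cmult[symmetric]) (auto simp: ennreal_mult'' mult.commute)
      with elim have "(\<Sum>k. ennreal (a (N k) t)) \<noteq> \<infinity>"
        using w_pos[of t] by (auto simp: ennreal_mult_eq_top_iff)
      moreover have "(\<integral>\<^sup>+ z. (\<Sum>k. ennreal \<bar>\<Gamma>n (N k) (t, z) - G t z\<bar>) \<partial>lborel) = (\<Sum>k. ennreal (a (N k) t))"
        unfolding a_def using int_G by (subst nn_integral_suminf) (auto simp: \<Gamma>n_eq intro!: suminf_cong nn_integral_eq_integral)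
      ultimately have "(\<integral>\<^sup>+ z. (\<Sum>k. ennreal \<bar>\<Gamma>n (N k) (t, z) - G t z\<bar>) \<partial>lborel) \<noteq> \<infinity>" by simp
      then have "AE z in lborel. (\<Sum>k. ennreal \<bar>\<Gamma>n (N k) (t, z) - G t z\<bar>) \<noteq> \<infinity>"
        by (intro nn_integral_PInf_AE) (auto simp: \<Gamma>n_eq)
      with Gg[OF t] show "AE z in lborel. g t z = ereal (\<Gamma> (t, z))"
      proof eventually_elim
        case (elim z)
        then have "summable (\<lambda>k. \<bar>\<Gamma>n (N k) (t, z) - G t z\<bar>)"
          by (intro summable_suminf_not_top) auto
        then have "(\<lambda>k. \<bar>\<Gamma>n (N k) (t, z) - G t z\<bar>) \<longlonglongrightarrow> 0" by (rule summable_LIMSEQ_zero)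
        then have "(\<lambda>k. \<Gamma>n (N k) (t, z)) \<longlonglongrightarrow> G t z"
          by (simp add: tendsto_rabs_zero_iff LIM_zero_iff)
        then have "lim (\<lambda>k. \<Gamma>n (N k) (t, z)) = G t z" by (rule limI)
        then show ?case using elim(1) Gb[of t z] by (simp add: \<Gamma>_def)
      qed
    qed
  qed
  ultimately show ?thesis by blast
qed

section \<open>The integral form of a weak equation\<close>

text \<open>
  Averages with weight \<open>k\<close> of functions that are \<open>e\<close>-close to
  \<open>G\<close> in \<open>L\<^sup>1\<close> on the support of \<open>k\<close> are
  \<open>e\<close>-close to \<open>G\<close>.
\<close>

lemma approximate_identity:
  fixes \<Gamma> :: "real \<times> 'z::euclidean_space \<Rightarrow> real"
  assumes k [measurable]: "k \<in> borel_measurable borel" and k0: "\<And>t. 0 \<le> k t"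
    and k1: "has_bochner_integral lborel k 1"
    and \<Gamma> [measurable]: "\<Gamma> \<in> borel_measurable borel" and G [measurable]: "G \<in> borel_measurable borel"
    and int: "\<And>z. integrable lborel (\<lambda>t. k t * \<Gamma> (t, z))"
    and close: "AE t in lborel. k t \<noteq> 0 \<longrightarrow> (\<integral>\<^sup>+ z. ennreal \<bar>\<Gamma> (t, z) - G z\<bar> \<partial>lborel) \<le> e"
  shows "(\<integral>\<^sup>+ z. ennreal \<bar>(\<integral>t. k t * \<Gamma> (t, z) \<partial>lborel) - G z\<bar> \<partial>lborel) \<le> e"
proof -
  have kG: "has_bochner_integral lborel (\<lambda>t. k t * G z) (1 * G z)" for z
    using k1 by (rule has_bochner_integral_mult_left)
  have e: "(\<integral>t. k t * G z \<partial>lborel) = G z" for z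
    using has_bochner_integral_integral_eq[OF kG[of z]] by (simp only: mult_1)
  have "(\<integral>\<^sup>+ z. ennreal \<bar>(\<integral>t. k t * \<Gamma> (t, z) \<partial>lborel) - G z\<bar> \<partial>lborel) =
      (\<integral>\<^sup>+ z. ennreal \<bar>(\<integral>t. (\<lambda>p. k (fst p) * \<Gamma> p) (t, z) \<partial>lborel) - (\<integral>t. (\<lambda>p. k (fst p) * G (snd p)) (t, z) \<partial>lborel)\<bar> \<partial>lborel)"
    by (simp only: e fst_conv snd_conv)
  also have "\<dots> \<le> (\<integral>\<^sup>+ t. \<integral>\<^sup>+ z. ennreal \<bar>(\<lambda>p. k (fst p) * \<Gamma> p) (t, z) - (\<lambda>p. k (fst p) * G (snd p)) (t, z)\<bar> \<partial>lborel \<partial>lborel)"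
    by (rule L1_norm_time_integrals) (use int integrable.intros[OF kG] in auto)
  also have "\<dots> \<le> (\<integral>\<^sup>+ t. ennreal (k t) * e \<partial>lborel)"
  proof (rule nn_integral_mono_AE)
    show "AE t in lborel. (\<integral>\<^sup>+ z. ennreal \<bar>(\<lambda>p. k (fst p) * \<Gamma> p) (t, z) - (\<lambda>p. k (fst p) * G (snd p)) (t, z)\<bar> \<partial>lborel) \<le> ennreal (k t) * e"
      using close
    proof eventually_elim
      case (elim t)
      have "(\<integral>\<^sup>+ z. ennreal \<bar>(\<lambda>p. k (fst p) * \<Gamma> p) (t, z) - (\<lambda>p. k (fst p) * G (snd p)) (t, z)\<bar> \<partial>lborel) =
          (\<integral>\<^sup>+ z. ennreal (k t) * ennreal \<bar>\<Gamma> (t, z) - G z\<bar> \<partial>lborel)"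
        using k0[of t] by (intro nn_integral_cong)
          (auto simp: ennreal_mult'[symmetric] abs_mult right_diff_distrib[symmetric])
      also have "\<dots> = ennreal (k t) * (\<integral>\<^sup>+ z. ennreal \<bar>\<Gamma> (t, z) - G z\<bar> \<partial>lborel)"
        by (rule nn_integral_cmult) measurable
      also have "\<dots> \<le> ennreal (k t) * e"
        using elim by (cases "k t = 0") (auto intro: mult_left_mono)
      finally show ?case .
    qed
  qed
  also have "\<dots> = (\<integral>\<^sup>+ t. ennreal (k t) \<partial>lborel) * e" by (rule nn_integral_multc) measurable
  also have "(\<integral>\<^sup>+ t. ennreal (k t) \<partial>lborel) = ennreal 1"
    using k1 k0 has_bochner_integral_iff[of lborel k 1] by (subst nn_integral_eq_integral) auto
  finally show ?thesis by simp
qed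

lemma step_derivative_kernel:
  fixes \<Phi> :: "real \<Rightarrow> real"
  assumes sm: "\<And>k t. (deriv ^^ k) \<Phi> differentiable at t"
    and low: "\<And>t. t \<le> 0 \<Longrightarrow> \<Phi> t = 0" and high: "\<And>t. 1 \<le> t \<Longrightarrow> \<Phi> t = 1"
    and nn: "\<And>t. 0 \<le> deriv \<Phi> t" and supp: "\<And>t. t \<notin> {0..1} \<Longrightarrow> deriv \<Phi> t = 0"
    and cont: "continuous_on UNIV (deriv \<Phi>)" and m: "0 < m"
  shows "has_bochner_integral lborel (\<lambda>t. m * deriv \<Phi> (m * t + d)) 1"
proof -
  have D: "(\<Phi> has_real_derivative deriv \<Phi> x) (at x)" for x
    using sm[of 0 x] by (simp add: DERIV_deriv_iff_real_differentiable)
  have "has_bochner_integral lborel (\<lambda>x. deriv \<Phi> x * indicator {0..1} x) (\<Phi> 1 - \<Phi> 0)"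
    by (rule has_bochner_integral_FTC_Icc_real[OF _ D])
      (use cont nn in \<open>auto simp: continuous_on_eq_continuous_at\<close>)
  moreover have "(\<lambda>x. deriv \<Phi> x * indicator {0..1} x) = deriv \<Phi>"
    using supp by (auto simp: indicator_def fun_eq_iff)
  ultimately have "has_bochner_integral lborel (deriv \<Phi>) 1" using low[of 0] high[of 1] by simp
  then have "has_bochner_integral lborel (\<lambda>t. deriv \<Phi> (d + m * t)) (1 /\<^sub>R \<bar>m\<bar>)"
    using m by (subst (asm) lborel_has_bochner_integral_real_affine_iff[of m _ _ d]) auto
  then have "has_bochner_integral lborel (\<lambda>t. m * deriv \<Phi> (d + m * t)) (m * (1 /\<^sub>R \<bar>m\<bar>))"
    by (rule has_bochner_integral_mult_right)
  then show ?thesis using m by (simp add: add.commute)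
qed

text \<open>
  Test the weak equation with smooth approximations \<open>\<phi> n\<close> of the indicator of
  \<open>{0..b}\<close>, each the difference of two smooth steps. Their derivatives are differences
  of two approximate identities, concentrated near 0 and near \<open>b\<close>. There the continuity
  of \<open>f\<close> in \<open>L\<^sup>1\<close> identifies the limits, while the other side
  converges by dominated convergence.
\<close>

theorem weak_solution_integral_form:
  fixes f h :: "real \<Rightarrow> 'a::euclidean_space phase_fun" and H :: "real \<times> ('a \<times> 'a) \<Rightarrow> real"
  assumes I_def: "I = time_set T"
    and M: "integrable lborel M" "\<And>z. 0 < M z"
    and \<Gamma>: "\<Gamma> \<in> weighted_ball R M"
    and f\<Gamma>: "AE t in lborel. t \<in> I \<longrightarrow> (AE z in lborel. f t z = ereal (\<Gamma> (t, z)))"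
    and f_real: "\<And>t. t \<in> I \<Longrightarrow> AE z in lborel. f t z = ereal (F t z)"
    and Fm: "\<And>t. t \<in> I \<Longrightarrow> F t \<in> borel_measurable borel"
    and f_cont: "\<And>t. t \<in> I \<Longrightarrow> ((\<lambda>s. L1_norm (\<lambda>z. f s z - f t z)) \<longlongrightarrow> 0) (at t within I)"
    and H [measurable]: "H \<in> borel_measurable borel" and H_off: "\<And>t z. t \<notin> I \<Longrightarrow> H (t, z) = 0"
    and H_int: "\<And>z. integrable lborel (\<lambda>t. H (t, z))"
    and H_fin: "(\<integral>\<^sup>+ t. \<integral>\<^sup>+ z. ennreal \<bar>H (t, z)\<bar> \<partial>lborel \<partial>lborel) < \<infinity>"
    and hH: "AE t in lborel. t \<in> I \<longrightarrow> (AE z in lborel. h t z = ereal (H (t, z)))"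
    and weak: "has_weak_time_derivative T f h"
    and b: "b \<in> I" "0 < b"
  shows "AE z in lborel. F b z = F 0 z + (\<integral>s. indicator {0..b} s * H (s, z) \<partial>lborel)"
proof -
  have Mm [measurable]: "M \<in> borel_measurable borel" using borel_measurable_integrable[OF M(1)] by simp
  have \<Gamma>m [measurable]: "\<Gamma> \<in> borel_measurable borel" using \<Gamma> by (simp add: weighted_ball_def)
  have \<Gamma>b: "0 \<le> \<Gamma> (t, z)" "\<Gamma> (t, z) \<le> R * M z" for t z using \<Gamma> unfolding weighted_ball_def by blast+
  have I: "I \<in> sets borel"
  proof -
    have "{t. ereal t < T} \<in> sets borel" by measurable
    moreover have "I = {0..} \<inter> {t. ereal t < T}" by (auto simp: I_def time_set_def)
    ultimately show ?thesis by simp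
  qed
  have Ib: "t \<in> I" if "0 \<le> t" "t \<le> b" for t
    using b(1) that order_le_less_trans[of "ereal t" "ereal b" T] by (simp add: I_def time_set_def)
  have I0: "0 \<in> I" using Ib[of 0] b by simp
  have [measurable]: "F b \<in> borel_measurable borel" "F 0 \<in> borel_measurable borel" using Fm I0 b by auto
  obtain \<Phi> :: "real \<Rightarrow> real" where \<Phi>: "\<And>k t. (deriv ^^ k) \<Phi> differentiable at t"
      "\<And>t. t \<le> 0 \<Longrightarrow> \<Phi> t = 0" "\<And>t. 1 \<le> t \<Longrightarrow> \<Phi> t = 1" "\<And>t. 0 \<le> \<Phi> t \<and> \<Phi> t \<le> 1"
      "\<And>t. 0 \<le> deriv \<Phi> t" "\<And>t. t \<notin> {0..1} \<Longrightarrow> deriv \<Phi> t = 0" "continuous_on UNIV (deriv \<Phi>)"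
    using smooth_step_exists by metis
  have D\<Phi>: "(\<Phi> has_real_derivative deriv \<Phi> x) (at x)" for x
    using \<Phi>(1)[of 0 x] by (simp add: DERIV_deriv_iff_real_differentiable)
  have \<Phi>m [measurable]: "\<Phi> \<in> borel_measurable borel"
    by (rule borel_measurable_continuous_onI) (use D\<Phi> in \<open>blast intro: continuous_at_imp_continuous_on DERIV_isCont\<close>)
  have \<rho>m [measurable]: "deriv \<Phi> \<in> borel_measurable borel"
    by (rule borel_measurable_continuous_onI[OF \<Phi>(7)])
  \<comment> \<open>Shifting the first step by 1 / n keeps the support of the test function away from 0.\<close>
  define \<phi> where "\<phi> = (\<lambda>n t. \<Phi> (real n * t + (- 1)) - \<Phi> (real n * t + (- real n * b)))"
  define k where "k = (\<lambda>c n t. real n * deriv \<Phi> (real n * t + c n))"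
  define c0 where "c0 = (\<lambda>n::nat. - 1 :: real)"
  define cb where "cb = (\<lambda>n::nat. - real n * b)"
  have km [measurable]: "k c n \<in> borel_measurable borel" for c n unfolding k_def by measurable
  have k_nn: "0 \<le> k c n t" for c n t using \<Phi>(5) by (simp add: k_def)
  have k_int: "has_bochner_integral lborel (k c n) 1" if "0 < n" for c n
    unfolding k_def by (rule step_derivative_kernel[OF \<Phi>(1-3) \<Phi>(5-7)]) (use that in auto)
  have \<phi>': "(\<phi> n has_real_derivative k c0 n t - k cb n t) (at t)" for n t
    unfolding \<phi>_def k_def c0_def cb_def
    by (auto intro!: derivative_eq_intros DERIV_chain2[OF D\<Phi>])
  then have d\<phi>: "deriv (\<phi> n) = (\<lambda>t. k c0 n t - k cb n t)" for n
    by (intro ext DERIV_imp_deriv)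
  have \<phi>_abs: "\<bar>\<phi> n t\<bar> \<le> 1" for n t
    using \<Phi>(4)[of "real n * t + (- 1)"] \<Phi>(4)[of "real n * t + (- real n * b)"] by (auto simp: \<phi>_def)
  have [measurable]: "\<phi> n \<in> borel_measurable borel" for n unfolding \<phi>_def by measurable
  \<comment> \<open>The second step lies just to the right of b and needs room there.\<close>
  have "\<exists>b'>b. ereal b' < T"
  proof -
    have "ereal b < T" using b by (simp add: I_def time_set_def)
    then obtain x where "ereal b < ereal x" "ereal x < T" using ereal_dense2 by blast
    then show ?thesis by auto
  qed
  then obtain b' where b': "b < b'" "ereal b' < T" by blast
  have b'I: "t \<in> I" if "0 \<le> t" "t \<le> b'" for t
    using b'(2) that order_le_less_trans[of "ereal t" "ereal b'" T] by (simp add: I_def time_set_def)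
  define good where "good = (\<lambda>n::nat. 0 < n \<and> 1 / real n \<le> b \<and> b + 1 / real n \<le> b')"
  have good_ev: "eventually good sequentially"
  proof -
    have l: "(\<lambda>n. 1 / real n) \<longlonglongrightarrow> 0" by (rule lim_1_over_n)
    have "\<forall>\<^sub>F n in sequentially. 1 / real n < min b (b' - b)"
      using b b' by (intro order_tendstoD(2)[OF l]) auto
    then show ?thesis
      using eventually_gt_at_top[of 0] by eventually_elim (auto simp: good_def)
  qed
  have k_supp: "k c0 n t = 0" if "good n" "t \<notin> {1 / real n..2 / real n}" for n t
  proof -
    have n: "0 < real n" using that(1) by (simp add: good_def)
    have "real n * t + c0 n \<notin> {0..1}" using that(2) n by (auto simp: c0_def field_simps)
    then show ?thesis using \<Phi>(6) by (simp add: k_def)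
  qed
  have k_supp': "k cb n t = 0" if "good n" "t \<notin> {b..b + 1 / real n}" for n t
  proof -
    have n: "0 < real n" using that(1) by (simp add: good_def)
    have "real n * t + cb n \<notin> {0..1}"
      using that(2) n by (auto simp: cb_def field_simps)
    then show ?thesis using \<Phi>(6) by (simp add: k_def)
  qed
  have \<phi>_supp: "\<phi> n t = 0" if "good n" "t \<notin> {1 / real n..b + 1 / real n}" for n t
  proof -
    have n: "0 < real n" "1 \<le> real n * b" using that(1) by (auto simp: good_def field_simps)
    have "t < 1 / real n \<or> b + 1 / real n < t" using that(2) by auto
    then consider "t < 1 / real n" | "b + 1 / real n < t" by blast
    then show ?thesis
    proof cases
      case 1
      then have 1: "real n * t < 1" using n by (simp add: field_simps)
      then have "real n * t < real n * b" using n by linarith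
      then have "t < b" using n by simp
      then have "\<Phi> (real n * t + (- 1)) = 0" "\<Phi> (real n * t + (- real n * b)) = 0"
        using 1 n \<open>t < b\<close> by (auto intro!: \<Phi>(2))
      then show ?thesis by (simp add: \<phi>_def)
    next
      case 2
      then have 2: "real n * b + 1 < real n * t" using n by (simp add: field_simps)
      then have "\<Phi> (real n * t + (- 1)) = 1" "\<Phi> (real n * t + (- real n * b)) = 1"
        using 2 n by (auto intro!: \<Phi>(3))
      then show ?thesis by (simp add: \<phi>_def)
    qed
  qed
  have test: "test_function T (\<phi> n)" if "good n" for n
    unfolding test_function_def
  proof (intro conjI exI[of _ "{1 / real n..b + 1 / real n}"] allI impI)
    show "(deriv ^^ j) (\<phi> n) differentiable at t" for j t
      unfolding \<phi>_def by (intro higher_deriv_diff(2) higher_deriv_affine(2) \<Phi>(1))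
    show "{1 / real n..b + 1 / real n} \<subseteq> {t. 0 < t \<and> ereal t < T}"
    proof
      fix t assume t: "t \<in> {1 / real n..b + 1 / real n}"
      have "0 < 1 / real n" "b + 1 / real n \<le> b'" using that by (auto simp: good_def)
      with t have "0 < t" "t \<le> b'" unfolding atLeastAtMost_iff by linarith+
      then show "t \<in> {t. 0 < t \<and> ereal t < T}"
        using b'(2) order_le_less_trans[of "ereal t" "ereal b'" T] by simp
    qed
  qed (use \<phi>_supp[OF that] in auto)
  have supp_I: "{1 / real n..2 / real n} \<subseteq> I" "{b..b + 1 / real n} \<subseteq> I" "{1 / real n..b + 1 / real n} \<subseteq> I" if "good n" for n
  proof -
    have n: "0 < real n" "1 / real n \<le> b" "b + 1 / real n \<le> b'" using that by (auto simp: good_def)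
    define d where "d = 1 / real n"
    have d: "0 < d" "d \<le> b" "b + d \<le> b'" "2 / real n = d + d" using n by (auto simp: d_def)
    show "{1 / real n..2 / real n} \<subseteq> I" "{b..b + 1 / real n} \<subseteq> I" "{1 / real n..b + 1 / real n} \<subseteq> I"
      unfolding d(4) d_def[symmetric] using d(1-3) by (auto intro!: b'I)
  qed
  have k\<Gamma>_int: "integrable lborel (\<lambda>t. k c n t * \<Gamma> (t, z))" if "0 < n" for c n z
  proof (rule Bochner_Integration.integrable_bound)
    show "integrable lborel (\<lambda>t. k c n t * (R * M z))"
      using integrable.intros[OF k_int[OF that, of c]] by simp
    show "AE t in lborel. norm (k c n t * \<Gamma> (t, z)) \<le> norm (k c n t * (R * M z))"
    proof (rule AE_I2)
      fix t
      show "norm (k c n t * \<Gamma> (t, z)) \<le> norm (k c n t * (R * M z))"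
      proof -
        have "\<bar>\<Gamma> (t, z)\<bar> \<le> \<bar>R * M z\<bar>" using \<Gamma>b[of t z] by linarith
        then have "\<bar>k c n t\<bar> * \<bar>\<Gamma> (t, z)\<bar> \<le> \<bar>k c n t\<bar> * \<bar>R * M z\<bar>" by (rule mult_left_mono) simp
        then show ?thesis by (simp add: abs_mult)
      qed
    qed
  qed measurable
  define A where "A = (\<lambda>n z. \<integral>t. k c0 n t * \<Gamma> (t, z) \<partial>lborel)"
  define B where "B = (\<lambda>n z. \<integral>t. k cb n t * \<Gamma> (t, z) \<partial>lborel)"
  have \<phi>H_int: "integrable lborel (\<lambda>t. \<phi> n t * H (t, z))" for n z
    using \<phi>_abs[of n]
    by (intro Bochner_Integration.integrable_bound[OF H_int[of z]] AE_I2) (auto simp: abs_mult intro!: mult_left_le_one_le)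
  have by_parts: "AE z in lborel. A n z - B n z = - (\<integral>t. \<phi> n t * H (t, z) \<partial>lborel)" if n: "good n" for n
  proof -
    have n0: "0 < n" using n by (simp add: good_def)
    from weak test[OF n] obtain J1 J2 where
      J1: "has_L1_integral I (\<lambda>t z. ereal (deriv (\<phi> n) t) * f t z) J1" and
      J2: "has_L1_integral I (\<lambda>t z. ereal (\<phi> n t) * h t z) J2" and
      J12: "AE z in lborel. J2 z = - J1 z"
      unfolding has_weak_time_derivative_def I_def by blast
    have off: "k c0 n t - k cb n t = 0" if "t \<notin> I" for t
      using that k_supp[OF n, of t] k_supp'[OF n, of t] supp_I[OF n] by fastforce
    have "AE z in lborel. J1 z = ereal (\<integral>t. (\<lambda>p. (k c0 n (fst p) - k cb n (fst p)) * \<Gamma> p) (t, z) \<partial>lborel)"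
    proof (rule has_L1_integral_eq_lebesgue[OF I _ _ _ _ J1])
      show "(\<lambda>p. (k c0 n (fst p) - k cb n (fst p)) * \<Gamma> p) \<in> borel_measurable borel" by measurable
      show "integrable lborel (\<lambda>t. (\<lambda>p. (k c0 n (fst p) - k cb n (fst p)) * \<Gamma> p) (t, z))" for z
        using k\<Gamma>_int[OF n0, of c0 z] k\<Gamma>_int[OF n0, of cb z] by (simp add: left_diff_distrib)
      show "AE t in lborel. t \<in> I \<longrightarrow> (AE z in lborel. ereal (deriv (\<phi> n) t) * f t z = ereal ((\<lambda>p. (k c0 n (fst p) - k cb n (fst p)) * \<Gamma> p) (t, z)))"
        using f\<Gamma>
      proof eventually_elim
        case (elim t)
        show ?case
        proof
          assume "t \<in> I"
          with elim have "AE z in lborel. f t z = ereal (\<Gamma> (t, z))" by simp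
          then show "AE z in lborel. ereal (deriv (\<phi> n) t) * f t z = ereal ((\<lambda>p. (k c0 n (fst p) - k cb n (fst p)) * \<Gamma> p) (t, z))"
            by eventually_elim (simp add: d\<phi>)
        qed
      qed
    qed (simp add: off)
    moreover have "AE z in lborel. J2 z = ereal (\<integral>t. (\<lambda>p. \<phi> n (fst p) * H p) (t, z) \<partial>lborel)"
    proof (rule has_L1_integral_eq_lebesgue[OF I _ _ _ _ J2])
      show "(\<lambda>p. \<phi> n (fst p) * H p) \<in> borel_measurable borel" by measurable
      show "integrable lborel (\<lambda>t. (\<lambda>p. \<phi> n (fst p) * H p) (t, z))" for z using \<phi>H_int by simp
      show "AE t in lborel. t \<in> I \<longrightarrow> (AE z in lborel. ereal (\<phi> n t) * h t z = ereal ((\<lambda>p. \<phi> n (fst p) * H p) (t, z)))"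
        using hH
      proof eventually_elim
        case (elim t)
        show ?case
        proof
          assume "t \<in> I"
          with elim have "AE z in lborel. h t z = ereal (H (t, z))" by simp
          then show "AE z in lborel. ereal (\<phi> n t) * h t z = ereal ((\<lambda>p. \<phi> n (fst p) * H p) (t, z))"
            by eventually_elim simp
        qed
      qed
    qed (simp add: H_off)
    ultimately show ?thesis
      using J12
    proof eventually_elim
      case (elim z)
      have "(\<integral>t. (k c0 n t - k cb n t) * \<Gamma> (t, z) \<partial>lborel) = A n z - B n z"
        unfolding A_def B_def using k\<Gamma>_int[OF n0, of c0 z] k\<Gamma>_int[OF n0, of cb z] by (simp add: left_diff_distrib)
      then show ?case using elim by simp
    qed
  qed
  have Am [measurable]: "A n \<in> borel_measurable borel" "B n \<in> borel_measurable borel" for n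
    unfolding A_def B_def by (rule lborel.borel_measurable_lebesgue_integral, measurable)+
  have norm_conv: "L1_norm (\<lambda>z. f t z - f c z) = (\<integral>\<^sup>+ z. ennreal \<bar>\<Gamma> (t, z) - F c z\<bar> \<partial>lborel)"
    if "AE z in lborel. f t z = ereal (\<Gamma> (t, z))" "c \<in> I" for t c
    unfolding L1_norm_ereal[symmetric] using that(1) f_real[OF that(2)] by (intro L1_norm_cong_AE) auto
  have near: "eventually (\<lambda>s. L1_norm (\<lambda>z. f s z - f c z) < ennreal e) (at c within I)" if "c \<in> I" "0 < e" for c e
    using order_tendstoD(2)[OF f_cont[OF that(1)], of "ennreal e"] that(2) by simp
  have close: "eventually (\<lambda>n. (\<integral>\<^sup>+ z. ennreal \<bar>A n z - F 0 z\<bar> \<partial>lborel) \<le> ennreal e \<and>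
      (\<integral>\<^sup>+ z. ennreal \<bar>B n z - F b z\<bar> \<partial>lborel) \<le> ennreal e) sequentially" if e: "0 < e" for e
  proof -
    obtain d1 where d1: "0 < d1" "\<And>s. s \<in> I \<Longrightarrow> s \<noteq> 0 \<Longrightarrow> dist s 0 < d1 \<Longrightarrow> L1_norm (\<lambda>z. f s z - f 0 z) < ennreal e"
      using near[OF I0 e] unfolding eventually_at by blast
    obtain d2 where d2: "0 < d2" "\<And>s. s \<in> I \<Longrightarrow> s \<noteq> b \<Longrightarrow> dist s b < d2 \<Longrightarrow> L1_norm (\<lambda>z. f s z - f b z) < ennreal e"
      using near[OF b(1) e] unfolding eventually_at by blast
    have "\<forall>\<^sub>F n in sequentially. 1 / real n < min (d1 / 2) d2"
      using d1 d2 by (intro order_tendstoD(2)[OF lim_1_over_n]) auto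
    then show ?thesis
      using good_ev
    proof eventually_elim
      case (elim n)
      have n0: "0 < n" using elim(2) by (simp add: good_def)
      have small: "1 / real n < d1 / 2" "1 / real n < d2" using elim(1) by auto
      have A: "(\<integral>\<^sup>+ z. ennreal \<bar>(\<integral>t. k c0 n t * \<Gamma> (t, z) \<partial>lborel) - F 0 z\<bar> \<partial>lborel) \<le> ennreal e"
      proof (rule approximate_identity[OF km k_nn k_int[OF n0] \<Gamma>m _ k\<Gamma>_int[OF n0]])
        show "AE t in lborel. k c0 n t \<noteq> 0 \<longrightarrow> (\<integral>\<^sup>+ z. ennreal \<bar>\<Gamma> (t, z) - F 0 z\<bar> \<partial>lborel) \<le> ennreal e"
          using f\<Gamma>
        proof eventually_elim
          case (elim t)
          show ?case
          proof
            assume "k c0 n t \<noteq> 0"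
            then have t: "t \<in> {1 / real n..2 / real n}" using k_supp[OF \<open>good n\<close>] by blast
            then have tI: "t \<in> I" using supp_I[OF \<open>good n\<close>] by blast
            have tn: "t \<noteq> 0" "dist t 0 < d1"
            proof -
              have p: "0 < 1 / real n" "1 / real n < d1 / 2" "2 / real n = 2 * (1 / real n)"
                using n0 small by simp_all
              have tl: "1 / real n \<le> t" "t \<le> 2 / real n" using t by simp_all
              show "t \<noteq> 0" using tl(1) p(1) by linarith
              show "dist t 0 < d1" unfolding dist_real_def using tl p by linarith
            qed
            have "AE z in lborel. f t z = ereal (\<Gamma> (t, z))" using elim tI by simp
            then show "(\<integral>\<^sup>+ z. ennreal \<bar>\<Gamma> (t, z) - F 0 z\<bar> \<partial>lborel) \<le> ennreal e"
              using d1(2)[OF tI tn] norm_conv[OF _ I0, of t] by simp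
          qed
        qed
      qed measurable
      have B: "(\<integral>\<^sup>+ z. ennreal \<bar>(\<integral>t. k cb n t * \<Gamma> (t, z) \<partial>lborel) - F b z\<bar> \<partial>lborel) \<le> ennreal e"
      proof (rule approximate_identity[OF km k_nn k_int[OF n0] \<Gamma>m _ k\<Gamma>_int[OF n0]])
        show "AE t in lborel. k cb n t \<noteq> 0 \<longrightarrow> (\<integral>\<^sup>+ z. ennreal \<bar>\<Gamma> (t, z) - F b z\<bar> \<partial>lborel) \<le> ennreal e"
          using f\<Gamma> AE_lborel_singleton[of b]
        proof eventually_elim
          case (elim t)
          show ?case
          proof
            assume "k cb n t \<noteq> 0"
            then have t: "t \<in> {b..b + 1 / real n}" using k_supp'[OF \<open>good n\<close>] by blast
            then have tI: "t \<in> I" using supp_I[OF \<open>good n\<close>] by blast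
            have tl: "b \<le> t" "t \<le> b + 1 / real n" using t by simp_all
            have td: "dist t b < d2" unfolding dist_real_def using tl small by linarith
            have "AE z in lborel. f t z = ereal (\<Gamma> (t, z))" using elim tI by simp
            then show "(\<integral>\<^sup>+ z. ennreal \<bar>\<Gamma> (t, z) - F b z\<bar> \<partial>lborel) \<le> ennreal e"
              using d2(2)[OF tI elim(2) td] norm_conv[OF _ b(1), of t] by simp
          qed
        qed
      qed measurable
      show ?case using A B by (simp add: A_def B_def)
    qed
  qed
  let ?P = "\<lambda>z. \<integral>s. indicator {0..b} s * H (s, z) \<partial>lborel"
  have PH_int: "integrable lborel (\<lambda>s. indicator {0..b} s * H (s, z))" for z
    using integrable_mult_indicator[OF _ H_int[of z], of "{0..b}"] by simp
  have Pm [measurable]: "?P \<in> borel_measurable borel"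
    by (rule lborel.borel_measurable_lebesgue_integral) measurable
  define c where "c = (\<lambda>n. \<integral>\<^sup>+ t. \<integral>\<^sup>+ z. ennreal \<bar>\<phi> n t * H (t, z) - indicator {0..b} t * H (t, z)\<bar> \<partial>lborel \<partial>lborel)"
  have \<phi>_lim: "(\<lambda>n. \<phi> n t) \<longlonglongrightarrow> indicator {0..b} t" if t: "t \<noteq> 0" for t
  proof (rule tendsto_eventually)
    have ev: "\<forall>\<^sub>F n in sequentially. x < real n" for x
      using filterlim_real_sequentially by (simp add: filterlim_at_top_dense)
    consider "t < 0" | "0 < t" "t \<le> b" | "b < t" using t by linarith
    then show "\<forall>\<^sub>F n in sequentially. \<phi> n t = indicator {0..b} t"
    proof cases
      case 1
      have "\<phi> n t = indicator {0..b} t" for n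
      proof -
        have "real n * t \<le> 0" "0 \<le> real n * b" using 1 b by (auto intro: mult_nonneg_nonpos)
        then have "\<Phi> (real n * t + (- 1)) = 0" "\<Phi> (real n * t + (- real n * b)) = 0"
          by (auto intro!: \<Phi>(2))
        then show ?thesis using 1 by (simp add: \<phi>_def)
      qed
      then show ?thesis by simp
    next
      case 2
      show ?thesis
        using ev[of "2 / t"]
      proof eventually_elim
        case (elim n)
        then have "2 < real n * t" using 2 by (simp add: field_simps)
        moreover have "real n * t \<le> real n * b" using 2 by (intro mult_left_mono) auto
        ultimately have "\<Phi> (real n * t + (- 1)) = 1" "\<Phi> (real n * t + (- real n * b)) = 0"
          by (auto intro!: \<Phi>(2,3))
        then show ?case using 2 by (simp add: \<phi>_def)
      qed
    next
      case 3
      show ?thesis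
        using ev[of "1 / (t - b)"] ev[of "2 / t"]
      proof eventually_elim
        case (elim n)
        then have "2 < real n * t" "1 < real n * t - real n * b" using 3 b by (auto simp: field_simps)
        then have "\<Phi> (real n * t + (- 1)) = 1" "\<Phi> (real n * t + (- real n * b)) = 1"
          by (auto intro!: \<Phi>(3))
        then show ?case using 3 by (simp add: \<phi>_def)
      qed
    qed
  qed
  have "c \<longlonglongrightarrow> (\<integral>\<^sup>+ t. 0 \<partial>(lborel :: real measure))"
    unfolding c_def
  proof (rule nn_integral_dominated_convergence[where w="\<lambda>t. 2 * (\<integral>\<^sup>+ z. ennreal \<bar>H (t, z)\<bar> \<partial>lborel)"])
    have eq: "(\<integral>\<^sup>+ z. ennreal \<bar>\<phi> n t * H (t, z) - indicator {0..b} t * H (t, z)\<bar> \<partial>lborel) =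
        ennreal \<bar>\<phi> n t - indicator {0..b} t\<bar> * (\<integral>\<^sup>+ z. ennreal \<bar>H (t, z)\<bar> \<partial>lborel)" for n t
      by (subst nn_integral_cmult[symmetric]) (auto simp: left_diff_distrib[symmetric] abs_mult ennreal_mult' intro!: nn_integral_cong)
    have fin: "AE t in lborel. (\<integral>\<^sup>+ z. ennreal \<bar>H (t, z)\<bar> \<partial>lborel) \<noteq> \<infinity>"
      by (rule nn_integral_PInf_AE) (use H_fin in auto)
    show "AE t in lborel. (\<lambda>n. \<integral>\<^sup>+ z. ennreal \<bar>\<phi> n t * H (t, z) - indicator {0..b} t * H (t, z)\<bar> \<partial>lborel) \<longlonglongrightarrow> 0"
      using fin AE_lborel_singleton[of 0]
    proof eventually_elim
      case (elim t)
      have "(\<lambda>n. \<bar>\<phi> n t - indicator {0..b} t\<bar>) \<longlonglongrightarrow> \<bar>indicator {0..b} t - indicator {0..b} t\<bar>"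
        by (intro tendsto_intros \<phi>_lim elim)
      then have "(\<lambda>n. ennreal \<bar>\<phi> n t - indicator {0..b} t\<bar>) \<longlonglongrightarrow> ennreal 0"
        by (intro tendsto_ennrealI) simp
      then have "(\<lambda>n. (\<integral>\<^sup>+ z. ennreal \<bar>H (t, z)\<bar> \<partial>lborel) * ennreal \<bar>\<phi> n t - indicator {0..b} t\<bar>) \<longlonglongrightarrow> (\<integral>\<^sup>+ z. ennreal \<bar>H (t, z)\<bar> \<partial>lborel) * ennreal 0"
        using elim(1) by (intro ennreal_tendsto_cmult) (simp_all add: less_top)
      then show ?case unfolding eq by (simp add: mult.commute)
    qed
    show "AE t in lborel. (\<integral>\<^sup>+ z. ennreal \<bar>\<phi> n t * H (t, z) - indicator {0..b} t * H (t, z)\<bar> \<partial>lborel) \<le> 2 * (\<integral>\<^sup>+ z. ennreal \<bar>H (t, z)\<bar> \<partial>lborel)" for n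
    proof (rule AE_I2)
      fix t
      have "\<bar>\<phi> n t - indicator {0..b} t\<bar> \<le> 2" using \<phi>_abs[of n t] by (auto simp: indicator_def)
      then have "ennreal \<bar>\<phi> n t - indicator {0..b} t\<bar> \<le> 2"
        by (metis ennreal_leI ennreal_numeral zero_le_numeral)
      then show "(\<integral>\<^sup>+ z. ennreal \<bar>\<phi> n t * H (t, z) - indicator {0..b} t * H (t, z)\<bar> \<partial>lborel) \<le> 2 * (\<integral>\<^sup>+ z. ennreal \<bar>H (t, z)\<bar> \<partial>lborel)"
        unfolding eq by (rule mult_right_mono) simp
    qed
    show "(\<integral>\<^sup>+ t. 2 * (\<integral>\<^sup>+ z. ennreal \<bar>H (t, z)\<bar> \<partial>lborel) \<partial>lborel) < \<infinity>"
      using H_fin by (subst nn_integral_cmult) (auto simp: ennreal_mult_less_top)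
  qed measurable
  then have c_lim: "c \<longlonglongrightarrow> 0" by simp
  define E where "E = (\<integral>\<^sup>+ z. ennreal \<bar>F b z - F 0 z - ?P z\<bar> \<partial>lborel)"
  have "E \<le> ennreal (3 * e)" if e: "0 < e" for e
  proof -
    have "\<forall>\<^sub>F n in sequentially. c n < ennreal e" using order_tendstoD(2)[OF c_lim, of "ennreal e"] e by simp
    with close[OF e] good_ev have "\<forall>\<^sub>F n in sequentially. E \<le> ennreal (3 * e)"
    proof eventually_elim
      case (elim n)
      let ?Q = "\<lambda>z. \<integral>t. \<phi> n t * H (t, z) \<partial>lborel"
      have Qm [measurable]: "?Q \<in> borel_measurable borel"
        by (rule lborel.borel_measurable_lebesgue_integral) measurable
      have "E \<le> (\<integral>\<^sup>+ z. ennreal \<bar>B n z - F b z\<bar> + ennreal \<bar>A n z - F 0 z\<bar> + ennreal \<bar>?Q z - ?P z\<bar> \<partial>lborel)"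
        unfolding E_def
      proof (rule nn_integral_mono_AE)
        show "AE z in lborel. ennreal \<bar>F b z - F 0 z - ?P z\<bar> \<le> ennreal \<bar>B n z - F b z\<bar> + ennreal \<bar>A n z - F 0 z\<bar> + ennreal \<bar>?Q z - ?P z\<bar>"
          using by_parts[OF elim(2)]
        proof eventually_elim
          case (elim z)
          then have "\<bar>F b z - F 0 z - ?P z\<bar> \<le> \<bar>B n z - F b z\<bar> + \<bar>A n z - F 0 z\<bar> + \<bar>?Q z - ?P z\<bar>" by linarith
          then show ?case by (simp add: ennreal_plus[symmetric] ennreal_leI del: ennreal_plus)
        qed
      qed
      also have "\<dots> = (\<integral>\<^sup>+ z. ennreal \<bar>B n z - F b z\<bar> \<partial>lborel) + (\<integral>\<^sup>+ z. ennreal \<bar>A n z - F 0 z\<bar> \<partial>lborel) + (\<integral>\<^sup>+ z. ennreal \<bar>?Q z - ?P z\<bar> \<partial>lborel)"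
        by (simp add: nn_integral_add)
      also have "(\<integral>\<^sup>+ z. ennreal \<bar>?Q z - ?P z\<bar> \<partial>lborel) \<le> c n"
        using L1_norm_time_integrals[of "\<lambda>p. \<phi> n (fst p) * H p" "\<lambda>p. indicator {0..b} (fst p) * H p"] \<phi>H_int PH_int
        by (simp add: c_def)
      also have "(\<integral>\<^sup>+ z. ennreal \<bar>B n z - F b z\<bar> \<partial>lborel) + (\<integral>\<^sup>+ z. ennreal \<bar>A n z - F 0 z\<bar> \<partial>lborel) + c n \<le> ennreal e + ennreal e + ennreal e"
        using elim by (intro add_mono) auto
      also have "\<dots> = ennreal (3 * e)" using e by (simp add: ennreal_plus[symmetric] del: ennreal_plus)
      finally show ?case by (simp add: add_left_mono)
    qed
    then show ?thesis by simp
  qed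
  from this[of "e / 3" for e] have "E \<le> 0 + ennreal e" if "0 < e" for e using that by simp
  then have "E \<le> 0" by (rule ennreal_le_epsilon)
  then have "E = 0" by simp
  then have "AE z in lborel. ennreal \<bar>F b z - F 0 z - ?P z\<bar> = 0"
    unfolding E_def by (subst (asm) nn_integral_0_iff_AE) auto
  then show ?thesis
  proof eventually_elim
    case (elim z)
    then have "\<bar>F b z - F 0 z - ?P z\<bar> \<le> 0" by (simp only: ennreal_eq_0_iff)
    then show ?case by simp
  qed
qed

section \<open>Collision terms along the free flow\<close>

text \<open>
  Replace the factors one at a time; each exchange costs \<open>N\<close> and leaves \<open>m -
  1\<close> factors bounded by \<open>R\<close>.
\<close>

lemma prod_diff_bound:
  fixes F G M :: "nat \<Rightarrow> real"
  assumes "\<And>i. i < m \<Longrightarrow> 0 \<le> F i \<and> F i \<le> R * M i" "\<And>i. i < m \<Longrightarrow> 0 \<le> G i \<and> G i \<le> R * M i"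
    and "\<And>i. i < m \<Longrightarrow> \<bar>F i - G i\<bar> \<le> N * M i" "\<And>i. i < m \<Longrightarrow> 0 \<le> M i" and R: "0 \<le> R" and N: "0 \<le> N"
  shows "0 \<le> (\<Prod>i<m. F i) \<and> (\<Prod>i<m. F i) \<le> R ^ m * (\<Prod>i<m. M i) \<and>
     \<bar>(\<Prod>i<m. F i) - (\<Prod>i<m. G i)\<bar> \<le> real m * R ^ (m - 1) * N * (\<Prod>i<m. M i)"
  using assms(1-4)
proof (induction m arbitrary: )
  case (Suc m)
  let ?P = "\<Prod>i<m. F i" and ?Q = "\<Prod>i<m. G i" and ?M = "\<Prod>i<m. M i"
  have IH: "0 \<le> ?P" "?P \<le> R ^ m * ?M" "\<bar>?P - ?Q\<bar> \<le> real m * R ^ (m - 1) * N * ?M"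
    using Suc by (auto simp: less_Suc_eq)
  have M0: "0 \<le> ?M" using Suc.prems(4) by (intro prod_nonneg) auto
  have Q: "0 \<le> ?Q" "?Q \<le> R ^ m * ?M"
  proof -
    show "0 \<le> ?Q" using Suc.prems(2) by (intro prod_nonneg) auto
    have "?Q \<le> (\<Prod>i<m. R * M i)" using Suc.prems(2) by (intro prod_mono) auto
    then show "?Q \<le> R ^ m * ?M" by (simp add: prod.distrib)
  qed
  have F: "0 \<le> F m" "F m \<le> R * M m" "\<bar>F m - G m\<bar> \<le> N * M m" "0 \<le> M m" using Suc.prems by auto
  have RM: "real m * R ^ (m - 1) * R = real m * R ^ m" by (cases m) auto
  have "\<bar>?P * F m - ?Q * G m\<bar> \<le> \<bar>?P - ?Q\<bar> * F m + ?Q * \<bar>F m - G m\<bar>"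
  proof -
    have "?P * F m - ?Q * G m = (?P - ?Q) * F m + ?Q * (F m - G m)" by (simp add: algebra_simps)
    also have "\<bar>\<dots>\<bar> \<le> \<bar>(?P - ?Q) * F m\<bar> + \<bar>?Q * (F m - G m)\<bar>" by (rule abs_triangle_ineq)
    finally show ?thesis using F(1) Q(1) by (simp add: abs_mult)
  qed
  also have "\<dots> \<le> (real m * R ^ (m - 1) * N * ?M) * (R * M m) + (R ^ m * ?M) * (N * M m)"
    using IH(3) F Q R N M0 by (intro add_mono mult_mono) auto
  also have "\<dots> = (real m * R ^ (m - 1) * R) * N * ?M * M m + R ^ m * N * ?M * M m" by (simp add: algebra_simps)
  also have "\<dots> = real (Suc m) * R ^ (Suc m - 1) * N * (\<Prod>i<Suc m. M i)"
    unfolding RM by (simp add: algebra_simps)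
  finally have "\<bar>?P * F m - ?Q * G m\<bar> \<le> real (Suc m) * R ^ (Suc m - 1) * N * (\<Prod>i<Suc m. M i)" .
  moreover have "?P * F m \<le> (R ^ m * ?M) * (R * M m)" using IH F R M0 by (intro mult_mono) auto
  ultimately show ?case using IH(1) F(1) by (simp add: mult_ac)
qed (use R in simp)

text \<open>
  Used to absorb one power of a velocity into half of a Gaussian.
\<close>

lemma le_const_exp_square:
  fixes r b :: real
  assumes "0 \<le> r" "0 < b"
  shows "r \<le> (1 + 2 / b) * exp (b / 2 * r\<^sup>2)"
proof -
  define E where "E = exp (b / 2 * r\<^sup>2)"
  have "r \<le> 1 + r\<^sup>2"
  proof (cases "r \<le> 1")
    case False
    then have "r * 1 \<le> r * r" by (intro mult_left_mono) auto
    then show ?thesis by (simp add: power2_eq_square)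
  qed (simp add: add_increasing2)
  moreover have "1 \<le> E" using assms by (simp add: E_def)
  moreover have "r\<^sup>2 \<le> (2 / b) * E"
  proof -
    have "b / 2 * r\<^sup>2 \<le> E" using exp_ge_add_one_self[of "b / 2 * r\<^sup>2"] unfolding E_def by linarith
    then have "(2 / b) * (b / 2 * r\<^sup>2) \<le> (2 / b) * E" using assms by (intro mult_left_mono) auto
    then show ?thesis using assms by simp
  qed
  moreover have "(1 + 2 / b) * E = E + (2 / b) * E" by (simp only: distrib_right mult_1)
  ultimately show ?thesis unfolding E_def[symmetric] by linarith
qed

text \<open>
  Impact directions and velocities of the collision partners. For ternary collisions
  \<open>'w\<close> is the product of two velocity spaces.
\<close>

definition angular_space :: "('w::euclidean_space \<times> 'w) measure" where
  "angular_space = sphere_measure \<Otimes>\<^sub>M lborel"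

lemma sets_angular_space [simp, measurable_cong]: "sets angular_space = sets borel"
  unfolding angular_space_def by (simp only: sets_pair_measure_cong[OF sets_sphere_measure sets_lborel] borel_prod)

lemma space_angular_space [simp]: "space angular_space = UNIV"
  by (simp add: angular_space_def space_pair_measure)

interpretation sphere_lborel: pair_sigma_finite "sphere_measure :: 'w::euclidean_space measure" "lborel :: 'w measure" ..

interpretation angular: sigma_finite_measure "angular_space :: ('w::euclidean_space \<times> 'w) measure"
  unfolding angular_space_def ..

lemma borel_pair_angular:
  fixes f :: "'b::second_countable_topology \<times> ('w::euclidean_space \<times> 'w) \<Rightarrow> 'c::topological_space"
  assumes "f \<in> borel_measurable borel"
  shows "(\<lambda>(y, p). f (y, p)) \<in> borel_measurable (borel \<Otimes>\<^sub>M angular_space)"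
proof -
  have S: "sets (borel \<Otimes>\<^sub>M angular_space) = sets (borel :: ('b \<times> ('w \<times> 'w)) measure)"
    by (simp only: sets_pair_measure_cong[OF refl sets_angular_space] borel_prod)
  show ?thesis unfolding measurable_cong_sets[OF S refl] using assms by simp
qed

lemma nn_integral_angular_space:
  assumes "f \<in> borel_measurable borel"
  shows "(\<integral>\<^sup>+ p. f p \<partial>(angular_space :: ('w::euclidean_space \<times> 'w) measure)) = (\<integral>\<^sup>+ w. \<integral>\<^sup>+ \<omega>. f (\<omega>, w) \<partial>sphere_measure \<partial>lborel)"
proof -
  have "f \<in> borel_measurable (sphere_measure \<Otimes>\<^sub>M lborel)"
    using assms by (simp add: angular_space_def[symmetric])
  from sphere_lborel.nn_integral_snd[OF this] show ?thesis by (simp add: angular_space_def)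
qed

text \<open>
  The two summands come from the singularity of the kernel, with exponent \<open>\<gamma> -
  1\<close>, and from the Gaussian; the factor 2 from comparing the size of the relative velocity
  with its norm.
\<close>

definition cross_bound :: "'w::euclidean_space itself \<Rightarrow> real \<Rightarrow> real \<Rightarrow> real \<Rightarrow> real" where
  "cross_bound _ B \<gamma> \<beta> = 2 * B * (unit_ball_vol DIM('w) * real DIM('w) / (real DIM('w) + \<gamma> - 1) +
     pi powr (DIM('w) / 2) * \<beta> powr (- real DIM('w) / 2))"

text \<open>
  A gain or loss term of binary or ternary collisions, in coordinates that move with the free flow.
  The velocities of the partners form one vector \<open>w\<close>, the relative velocity is \<open>w
  - \<Delta> v\<close> and has size \<open>\<rho>\<close>, and the angular kernel \<open>ang\<close>
  has total mass at most \<open>B\<close>. The product of \<open>m\<close> densities is taken at the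
  points \<open>\<phi> i\<close>.

  The condition \<open>\<phi>_conserve\<close> combines conservation of momentum and energy; its
  right-hand side is the same for gain and loss. By \<open>\<phi>_null\<close> the collision points
  avoid null sets, so that the term is well defined on functions given up to null sets.
\<close>

locale collision =
  fixes \<alpha> \<beta> \<gamma> B :: real and \<Delta> :: "'a::euclidean_space \<Rightarrow> 'w::euclidean_space"
    and \<rho> :: "'w \<Rightarrow> real" and ang :: "'w \<times> 'w \<Rightarrow> real"
    and m :: nat and \<phi> :: "nat \<Rightarrow> (real \<times> 'a \<times> 'a) \<times> ('w \<times> 'w) \<Rightarrow> 'a \<times> 'a"
  assumes \<alpha>: "0 < \<alpha>" and \<beta>: "0 < \<beta>" and \<gamma>: "- real DIM('w) + 1 < \<gamma>" "\<gamma> \<le> 1" and B: "0 \<le> B"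
    and \<Delta>: "linear \<Delta>" "\<And>v. norm (\<Delta> v) \<le> 2 * norm v"
    and \<rho>_measurable [measurable]: "\<rho> \<in> borel_measurable borel"
    and \<rho>: "\<And>u. norm u \<le> \<rho> u" "\<And>u. \<rho> u \<le> 2 * norm u"
    and ang_measurable [measurable]: "ang \<in> borel_measurable borel" and ang_nonneg: "\<And>p. 0 \<le> ang p"
    and ang_bound: "\<And>u. u \<noteq> 0 \<Longrightarrow> (\<integral>\<^sup>+ \<omega>. ennreal (ang (u, \<omega>)) \<partial>sphere_measure) \<le> ennreal B"
    and \<phi>_measurable [measurable]: "\<And>i. i < m \<Longrightarrow> \<phi> i \<in> borel_measurable borel"
    and \<phi>_conserve: "\<And>t x v \<omega> w. norm \<omega> = 1 \<Longrightarrow>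
       (\<Prod>i<m. maxwellian \<alpha> \<beta> (\<phi> i ((t, x, v), (\<omega>, w)))) =
       maxwellian \<alpha> \<beta> (x, v) * exp (- \<alpha> * (norm (\<Delta> x + t *\<^sub>R (\<Delta> v - w)))\<^sup>2 - \<beta> * (norm w)\<^sup>2)"
    and \<phi>_null: "\<And>i t P. i < m \<Longrightarrow> (AE z in lborel. P z) \<Longrightarrow>
       (AE z in lborel. AE p in angular_space. norm (fst p) = 1 \<longrightarrow> P (\<phi> i ((t, z), p)))"
begin

abbreviation M :: "'a \<times> 'a \<Rightarrow> real" where "M \<equiv> maxwellian \<alpha> \<beta>"

text \<open>
  The indicator discards directions off the unit sphere, which carry no mass, so that the
  conservation laws hold wherever the kernel is nonzero.
\<close>

definition kern :: "(real \<times> 'a \<times> 'a) \<times> ('w \<times> 'w) \<Rightarrow> real" where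
  "kern = (\<lambda>((t, x, v), (\<omega>, w)). indicator {1} (norm \<omega>) * (\<rho> (w - \<Delta> v) powr \<gamma> * ang (w - \<Delta> v, \<omega>)))"

definition coll :: "(real \<times> 'a \<times> 'a \<Rightarrow> real) \<Rightarrow> real \<times> 'a \<times> 'a \<Rightarrow> real" where
  "coll F = (\<lambda>y. \<integral>p. kern (y, p) * (\<Prod>i<m. F (fst y, \<phi> i (y, p))) \<partial>angular_space)"

lemma \<Delta>_measurable [measurable]: "\<Delta> \<in> borel_measurable borel"
  using \<Delta>(1) by (simp add: borel_measurable_continuous_onI linear_continuous_on linear_conv_bounded_linear)

lemma kern_measurable [measurable]: "kern \<in> borel_measurable borel"
  unfolding kern_def split_beta' by measurable

lemma kern_nonneg: "0 \<le> kern p"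
  using ang_nonneg by (auto simp: kern_def split_beta')

lemma M_measurable [measurable]: "M \<in> borel_measurable borel"
  unfolding maxwellian_def split_beta' by measurable

lemma M_pos: "0 < M z" by (auto simp: maxwellian_def split_beta')

text \<open>
  The collision term of the Maxwellian itself; it dominates all terms with densities in a weighted
  ball.
\<close>

definition weight :: "real \<times> 'a \<times> 'a \<Rightarrow> ennreal" where
  "weight y = (\<integral>\<^sup>+ p. ennreal (kern (y, p) * (\<Prod>i<m. M (\<phi> i (y, p)))) \<partial>angular_space)"

lemma prodM_measurable [measurable]: "(\<lambda>q. \<Prod>i<m. M (\<phi> i q)) \<in> borel_measurable borel"
  by (intro borel_measurable_prod) (use \<phi>_measurable in \<open>auto intro: measurable_compose[OF _ M_measurable]\<close>)

lemma weight_measurable [measurable]: "weight \<in> borel_measurable borel"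
proof -
  have "(\<lambda>(y, p). ennreal (kern (y, p) * (\<Prod>i<m. M (\<phi> i (y, p))))) \<in> borel_measurable (borel \<Otimes>\<^sub>M angular_space)"
    by (rule borel_pair_angular) measurable
  then show ?thesis unfolding weight_def by (rule angular.borel_measurable_nn_integral)
qed

text \<open>
  One power of the norm is split off: it will cancel against the time integral. The remaining
  exponent \<open>\<gamma> - 1\<close> is nonpositive, so the lower bound on \<open>\<rho>\<close>
  applies to it.
\<close>

lemma cross_section: 
  "(\<integral>\<^sup>+ \<omega>. ennreal (kern ((t, x, v), (\<omega>, w))) \<partial>sphere_measure) \<le> ennreal (2 * B * norm (w - \<Delta> v) * norm (w - \<Delta> v) powr (\<gamma> - 1))"
proof -
  let ?u = "w - \<Delta> v"
  show ?thesis
  proof (cases "?u = 0")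
    case True
    then have "\<rho> ?u = 0" using \<rho>[of ?u] by simp
    then show ?thesis by (simp add: kern_def)
  next
    case False
    then have u: "0 < norm ?u" by simp
    then have r: "0 < \<rho> ?u" using \<rho>(1)[of ?u] by linarith
    have "(\<integral>\<^sup>+ \<omega>. ennreal (kern ((t, x, v), (\<omega>, w))) \<partial>sphere_measure) \<le> (\<integral>\<^sup>+ \<omega>. ennreal (\<rho> ?u powr \<gamma>) * ennreal (ang (?u, \<omega>)) \<partial>sphere_measure)"
      using ang_nonneg by (intro nn_integral_mono) (auto simp: kern_def ennreal_mult[symmetric] indicator_def)
    also have "\<dots> = ennreal (\<rho> ?u powr \<gamma>) * (\<integral>\<^sup>+ \<omega>. ennreal (ang (?u, \<omega>)) \<partial>sphere_measure)"
      by (rule nn_integral_cmult) measurable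
    also have "\<dots> \<le> ennreal (\<rho> ?u powr \<gamma>) * ennreal B" by (intro mult_left_mono ang_bound False) simp
    also have "\<dots> = ennreal (\<rho> ?u powr \<gamma> * B)" using B by (simp add: ennreal_mult)
    also have "\<dots> \<le> ennreal (2 * B * norm ?u * norm ?u powr (\<gamma> - 1))"
    proof (rule ennreal_leI)
      have "\<rho> ?u powr \<gamma> = \<rho> ?u powr (\<gamma> - 1) * \<rho> ?u" using r by (simp add: powr_diff)
      also have "\<dots> \<le> norm ?u powr (\<gamma> - 1) * (2 * norm ?u)"
        using r u \<rho> \<gamma> by (intro mult_mono powr_mono2') auto
      finally have "\<rho> ?u powr \<gamma> * B \<le> norm ?u powr (\<gamma> - 1) * (2 * norm ?u) * B" using B by (intro mult_right_mono)
      then show "\<rho> ?u powr \<gamma> * B \<le> 2 * B * norm ?u * norm ?u powr (\<gamma> - 1)" by (simp add: mult_ac)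
    qed
    finally show ?thesis .
  qed
qed

lemma weight_le:
  "weight (t, x, v) \<le> (\<integral>\<^sup>+ w. ennreal (2 * B * norm (w - \<Delta> v) * norm (w - \<Delta> v) powr (\<gamma> - 1) *
      (M (x, v) * exp (- \<alpha> * (norm (\<Delta> x + t *\<^sub>R (\<Delta> v - w)))\<^sup>2 - \<beta> * (norm w)\<^sup>2))) \<partial>lborel)"
proof -
  let ?E = "\<lambda>w. M (x, v) * exp (- \<alpha> * (norm (\<Delta> x + t *\<^sub>R (\<Delta> v - w)))\<^sup>2 - \<beta> * (norm w)\<^sup>2)"
  have "weight (t, x, v) = (\<integral>\<^sup>+ p. ennreal (kern ((t, x, v), p) * ?E (snd p)) \<partial>angular_space)"
    unfolding weight_def
  proof (intro nn_integral_cong arg_cong[of _ _ ennreal])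
    fix p :: "'w \<times> 'w"
    obtain \<omega> w where p: "p = (\<omega>, w)" by (cases p)
    show "kern ((t, x, v), p) * (\<Prod>i<m. M (\<phi> i ((t, x, v), p))) = kern ((t, x, v), p) * ?E (snd p)"
    proof (cases "norm \<omega> = 1")
      case True
      then show ?thesis unfolding p by (simp only: \<phi>_conserve[OF True] snd_conv)
    next
      case False
      then show ?thesis by (simp add: p kern_def)
    qed
  qed
  also have "\<dots> = (\<integral>\<^sup>+ w. \<integral>\<^sup>+ \<omega>. ennreal (kern ((t, x, v), (\<omega>, w)) * ?E w) \<partial>sphere_measure \<partial>lborel)"
    by (subst nn_integral_angular_space) auto
  also have "\<dots> \<le> (\<integral>\<^sup>+ w. ennreal (2 * B * norm (w - \<Delta> v) * norm (w - \<Delta> v) powr (\<gamma> - 1) * ?E w) \<partial>lborel)"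
  proof (rule nn_integral_mono)
    fix w :: 'w
    have E: "0 \<le> ?E w" using M_pos[of "(x, v)"] by simp
    have "(\<integral>\<^sup>+ \<omega>. ennreal (kern ((t, x, v), (\<omega>, w)) * ?E w) \<partial>sphere_measure) =
        (\<integral>\<^sup>+ \<omega>. ennreal (kern ((t, x, v), (\<omega>, w))) * ennreal (?E w) \<partial>sphere_measure)"
      using E kern_nonneg by (intro nn_integral_cong) (simp add: ennreal_mult)
    also have "\<dots> = (\<integral>\<^sup>+ \<omega>. ennreal (kern ((t, x, v), (\<omega>, w))) \<partial>sphere_measure) * ennreal (?E w)"
      by (rule nn_integral_multc) measurable
    also have "\<dots> \<le> ennreal (2 * B * norm (w - \<Delta> v) * norm (w - \<Delta> v) powr (\<gamma> - 1)) * ennreal (?E w)"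
      by (intro mult_right_mono cross_section) simp
    also have "\<dots> = ennreal (2 * B * norm (w - \<Delta> v) * norm (w - \<Delta> v) powr (\<gamma> - 1) * ?E w)"
      using B E by (intro ennreal_mult[symmetric]) auto
    finally show "(\<integral>\<^sup>+ \<omega>. ennreal (kern ((t, x, v), (\<omega>, w)) * ?E w) \<partial>sphere_measure) \<le> ennreal (2 * B * norm (w - \<Delta> v) * norm (w - \<Delta> v) powr (\<gamma> - 1) * ?E w)" .
  qed
  finally show ?thesis .
qed

definition \<kappa> :: real where "\<kappa> = sqrt (pi / \<alpha>) * cross_bound TYPE('w) B \<gamma> \<beta>"

lemma singular: "(\<integral>\<^sup>+ w. ennreal (norm (w - y) powr (\<gamma> - 1) * exp (- b * (norm (w :: 'w))\<^sup>2)) \<partial>lborel) \<le>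
    ennreal (unit_ball_vol DIM('w) * real DIM('w) / (real DIM('w) + \<gamma> - 1) + pi powr (DIM('w) / 2) * b powr (- real DIM('w) / 2))" if "0 < b"
  by (rule nn_integral_singular_gaussian[where 'a='w, of "\<gamma> - 1" b y, unfolded add_diff_eq]) (use \<gamma> that in auto)

lemma cross_bound_nonneg: "0 \<le> cross_bound TYPE('w) B \<gamma> \<beta>"
  unfolding cross_bound_def using B \<gamma> by (intro mult_nonneg_nonneg add_nonneg_nonneg divide_nonneg_nonneg) auto

lemma \<kappa>_nonneg: "0 \<le> \<kappa>" unfolding \<kappa>_def using cross_bound_nonneg \<alpha> by simp

text \<open>
  By the conservation laws the product of Maxwellians is, as a function of time, a Gaussian along a
  line with velocity \<open>\<Delta> v - w\<close>. Its time integral costs a factor \<open>1 / norm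
  (w - \<Delta> v)\<close>, which turns the kernel \<open>\<bar>u\<bar> powr \<gamma>\<close> into
  \<open>\<bar>u\<bar> powr (\<gamma> - 1)\<close>: locally integrable because \<open>\<gamma> -
  1\<close> exceeds minus the dimension, and bounded at infinity because \<open>\<gamma> \<le>
  1\<close>.
\<close>

lemma weight_time_integral: "(\<integral>\<^sup>+ t. weight (t, z) \<partial>lborel) \<le> ennreal (\<kappa> * M z)"
proof -
  obtain x v where z: "z = (x, v)" by (cases z)
  let ?E = "\<lambda>t w. M (x, v) * exp (- \<alpha> * (norm (\<Delta> x + t *\<^sub>R (\<Delta> v - w)))\<^sup>2 - \<beta> * (norm w)\<^sup>2)"
  let ?s = "\<lambda>w. norm (w - \<Delta> v) powr (\<gamma> - 1)"
  let ?c = "2 * B * M (x, v) * sqrt (pi / \<alpha>)"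
  have Mp: "0 < M (x, v)" by (rule M_pos)
  have "(\<integral>\<^sup>+ t. weight (t, z) \<partial>lborel) \<le> (\<integral>\<^sup>+ t. \<integral>\<^sup>+ w. ennreal (2 * B * norm (w - \<Delta> v) * ?s w * ?E t w) \<partial>lborel \<partial>lborel)"
    unfolding z by (intro nn_integral_mono weight_le)
  also have "\<dots> = (\<integral>\<^sup>+ w. \<integral>\<^sup>+ t. ennreal (2 * B * norm (w - \<Delta> v) * ?s w * ?E t w) \<partial>lborel \<partial>lborel)"
    by (rule lborel_pair.Fubini') (simp add: split_beta')
  also have "\<dots> \<le> (\<integral>\<^sup>+ w. ennreal ?c * ennreal (?s w * exp (- \<beta> * (norm w)\<^sup>2)) \<partial>lborel)"
  proof (rule nn_integral_mono)
    fix w :: 'w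
    let ?u = "\<Delta> v - w"
    show "(\<integral>\<^sup>+ t. ennreal (2 * B * norm (w - \<Delta> v) * ?s w * ?E t w) \<partial>lborel) \<le> ennreal ?c * ennreal (?s w * exp (- \<beta> * (norm w)\<^sup>2))"
    proof (cases "?u = 0")
      case False
      let ?d = "2 * B * norm (w - \<Delta> v) * ?s w * M (x, v) * exp (- \<beta> * (norm w)\<^sup>2)"
      have d: "0 \<le> ?d" using B Mp by simp
      have "(\<integral>\<^sup>+ t. ennreal (2 * B * norm (w - \<Delta> v) * ?s w * ?E t w) \<partial>lborel) =
          (\<integral>\<^sup>+ t. ennreal ?d * ennreal (exp (- \<alpha> * (norm (\<Delta> x + t *\<^sub>R ?u))\<^sup>2)) \<partial>lborel)"
        using d by (intro nn_integral_cong) (simp add: ennreal_mult[symmetric] exp_diff exp_minus field_simps)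
      also have "\<dots> = ennreal ?d * (\<integral>\<^sup>+ t. ennreal (exp (- \<alpha> * (norm (\<Delta> x + t *\<^sub>R ?u))\<^sup>2)) \<partial>lborel)"
        by (rule nn_integral_cmult) measurable
      also have "\<dots> \<le> ennreal ?d * ennreal (sqrt (pi / \<alpha>) / norm ?u)"
        by (intro mult_left_mono nn_integral_gaussian_along_line \<alpha> False) simp
      also have "\<dots> = ennreal (?d * (sqrt (pi / \<alpha>) / norm ?u))"
        using d \<alpha> by (intro ennreal_mult[symmetric]) auto
      also have "?d * (sqrt (pi / \<alpha>) / norm ?u) = ?c * (?s w * exp (- \<beta> * (norm w)\<^sup>2))"
        using False by (simp add: norm_minus_commute field_simps)
      also have "ennreal \<dots> = ennreal ?c * ennreal (?s w * exp (- \<beta> * (norm w)\<^sup>2))"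
        using B Mp \<alpha> by (intro ennreal_mult) auto
      finally show ?thesis .
    qed (simp add: norm_minus_commute)
  qed
  also have "\<dots> = ennreal ?c * (\<integral>\<^sup>+ w. ennreal (?s w * exp (- \<beta> * (norm w)\<^sup>2)) \<partial>lborel)"
    by (rule nn_integral_cmult) measurable
  also have "\<dots> \<le> ennreal ?c * ennreal (unit_ball_vol DIM('w) * real DIM('w) / (real DIM('w) + \<gamma> - 1) + pi powr (DIM('w) / 2) * \<beta> powr (- real DIM('w) / 2))"
    by (intro mult_left_mono singular \<beta>) simp
  also have "\<dots> = ennreal (\<kappa> * M z)"
    using B Mp \<alpha> \<gamma> by (subst ennreal_mult[symmetric]) (auto simp: \<kappa>_def cross_bound_def z mult_ac)
  finally show ?thesis .
qed

definition mass :: real where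
  "mass = 8 * B * (1 + 2 / \<beta>) * (unit_ball_vol DIM('w) * real DIM('w) / (real DIM('w) + \<gamma> - 1) + pi powr (DIM('w) / 2) * (\<beta> / 2) powr (- real DIM('w) / 2))"

lemma mass_nonneg: "0 \<le> mass"
  unfolding mass_def using B \<beta> \<gamma> by (intro mult_nonneg_nonneg add_nonneg_nonneg divide_nonneg_nonneg) auto

text \<open>
  At a fixed time the power of the relative velocity is not compensated. It is absorbed by half of
  the Gaussians in \<open>v\<close> and \<open>w\<close>, at the price of a wider Maxwellian.
\<close>

lemma weight_pointwise: "weight (t, z) \<le> ennreal (mass * maxwellian \<alpha> (\<beta> / 2) z)"
proof -
  obtain x v where z: "z = (x, v)" by (cases z)
  let ?s = "\<lambda>w. norm (w - \<Delta> v) powr (\<gamma> - 1)"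
  let ?E = "\<lambda>w. M (x, v) * exp (- \<alpha> * (norm (\<Delta> x + t *\<^sub>R (\<Delta> v - w)))\<^sup>2 - \<beta> * (norm w)\<^sup>2)"
  let ?c = "8 * B * (1 + 2 / \<beta>) * maxwellian \<alpha> (\<beta> / 2) (x, v)"
  have Mp: "0 < M (x, v)" by (rule M_pos)
  have Mq: "0 < maxwellian \<alpha> (\<beta> / 2) (x, v)" by (simp add: maxwellian_def)
  have c0: "0 \<le> ?c" using B \<beta> Mq by simp
  have "weight (t, z) \<le> (\<integral>\<^sup>+ w. ennreal (2 * B * norm (w - \<Delta> v) * ?s w * ?E w) \<partial>lborel)"
    unfolding z by (rule weight_le)
  also have "\<dots> \<le> (\<integral>\<^sup>+ w. ennreal ?c * ennreal (?s w * exp (- (\<beta> / 2) * (norm w)\<^sup>2)) \<partial>lborel)"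
  proof (rule nn_integral_mono)
    fix w :: 'w
    define e1 where "e1 = exp (\<beta> / 2 * (norm w)\<^sup>2)"
    define e2 where "e2 = exp (\<beta> / 2 * (norm v)\<^sup>2)"
    define k where "k = 1 + 2 / \<beta>"
    have e: "1 \<le> e1" "1 \<le> e2" "0 \<le> k" using \<beta> by (auto simp: e1_def e2_def k_def)
    have "norm w \<le> k * e1" "norm v \<le> k * e2"
      unfolding k_def e1_def e2_def by (intro le_const_exp_square \<beta> norm_ge_zero)+
    moreover have "k * e1 \<le> k * (e1 * e2)" "k * e2 \<le> k * (e1 * e2)"
      using e by (auto intro!: mult_left_mono simp: mult_le_cancel_left1 mult_le_cancel_right1)
    moreover have "norm (w - \<Delta> v) \<le> norm w + 2 * norm v"
      using norm_triangle_ineq4[of w "\<Delta> v"] \<Delta>(2)[of v] by linarith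
    moreover have "0 \<le> norm w" by simp
    ultimately have u: "norm (w - \<Delta> v) \<le> 4 * (k * (e1 * e2))" by linarith
    have E: "?E w \<le> M (x, v) * exp (- \<beta> * (norm w)\<^sup>2)"
      using \<alpha> Mp by (intro mult_left_mono) auto
    have M2: "M (x, v) * e2 = maxwellian \<alpha> (\<beta> / 2) (x, v)"
      unfolding maxwellian_def e2_def by (simp add: exp_add[symmetric] algebra_simps)
    have W2: "exp (- \<beta> * (norm w)\<^sup>2) * e1 = exp (- (\<beta> / 2) * (norm w)\<^sup>2)"
      unfolding e1_def by (simp add: exp_add[symmetric] algebra_simps)
    have "4 * (k * (a * b)) * (c * d) = 4 * k * (c * b) * (d * a)" for a b c d :: real
      by (simp only: mult_ac)
    then have eq: "4 * (k * (e1 * e2)) * (M (x, v) * exp (- \<beta> * (norm w)\<^sup>2)) =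
        4 * k * maxwellian \<alpha> (\<beta> / 2) (x, v) * exp (- (\<beta> / 2) * (norm w)\<^sup>2)"
      unfolding M2[symmetric] W2[symmetric] .
    have "norm (w - \<Delta> v) * ?E w \<le> 4 * (k * (e1 * e2)) * (M (x, v) * exp (- \<beta> * (norm w)\<^sup>2))"
      using u E e Mp by (intro mult_mono) auto
    then have "(2 * B * ?s w) * (norm (w - \<Delta> v) * ?E w) \<le> (2 * B * ?s w) * (4 * k * maxwellian \<alpha> (\<beta> / 2) (x, v) * exp (- (\<beta> / 2) * (norm w)\<^sup>2))"
      unfolding eq using B by (intro mult_left_mono) auto
    moreover have "2 * b * n * s * E = (2 * b * s) * (n * E)" "8 * b * k * Q * (s * X) = (2 * b * s) * (4 * k * Q * X)"
      for b n s E Q X :: real by simp_all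
    ultimately have "2 * B * norm (w - \<Delta> v) * ?s w * ?E w \<le> ?c * (?s w * exp (- (\<beta> / 2) * (norm w)\<^sup>2))"
      unfolding k_def[symmetric] by (simp only:)
    then have "ennreal (2 * B * norm (w - \<Delta> v) * ?s w * ?E w) \<le> ennreal (?c * (?s w * exp (- (\<beta> / 2) * (norm w)\<^sup>2)))"
      by (rule ennreal_leI)
    also have "\<dots> = ennreal ?c * ennreal (?s w * exp (- (\<beta> / 2) * (norm w)\<^sup>2))"
      using c0 by (intro ennreal_mult) auto
    finally show "ennreal (2 * B * norm (w - \<Delta> v) * ?s w * ?E w) \<le> ennreal ?c * ennreal (?s w * exp (- (\<beta> / 2) * (norm w)\<^sup>2))" .
  qed
  also have "\<dots> = ennreal ?c * (\<integral>\<^sup>+ w. ennreal (?s w * exp (- (\<beta> / 2) * (norm w)\<^sup>2)) \<partial>lborel)"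
    by (rule nn_integral_cmult) measurable
  also have "\<dots> \<le> ennreal ?c * ennreal (unit_ball_vol DIM('w) * real DIM('w) / (real DIM('w) + \<gamma> - 1) + pi powr (DIM('w) / 2) * (\<beta> / 2) powr (- real DIM('w) / 2))"
    by (intro mult_left_mono singular) (use \<beta> in auto)
  also have "\<dots> = ennreal (mass * maxwellian \<alpha> (\<beta> / 2) z)"
    using c0 \<gamma> by (subst ennreal_mult[symmetric]) (auto simp: mass_def z mult_ac)
  finally show ?thesis .
qed

lemma ball_section: "F \<in> weighted_ball R M \<Longrightarrow> 0 \<le> F (t, z) \<and> F (t, z) \<le> R * M z"
  unfolding weighted_ball_def by blast

lemma integrand_measurable [measurable]:
  assumes F: "F \<in> weighted_ball R M"
  shows "(\<lambda>q. kern q * (\<Prod>i<m. F (fst (fst q), \<phi> i q))) \<in> borel_measurable borel"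
proof (intro borel_measurable_times kern_measurable borel_measurable_prod)
  fix i assume "i \<in> {..<m}"
  then have [measurable]: "\<phi> i \<in> borel_measurable borel" by auto
  have [measurable]: "F \<in> borel_measurable borel" using F by (simp add: weighted_ball_def)
  show "(\<lambda>q. F (fst (fst q), \<phi> i q)) \<in> borel_measurable borel" by measurable
qed

lemma integrand_section_measurable:
  assumes F: "F \<in> weighted_ball R M"
  shows "(\<lambda>p. kern (y, p) * (\<Prod>i<m. F (fst y, \<phi> i (y, p)))) \<in> borel_measurable angular_space"
  using measurable_compose[OF _ integrand_measurable[OF F], of "\<lambda>p. (y, p)" angular_space] by simp

lemma integrand_bound:
  assumes F: "F \<in> weighted_ball R M" and R: "0 \<le> R"
  shows "0 \<le> kern (y, p) * (\<Prod>i<m. F (fst y, \<phi> i (y, p)))"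
    and "kern (y, p) * (\<Prod>i<m. F (fst y, \<phi> i (y, p))) \<le> R ^ m * (kern (y, p) * (\<Prod>i<m. M (\<phi> i (y, p))))"
proof -
  have "0 \<le> (\<Prod>i<m. F (fst y, \<phi> i (y, p))) \<and> (\<Prod>i<m. F (fst y, \<phi> i (y, p))) \<le> R ^ m * (\<Prod>i<m. M (\<phi> i (y, p)))"
    using prod_diff_bound[of m "\<lambda>i. F (fst y, \<phi> i (y, p))" R "\<lambda>i. M (\<phi> i (y, p))" "\<lambda>i. F (fst y, \<phi> i (y, p))" 0]
      ball_section[OF F] R less_imp_le[OF M_pos] by simp
  then show "0 \<le> kern (y, p) * (\<Prod>i<m. F (fst y, \<phi> i (y, p)))"
    and "kern (y, p) * (\<Prod>i<m. F (fst y, \<phi> i (y, p))) \<le> R ^ m * (kern (y, p) * (\<Prod>i<m. M (\<phi> i (y, p))))"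
    using kern_nonneg[of "(y, p)"] mult_left_mono[of "\<Prod>i<m. F (fst y, \<phi> i (y, p))" "R ^ m * (\<Prod>i<m. M (\<phi> i (y, p)))" "kern (y, p)"]
    by (auto simp: mult.left_commute)
qed

lemma prodM_section_measurable: "(\<lambda>p. ennreal (kern (y, p) * (\<Prod>i<m. M (\<phi> i (y, p))))) \<in> borel_measurable angular_space"
proof -
  have "(\<lambda>q. ennreal (kern q * (\<Prod>i<m. M (\<phi> i q)))) \<in> borel_measurable borel" by measurable
  from measurable_compose[OF _ this, of "\<lambda>p. (y, p)" angular_space] show ?thesis by simp
qed

lemma nn_integrand_bound:
  assumes "0 \<le> c" "\<And>p. f p \<le> c * (kern (y, p) * (\<Prod>i<m. M (\<phi> i (y, p))))"
  shows "(\<integral>\<^sup>+ p. ennreal (f p) \<partial>angular_space) \<le> ennreal c * weight y"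
proof -
  have "(\<integral>\<^sup>+ p. ennreal (f p) \<partial>angular_space) \<le> (\<integral>\<^sup>+ p. ennreal c * ennreal (kern (y, p) * (\<Prod>i<m. M (\<phi> i (y, p)))) \<partial>angular_space)"
    using assms by (intro nn_integral_mono) (auto simp: ennreal_mult'[symmetric] intro!: ennreal_leI)
  also have "\<dots> = ennreal c * weight y"
    unfolding weight_def by (rule nn_integral_cmult[OF prodM_section_measurable])
  finally show ?thesis .
qed

lemma weight_finite: "weight y < \<infinity>"
  using weight_pointwise[of "fst y" "snd y"] by (simp add: order_le_less_trans)

lemma integrand_integrable:
  assumes F: "F \<in> weighted_ball R M" and R: "0 \<le> R"
  shows "integrable angular_space (\<lambda>p. kern (y, p) * (\<Prod>i<m. F (fst y, \<phi> i (y, p))))"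
proof (rule integrableI_bounded[OF integrand_section_measurable[OF F]])
  have "(\<integral>\<^sup>+ p. ennreal (norm (kern (y, p) * (\<Prod>i<m. F (fst y, \<phi> i (y, p))))) \<partial>angular_space) \<le> ennreal (R ^ m) * weight y"
    using integrand_bound[OF F R] R by (intro nn_integrand_bound) auto
  also have "\<dots> < \<infinity>" using weight_finite[of y] by (simp add: ennreal_mult_less_top)
  finally show "(\<integral>\<^sup>+ p. ennreal (norm (kern (y, p) * (\<Prod>i<m. F (fst y, \<phi> i (y, p))))) \<partial>angular_space) < \<infinity>" .
qed

lemma coll_measurable:
  assumes F: "F \<in> weighted_ball R M"
  shows "coll F \<in> borel_measurable borel"
proof -
  have "(\<lambda>(y, p). (\<lambda>q. kern q * (\<Prod>i<m. F (fst (fst q), \<phi> i q))) (y, p)) \<in> borel_measurable (borel \<Otimes>\<^sub>M angular_space)"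
    by (rule borel_pair_angular[OF integrand_measurable[OF F]])
  from angular.borel_measurable_lebesgue_integral[OF this] show ?thesis by (simp add: coll_def)
qed

lemma coll_nonneg:
  assumes F: "F \<in> weighted_ball R M" and R: "0 \<le> R"
  shows "0 \<le> coll F y"
  unfolding coll_def using integrand_bound(1)[OF F R] by (intro integral_nonneg_AE) simp

lemma coll_nn_integral:
  assumes F: "F \<in> weighted_ball R M" and R: "0 \<le> R"
    and Y: "AE p in angular_space. Y p = ennreal (kern (y, p) * (\<Prod>i<m. F (fst y, \<phi> i (y, p))))"
  shows "(\<integral>\<^sup>+ p. Y p \<partial>angular_space) = ennreal (coll F y)"
proof -
  have "(\<integral>\<^sup>+ p. Y p \<partial>angular_space) = (\<integral>\<^sup>+ p. ennreal (kern (y, p) * (\<Prod>i<m. F (fst y, \<phi> i (y, p)))) \<partial>angular_space)"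
    by (rule nn_integral_cong_AE[OF Y])
  also have "\<dots> = ennreal (coll F y)"
    unfolding coll_def using integrand_bound(1)[OF F R] by (intro nn_integral_eq_integral integrand_integrable[OF F R]) simp
  finally show ?thesis .
qed

lemma coll_le_weight:
  assumes F: "F \<in> weighted_ball R M" and R: "0 \<le> R"
  shows "ennreal (coll F y) \<le> ennreal (R ^ m) * weight y"
proof -
  have "ennreal (coll F y) = (\<integral>\<^sup>+ p. ennreal (kern (y, p) * (\<Prod>i<m. F (fst y, \<phi> i (y, p)))) \<partial>angular_space)"
    by (rule coll_nn_integral[OF F R, symmetric]) simp
  also have "\<dots> \<le> ennreal (R ^ m) * weight y"
    using integrand_bound(2)[OF F R] R by (intro nn_integrand_bound) auto
  finally show ?thesis .
qed

lemma coll_diff_le_weight: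
  assumes F: "F \<in> weighted_ball R M" and G: "G \<in> weighted_ball R M" and R: "0 \<le> R" and N: "0 \<le> N"
    and d: "\<And>t z. \<bar>F (t, z) - G (t, z)\<bar> \<le> N * M z"
  shows "ennreal \<bar>coll F y - coll G y\<bar> \<le> ennreal (real m * R ^ (m - 1) * N) * weight y"
proof -
  have "ennreal \<bar>coll F y - coll G y\<bar> \<le> (\<integral>\<^sup>+ p. ennreal \<bar>kern (y, p) * (\<Prod>i<m. F (fst y, \<phi> i (y, p))) - kern (y, p) * (\<Prod>i<m. G (fst y, \<phi> i (y, p)))\<bar> \<partial>angular_space)"
    unfolding coll_def by (intro ennreal_integral_diff_le integrand_integrable[OF F R] integrand_integrable[OF G R])
  also have "\<dots> \<le> ennreal (real m * R ^ (m - 1) * N) * weight y"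
  proof (rule nn_integrand_bound)
    fix p
    have "\<bar>(\<Prod>i<m. F (fst y, \<phi> i (y, p))) - (\<Prod>i<m. G (fst y, \<phi> i (y, p)))\<bar> \<le> real m * R ^ (m - 1) * N * (\<Prod>i<m. M (\<phi> i (y, p)))"
      using prod_diff_bound[of m "\<lambda>i. F (fst y, \<phi> i (y, p))" R "\<lambda>i. M (\<phi> i (y, p))" "\<lambda>i. G (fst y, \<phi> i (y, p))" N]
        ball_section[OF F] ball_section[OF G] R N d less_imp_le[OF M_pos] by simp
    then have "kern (y, p) * \<bar>(\<Prod>i<m. F (fst y, \<phi> i (y, p))) - (\<Prod>i<m. G (fst y, \<phi> i (y, p)))\<bar> \<le> kern (y, p) * (real m * R ^ (m - 1) * N * (\<Prod>i<m. M (\<phi> i (y, p))))"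
      by (rule mult_left_mono[OF _ kern_nonneg])
    then show "\<bar>kern (y, p) * (\<Prod>i<m. F (fst y, \<phi> i (y, p))) - kern (y, p) * (\<Prod>i<m. G (fst y, \<phi> i (y, p)))\<bar> \<le> real m * R ^ (m - 1) * N * (kern (y, p) * (\<Prod>i<m. M (\<phi> i (y, p))))"
      using kern_nonneg[of "(y, p)"] by (simp add: right_diff_distrib[symmetric] abs_mult mult_ac)
  qed (use R N in simp)
  finally show ?thesis .
qed

lemma time_bound:
  assumes "0 \<le> c" "\<And>t. g t \<le> ennreal c * weight (t, z)"
  shows "(\<integral>\<^sup>+ t. g t \<partial>lborel) \<le> ennreal (c * \<kappa> * M z)"
proof -
  have "(\<integral>\<^sup>+ t. g t \<partial>lborel) \<le> (\<integral>\<^sup>+ t. ennreal c * weight (t, z) \<partial>lborel)"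
    by (intro nn_integral_mono assms)
  also have "\<dots> = ennreal c * (\<integral>\<^sup>+ t. weight (t, z) \<partial>lborel)" by (rule nn_integral_cmult) measurable
  also have "\<dots> \<le> ennreal c * ennreal (\<kappa> * M z)" by (intro mult_left_mono weight_time_integral) simp
  also have "\<dots> = ennreal (c * \<kappa> * M z)"
    using assms(1) \<kappa>_nonneg less_imp_le[OF M_pos] by (subst ennreal_mult[symmetric]) (auto simp: mult.assoc)
  finally show ?thesis .
qed

lemma coll_time_bound:
  assumes F: "F \<in> weighted_ball R M" and R: "0 \<le> R"
  shows "(\<integral>\<^sup>+ t. ennreal (coll F (t, z)) \<partial>lborel) \<le> ennreal (R ^ m * \<kappa> * M z)"
  by (rule time_bound) (use R coll_le_weight[OF F R] in auto)

lemma coll_time_Lipschitz: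
  assumes F: "F \<in> weighted_ball R M" and G: "G \<in> weighted_ball R M" and R: "0 \<le> R" and N: "0 \<le> N"
    and d: "\<And>t z. \<bar>F (t, z) - G (t, z)\<bar> \<le> N * M z"
  shows "(\<integral>\<^sup>+ t. ennreal \<bar>coll F (t, z) - coll G (t, z)\<bar> \<partial>lborel) \<le> ennreal (real m * R ^ (m - 1) * N * \<kappa> * M z)"
  by (rule time_bound) (use R N coll_diff_le_weight[OF F G R N d] in auto)

lemma coll_pointwise:
  assumes F: "F \<in> weighted_ball R M" and R: "0 \<le> R"
  shows "coll F (t, z) \<le> R ^ m * mass * maxwellian \<alpha> (\<beta> / 2) z"
proof -
  have "ennreal (coll F (t, z)) \<le> ennreal (R ^ m) * weight (t, z)" by (rule coll_le_weight[OF F R])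
  also have "\<dots> \<le> ennreal (R ^ m) * ennreal (mass * maxwellian \<alpha> (\<beta> / 2) z)"
    by (intro mult_left_mono weight_pointwise) simp
  also have "\<dots> = ennreal (R ^ m * mass * maxwellian \<alpha> (\<beta> / 2) z)"
    using R mass_nonneg by (subst ennreal_mult[symmetric]) (auto simp: mult.assoc maxwellian_def split_beta')
  finally show ?thesis
    using R mass_nonneg by (subst (asm) ennreal_le_iff) (auto simp: maxwellian_def split_beta')
qed

lemma AE_collision_points:
  assumes P: "AE z in lborel. P z"
  shows "AE z in lborel. AE p in angular_space. norm (fst p) = 1 \<longrightarrow> (\<forall>i<m. P (\<phi> i ((t, z), p)))"
proof -
  have "AE z in lborel. \<forall>i\<in>{..<m}. AE p in angular_space. norm (fst p) = 1 \<longrightarrow> P (\<phi> i ((t, z), p))"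
    using \<phi>_null[OF _ P] by (intro AE_finite_allI) auto
  then show ?thesis
  proof eventually_elim
    case (elim z)
    then have "AE p in angular_space. \<forall>i\<in>{..<m}. norm (fst p) = 1 \<longrightarrow> P (\<phi> i ((t, z), p))"
      by (intro AE_finite_allI) auto
    then show ?case by eventually_elim auto
  qed
qed

lemma coll_cong_AE:
  assumes F: "F \<in> weighted_ball R M" and G: "G \<in> weighted_ball R M"
    and eq: "AE z in lborel. F (t, z) = G (t, z)"
  shows "AE z in lborel. coll F (t, z) = coll G (t, z)"
  using AE_collision_points[OF eq, of t]
proof eventually_elim
  case (elim z)
  have "AE p in angular_space. kern ((t, z), p) * (\<Prod>i<m. F (t, \<phi> i ((t, z), p))) = kern ((t, z), p) * (\<Prod>i<m. G (t, \<phi> i ((t, z), p)))"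
    using elim
  proof eventually_elim
    case (elim p)
    show ?case
    proof (cases "norm (fst p) = 1")
      case True
      with elim show ?thesis by simp
    next
      case False
      then have "kern ((t, z), p) = 0" by (simp add: kern_def split_beta')
      then show ?thesis by simp
    qed
  qed
  then show ?case
    unfolding coll_def fst_conv
    by (intro integral_cong_AE integrand_section_measurable[OF F, of "(t, z)", unfolded fst_conv]
        integrand_section_measurable[OF G, of "(t, z)", unfolded fst_conv])
qed

text \<open>
  A loss term contains the density at the point itself as a factor.
\<close>

lemma coll_vanishes:
  assumes "0 < m" "\<And>p. \<phi> 0 (y, p) = snd y" "F y = 0"
  shows "coll F y = 0"
proof -
  have z0: "(\<Prod>i<m. F (fst y, \<phi> i (y, p))) = 0" for p
    using assms by (intro prod_zero bexI[of _ 0]) auto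
  show ?thesis unfolding coll_def z0 by simp
qed

end

lemma AE_angular_space_unit: "AE p in (angular_space :: ('w::euclidean_space \<times> 'w) measure). norm (fst p) = 1"
  unfolding angular_space_def
proof (rule sphere_lborel.AE_pair_measure)
  show "{x \<in> space (sphere_measure \<Otimes>\<^sub>M lborel). norm (fst x) = 1} \<in> sets ((sphere_measure :: 'w measure) \<Otimes>\<^sub>M (lborel :: 'w measure))"
    unfolding angular_space_def[symmetric] sets_angular_space by simp
  show "AE \<omega> in sphere_measure. AE w in (lborel :: 'w measure). norm (fst (\<omega> :: 'w, w)) = 1"
    using AE_sphere_measure_norm by eventually_elim simp
qed

section \<open>Binary and ternary collision laws\<close>

text \<open>
  The exponent depends on the velocities only through their sum and the sum of their squares.
\<close>

lemma maxwellian_conserve: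
  fixes s u :: "nat \<Rightarrow> 'a::euclidean_space"
  assumes mom: "(\<Sum>i<m. s i) = (\<Sum>i<m. u i)" and en: "(\<Sum>i<m. (norm (s i))\<^sup>2) = (\<Sum>i<m. (norm (u i))\<^sup>2)"
  shows "(\<Prod>i<m. maxwellian \<alpha> \<beta> (x + t *\<^sub>R (v - s i), s i)) = (\<Prod>i<m. maxwellian \<alpha> \<beta> (x + t *\<^sub>R (v - u i), u i))"
proof -
  have *: "(\<Prod>i<m. maxwellian \<alpha> \<beta> (x + t *\<^sub>R (v - r i), r i)) =
     exp (- \<alpha> * (real m * (norm (x + t *\<^sub>R v))\<^sup>2 - 2 * t * ((x + t *\<^sub>R v) \<bullet> (\<Sum>i<m. r i)) + t\<^sup>2 * (\<Sum>i<m. (norm (r i))\<^sup>2))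
        - \<beta> * (\<Sum>i<m. (norm (r i))\<^sup>2))" for r :: "nat \<Rightarrow> 'a"
  proof -
    have "(norm (x + t *\<^sub>R (v - r i)))\<^sup>2 = (norm (x + t *\<^sub>R v))\<^sup>2 - 2 * t * ((x + t *\<^sub>R v) \<bullet> r i) + t\<^sup>2 * (norm (r i))\<^sup>2" for i
      unfolding power2_norm_eq_inner
      by (simp add: inner_diff_left inner_diff_right inner_add_left inner_add_right inner_commute power2_eq_square algebra_simps)
    then have "(\<Sum>i<m. - \<alpha> * (norm (x + t *\<^sub>R (v - r i)))\<^sup>2 - \<beta> * (norm (r i))\<^sup>2) =
        - \<alpha> * (real m * (norm (x + t *\<^sub>R v))\<^sup>2 - 2 * t * ((x + t *\<^sub>R v) \<bullet> (\<Sum>i<m. r i)) + t\<^sup>2 * (\<Sum>i<m. (norm (r i))\<^sup>2))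
        - \<beta> * (\<Sum>i<m. (norm (r i))\<^sup>2)"
      by (simp add: sum_subtractf sum.distrib sum_distrib_left[symmetric] inner_sum_right sum_negf)
    then show ?thesis by (simp only: maxwellian_def prod.case exp_sum[OF finite_lessThan, symmetric])
  qed
  show ?thesis unfolding * mom en ..
qed

text \<open>
  For each unit vector \<open>\<omega>\<close> the map \<open>\<Phi> \<omega>\<close> is linear and
  injective, so that its preimages of null sets are null sets; Tonelli's theorem exchanges the roles
  of \<open>\<omega>\<close> and \<open>z\<close>.
\<close>

lemma AE_unit_linear_inj:
  fixes \<Phi> :: "'w::euclidean_space \<Rightarrow> 'z::euclidean_space \<times> 'w \<Rightarrow> 'z \<times> 'w"
  assumes lin: "\<And>\<omega>. norm \<omega> = 1 \<Longrightarrow> linear (\<Phi> \<omega>)" and inj: "\<And>\<omega> y. norm \<omega> = 1 \<Longrightarrow> \<Phi> \<omega> y = 0 \<Longrightarrow> y = 0"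
    and meas: "(\<lambda>q. fst (\<Phi> (fst q) (snd q))) \<in> borel_measurable borel"
    and P: "AE z in lborel. P z"
  shows "AE z in lborel. AE p in angular_space. norm (fst p) = 1 \<longrightarrow> P (fst (\<Phi> (fst p) (z, snd p)))"
proof -
  from P obtain N where N: "N \<in> null_sets lborel" "{z. \<not> P z} \<subseteq> N" by (auto simp: eventually_ae_filter)
  have [measurable]: "N \<in> sets borel" using N by (auto simp: null_sets_def)
  define f :: "'w \<times> ('z \<times> 'w) \<Rightarrow> ennreal" where "f = (\<lambda>q. indicator {1} (norm (fst q)) * indicator N (fst (\<Phi> (fst q) (snd q))))"
  have fm [measurable]: "f \<in> borel_measurable borel"
    unfolding f_def using measurable_compose[OF meas, of "indicator N :: _ \<Rightarrow> ennreal" borel] by measurable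
  have z0: "(\<integral>\<^sup>+ y. f (\<omega>, y) \<partial>lborel) = 0" for \<omega>
  proof (cases "norm \<omega> = 1")
    case True
    have "inj (\<Phi> \<omega>)" using inj[OF True] linear_injective_0[OF lin[OF True]] by blast
    moreover have "AE y in (lborel :: ('z \<times> 'w) measure). fst y \<notin> N"
    proof (subst AE_lborel_pair_iff)
      show "AE x in lborel. AE y in lborel. fst (x :: 'z, y :: 'w) \<notin> N"
        using AE_not_in[OF N(1)] by eventually_elim simp
    qed measurable
    ultimately have "AE y in lborel. fst (\<Phi> \<omega> y) \<notin> N"
      using AE_lborel_linear_inj[OF lin[OF True]] by blast
    then have "AE y in lborel. f (\<omega>, y) = 0" by eventually_elim (simp add: f_def)
    then show ?thesis by (subst nn_integral_0_iff_AE) auto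
  qed (simp add: f_def)
  have gm: "(\<lambda>q. f (fst (snd q), (fst q, snd (snd q)))) \<in> borel_measurable (borel :: ('z \<times> ('w \<times> 'w)) measure)"
    by measurable
  have "(\<integral>\<^sup>+ z. \<integral>\<^sup>+ p. f (fst p, (z, snd p)) \<partial>angular_space \<partial>lborel) = (\<integral>\<^sup>+ z. \<integral>\<^sup>+ w. \<integral>\<^sup>+ \<omega>. f (\<omega>, (z, w)) \<partial>sphere_measure \<partial>lborel \<partial>lborel)"
    by (intro nn_integral_cong) (subst nn_integral_angular_space, auto)
  also have "\<dots> = (\<integral>\<^sup>+ y. \<integral>\<^sup>+ \<omega>. f (\<omega>, y) \<partial>sphere_measure \<partial>(lborel :: ('z \<times> 'w) measure))"
  proof -
    have "(\<lambda>(y, \<omega>). f (\<omega>, y)) \<in> borel_measurable (lborel \<Otimes>\<^sub>M sphere_measure)"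
    proof -
      have S: "sets ((lborel :: ('z \<times> 'w) measure) \<Otimes>\<^sub>M sphere_measure) = sets (borel :: (('z \<times> 'w) \<times> 'w) measure)"
        by (simp only: sets_pair_measure_cong[OF sets_lborel sets_sphere_measure] borel_prod)
      show ?thesis unfolding measurable_cong_sets[OF S refl] split_beta' by measurable
    qed
    then have "(\<lambda>y. \<integral>\<^sup>+ \<omega>. f (\<omega>, y) \<partial>sphere_measure) \<in> borel_measurable lborel"
      by (rule sphere.borel_measurable_nn_integral)
    then have "(\<lambda>y. \<integral>\<^sup>+ \<omega>. f (\<omega>, y) \<partial>sphere_measure) \<in> borel_measurable ((lborel :: 'z measure) \<Otimes>\<^sub>M (lborel :: 'w measure))"
      unfolding lborel_prod .
    from lborel.nn_integral_fst[OF this] show ?thesis unfolding lborel_prod by simp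
  qed
  also have "\<dots> = (\<integral>\<^sup>+ \<omega>. \<integral>\<^sup>+ y. f (\<omega>, y) \<partial>(lborel :: ('z \<times> 'w) measure) \<partial>sphere_measure)"
  proof -
    interpret p: pair_sigma_finite "sphere_measure :: 'w measure" "lborel :: ('z \<times> 'w) measure" ..
    have S: "sets (sphere_measure \<Otimes>\<^sub>M (lborel :: ('z \<times> 'w) measure)) = sets (borel :: ('w \<times> ('z \<times> 'w)) measure)"
      by (simp only: sets_pair_measure_cong[OF sets_sphere_measure sets_lborel] borel_prod)
    show ?thesis
      by (rule p.Fubini') (unfold measurable_cong_sets[OF S refl] split_beta', measurable)
  qed
  also have "\<dots> = 0" by (simp add: z0)
  finally have I0: "(\<integral>\<^sup>+ z. \<integral>\<^sup>+ p. f (fst p, (z, snd p)) \<partial>angular_space \<partial>lborel) = 0" .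
  have "(\<lambda>(z, p). f (fst p, (z, snd p))) \<in> borel_measurable (borel \<Otimes>\<^sub>M angular_space)"
    using borel_pair_angular[OF gm] by (simp add: split_beta')
  then have "(\<lambda>z. \<integral>\<^sup>+ p. f (fst p, (z, snd p)) \<partial>angular_space) \<in> borel_measurable borel"
    by (rule angular.borel_measurable_nn_integral)
  then have "AE z in lborel. (\<integral>\<^sup>+ p. f (fst p, (z, snd p)) \<partial>angular_space) = 0"
    using I0 by (subst (asm) nn_integral_0_iff_AE) auto
  then show ?thesis
  proof eventually_elim
    case (elim z)
    have "(\<lambda>p. f (fst p, (z, snd p))) \<in> borel_measurable borel" by measurable
    then have "AE p in angular_space. f (fst p, (z, snd p)) = 0"
      using elim by (subst (asm) nn_integral_0_iff_AE) auto
    then show ?case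
    proof eventually_elim
      case (elim p)
      then show ?case using N(2) by (auto simp: f_def indicator_def split: if_splits)
    qed
  qed
qed

text \<open>
  The velocities entering a gain term (\<open>post\<close> true) or a loss term (\<open>post\<close>
  false). Particle 0 is the one with velocity \<open>v\<close>; \<open>p\<close> holds the impact
  direction and the partner's velocity.
\<close>

definition bin_state :: "bool \<Rightarrow> nat \<Rightarrow> 'a::euclidean_space \<Rightarrow> 'a \<times> 'a \<Rightarrow> 'a" where
  "bin_state post i v p = (let c = (if post then fst p \<bullet> (snd p - v) else 0) in
     if i = 0 then v + c *\<^sub>R fst p else snd p - c *\<^sub>R fst p)"

text \<open>
  The same for two partners; both components of \<open>p\<close> are pairs.
\<close>

definition ter_state :: "bool \<Rightarrow> nat \<Rightarrow> 'a::euclidean_space \<Rightarrow> ('a \<times> 'a) \<times> ('a \<times> 'a) \<Rightarrow> 'a" where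
  "ter_state post i v p = (let \<omega>1 = fst (fst p); \<omega>2 = snd (fst p); v1 = fst (snd p); v2 = snd (snd p);
     c = (if post then (\<omega>1 \<bullet> (v1 - v) + \<omega>2 \<bullet> (v2 - v)) / (1 + \<omega>1 \<bullet> \<omega>2) else 0) in
     if i = 0 then v + c *\<^sub>R (\<omega>1 + \<omega>2) else if i = 1 then v1 - c *\<^sub>R \<omega>1 else v2 - c *\<^sub>R \<omega>2)"

text \<open>
  A point \<open>(x, v)\<close> labels the particle that is at \<open>x + t *\<^sub>R v\<close> at
  time \<open>t\<close>. A particle with velocity \<open>s\<close> at the same time and place has
  the label \<open>(x + t *\<^sub>R (v - s), s)\<close>.
\<close>

definition free_flight :: "('a::euclidean_space \<Rightarrow> 'p \<Rightarrow> 'a) \<Rightarrow> (real \<times> 'a \<times> 'a) \<times> 'p \<Rightarrow> 'a \<times> 'a" where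
  "free_flight s = (\<lambda>((t, x, v), p). (x + t *\<^sub>R (v - s v p), s v p))"

lemma prod_less_2: "(\<Prod>i<2. f i) = f 0 * f (1::nat)" for f :: "nat \<Rightarrow> 'b::comm_monoid_mult"
  by (simp add: numeral_2_eq_2)

lemma sum_less_2: "(\<Sum>i<2. f i) = f 0 + f (1::nat)" for f :: "nat \<Rightarrow> 'b::comm_monoid_add"
  by (simp add: numeral_2_eq_2)

lemma prod_less_3: "(\<Prod>i<3. f i) = f 0 * f 1 * f (2::nat)" for f :: "nat \<Rightarrow> 'b::comm_monoid_mult"
  by (simp add: numeral_3_eq_3 numeral_2_eq_2)

lemma sum_less_3: "(\<Sum>i<3. f i) = f 0 + f 1 + f (2::nat)" for f :: "nat \<Rightarrow> 'b::comm_monoid_add"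
  by (simp add: numeral_3_eq_3 numeral_2_eq_2)

lemma bin_momentum: "bin_state post 0 v p + bin_state post (Suc 0) v p = v + snd p"
  by (simp add: bin_state_def Let_def)

lemma bin_energy:
  assumes "norm (fst p) = 1"
  shows "(norm (bin_state post 0 v p))\<^sup>2 + (norm (bin_state post (Suc 0) v p))\<^sup>2 = (norm v)\<^sup>2 + (norm (snd p))\<^sup>2"
proof -
  obtain \<omega> w where p: "p = (\<omega>, w)" by (cases p)
  have "\<omega> \<bullet> \<omega> = 1" using assms by (simp add: p dot_square_norm)
  then show ?thesis
    unfolding bin_state_def Let_def p power2_norm_eq_inner
    by (simp add: inner_add_left inner_add_right inner_diff_left inner_diff_right inner_commute algebra_simps)
qed

text \<open>
  In particular the denominator \<open>1 + \<omega>1 \<bullet> \<omega>2\<close> of the ternary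
  collision law is at least \<open>1 / 2\<close>.
\<close>

lemma unit_pair_denominator:
  fixes \<omega>1 \<omega>2 :: "'a::euclidean_space"
  assumes "norm (\<omega>1, \<omega>2) = 1"
  shows "\<bar>\<omega>1 \<bullet> \<omega>2\<bar> \<le> 1 / 2" "\<omega>1 \<bullet> \<omega>1 + \<omega>2 \<bullet> \<omega>2 = 1"
proof -
  show s: "\<omega>1 \<bullet> \<omega>1 + \<omega>2 \<bullet> \<omega>2 = 1"
    using assms by (simp add: norm_Pair real_sqrt_eq_1_iff dot_square_norm)
  have "0 \<le> (\<omega>1 - \<omega>2) \<bullet> (\<omega>1 - \<omega>2)" "0 \<le> (\<omega>1 + \<omega>2) \<bullet> (\<omega>1 + \<omega>2)" by simp_all
  then have "2 * (\<omega>1 \<bullet> \<omega>2) \<le> 1" "- 1 \<le> 2 * (\<omega>1 \<bullet> \<omega>2)"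
    using s by (simp_all add: inner_add_left inner_add_right inner_diff_left inner_diff_right inner_commute)
  then show "\<bar>\<omega>1 \<bullet> \<omega>2\<bar> \<le> 1 / 2" by linarith
qed

lemma ter_momentum:
  "ter_state post 0 v p + ter_state post (Suc 0) v p + ter_state post 2 v p = v + fst (snd p) + snd (snd p)"
  by (simp add: ter_state_def Let_def algebra_simps)

lemma ter_energy:
  assumes "norm (fst p) = 1"
  shows "(norm (ter_state post 0 v p))\<^sup>2 + (norm (ter_state post (Suc 0) v p))\<^sup>2 + (norm (ter_state post 2 v p))\<^sup>2 =
    (norm v)\<^sup>2 + (norm (fst (snd p)))\<^sup>2 + (norm (snd (snd p)))\<^sup>2"
proof -
  obtain \<omega>1 \<omega>2 v1 v2 where p: "p = ((\<omega>1, \<omega>2), (v1, v2))" by (cases p) auto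
  have u: "\<bar>\<omega>1 \<bullet> \<omega>2\<bar> \<le> 1 / 2" "\<omega>1 \<bullet> \<omega>1 + \<omega>2 \<bullet> \<omega>2 = 1"
    using unit_pair_denominator[of \<omega>1 \<omega>2] assms by (simp_all add: p)
  define a where "a = \<omega>1 \<bullet> (v1 - v) + \<omega>2 \<bullet> (v2 - v)"
  define c where "c = (if post then a / (1 + \<omega>1 \<bullet> \<omega>2) else 0)"
  \<comment> \<open>The value of c is the nonzero root of the change of energy, which is quadratic in c.\<close>
  have ca: "c * (c * (1 + \<omega>1 \<bullet> \<omega>2)) = c * a" using u(1) by (auto simp: c_def)
  have e: "(norm (v + c *\<^sub>R (\<omega>1 + \<omega>2)))\<^sup>2 + (norm (v1 - c *\<^sub>R \<omega>1))\<^sup>2 + (norm (v2 - c *\<^sub>R \<omega>2))\<^sup>2 =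
      (norm v)\<^sup>2 + (norm v1)\<^sup>2 + (norm v2)\<^sup>2 + (- 2 * (c * a) + c * c * (2 * (\<omega>1 \<bullet> \<omega>1 + \<omega>2 \<bullet> \<omega>2) + 2 * (\<omega>1 \<bullet> \<omega>2)))"
    unfolding power2_norm_eq_inner a_def
    by (simp add: inner_add_left inner_add_right inner_diff_left inner_diff_right inner_commute algebra_simps)
  have "- 2 * (c * a) + c * c * (2 * (\<omega>1 \<bullet> \<omega>1 + \<omega>2 \<bullet> \<omega>2) + 2 * (\<omega>1 \<bullet> \<omega>2)) = 0"
    unfolding ca[symmetric] u(2) by (simp add: algebra_simps)
  moreover have "ter_state post 0 v p = v + c *\<^sub>R (\<omega>1 + \<omega>2)" "ter_state post (Suc 0) v p = v1 - c *\<^sub>R \<omega>1"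
      "ter_state post 2 v p = v2 - c *\<^sub>R \<omega>2"
    by (simp_all add: ter_state_def Let_def p c_def a_def)
  ultimately show ?thesis using e by (simp only: p fst_conv snd_conv add_0_right)
qed

lemma bin_state_linear: "bounded_linear (\<lambda>y :: ('a \<times> 'a) \<times> 'a. bin_state post i (snd (fst y)) (\<omega>, snd y))" for \<omega> :: "'a::euclidean_space"
  by (rule linear_conv_bounded_linear[THEN iffD1], rule linearI) (auto simp: bin_state_def Let_def inner_add_right inner_diff_right algebra_simps)

lemma ter_state_linear: "bounded_linear (\<lambda>y :: ('a \<times> 'a) \<times> ('a \<times> 'a). ter_state post i (snd (fst y)) (\<omega>, snd y))" for \<omega> :: "'a::euclidean_space \<times> 'a"
proof (rule linear_conv_bounded_linear[THEN iffD1], rule linearI)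
  fix y y' :: "('a \<times> 'a) \<times> ('a \<times> 'a)" and r :: real
  let ?a = "\<lambda>y :: ('a \<times> 'a) \<times> ('a \<times> 'a). (fst \<omega> \<bullet> (fst (snd y) - snd (fst y)) + snd \<omega> \<bullet> (snd (snd y) - snd (fst y))) / (1 + fst \<omega> \<bullet> snd \<omega>)"
  have a: "?a (y + y') = ?a y + ?a y'" "?a (r *\<^sub>R y) = r * ?a y"
    by (simp_all add: inner_add_right inner_diff_right add_divide_distrib[symmetric] algebra_simps)
  define c where "c = (\<lambda>y. if post then ?a y else 0)"
  have c: "c (y + y') = c y + c y'" "c (r *\<^sub>R y) = r * c y" unfolding c_def using a by simp_all
  have s: "ter_state post i (snd (fst y)) (\<omega>, snd y) = (if i = 0 then snd (fst y) + c y *\<^sub>R (fst \<omega> + snd \<omega>)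
      else if i = 1 then fst (snd y) - c y *\<^sub>R fst \<omega> else snd (snd y) - c y *\<^sub>R snd \<omega>)" for y
    by (simp add: ter_state_def Let_def c_def)
  show "ter_state post i (snd (fst (y + y'))) (\<omega>, snd (y + y')) = ter_state post i (snd (fst y)) (\<omega>, snd y) + ter_state post i (snd (fst y')) (\<omega>, snd y')"
    unfolding s c by (simp add: algebra_simps)
  show "ter_state post i (snd (fst (r *\<^sub>R y))) (\<omega>, snd (r *\<^sub>R y)) = r *\<^sub>R ter_state post i (snd (fst y)) (\<omega>, snd y)"
    unfolding s c by (simp add: algebra_simps)
qed

lemma bin_state_measurable [measurable]: "(\<lambda>q. bin_state post i (fst q) (snd q)) \<in> borel_measurable borel"
  unfolding bin_state_def Let_def by measurable

lemma ter_state_measurable [measurable]: "(\<lambda>q. ter_state post i (fst q) (snd q)) \<in> borel_measurable borel"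
  unfolding ter_state_def Let_def by measurable

lemma free_flight_measurable:
  assumes [measurable]: "(\<lambda>q. s (fst q) (snd q)) \<in> borel_measurable borel"
  shows "free_flight s \<in> borel_measurable borel"
proof -
  have "(\<lambda>q. s (snd (snd (fst q))) (snd q)) \<in> borel_measurable borel"
    by (rule measurable_compose[OF _ assms, of "\<lambda>q. (snd (snd (fst q)), snd q)", simplified])
      (intro borel_measurable_continuous_onI continuous_intros)
  note s' = this
  show ?thesis unfolding free_flight_def split_beta'
    by (intro borel_measurable_Pair borel_measurable_add borel_measurable_scaleR borel_measurable_diff s';
        intro borel_measurable_continuous_onI continuous_intros)
qed

text \<open>
  The other outgoing velocities \<open>r\<close> complete the collision point to an injective linear
  function of position and all incoming velocities.
\<close>

lemma free_flight_null:
  fixes s :: "'a::euclidean_space \<Rightarrow> ('w::euclidean_space \<times> 'w) \<Rightarrow> 'a" and r :: "'a \<Rightarrow> ('w \<times> 'w) \<Rightarrow> 'w"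
  assumes s: "\<And>\<omega>. bounded_linear (\<lambda>y :: ('a \<times> 'a) \<times> 'w. s (snd (fst y)) (\<omega>, snd y))"
    and r: "\<And>\<omega>. bounded_linear (\<lambda>y :: ('a \<times> 'a) \<times> 'w. r (snd (fst y)) (\<omega>, snd y))"
    and inj: "\<And>v p. norm (fst p) = 1 \<Longrightarrow> s v p = 0 \<Longrightarrow> r v p = 0 \<Longrightarrow> v = 0 \<and> snd p = 0"
    and sm [measurable]: "(\<lambda>q. s (fst q) (snd q)) \<in> borel_measurable borel"
    and P: "AE z in lborel. P z"
  shows "AE z in lborel. AE p in angular_space. norm (fst p) = 1 \<longrightarrow> P (free_flight s ((t, z), p))"
proof -
  define \<Phi> where "\<Phi> = (\<lambda>\<omega> (y :: ('a \<times> 'a) \<times> 'w). ((fst (fst y) + t *\<^sub>R (snd (fst y) - s (snd (fst y)) (\<omega>, snd y)), s (snd (fst y)) (\<omega>, snd y)), r (snd (fst y)) (\<omega>, snd y)))"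
  have "AE z in lborel. AE p in angular_space. norm (fst p) = 1 \<longrightarrow> P (fst (\<Phi> (fst p) (z, snd p)))"
  proof (rule AE_unit_linear_inj[OF _ _ _ P])
    show "linear (\<Phi> \<omega>)" for \<omega>
      unfolding \<Phi>_def linear_conv_bounded_linear
      by (intro bounded_linear_Pair bounded_linear_add bounded_linear_const_scaleR bounded_linear_sub s r
          bounded_linear_compose[OF bounded_linear_fst bounded_linear_fst] bounded_linear_compose[OF bounded_linear_snd bounded_linear_fst])
    show "y = 0" if "norm \<omega> = 1" "\<Phi> \<omega> y = 0" for \<omega> y
    proof -
      obtain x v w where y: "y = ((x, v), w)" by (metis prod.exhaust)
      have "snd (fst (\<Phi> \<omega> y)) = 0" "snd (\<Phi> \<omega> y) = 0" "fst (fst (\<Phi> \<omega> y)) = 0"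
        using that(2) by simp_all
      then have e: "s v (\<omega>, w) = 0" "r v (\<omega>, w) = 0" "x + t *\<^sub>R (v - s v (\<omega>, w)) = 0"
        unfolding \<Phi>_def y by (simp_all only: fst_conv snd_conv)
      have vw: "v = 0 \<and> w = 0" using inj[of "(\<omega>, w)" v] e that(1) by simp
      have "x = 0" using e(3) vw unfolding e(1) by simp
      then show ?thesis using vw by (simp add: y zero_prod_def)
    qed
    have "(\<lambda>q. s (snd (fst (snd q))) (fst q, snd (snd q))) \<in> borel_measurable (borel :: ('w \<times> (('a \<times> 'a) \<times> 'w)) measure)"
      by (rule measurable_compose[OF _ sm, of "\<lambda>q. (snd (fst (snd q)), (fst q, snd (snd q)))", simplified])
        (intro borel_measurable_continuous_onI continuous_intros)
    note [measurable] = this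
    show "(\<lambda>q. fst (\<Phi> (fst q) (snd q))) \<in> borel_measurable borel"
      unfolding \<Phi>_def fst_conv by (intro borel_measurable_Pair) measurable
  qed
  then show ?thesis
    by (simp add: \<Phi>_def free_flight_def split_beta')
qed

section \<open>Binary and ternary collision terms\<close>

text \<open>
  Outside \<open>[-1,1]\<close> the kernel is arbitrary; the cutoff makes it measurable and
  nonnegative everywhere.
\<close>

definition bin_ang :: "(real \<Rightarrow> real) \<Rightarrow> 'a::euclidean_space \<times> 'a \<Rightarrow> real" where
  "bin_ang b p = (let z = sgn (fst p) \<bullet> snd p in indicator {-1..1} z * b z)"

definition ter_ang :: "(real \<times> real \<Rightarrow> real) \<Rightarrow> ('a::euclidean_space \<times> 'a) \<times> ('a \<times> 'a) \<Rightarrow> real" where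
  "ter_ang b p = (let q = ((fst p /\<^sub>R unorm (fst p)) \<bullet> snd p, fst (snd p) \<bullet> snd (snd p)) in
     indicator ({-1..1} \<times> {-1/2..1/2}) q * b q)"

lemma bin_angle_range:
  assumes "norm \<omega> = 1"
  shows "sgn u \<bullet> \<omega> \<in> {-1..1}"
proof -
  have "\<bar>sgn u \<bullet> \<omega>\<bar> \<le> norm (sgn u) * norm \<omega>" by (rule Cauchy_Schwarz_ineq2)
  also have "\<dots> \<le> 1" using assms by (simp add: norm_sgn)
  finally show ?thesis by (auto simp: abs_le_iff)
qed

lemma b2_clip:
  "b2_norm TYPE('a::euclidean_space) (\<lambda>z. indicator {-1..1} z * b z) = b2_norm TYPE('a) b"
  unfolding b2_norm_def Let_def
  by (intro arg_cong[of _ _ "\<lambda>x. _ * x"] nn_integral_cong) (auto simp: indicator_def)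

lemma b2_clip_measurable:
  assumes "binary_kernel TYPE('a::euclidean_space) \<gamma> b"
  shows "(\<lambda>z. indicator {-1..1} z * b z) \<in> borel_measurable borel" "0 \<le> indicator {-1..1} z * b z"
proof -
  have "b \<in> borel_measurable (restrict_space borel {-1..1})" using assms by (simp add: binary_kernel_def)
  then show "(\<lambda>z. indicator {-1..1} z * b z) \<in> borel_measurable borel"
    by (subst (asm) borel_measurable_restrict_space_iff) (auto simp: mult.commute)
  show "0 \<le> indicator {-1..1} z * b z" using assms by (auto simp: binary_kernel_def indicator_def)
qed

lemma b3_clip_measurable:
  assumes "ternary_kernel TYPE('a::euclidean_space) \<gamma> b"
  shows "(\<lambda>q. indicator ({-1..1} \<times> {-1/2..1/2}) q * b q) \<in> borel_measurable borel"
    "0 \<le> indicator ({-1..1} \<times> {-1/2..1/2}) q * b q"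
proof -
  have "b \<in> borel_measurable (restrict_space borel ({-1..1} \<times> {-1/2..1/2}))" using assms by (simp add: ternary_kernel_def)
  moreover have "closed ({-1..1::real} \<times> {-1/2..1/2::real})" by (intro closed_Times closed_atLeastAtMost)
  then have "({-1..1} \<times> {-1/2..1/2} :: (real \<times> real) set) \<in> sets borel" by (rule borel_closed)
  ultimately show "(\<lambda>q. indicator ({-1..1} \<times> {-1/2..1/2}) q * b q) \<in> borel_measurable borel"
    by (subst (asm) borel_measurable_restrict_space_iff) (auto simp: mult.commute)
  show "0 \<le> indicator ({-1..1} \<times> {-1/2..1/2}) q * b q"
    using assms by (cases q) (auto simp: ternary_kernel_def indicator_def)
qed

lemma bin_state_conserve:
  assumes "norm \<omega> = 1"
  shows "(\<Prod>i<2. maxwellian \<alpha> \<beta> (free_flight (bin_state post i) ((t, x, v), (\<omega>, w)))) =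
     maxwellian \<alpha> \<beta> (x, v) * exp (- \<alpha> * (norm (x + t *\<^sub>R (v - w)))\<^sup>2 - \<beta> * (norm w)\<^sup>2)"
proof -
  have "(\<Prod>i<2. maxwellian \<alpha> \<beta> (free_flight (bin_state post i) ((t, x, v), (\<omega>, w)))) =
     (\<Prod>i<2. maxwellian \<alpha> \<beta> (x + t *\<^sub>R (v - bin_state False i v (\<omega>, w)), bin_state False i v (\<omega>, w)))"
    unfolding free_flight_def prod.case
    by (rule maxwellian_conserve)
      (use bin_momentum[of _ v "(\<omega>, w)"] bin_energy[of "(\<omega>, w)" _ v] assms in \<open>simp_all add: sum_less_2\<close>)
  then show ?thesis by (simp add: prod_less_2 bin_state_def maxwellian_def)
qed

lemma ter_state_conserve:
  assumes "norm \<omega> = 1"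
  shows "(\<Prod>i<3. maxwellian \<alpha> \<beta> (free_flight (ter_state post i) ((t, x, v), (\<omega>, w)))) =
     maxwellian \<alpha> \<beta> (x, v) * exp (- \<alpha> * (norm ((x, x) + t *\<^sub>R ((v, v) - w)))\<^sup>2 - \<beta> * (norm w)\<^sup>2)"
proof -
  have "(\<Prod>i<3. maxwellian \<alpha> \<beta> (free_flight (ter_state post i) ((t, x, v), (\<omega>, w)))) =
     (\<Prod>i<3. maxwellian \<alpha> \<beta> (x + t *\<^sub>R (v - ter_state False i v (\<omega>, w)), ter_state False i v (\<omega>, w)))"
    unfolding free_flight_def prod.case
    by (rule maxwellian_conserve)
      (use ter_momentum[of _ v "(\<omega>, w)"] ter_energy[of "(\<omega>, w)" _ v] assms in \<open>simp_all add: sum_less_3\<close>)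
  also have "\<dots> = maxwellian \<alpha> \<beta> (x, v) * exp (- \<alpha> * (norm ((x, x) + t *\<^sub>R ((v, v) - w)))\<^sup>2 - \<beta> * (norm w)\<^sup>2)"
  proof -
    obtain v1 v2 where w: "w = (v1, v2)" by (cases w)
    have n: "(norm (a, b))\<^sup>2 = (norm a)\<^sup>2 + (norm b)\<^sup>2" for a b :: 'a
      by (simp add: norm_Pair)
    show ?thesis
      by (simp add: prod_less_3 ter_state_def Let_def maxwellian_def w n exp_add[symmetric] algebra_simps)
  qed
  finally show ?thesis .
qed

text \<open>
  The bound on the angular kernel is the formula for surface integrals. The collision points avoid
  null sets since, by conservation of energy, outgoing velocities vanish only if the incoming ones
  do.
\<close>

lemma bin_collision:
  assumes b: "binary_kernel TYPE(real^'n::finite) \<gamma> b" and d: "CARD('n) \<ge> 2" and \<alpha>: "0 < \<alpha>" and \<beta>: "0 < \<beta>"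
  shows "collision \<alpha> \<beta> \<gamma> (enn2real (b2_norm TYPE(real^'n) b)) (\<lambda>v :: real^'n. v) norm (bin_ang b) 2 (\<lambda>i. free_flight (bin_state post i))"
proof (rule collision.intro)
  show "- real DIM(real^'n) + 1 < \<gamma>" "\<gamma> \<le> 1" using b by (simp_all add: binary_kernel_def)
  have [measurable]: "(\<lambda>p :: (real^'n) \<times> (real^'n). sgn (fst p) \<bullet> snd p) \<in> borel_measurable borel" by measurable
  show "bin_ang b \<in> borel_measurable (borel :: ((real^'n) \<times> (real^'n)) measure)"
    unfolding bin_ang_def Let_def by (rule measurable_compose[OF _ b2_clip_measurable(1)[OF b]]) measurable
  show "0 \<le> bin_ang b p" for p :: "(real^'n) \<times> (real^'n)"
    unfolding bin_ang_def Let_def by (rule b2_clip_measurable(2)[OF b])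
  show "(\<integral>\<^sup>+ \<omega>. ennreal (bin_ang b (u, \<omega>)) \<partial>sphere_measure) \<le> ennreal (enn2real (b2_norm TYPE(real^'n) b))"
    if "u \<noteq> 0" for u :: "real^'n"
  proof -
    have "b2_norm TYPE(real^'n) b < \<infinity>" using b by (simp add: binary_kernel_def)
    then show ?thesis
      using nn_integral_sphere_inner[OF b2_clip_measurable(1)[OF b] b2_clip_measurable(2)[OF b] _ d, of "sgn u"] that
      by (simp add: bin_ang_def Let_def norm_sgn b2_clip)
  qed
  show "free_flight (bin_state post i) \<in> borel_measurable borel" for i
    by (rule free_flight_measurable[OF bin_state_measurable])
  show "(\<Prod>i<2. maxwellian \<alpha> \<beta> (free_flight (bin_state post i) ((t, x, v), (\<omega>, w)))) =
     maxwellian \<alpha> \<beta> (x, v) * exp (- \<alpha> * (norm (x + t *\<^sub>R (v - w)))\<^sup>2 - \<beta> * (norm w)\<^sup>2)"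
    if "norm \<omega> = 1" for t and x v \<omega> w :: "real^'n"
    by (rule bin_state_conserve[OF that])
  show "AE z in lborel. AE p in angular_space. norm (fst p) = 1 \<longrightarrow> P (free_flight (bin_state post i) ((t, z), p))"
    if i: "i < 2" and P: "AE z in lborel. P z" for i t and P :: "(real^'n) \<times> (real^'n) \<Rightarrow> bool"
  proof (rule free_flight_null[where r="bin_state post (1 - i)", OF bin_state_linear bin_state_linear _ bin_state_measurable P])
    fix v and p :: "(real^'n) \<times> (real^'n)"
    assume p: "norm (fst p) = 1" and z: "bin_state post i v p = 0" "bin_state post (1 - i) v p = 0"
    from i have "i = 0 \<or> i = 1" by auto
    with z have "bin_state post 0 v p = 0" "bin_state post (Suc 0) v p = 0" by auto
    with bin_energy[OF p, of post v] show "v = 0 \<and> snd p = 0"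
      by (simp add: add_nonneg_eq_0_iff)
  qed
qed (use \<alpha> \<beta> in \<open>auto intro: linear_ident\<close>)

lemma unorm_bounds: "norm u \<le> unorm u" "unorm u \<le> 2 * norm u" "(unorm u)\<^sup>2 = (norm (fst u))\<^sup>2 + (norm (snd u))\<^sup>2 + (norm (fst u - snd u))\<^sup>2"
  for u :: "'a::euclidean_space \<times> 'a"
proof -
  show sq: "(unorm u)\<^sup>2 = (norm (fst u))\<^sup>2 + (norm (snd u))\<^sup>2 + (norm (fst u - snd u))\<^sup>2"
    unfolding unorm_def by (rule real_sqrt_pow2) simp
  have n: "(norm u)\<^sup>2 = (norm (fst u))\<^sup>2 + (norm (snd u))\<^sup>2"
    by (cases u) (simp add: norm_Pair)
  have u0: "0 \<le> unorm u" by (simp add: unorm_def)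
  show "norm u \<le> unorm u" by (rule power2_le_imp_le[OF _ u0]) (simp add: sq n)
  have "(norm (fst u - snd u))\<^sup>2 \<le> (norm (fst u) + norm (snd u))\<^sup>2"
    by (rule power_mono[OF norm_triangle_ineq4]) simp
  also have "\<dots> \<le> 2 * (norm (fst u))\<^sup>2 + 2 * (norm (snd u))\<^sup>2"
    using sum_squares_bound[of "norm (fst u)" "norm (snd u)"] by (simp add: power2_sum)
  finally have "(unorm u)\<^sup>2 \<le> 4 * (norm u)\<^sup>2"
  proof -
    assume c: "(norm (fst u - snd u))\<^sup>2 \<le> 2 * (norm (fst u))\<^sup>2 + 2 * (norm (snd u))\<^sup>2"
    have gen: "p + q + c \<le> 4 * (p + q)" if "c \<le> 2 * p + 2 * q" "0 \<le> p" "0 \<le> q" for p q c :: real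
      using that by simp
    show ?thesis unfolding sq n by (rule gen[OF c]) simp_all
  qed
  then have "(unorm u)\<^sup>2 \<le> (2 * norm u)\<^sup>2" by (simp add: power_mult_distrib)
  then show "unorm u \<le> 2 * norm u" by (rule power2_le_imp_le) simp
qed

lemma ter_angle_range:
  fixes u \<omega> :: "'a::euclidean_space \<times> 'a"
  assumes "norm \<omega> = 1"
  shows "((u /\<^sub>R unorm u) \<bullet> \<omega>, fst \<omega> \<bullet> snd \<omega>) \<in> {-1..1} \<times> {-1/2..1/2}"
proof -
  have "\<bar>(u /\<^sub>R unorm u) \<bullet> \<omega>\<bar> \<le> norm (u /\<^sub>R unorm u) * norm \<omega>" by (rule Cauchy_Schwarz_ineq2)
  also have "\<dots> \<le> 1"
    using assms unorm_bounds(1)[of u] norm_ge_zero[of u] by (auto simp: field_simps divide_simps abs_of_nonneg)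
  finally have "(u /\<^sub>R unorm u) \<bullet> \<omega> \<in> {-1..1}" unfolding abs_le_iff atLeastAtMost_iff by linarith
  moreover have "fst \<omega> \<bullet> snd \<omega> \<in> {-1/2..1/2}"
    using unit_pair_denominator(1)[of "fst \<omega>" "snd \<omega>"] assms unfolding prod.collapse abs_le_iff atLeastAtMost_iff by auto
  ultimately show ?thesis by blast
qed

lemma unorm_measurable [measurable]: "unorm \<in> borel_measurable borel"
  unfolding unorm_def by (intro borel_measurable_continuous_onI continuous_intros)

text \<open>
  The two partners act as one with velocity in \<open>\<real>\<^sup>2\<^sup>d\<close>, which meets
  the particle with the doubled velocity \<open>(v, v)\<close>. The relative velocity divided by its
  size lies on the ellipsoid over which the angular norm is a supremum.
\<close>

lemma ter_collision:
  assumes b: "ternary_kernel TYPE(real^'n::finite) \<gamma> b" and \<alpha>: "0 < \<alpha>" and \<beta>: "0 < \<beta>"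
  shows "collision \<alpha> \<beta> \<gamma> (enn2real (b3_norm TYPE(real^'n) b)) (\<lambda>v :: real^'n. (v, v)) unorm (ter_ang b) 3 (\<lambda>i. free_flight (ter_state post i))"
proof (rule collision.intro)
  show "- real DIM((real^'n) \<times> (real^'n)) + 1 < \<gamma>" "\<gamma> \<le> 1" using b by (simp_all add: ternary_kernel_def)
  show "linear (\<lambda>v :: real^'n. (v, v))" by (rule linearI) auto
  show "norm (v, v) \<le> 2 * norm v" for v :: "real^'n"
  proof (rule power2_le_imp_le)
    show "(norm (v, v))\<^sup>2 \<le> (2 * norm v)\<^sup>2" by (simp add: norm_Pair power_mult_distrib)
  qed simp
  have "(\<lambda>p :: ((real^'n) \<times> (real^'n)) \<times> ((real^'n) \<times> (real^'n)). ((fst p /\<^sub>R unorm (fst p)) \<bullet> snd p, fst (snd p) \<bullet> snd (snd p))) \<in> borel_measurable borel"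
  proof (rule borel_measurable_Pair)
    have "(\<lambda>p :: ((real^'n) \<times> (real^'n)) \<times> ((real^'n) \<times> (real^'n)). unorm (fst p)) \<in> borel_measurable borel"
      by (rule measurable_compose[OF fst_borel_measurable unorm_measurable])
    then show "(\<lambda>p :: ((real^'n) \<times> (real^'n)) \<times> ((real^'n) \<times> (real^'n)). (fst p /\<^sub>R unorm (fst p)) \<bullet> snd p) \<in> borel_measurable borel"
      by (intro borel_measurable_inner borel_measurable_scaleR borel_measurable_inverse fst_borel_measurable snd_borel_measurable)
    show "(\<lambda>p :: ((real^'n) \<times> (real^'n)) \<times> ((real^'n) \<times> (real^'n)). fst (snd p) \<bullet> snd (snd p)) \<in> borel_measurable borel"
      by (intro borel_measurable_continuous_onI continuous_intros)
  qed
  from measurable_compose[OF this b3_clip_measurable(1)[OF b]]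
  show "ter_ang b \<in> borel_measurable (borel :: (((real^'n) \<times> (real^'n)) \<times> ((real^'n) \<times> (real^'n))) measure)"
    unfolding ter_ang_def Let_def .
  show "0 \<le> ter_ang b p" for p :: "((real^'n) \<times> (real^'n)) \<times> ((real^'n) \<times> (real^'n))"
    unfolding ter_ang_def Let_def by (rule b3_clip_measurable(2)[OF b])
  show "(\<integral>\<^sup>+ \<omega>. ennreal (ter_ang b (u, \<omega>)) \<partial>sphere_measure) \<le> ennreal (enn2real (b3_norm TYPE(real^'n) b))"
    if "u \<noteq> 0" for u :: "(real^'n) \<times> (real^'n)"
  proof -
    have fin: "b3_norm TYPE(real^'n) b < \<infinity>" using b by (simp add: ternary_kernel_def)
    have "0 < norm u" using that by simp
    then have u: "0 < unorm u" using unorm_bounds(1)[of u] by linarith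
    let ?\<nu> = "u /\<^sub>R unorm u"
    have sc: "(norm (x /\<^sub>R unorm u))\<^sup>2 = (norm x)\<^sup>2 / (unorm u)\<^sup>2" for x :: "real^'n"
      using u by (simp add: power_mult_distrib divide_inverse power_inverse mult.commute)
    have parts: "fst ?\<nu> = fst u /\<^sub>R unorm u" "snd ?\<nu> = snd u /\<^sub>R unorm u"
      by simp_all
    have "fst ?\<nu> - snd ?\<nu> = (fst u - snd u) /\<^sub>R unorm u"
      unfolding parts by (rule scaleR_diff_right[symmetric])
    then have "(norm (fst ?\<nu>))\<^sup>2 + (norm (snd ?\<nu>))\<^sup>2 + (norm (fst ?\<nu> - snd ?\<nu>))\<^sup>2 =
        ((norm (fst u))\<^sup>2 + (norm (snd u))\<^sup>2 + (norm (fst u - snd u))\<^sup>2) / (unorm u)\<^sup>2"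
      by (simp only: parts sc add_divide_distrib)
    also have "\<dots> = 1" unfolding unorm_bounds(3)[of u, symmetric] using u by simp
    finally have e: "(norm (fst ?\<nu>))\<^sup>2 + (norm (snd ?\<nu>))\<^sup>2 + (norm (fst ?\<nu> - snd ?\<nu>))\<^sup>2 = 1" .
    have \<nu>: "?\<nu> \<in> ellipsoid"
      unfolding ellipsoid_def mem_Collect_eq split_beta by (rule e)
    have "(\<integral>\<^sup>+ \<omega>. ennreal (ter_ang b (u, \<omega>)) \<partial>sphere_measure) = (\<integral>\<^sup>+ \<omega>. ennreal (b (?\<nu> \<bullet> \<omega>, fst \<omega> \<bullet> snd \<omega>)) \<partial>sphere_measure)"
    proof (rule nn_integral_cong_AE)
      show "AE \<omega> in sphere_measure. ennreal (ter_ang b (u, \<omega>)) = ennreal (b (?\<nu> \<bullet> \<omega>, fst \<omega> \<bullet> snd \<omega>))"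
        using AE_sphere_measure_norm
      proof eventually_elim
        case (elim \<omega>)
        then show ?case using ter_angle_range[OF elim, of u] by (simp add: ter_ang_def Let_def del: mem_Sigma_iff)
      qed
    qed
    also have "\<dots> \<le> b3_norm TYPE(real^'n) b"
      unfolding b3_norm_def by (rule SUP_upper[OF \<nu>])
    finally show ?thesis using fin by simp
  qed
  show "free_flight (ter_state post i) \<in> borel_measurable borel" for i
    by (rule free_flight_measurable[OF ter_state_measurable])
  show "(\<Prod>i<3. maxwellian \<alpha> \<beta> (free_flight (ter_state post i) ((t, x, v), (\<omega>, w)))) =
     maxwellian \<alpha> \<beta> (x, v) * exp (- \<alpha> * (norm ((x, x) + t *\<^sub>R ((v, v) - w)))\<^sup>2 - \<beta> * (norm w)\<^sup>2)"
    if "norm \<omega> = 1" for t and x v :: "real^'n" and \<omega> w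
    by (rule ter_state_conserve[OF that])
  show "AE z in lborel. AE p in angular_space. norm (fst p) = 1 \<longrightarrow> P (free_flight (ter_state post i) ((t, z), p))"
    if i: "i < 3" and P: "AE z in lborel. P z" for i t and P :: "(real^'n) \<times> (real^'n) \<Rightarrow> bool"
  proof (rule free_flight_null[where r="\<lambda>v p. (ter_state post ((i + 1) mod 3) v p, ter_state post ((i + 2) mod 3) v p)", OF ter_state_linear bounded_linear_Pair[OF ter_state_linear ter_state_linear] _ ter_state_measurable P])
    fix v and p :: "((real^'n) \<times> (real^'n)) \<times> ((real^'n) \<times> (real^'n))"
    assume p: "norm (fst p) = 1" and z: "ter_state post i v p = 0" "(ter_state post ((i + 1) mod 3) v p, ter_state post ((i + 2) mod 3) v p) = 0"
    from i have "i = 0 \<or> i = 1 \<or> i = 2" by auto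
    with z have "ter_state post 0 v p = 0" "ter_state post (Suc 0) v p = 0" "ter_state post 2 v p = 0"
      by (auto simp: zero_prod_def simp flip: numeral_2_eq_2)
    with ter_energy[OF p, of post v] have "(norm v)\<^sup>2 + (norm (fst (snd p)))\<^sup>2 + (norm (snd (snd p)))\<^sup>2 = 0" by simp
    then have "v = 0" "fst (snd p) = 0" "snd (snd p) = 0" by (simp_all add: add_nonneg_eq_0_iff)
    then show "v = 0 \<and> snd p = 0" by (simp add: prod_eq_iff)
  qed
qed (use \<alpha> \<beta> unorm_bounds in auto)

section \<open>Gain and loss operators\<close>

lemma maxwellian_integrable:
  assumes "0 < \<alpha>" "0 < \<beta>"
  shows "integrable lborel (maxwellian \<alpha> \<beta> :: ('a::euclidean_space \<times> 'a) \<Rightarrow> real)"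
proof (rule integrableI_bounded)
  have m: "(maxwellian \<alpha> \<beta> :: ('a \<times> 'a) \<Rightarrow> real) \<in> borel_measurable borel"
    unfolding maxwellian_def split_beta' by (intro borel_measurable_continuous_onI continuous_intros)
  then show "(maxwellian \<alpha> \<beta> :: ('a \<times> 'a) \<Rightarrow> real) \<in> borel_measurable lborel" by simp
  have "(\<lambda>z. ennreal (maxwellian \<alpha> \<beta> z)) \<in> borel_measurable ((lborel :: 'a measure) \<Otimes>\<^sub>M (lborel :: 'a measure))"
    unfolding lborel_prod using m by simp
  from lborel.nn_integral_fst[OF this]
  have "(\<integral>\<^sup>+ z. ennreal (maxwellian \<alpha> \<beta> z) \<partial>(lborel :: ('a \<times> 'a) measure)) = (\<integral>\<^sup>+ x. \<integral>\<^sup>+ v. ennreal (maxwellian \<alpha> \<beta> (x :: 'a, v :: 'a)) \<partial>lborel \<partial>lborel)"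
    unfolding lborel_prod by simp
  also have "\<dots> = (\<integral>\<^sup>+ x. \<integral>\<^sup>+ v. ennreal (exp (- \<alpha> * (norm (x :: 'a))\<^sup>2)) * ennreal (exp (- \<beta> * (norm (v :: 'a))\<^sup>2)) \<partial>lborel \<partial>lborel)"
    by (intro nn_integral_cong) (simp add: maxwellian_def ennreal_mult'[symmetric] exp_add[symmetric])
  also have "\<dots> = (\<integral>\<^sup>+ x. ennreal (exp (- \<alpha> * (norm (x :: 'a))\<^sup>2)) * (\<integral>\<^sup>+ v. ennreal (exp (- \<beta> * (norm (v :: 'a))\<^sup>2)) \<partial>lborel) \<partial>lborel)"
    by (intro nn_integral_cong nn_integral_cmult) measurable
  also have "\<dots> = (\<integral>\<^sup>+ x. ennreal (exp (- \<alpha> * (norm (x :: 'a))\<^sup>2)) \<partial>lborel) * (\<integral>\<^sup>+ v. ennreal (exp (- \<beta> * (norm (v :: 'a))\<^sup>2)) \<partial>lborel)"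
    by (rule nn_integral_multc) measurable
  also have "\<dots> < \<infinity>"
    unfolding nn_integral_gaussian[OF assms(1)] nn_integral_gaussian[OF assms(2)] by (simp add: ennreal_mult_less_top)
  finally show "(\<integral>\<^sup>+ z. ennreal (norm (maxwellian \<alpha> \<beta> (z :: 'a \<times> 'a))) \<partial>lborel) < \<infinity>"
    by (simp add: maxwellian_def split_beta')
qed

lemma transport_flight: "transport f t (free_flight s ((t, x, v), p)) = f t (x + t *\<^sub>R v, s v p)"
  by (simp add: transport_def free_flight_def scaleR_diff_right)

text \<open>
  The type argument \<open>ty\<close> only fixes the index type of the velocity space.
\<close>

locale boltzmann =
  fixes ty :: "'n::finite itself" and \<gamma>2 :: real and b2 :: "real \<Rightarrow> real" and \<gamma>3 :: real
    and b3 :: "real \<times> real \<Rightarrow> real" and \<alpha> \<beta> :: real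
  assumes dim: "CARD('n) \<ge> 2" and b2: "binary_kernel TYPE(real^'n) \<gamma>2 b2"
    and b3: "ternary_kernel TYPE(real^'n) \<gamma>3 b3" and \<alpha>: "0 < \<alpha>" and \<beta>: "0 < \<beta>"
begin

sublocale g2: collision \<alpha> \<beta> \<gamma>2 "enn2real (b2_norm TYPE(real^'n) b2)" "\<lambda>v :: real^'n. v" norm "bin_ang b2" 2 "\<lambda>i. free_flight (bin_state True i)"
  by (rule bin_collision[OF b2 dim \<alpha> \<beta>])
sublocale l2: collision \<alpha> \<beta> \<gamma>2 "enn2real (b2_norm TYPE(real^'n) b2)" "\<lambda>v :: real^'n. v" norm "bin_ang b2" 2 "\<lambda>i. free_flight (bin_state False i)"
  by (rule bin_collision[OF b2 dim \<alpha> \<beta>])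
sublocale g3: collision \<alpha> \<beta> \<gamma>3 "enn2real (b3_norm TYPE(real^'n) b3)" "\<lambda>v :: real^'n. (v, v)" unorm "ter_ang b3" 3 "\<lambda>i. free_flight (ter_state True i)"
  by (rule ter_collision[OF b3 \<alpha> \<beta>])
sublocale l3: collision \<alpha> \<beta> \<gamma>3 "enn2real (b3_norm TYPE(real^'n) b3)" "\<lambda>v :: real^'n. (v, v)" unorm "ter_ang b3" 3 "\<lambda>i. free_flight (ter_state False i)"
  by (rule ter_collision[OF b3 \<alpha> \<beta>])

abbreviation "Mx \<equiv> (maxwellian \<alpha> \<beta> :: (real^'n) \<times> (real^'n) \<Rightarrow> real)"

definition gainF :: "(real \<times> (real^'n) \<times> (real^'n) \<Rightarrow> real) \<Rightarrow> real \<times> (real^'n) \<times> (real^'n) \<Rightarrow> real" where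
  "gainF F y = g2.coll F y + g3.coll F y"

definition lossF :: "(real \<times> (real^'n) \<times> (real^'n) \<Rightarrow> real) \<Rightarrow> real \<times> (real^'n) \<times> (real^'n) \<Rightarrow> real" where
  "lossF F y = l2.coll F y + l3.coll F y"

lemma B2_kern:
  assumes "norm \<omega> = 1"
  shows "B2 \<gamma>2 b2 (w - v) \<omega> = g2.kern ((t, x, v), (\<omega>, w))"
  using bin_angle_range[OF assms, of "w - v"] assms
  by (simp add: B2_def g2.kern_def bin_ang_def Let_def del: atLeastAtMost_iff)

lemma B3_kern:
  assumes "norm (\<omega>1, \<omega>2) = 1"
  shows "B3 \<gamma>3 b3 (v1 - v, v2 - v) (\<omega>1, \<omega>2) = g3.kern ((t, x, v), ((\<omega>1, \<omega>2), (v1, v2)))"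
proof -
  let ?u = "(v1 - v, v2 - v)"
  have n: "indicator {1} (norm (\<omega>1, \<omega>2)) = (1 :: real)" using assms by simp
  have i: "indicator ({-1..1} \<times> {-1/2..1/2}) ((?u /\<^sub>R unorm ?u) \<bullet> (\<omega>1, \<omega>2), \<omega>1 \<bullet> \<omega>2) = (1 :: real)"
    using ter_angle_range[OF assms, of ?u] unfolding fst_conv snd_conv by (rule indicator_simps(1))
  show ?thesis
    unfolding B3_def g3.kern_def prod.case ter_ang_def Let_def diff_Pair fst_conv snd_conv n i mult_1_left ..
qed

lemma e2ennreal_product2: "e2ennreal (ereal a * ereal b * ereal c) = ennreal (a * (b * c))"
  by (simp add: mult.assoc)

lemma e2ennreal_product3: "e2ennreal (ereal a * ereal b * ereal c * ereal d) = ennreal (a * (b * c * d))"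
  by (simp add: mult.assoc)

text \<open>
  The operators with values in the extended reals are integrals of \<open>f t\<close> at the
  physical collision points, and \<open>F\<close> is evaluated at their labels in the free flow;
  agreement at almost all of these points is enough.
\<close>

lemma collision_operators_at:
  fixes f :: "real \<Rightarrow> (real^'n) phase_fun"
  assumes F: "F \<in> weighted_ball R Mx" and R: "0 \<le> R"
    and p2: "\<And>post. AE p in angular_space. norm (fst p) = 1 \<longrightarrow>
       (\<forall>i<2. transport f t (free_flight (bin_state post i) ((t, x, v), p)) = ereal (F (t, free_flight (bin_state post i) ((t, x, v), p))))"
    and p3: "\<And>post. AE p in angular_space. norm (fst p) = 1 \<longrightarrow>
       (\<forall>i<3. transport f t (free_flight (ter_state post i) ((t, x, v), p)) = ereal (F (t, free_flight (ter_state post i) ((t, x, v), p))))"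
  shows "gain_sharp \<gamma>2 b2 \<gamma>3 b3 f t (x, v) = ereal (gainF F (t, x, v))"
    and "loss_sharp \<gamma>2 b2 \<gamma>3 b3 f t (x, v) = ereal (lossF F (t, x, v))"
proof -
  let ?X = "x + t *\<^sub>R v"
  let ?h = "\<lambda>w. f t (?X, w)"
  have G2: "G2 \<gamma>2 b2 ?h ?h v = ereal (g2.coll F (t, x, v))"
  proof -
    have I: "(\<integral>\<^sup>+ p. (case p of (\<omega>, v1) \<Rightarrow> let u = v1 - v; v' = v + (\<omega> \<bullet> u) *\<^sub>R \<omega>; v1' = v1 - (\<omega> \<bullet> u) *\<^sub>R \<omega>
        in e2ennreal (ereal (B2 \<gamma>2 b2 u \<omega>) * ?h v' * ?h v1')) \<partial>angular_space) = ennreal (g2.coll F (t, x, v))"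
    proof (rule g2.coll_nn_integral[OF F R])
      show "AE p in angular_space. (case p of (\<omega>, v1) \<Rightarrow> let u = v1 - v; v' = v + (\<omega> \<bullet> u) *\<^sub>R \<omega>; v1' = v1 - (\<omega> \<bullet> u) *\<^sub>R \<omega>
        in e2ennreal (ereal (B2 \<gamma>2 b2 u \<omega>) * ?h v' * ?h v1')) =
        ennreal (g2.kern ((t, x, v), p) * (\<Prod>i<2. F (fst (t, x, v), free_flight (bin_state True i) ((t, x, v), p))))"
        using p2[of True] AE_angular_space_unit
      proof eventually_elim
        case (elim p)
        obtain \<omega> w where p: "p = (\<omega>, w)" by (cases p)
        have n: "norm \<omega> = 1" using elim by (simp add: p)
        have "transport f t (free_flight (bin_state True i) ((t, x, v), p)) = ereal (F (t, free_flight (bin_state True i) ((t, x, v), p)))" if "i < 2" for i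
          using elim that by simp
        from this[of 0] this[of 1]
        have h: "?h (v + (\<omega> \<bullet> (w - v)) *\<^sub>R \<omega>) = ereal (F (t, free_flight (bin_state True 0) ((t, x, v), p)))"
          "?h (w - (\<omega> \<bullet> (w - v)) *\<^sub>R \<omega>) = ereal (F (t, free_flight (bin_state True 1) ((t, x, v), p)))"
          unfolding transport_flight by (simp_all add: bin_state_def p)
        show ?case
          unfolding p prod.case Let_def h[unfolded p] e2ennreal_product2 B2_kern[OF n, of w v t x] prod_less_2 fst_conv ..
      qed
    qed
    show ?thesis
      unfolding G2_def angular_space_def[symmetric] I using g2.coll_nonneg[OF F R] by simp
  qed
  have L2: "L2 \<gamma>2 b2 ?h ?h v = ereal (l2.coll F (t, x, v))"
  proof -
    have I: "(\<integral>\<^sup>+ p. (case p of (\<omega>, v1) \<Rightarrow> e2ennreal (ereal (B2 \<gamma>2 b2 (v1 - v) \<omega>) * ?h v * ?h v1)) \<partial>angular_space) = ennreal (l2.coll F (t, x, v))"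
    proof (rule l2.coll_nn_integral[OF F R])
      show "AE p in angular_space. (case p of (\<omega>, v1) \<Rightarrow> e2ennreal (ereal (B2 \<gamma>2 b2 (v1 - v) \<omega>) * ?h v * ?h v1)) =
        ennreal (g2.kern ((t, x, v), p) * (\<Prod>i<2. F (fst (t, x, v), free_flight (bin_state False i) ((t, x, v), p))))"
        using p2[of False] AE_angular_space_unit
      proof eventually_elim
        case (elim p)
        obtain \<omega> w where p: "p = (\<omega>, w)" by (cases p)
        have n: "norm \<omega> = 1" using elim by (simp add: p)
        have "transport f t (free_flight (bin_state False i) ((t, x, v), p)) = ereal (F (t, free_flight (bin_state False i) ((t, x, v), p)))" if "i < 2" for i
          using elim that by simp
        from this[of 0] this[of 1]
        have h: "?h v = ereal (F (t, free_flight (bin_state False 0) ((t, x, v), p)))"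
          "?h w = ereal (F (t, free_flight (bin_state False 1) ((t, x, v), p)))"
          unfolding transport_flight by (simp_all add: bin_state_def p)
        show ?case
          unfolding p prod.case h[unfolded p] e2ennreal_product2 B2_kern[OF n, of w v t x] prod_less_2 fst_conv ..
      qed
    qed
    show ?thesis
      unfolding L2_def angular_space_def[symmetric] I using l2.coll_nonneg[OF F R] by simp
  qed
  have G3: "G3 \<gamma>3 b3 ?h ?h ?h v = ereal (g3.coll F (t, x, v))"
  proof -
    have I: "(\<integral>\<^sup>+ ((\<omega>1, \<omega>2), (v1, v2)). (
        let c = (\<omega>1 \<bullet> (v1 - v) + \<omega>2 \<bullet> (v2 - v)) / (1 + \<omega>1 \<bullet> \<omega>2);
          vs = v + c *\<^sub>R (\<omega>1 + \<omega>2); v1s = v1 - c *\<^sub>R \<omega>1; v2s = v2 - c *\<^sub>R \<omega>2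
        in e2ennreal (ereal (B3 \<gamma>3 b3 (v1 - v, v2 - v) (\<omega>1, \<omega>2)) * ?h vs * ?h v1s * ?h v2s)) \<partial>angular_space) = ennreal (g3.coll F (t, x, v))"
    proof (rule g3.coll_nn_integral[OF F R])
      show "AE p in angular_space. (\<lambda>((\<omega>1, \<omega>2), (v1, v2)).
        let c = (\<omega>1 \<bullet> (v1 - v) + \<omega>2 \<bullet> (v2 - v)) / (1 + \<omega>1 \<bullet> \<omega>2);
          vs = v + c *\<^sub>R (\<omega>1 + \<omega>2); v1s = v1 - c *\<^sub>R \<omega>1; v2s = v2 - c *\<^sub>R \<omega>2
        in e2ennreal (ereal (B3 \<gamma>3 b3 (v1 - v, v2 - v) (\<omega>1, \<omega>2)) * ?h vs * ?h v1s * ?h v2s)) p =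
        ennreal (g3.kern ((t, x, v), p) * (\<Prod>i<3. F (fst (t, x, v), free_flight (ter_state True i) ((t, x, v), p))))"
        using p3[of True] AE_angular_space_unit
      proof eventually_elim
        case (elim p)
        obtain \<omega>1 \<omega>2 v1 v2 where p: "p = ((\<omega>1, \<omega>2), (v1, v2))" by (metis prod.exhaust)
        have n: "norm (\<omega>1, \<omega>2) = 1" using elim by (simp add: p)
        let ?c = "(\<omega>1 \<bullet> (v1 - v) + \<omega>2 \<bullet> (v2 - v)) / (1 + \<omega>1 \<bullet> \<omega>2)"
        have "transport f t (free_flight (ter_state True i) ((t, x, v), p)) = ereal (F (t, free_flight (ter_state True i) ((t, x, v), p)))" if "i < 3" for i
          using elim that by simp
        from this[of 0] this[of 1] this[of 2]
        have h: "?h (v + ?c *\<^sub>R (\<omega>1 + \<omega>2)) = ereal (F (t, free_flight (ter_state True 0) ((t, x, v), p)))"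
          "?h (v1 - ?c *\<^sub>R \<omega>1) = ereal (F (t, free_flight (ter_state True 1) ((t, x, v), p)))"
          "?h (v2 - ?c *\<^sub>R \<omega>2) = ereal (F (t, free_flight (ter_state True 2) ((t, x, v), p)))"
          unfolding transport_flight by (simp_all add: ter_state_def p Let_def)
        show ?case
          unfolding p prod.case Let_def h[unfolded p] e2ennreal_product3 B3_kern[OF n, of v1 v v2 t x] prod_less_3 fst_conv ..
      qed
    qed
    show ?thesis
      unfolding G3_def angular_space_def[symmetric] I using g3.coll_nonneg[OF F R] by simp
  qed
  have L3: "L3 \<gamma>3 b3 ?h ?h ?h v = ereal (l3.coll F (t, x, v))"
  proof -
    have I: "(\<integral>\<^sup>+ p. (case p of (\<omega>, (v1, v2)) \<Rightarrow> e2ennreal (ereal (B3 \<gamma>3 b3 (v1 - v, v2 - v) \<omega>) * ?h v * ?h v1 * ?h v2)) \<partial>angular_space) = ennreal (l3.coll F (t, x, v))"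
    proof (rule l3.coll_nn_integral[OF F R])
      show "AE p in angular_space. (case p of (\<omega>, (v1, v2)) \<Rightarrow> e2ennreal (ereal (B3 \<gamma>3 b3 (v1 - v, v2 - v) \<omega>) * ?h v * ?h v1 * ?h v2)) =
        ennreal (g3.kern ((t, x, v), p) * (\<Prod>i<3. F (fst (t, x, v), free_flight (ter_state False i) ((t, x, v), p))))"
        using p3[of False] AE_angular_space_unit
      proof eventually_elim
        case (elim p)
        obtain \<omega>1 \<omega>2 v1 v2 where p: "p = ((\<omega>1, \<omega>2), (v1, v2))" by (metis prod.exhaust)
        have n: "norm (\<omega>1, \<omega>2) = 1" using elim by (simp add: p)
        have "transport f t (free_flight (ter_state False i) ((t, x, v), p)) = ereal (F (t, free_flight (ter_state False i) ((t, x, v), p)))" if "i < 3" for i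
          using elim that by simp
        from this[of 0] this[of 1] this[of 2]
        have h: "?h v = ereal (F (t, free_flight (ter_state False 0) ((t, x, v), p)))"
          "?h v1 = ereal (F (t, free_flight (ter_state False 1) ((t, x, v), p)))"
          "?h v2 = ereal (F (t, free_flight (ter_state False 2) ((t, x, v), p)))"
          unfolding transport_flight by (simp_all add: ter_state_def p Let_def)
        show ?case
          unfolding p prod.case h[unfolded p] e2ennreal_product3 B3_kern[OF n, of v1 v v2 t x] prod_less_3 fst_conv ..
      qed
    qed
    show ?thesis
      unfolding L3_def angular_space_def[symmetric] I using l3.coll_nonneg[OF F R] by simp
  qed
  show "gain_sharp \<gamma>2 b2 \<gamma>3 b3 f t (x, v) = ereal (gainF F (t, x, v))"
    by (simp add: gain_sharp_def transport_def gain_def G2 G3 gainF_def)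
  show "loss_sharp \<gamma>2 b2 \<gamma>3 b3 f t (x, v) = ereal (lossF F (t, x, v))"
    by (simp add: loss_sharp_def transport_def loss_def L2 L3 lossF_def)
qed

lemma collision_operators_everywhere:
  assumes F: "F \<in> weighted_ball R Mx" and R: "0 \<le> R" and eq: "\<And>z. transport f t z = ereal (F (t, z))"
  shows "gain_sharp \<gamma>2 b2 \<gamma>3 b3 f t z = ereal (gainF F (t, z))" "loss_sharp \<gamma>2 b2 \<gamma>3 b3 f t z = ereal (lossF F (t, z))"
proof -
  obtain x v where z: "z = (x, v)" by (cases z)
  show "gain_sharp \<gamma>2 b2 \<gamma>3 b3 f t z = ereal (gainF F (t, z))" "loss_sharp \<gamma>2 b2 \<gamma>3 b3 f t z = ereal (lossF F (t, z))"
    unfolding z by (rule collision_operators_at[OF F R]; simp add: eq)+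
qed

lemma collision_operators_AE:
  assumes F: "F \<in> weighted_ball R Mx" and R: "0 \<le> R" and eq: "AE z in lborel. transport f t z = ereal (F (t, z))"
  shows "AE z in lborel. gain_sharp \<gamma>2 b2 \<gamma>3 b3 f t z = ereal (gainF F (t, z)) \<and> loss_sharp \<gamma>2 b2 \<gamma>3 b3 f t z = ereal (lossF F (t, z))"
  using g2.AE_collision_points[OF eq, of t] l2.AE_collision_points[OF eq, of t]
    g3.AE_collision_points[OF eq, of t] l3.AE_collision_points[OF eq, of t]
proof eventually_elim
  case (elim z)
  obtain x v where z: "z = (x, v)" by (cases z)
  show ?case
    unfolding z
  proof (intro conjI)
    have p2: "AE p in angular_space. norm (fst p) = 1 \<longrightarrow>
       (\<forall>i<2. transport f t (free_flight (bin_state post i) ((t, x, v), p)) = ereal (F (t, free_flight (bin_state post i) ((t, x, v), p))))" for post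
      using elim(1,2) by (cases post) (simp_all only: z)
    have p3: "AE p in angular_space. norm (fst p) = 1 \<longrightarrow>
       (\<forall>i<3. transport f t (free_flight (ter_state post i) ((t, x, v), p)) = ereal (F (t, free_flight (ter_state post i) ((t, x, v), p))))" for post
      using elim(3,4) by (cases post) (simp_all only: z)
    show "gain_sharp \<gamma>2 b2 \<gamma>3 b3 f t (x, v) = ereal (gainF F (t, x, v))"
      by (rule collision_operators_at(1)[OF F R p2 p3])
    show "loss_sharp \<gamma>2 b2 \<gamma>3 b3 f t (x, v) = ereal (lossF F (t, x, v))"
      by (rule collision_operators_at(2)[OF F R p2 p3])
  qed
qed

end

section \<open>Integration by parts against test functions\<close>

lemma compact_support_derivative:
  fixes \<phi> :: "real \<Rightarrow> real"
  assumes sm: "\<And>k t. (deriv ^^ k) \<phi> differentiable at t" and S: "compact S" and supp: "\<And>t. t \<notin> S \<Longrightarrow> \<phi> t = 0"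
  shows "(\<phi> has_real_derivative deriv \<phi> t) (at t)" "continuous_on A \<phi>" "continuous_on A (deriv \<phi>)"
    "t \<notin> S \<Longrightarrow> deriv \<phi> t = 0"
proof -
  show D: "(\<phi> has_real_derivative deriv \<phi> t) (at t)" for t
    using sm[of 0 t] by (simp add: DERIV_deriv_iff_real_differentiable)
  show "continuous_on A \<phi>" by (blast intro: continuous_at_imp_continuous_on DERIV_isCont D)
  have D': "(deriv \<phi> has_real_derivative deriv (deriv \<phi>) t) (at t)" for t
    using sm[of 1 t] by (simp add: DERIV_deriv_iff_real_differentiable)
  show "continuous_on A (deriv \<phi>)" by (blast intro: continuous_at_imp_continuous_on DERIV_isCont D')
  show "deriv \<phi> t = 0" if t: "t \<notin> S"
  proof -
    have "((\<lambda>t. 0) has_real_derivative 0) (at t)" by simp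
    moreover have "open (- S)" using S by (simp add: compact_imp_closed open_Compl)
    ultimately have "(\<phi> has_real_derivative 0) (at t)"
      by (rule has_field_derivative_transform_within_open) (use t supp in auto)
    then show ?thesis by (rule DERIV_imp_deriv)
  qed
qed

lemma compact_support_integrable:
  fixes f :: "real \<Rightarrow> real"
  assumes S: "compact S" and supp: "\<And>t. t \<notin> S \<Longrightarrow> f t = 0" and cont: "continuous_on S f"
  shows "integrable lborel f"
proof -
  have "(\<lambda>t. indicator S t *\<^sub>R f t) = f"
  proof (rule ext)
    show "indicator S t *\<^sub>R f t = f t" for t using supp[of t] by (cases "t \<in> S") auto
  qed
  then show ?thesis using borel_integrable_compact[OF S cont] by simp
qed

text \<open>
  Exchange the two time integrals; the integral of \<open>deriv \<phi>\<close> over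
  \<open>{s..}\<close> is \<open>- \<phi> s\<close>, and over the whole line it is 0, which removes
  the constant \<open>a\<close>.
\<close>

lemma integral_by_parts_primitive:
  fixes \<phi> \<theta> :: "real \<Rightarrow> real"
  assumes sm: "\<And>k t. (deriv ^^ k) \<phi> differentiable at t" and S: "compact S" "S \<subseteq> {0<..}" and supp: "\<And>t. t \<notin> S \<Longrightarrow> \<phi> t = 0"
    and \<theta>: "integrable lborel \<theta>"
  shows "(\<integral>t. deriv \<phi> t * (a + (\<integral>s. indicator {0..t} s * \<theta> s \<partial>lborel)) \<partial>lborel) = - (\<integral>s. \<phi> s * \<theta> s \<partial>lborel)"
proof -
  note C = compact_support_derivative[OF sm S(1) supp]
  obtain c where c: "0 < c" "S \<subseteq> {-c<..<c}"
  proof -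
    have "bounded S" using S(1) by (rule compact_imp_bounded)
    then obtain b where "\<forall>x\<in>S. \<bar>x\<bar> \<le> b" by (auto simp: bounded_iff)
    then show ?thesis by (intro that[of "\<bar>b\<bar> + 1"]) force+
  qed
  have [measurable]: "deriv \<phi> \<in> borel_measurable borel"
    using C(3) by (auto intro: borel_measurable_continuous_onI)
  have [measurable]: "\<theta> \<in> borel_measurable borel" using borel_measurable_integrable[OF \<theta>] by simp
  have c_out: "deriv \<phi> t = 0" if "t \<notin> {-c..c}" for t using C(4)[of t] c(2) that by force
  have \<phi>'_int: "integrable lborel (deriv \<phi>)" by (rule compact_support_integrable[OF S(1) C(4) C(3)])
  have tail: "(\<integral>t. deriv \<phi> t * indicator {s..} t \<partial>lborel) = - \<phi> s" for s
  proof (cases "s \<le> c")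
    case True
    have isC: "isCont (deriv \<phi>) t" for t
      by (rule continuous_on_interior[where S = UNIV]) (simp_all add: C(3))
    have "(\<integral>t. deriv \<phi> t * indicator {s..c} t \<partial>lborel) = \<phi> c - \<phi> s"
      by (rule integral_FTC_Icc_real[OF True]) (auto intro: C(1) isC)
    moreover have "deriv \<phi> t * indicator {s..} t = deriv \<phi> t * indicator {s..c} t" for t
      using C(4)[of t] c(2) by (cases "t \<in> S") (force simp: indicator_def)+
    moreover have "\<phi> c = 0" using supp[of c] c by force
    ultimately show ?thesis by (simp only: diff_0)
  next
    case False
    have "deriv \<phi> t * indicator {s..} t = 0" for t
      using C(4)[of t] c(2) False by (cases "t \<in> S") (force simp: indicator_def)+
    moreover have "\<phi> s = 0" using supp[of s] c False by force
    ultimately show ?thesis by (simp only: Bochner_Integration.integral_zero minus_zero)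
  qed
  have total: "(\<integral>t. deriv \<phi> t \<partial>lborel) = 0"
  proof -
    have "(\<integral>t. deriv \<phi> t * indicator {- c..} t \<partial>lborel) = - \<phi> (- c)" by (rule tail)
    moreover have "deriv \<phi> t * indicator {- c..} t = deriv \<phi> t" for t
      using c_out[of t] by (cases "t \<in> {-c..c}") auto
    moreover have "\<phi> (- c) = 0" using supp[of "- c"] c by force
    ultimately show ?thesis by simp
  qed
  let ?K = "\<lambda>p :: real \<times> real. deriv \<phi> (fst p) * (indicator {q. 0 \<le> snd q \<and> snd q \<le> fst q} p * \<theta> (snd p))"
  have Dm: "{q :: real \<times> real. 0 \<le> snd q \<and> snd q \<le> fst q} \<in> sets borel"
    by (intro borel_closed closed_Collect_conj closed_Collect_le continuous_intros)
  have Km: "?K \<in> borel_measurable (lborel \<Otimes>\<^sub>M lborel)"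
    unfolding lborel_prod using Dm by measurable
  have K_int: "integrable (lborel \<Otimes>\<^sub>M lborel) ?K"
  proof (rule Bochner_Integration.integrable_bound[OF _ Km])
    show "integrable (lborel \<Otimes>\<^sub>M lborel) (\<lambda>p :: real \<times> real. deriv \<phi> (fst p) * \<theta> (snd p))"
    proof (rule lborel_pair.Fubini_integrable)
      show "(\<lambda>p :: real \<times> real. deriv \<phi> (fst p) * \<theta> (snd p)) \<in> borel_measurable (lborel \<Otimes>\<^sub>M lborel)"
        unfolding lborel_prod by measurable
      show "integrable lborel (\<lambda>t. \<integral>s. norm (deriv \<phi> (fst (t, s)) * \<theta> (snd (t, s))) \<partial>lborel)"
        using \<phi>'_int by (simp add: abs_mult)
      show "AE t in lborel. integrable lborel (\<lambda>s. deriv \<phi> (fst (t, s)) * \<theta> (snd (t, s)))"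
        using \<theta> by simp
    qed
    show "AE p in lborel \<Otimes>\<^sub>M lborel. norm (?K p) \<le> norm (deriv \<phi> (fst p) * \<theta> (snd p))"
      by (intro AE_I2) (auto simp: indicator_def)
  qed
  have P_int: "integrable lborel (\<lambda>s. indicator {0..t} s * \<theta> s)" for t
    using integrable_mult_indicator[OF _ \<theta>, of "{0..t}"] by simp
  have "(\<integral>t. deriv \<phi> t * (a + (\<integral>s. indicator {0..t} s * \<theta> s \<partial>lborel)) \<partial>lborel) =
      (\<integral>t. a * deriv \<phi> t + (\<integral>s. ?K (t, s) \<partial>lborel) \<partial>lborel)"
  proof (intro Bochner_Integration.integral_cong refl)
    fix t
    have "(\<integral>s. ?K (t, s) \<partial>lborel) = (\<integral>s. deriv \<phi> t * (indicator {0..t} s * \<theta> s) \<partial>lborel)"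
      by (intro Bochner_Integration.integral_cong) (auto simp: indicator_def)
    also have "\<dots> = deriv \<phi> t * (\<integral>s. indicator {0..t} s * \<theta> s \<partial>lborel)" by (rule integral_mult_right_zero)
    finally show "deriv \<phi> t * (a + (\<integral>s. indicator {0..t} s * \<theta> s \<partial>lborel)) = a * deriv \<phi> t + (\<integral>s. ?K (t, s) \<partial>lborel)"
      by (simp add: algebra_simps)
  qed
  also have "\<dots> = a * (\<integral>t. deriv \<phi> t \<partial>lborel) + (\<integral>t. \<integral>s. ?K (t, s) \<partial>lborel \<partial>lborel)"
    using lborel_pair.integrable_fst'[OF K_int] \<phi>'_int by (subst Bochner_Integration.integral_add) auto
  also have "(\<integral>t. \<integral>s. ?K (t, s) \<partial>lborel \<partial>lborel) = (\<integral>s. \<integral>t. ?K (t, s) \<partial>lborel \<partial>lborel)"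
    by (rule lborel_pair.Fubini_integral[symmetric]) (use K_int in \<open>simp add: split_beta'\<close>)
  also have "\<dots> = (\<integral>s. - (\<phi> s * \<theta> s) \<partial>lborel)"
  proof (intro Bochner_Integration.integral_cong refl)
    fix s
    have "(\<integral>t. ?K (t, s) \<partial>lborel) = (\<integral>t. (indicator {0..} s * \<theta> s) * (deriv \<phi> t * indicator {s..} t) \<partial>lborel)"
      by (intro Bochner_Integration.integral_cong) (auto simp: indicator_def)
    also have "\<dots> = (indicator {0..} s * \<theta> s) * (\<integral>t. deriv \<phi> t * indicator {s..} t \<partial>lborel)" by (rule integral_mult_right_zero)
    also have "\<dots> = - (\<phi> s * \<theta> s)"
    proof (cases "0 \<le> s")
      case False
      then have "\<phi> s = 0" using supp[of s] S(2) by force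
      then show ?thesis using False by simp
    qed (simp add: tail)
    finally show "(\<integral>t. ?K (t, s) \<partial>lborel) = - (\<phi> s * \<theta> s)" .
  qed
  finally show "(\<integral>t. deriv \<phi> t * (a + (\<integral>s. indicator {0..t} s * \<theta> s \<partial>lborel)) \<partial>lborel) = - (\<integral>s. \<phi> s * \<theta> s \<partial>lborel)"
    by (simp add: total)
qed

section \<open>Contraction for small data\<close>

lemma nn_integral_le_four:
  assumes [measurable]: "a \<in> borel_measurable N" "b \<in> borel_measurable N" "c \<in> borel_measurable N" "d \<in> borel_measurable N"
    and e: "\<And>x. e x \<le> a x + b x + c x + d x"
    and le: "(\<integral>\<^sup>+ x. a x \<partial>N) \<le> ennreal A" "(\<integral>\<^sup>+ x. b x \<partial>N) \<le> ennreal B" "(\<integral>\<^sup>+ x. c x \<partial>N) \<le> ennreal C" "(\<integral>\<^sup>+ x. d x \<partial>N) \<le> ennreal D"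
    and nn: "0 \<le> A" "0 \<le> B" "0 \<le> C" "0 \<le> D"
  shows "(\<integral>\<^sup>+ x. e x \<partial>N) \<le> ennreal (A + B + C + D)"
proof -
  have "(\<integral>\<^sup>+ x. e x \<partial>N) \<le> (\<integral>\<^sup>+ x. a x + b x + c x + d x \<partial>N)" by (intro nn_integral_mono e)
  also have "\<dots> = (\<integral>\<^sup>+ x. a x \<partial>N) + (\<integral>\<^sup>+ x. b x \<partial>N) + (\<integral>\<^sup>+ x. c x \<partial>N) + (\<integral>\<^sup>+ x. d x \<partial>N)"
    by (simp add: nn_integral_add)
  also have "\<dots> \<le> ennreal A + ennreal B + ennreal C + ennreal D" by (intro add_mono le)
  finally show ?thesis using nn by (simp add: ennreal_plus[symmetric] del: ennreal_plus)
qed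

text \<open>
  With \<open>h = \<alpha> powr (-1/2)\<close> and \<open>a = 24 * K * h * (1 + e)\<close>,
  \<open>R\<close> is the smaller root of \<open>a / 2 * R\<^sup>2 - R + m0 = 0\<close>. The number
  \<open>e\<close> satisfies \<open>24 * K * h * e\<^sup>2 = 1\<close>, whence \<open>R \<le> 1 / a
  \<le> e\<close>. So the cubic terms \<open>\<kappa>3 * R ^ 3\<close> are at most \<open>\<kappa>3
  * e * R\<^sup>2\<close>, and both collision terms are controlled by the quadratic equation.
\<close>

lemma contraction_radius:
  fixes K \<alpha> \<kappa>2 \<kappa>3 m0 :: real
  defines "e \<equiv> \<alpha> powr (1/4) / (2 * sqrt (6 * K))"
  defines "R \<equiv> (1 - sqrt (1 - 48 * K * \<alpha> powr (-1/2) * (1 + e) * m0)) / (24 * K * \<alpha> powr (-1/2) * (1 + e))"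
  assumes K: "0 < K" and \<alpha>: "0 < \<alpha>" and \<kappa>: "0 \<le> \<kappa>2" "0 \<le> \<kappa>3" "\<kappa>2 + \<kappa>3 \<le> K * \<alpha> powr (-1/2)"
    and m0: "0 \<le> m0" "m0 < \<alpha> powr (1/2) / (48 * K * (1 + e))"
  shows "0 \<le> R" "m0 \<le> R" "2 * (R^2 * \<kappa>2 + R^3 * \<kappa>3) \<le> R - m0" "4 * R * \<kappa>2 + 6 * R^2 * \<kappa>3 \<le> 1/4"
proof -
  define h where "h = \<alpha> powr (-1/2)"
  define a where "a = 24 * K * h * (1 + e)"
  define s where "s = sqrt (1 - 2 * a * m0)"
  have h: "0 < h" "\<alpha> powr (1/2) = 1 / h" using \<alpha> by (simp_all add: h_def powr_minus_divide)
  have e: "0 < e" using \<alpha> K by (simp add: e_def)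
  have "e\<^sup>2 = (\<alpha> powr (1/4))\<^sup>2 / (24 * K)" using K by (simp add: e_def power_divide power_mult_distrib)
  also have "(\<alpha> powr (1/4))\<^sup>2 = 1 / h" using \<alpha> by (simp add: h(2)[symmetric] power2_eq_square powr_add[symmetric])
  finally have e2: "24 * K * h * e\<^sup>2 = 1" using K h by simp
  have a: "0 < a" using K h e by (simp add: a_def)
  have "a * e = 24 * K * h * e + 24 * K * h * e\<^sup>2" by (simp add: a_def algebra_simps power2_eq_square)
  then have ae: "1 \<le> a * e" using e2 K h e by simp
  have "48 * K * (1 + e) = 2 * a / h" using h by (simp add: a_def)
  then have "m0 < (1 / h) / (2 * a / h)" using m0(2) h(2) by simp
  then have m0a: "2 * a * m0 < 1" using h a by (simp add: field_simps)
  have s: "0 \<le> s" "s \<le> 1" "s\<^sup>2 = 1 - 2 * a * m0" using m0a m0(1) a by (simp_all add: s_def)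
  have R: "R = (1 - s) / a"
    unfolding R_def s_def a_def h_def by (simp only: mult.assoc) (simp add: mult_ac)
  show R0: "0 \<le> R" using s a by (simp add: R)
  have aR: "a * R = 1 - s" using a by (simp add: R)
  have "(a * R)\<^sup>2 = 2 * (a * R) - 2 * a * m0" unfolding aR using s(3) by (simp add: power2_eq_square algebra_simps)
  then have "a * (a * R\<^sup>2) = a * (2 * R - 2 * m0)" by (simp add: power2_eq_square algebra_simps)
  then have quad: "a / 2 * R\<^sup>2 = R - m0" using a by simp
  then show "m0 \<le> R" using a by (smt (verit) divide_nonneg_nonneg mult_nonneg_nonneg zero_le_power2)
  have "a * R \<le> a * e" using aR s ae by simp
  then have Re: "R \<le> e" using a by simp
  have "\<kappa>3 * R \<le> \<kappa>3 * e" by (rule mult_left_mono[OF Re \<kappa>(2)])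
  moreover have "\<kappa>2 * e \<ge> 0" using \<kappa> e by simp
  ultimately have "\<kappa>2 + \<kappa>3 * R \<le> (\<kappa>2 + \<kappa>3) * (1 + e)" using \<kappa> by (simp add: algebra_simps)
  also have "\<dots> \<le> K * h * (1 + e)" using \<kappa>(3) e by (intro mult_right_mono) (simp_all add: h_def)
  also have "\<dots> = a / 24" by (simp add: a_def)
  finally have main: "\<kappa>2 + \<kappa>3 * R \<le> a / 24" .
  have "2 * (R^2 * \<kappa>2 + R^3 * \<kappa>3) = 2 * R\<^sup>2 * (\<kappa>2 + \<kappa>3 * R)" by (simp add: power2_eq_square power3_eq_cube algebra_simps)
  also have "\<dots> \<le> 2 * R\<^sup>2 * (a / 24)" by (intro mult_left_mono main) simp
  also have "\<dots> \<le> a / 2 * R\<^sup>2" using a by simp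
  finally show "2 * (R^2 * \<kappa>2 + R^3 * \<kappa>3) \<le> R - m0" unfolding quad .
  have "4 * R * \<kappa>2 + 6 * R^2 * \<kappa>3 \<le> 6 * R * (\<kappa>2 + \<kappa>3 * R)"
    using mult_nonneg_nonneg[OF R0 \<kappa>(1)] by (simp add: power2_eq_square algebra_simps)
  also have "\<dots> \<le> 6 * R * (a / 24)" by (intro mult_left_mono main) (simp add: R0)
  also have "\<dots> = a * R / 4" by simp
  also have "\<dots> \<le> 1/4" using aR s by simp
  finally show "4 * R * \<kappa>2 + 6 * R^2 * \<kappa>3 \<le> 1/4" .
qed

context boltzmann
begin

text \<open>
  Gain and loss are estimated separately and enter with equal weight, whence the factors 2 in the
  estimates below.
\<close>

definition netF :: "(real \<times> (real^'n) \<times> (real^'n) \<Rightarrow> real) \<Rightarrow> real \<times> (real^'n) \<times> (real^'n) \<Rightarrow> real" where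
  "netF F y = gainF F y - lossF F y"

lemma gainF_lossF_measurable:
  assumes F: "F \<in> weighted_ball R Mx"
  shows "gainF F \<in> borel_measurable borel" "lossF F \<in> borel_measurable borel" "netF F \<in> borel_measurable borel"
proof -
  note [measurable] = g2.coll_measurable[OF F] g3.coll_measurable[OF F] l2.coll_measurable[OF F] l3.coll_measurable[OF F]
  show [measurable]: "gainF F \<in> borel_measurable borel" unfolding gainF_def[abs_def] by measurable
  show [measurable]: "lossF F \<in> borel_measurable borel" unfolding lossF_def[abs_def] by measurable
  show "netF F \<in> borel_measurable borel" unfolding netF_def[abs_def] by measurable
qed

lemma gainF_lossF_nonneg:
  assumes F: "F \<in> weighted_ball R Mx" and R: "0 \<le> R"
  shows "0 \<le> gainF F y" "0 \<le> lossF F y"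
  using g2.coll_nonneg[OF F R, of y] g3.coll_nonneg[OF F R, of y] l2.coll_nonneg[OF F R, of y] l3.coll_nonneg[OF F R, of y]
  by (simp_all add: gainF_def lossF_def)

lemma netF_time_bound:
  assumes F: "F \<in> weighted_ball R Mx" and R: "0 \<le> R"
  shows "(\<integral>\<^sup>+ t. ennreal \<bar>netF F (t, z)\<bar> \<partial>lborel) \<le> ennreal (2 * (R^2 * g2.\<kappa> + R^3 * g3.\<kappa>) * Mx z)"
proof -
  note [measurable] = g2.coll_measurable[OF F] g3.coll_measurable[OF F] l2.coll_measurable[OF F] l3.coll_measurable[OF F]
  have "(\<integral>\<^sup>+ t. ennreal \<bar>netF F (t, z)\<bar> \<partial>lborel) \<le>
      ennreal (R^2 * g2.\<kappa> * Mx z + R^3 * g3.\<kappa> * Mx z + R^2 * g2.\<kappa> * Mx z + R^3 * g3.\<kappa> * Mx z)"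
  proof (rule nn_integral_le_four[OF _ _ _ _ _ g2.coll_time_bound[OF F R] g3.coll_time_bound[OF F R] l2.coll_time_bound[OF F R] l3.coll_time_bound[OF F R]])
    show "ennreal \<bar>netF F (t, z)\<bar> \<le> ennreal (g2.coll F (t, z)) + ennreal (g3.coll F (t, z)) + ennreal (l2.coll F (t, z)) + ennreal (l3.coll F (t, z))" for t
      using g2.coll_nonneg[OF F R, of "(t, z)"] g3.coll_nonneg[OF F R, of "(t, z)"] l2.coll_nonneg[OF F R, of "(t, z)"] l3.coll_nonneg[OF F R, of "(t, z)"]
      by (simp add: netF_def gainF_def lossF_def ennreal_plus[symmetric] del: ennreal_plus)
  qed (use R g2.\<kappa>_nonneg g3.\<kappa>_nonneg g2.M_pos[of z] in \<open>simp_all add: less_imp_le\<close>)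
  then show ?thesis by (simp add: algebra_simps)
qed

lemma netF_time_Lipschitz:
  assumes F: "F \<in> weighted_ball R Mx" and G: "G \<in> weighted_ball R Mx" and R: "0 \<le> R" and N: "0 \<le> N"
    and d: "\<And>t z. \<bar>F (t, z) - G (t, z)\<bar> \<le> N * Mx z"
  shows "(\<integral>\<^sup>+ t. ennreal \<bar>netF F (t, z) - netF G (t, z)\<bar> \<partial>lborel) \<le> ennreal ((4 * R * g2.\<kappa> + 6 * R^2 * g3.\<kappa>) * N * Mx z)"
proof -
  note [measurable] = g2.coll_measurable[OF F] g3.coll_measurable[OF F] l2.coll_measurable[OF F] l3.coll_measurable[OF F]
    g2.coll_measurable[OF G] g3.coll_measurable[OF G] l2.coll_measurable[OF G] l3.coll_measurable[OF G]
  let ?A = "real 2 * R^(2-1) * N * g2.\<kappa> * Mx z" and ?B = "real 3 * R^(3-1) * N * g3.\<kappa> * Mx z"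
  have "(\<integral>\<^sup>+ t. ennreal \<bar>netF F (t, z) - netF G (t, z)\<bar> \<partial>lborel) \<le> ennreal (?A + ?B + ?A + ?B)"
  proof (rule nn_integral_le_four[OF _ _ _ _ _ g2.coll_time_Lipschitz[OF F G R N d] g3.coll_time_Lipschitz[OF F G R N d]
        l2.coll_time_Lipschitz[OF F G R N d] l3.coll_time_Lipschitz[OF F G R N d]])
    show "ennreal \<bar>netF F (t, z) - netF G (t, z)\<bar> \<le> ennreal \<bar>g2.coll F (t, z) - g2.coll G (t, z)\<bar> + ennreal \<bar>g3.coll F (t, z) - g3.coll G (t, z)\<bar>
        + ennreal \<bar>l2.coll F (t, z) - l2.coll G (t, z)\<bar> + ennreal \<bar>l3.coll F (t, z) - l3.coll G (t, z)\<bar>" for t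
      by (simp add: netF_def gainF_def lossF_def ennreal_plus[symmetric] del: ennreal_plus)
  qed (use R N g2.\<kappa>_nonneg g3.\<kappa>_nonneg g2.M_pos[of z] in \<open>simp_all add: less_imp_le\<close>)
  then show ?thesis by (simp add: algebra_simps)
qed

lemma collisionF_cong_AE:
  assumes F: "F \<in> weighted_ball R Mx" and G: "G \<in> weighted_ball R Mx" and eq: "AE z in lborel. F (t, z) = G (t, z)"
  shows "AE z in lborel. netF F (t, z) = netF G (t, z)"
  using g2.coll_cong_AE[OF F G eq] g3.coll_cong_AE[OF F G eq] l2.coll_cong_AE[OF F G eq] l3.coll_cong_AE[OF F G eq]
  by eventually_elim (simp add: netF_def gainF_def lossF_def)

lemma netF_quasi_positive:
  assumes F: "F \<in> weighted_ball R Mx" and R: "0 \<le> R" and z: "F (t, z) = 0"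
  shows "0 \<le> netF F (t, z)"
proof -
  obtain x v where zx: "z = (x, v)" by (cases z)
  have "l2.coll F (t, z) = 0" by (rule l2.coll_vanishes) (simp_all add: z[unfolded zx] zx free_flight_def bin_state_def)
  moreover have "l3.coll F (t, z) = 0" by (rule l3.coll_vanishes) (simp_all add: z[unfolded zx] zx free_flight_def ter_state_def split_beta' Let_def)
  ultimately show ?thesis using gainF_lossF_nonneg(1)[OF F R, of "(t, z)"] by (simp add: netF_def lossF_def)
qed

lemma evolution_net:
  assumes R: "0 \<le> R" and m: "m \<le> R" "2 * (R^2 * g2.\<kappa> + R^3 * g3.\<kappa>) \<le> R - m" and q: "4 * R * g2.\<kappa> + 6 * R^2 * g3.\<kappa> \<le> 1/4"
    and f0: "f0 \<in> borel_measurable borel" "\<And>z. 0 \<le> f0 z \<and> f0 z \<le> m * Mx z"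
  shows "evolution Mx R (1/4) m netF f0"
proof
  show "Mx \<in> borel_measurable borel" by (rule g2.M_measurable)
  show "0 < Mx z" for z by (rule g2.M_pos)
  show "netF F \<in> borel_measurable borel" if "F \<in> weighted_ball R Mx" for F by (rule gainF_lossF_measurable[OF that])
  show "(\<integral>\<^sup>+ t. ennreal \<bar>netF F (t, z)\<bar> \<partial>lborel) \<le> ennreal ((R - m) * Mx z)" if "F \<in> weighted_ball R Mx" for F z
    by (rule order_trans[OF netF_time_bound[OF that R]])
      (intro ennreal_leI mult_right_mono m(2) less_imp_le[OF g2.M_pos])
  show "(\<integral>\<^sup>+ t. ennreal \<bar>netF F (t, z) - netF G (t, z)\<bar> \<partial>lborel) \<le> ennreal (1 / 4 * N * Mx z)"
    if "F \<in> weighted_ball R Mx" "G \<in> weighted_ball R Mx" "0 \<le> N" "\<And>t z. \<bar>F (t, z) - G (t, z)\<bar> \<le> N * Mx z" for F G N z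
    by (rule order_trans[OF netF_time_Lipschitz[OF that(1,2) R that(3,4)]])
      (intro ennreal_leI mult_right_mono q that(3) less_imp_le[OF g2.M_pos])
  show "AE t in lborel. AE z in lborel. netF F (t, z) = netF G (t, z)"
    if "F \<in> weighted_ball R Mx" "G \<in> weighted_ball R Mx" "AE t in lborel. AE z in lborel. F (t, z) = G (t, z)" for F G
    using that(3) by eventually_elim (rule collisionF_cong_AE[OF that(1,2)])
  show "0 \<le> netF F (t, z)" if "F \<in> weighted_ball R Mx" "F (t, z) = 0" for F t z by (rule netF_quasi_positive[OF that(1) R that(2)])
qed (use m(1) f0 in simp_all)

lemma collisionF_pointwise:
  assumes F: "F \<in> weighted_ball R Mx" and R: "0 \<le> R"
  shows "\<exists>c\<ge>0. \<forall>t z. gainF F (t, z) \<le> c * maxwellian \<alpha> (\<beta> / 2) z \<and> lossF F (t, z) \<le> c * maxwellian \<alpha> (\<beta> / 2) z"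
proof (intro exI conjI allI)
  let ?c = "R^2 * g2.mass + R^3 * g3.mass + R^2 * l2.mass + R^3 * l3.mass"
  fix t :: real and z :: "(real^'n) \<times> (real^'n)"
  have p: "0 \<le> maxwellian \<alpha> (\<beta> / 2) z" by (simp add: maxwellian_def split_beta')
  have nn: "0 \<le> R^2 * g2.mass" "0 \<le> R^3 * g3.mass" "0 \<le> R^2 * l2.mass" "0 \<le> R^3 * l3.mass"
    using R g2.mass_nonneg g3.mass_nonneg l2.mass_nonneg l3.mass_nonneg by simp_all
  show "0 \<le> ?c" using nn by linarith
  have "gainF F (t, z) \<le> (R^2 * g2.mass + R^3 * g3.mass) * maxwellian \<alpha> (\<beta> / 2) z"
    using g2.coll_pointwise[OF F R, of t z] g3.coll_pointwise[OF F R, of t z] by (simp add: gainF_def distrib_right)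
  also have "\<dots> \<le> ?c * maxwellian \<alpha> (\<beta> / 2) z" using nn by (intro mult_right_mono p) linarith
  finally show "gainF F (t, z) \<le> ?c * maxwellian \<alpha> (\<beta> / 2) z" .
  have "lossF F (t, z) \<le> (R^2 * l2.mass + R^3 * l3.mass) * maxwellian \<alpha> (\<beta> / 2) z"
    using l2.coll_pointwise[OF F R, of t z] l3.coll_pointwise[OF F R, of t z] by (simp add: lossF_def distrib_right)
  also have "\<dots> \<le> ?c * maxwellian \<alpha> (\<beta> / 2) z" using nn by (intro mult_right_mono p) linarith
  finally show "lossF F (t, z) \<le> ?c * maxwellian \<alpha> (\<beta> / 2) z" .
qed

end

section \<open>Existence of a mild solution\<close>

lemma time_set_borel [measurable]: "time_set T \<in> sets borel"
  unfolding time_set_def by measurable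

text \<open>
  The form in which the integrals against test functions arise: an integrable function of time times
  a function dominated uniformly in time.
\<close>

lemma has_L1_integral_scaled:
  fixes H :: "real \<times> ('a::euclidean_space \<times> 'a) \<Rightarrow> real"
  assumes I: "I \<in> sets borel" and k: "integrable lborel k" "\<And>t. t \<notin> I \<Longrightarrow> k t = 0"
    and H [measurable]: "H \<in> borel_measurable borel" and w: "integrable lborel w" "\<And>t z. \<bar>H (t, z)\<bar> \<le> w z"
  shows "has_L1_integral I (\<lambda>t z. ereal (k t) * ereal (H (t, z))) (\<lambda>z. ereal (\<integral>t. k t * H (t, z) \<partial>lborel))"
proof -
  have [measurable]: "k \<in> borel_measurable borel" using borel_measurable_integrable[OF k(1)] by simp
  have [measurable]: "w \<in> borel_measurable borel" using borel_measurable_integrable[OF w(1)] by simp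
  have w0: "0 \<le> w z" for z using w(2)[of 0 z] by linarith
  have b: "\<bar>k t * H (t, z)\<bar> \<le> \<bar>k t\<bar> * w z" for t z by (simp add: abs_mult mult_left_mono w(2))
  have "has_L1_integral I (\<lambda>t z. ereal (k t) * ereal (H (t, z))) (\<lambda>z. ereal (\<integral>t. (\<lambda>p. k (fst p) * H p) (t, z) \<partial>lborel))"
  proof (rule has_L1_integral_joint[OF I])
    show "(\<lambda>p. k (fst p) * H p) \<in> borel_measurable borel" by measurable
    show "(\<lambda>p. k (fst p) * H p) (t, z) = 0" if "t \<notin> I" for t z using k(2)[OF that] by simp
    show "integrable lborel (\<lambda>z. (\<lambda>p. k (fst p) * H p) (t, z))" for t
      by (rule Bochner_Integration.integrable_bound[OF integrable_mult_right[OF w(1), of "\<bar>k t\<bar>"]])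
        (use b[of t] w0 in \<open>auto simp: abs_mult\<close>)
    show "integrable lborel (\<lambda>t. (\<lambda>p. k (fst p) * H p) (t, z))" for z
      by (rule Bochner_Integration.integrable_bound[OF integrable_mult_left[OF k(1), of "w z"]])
        (use b[of _ z] w0[of z] in \<open>auto simp: abs_mult\<close>)
    have "(\<integral>\<^sup>+ t. \<integral>\<^sup>+ z. ennreal \<bar>(\<lambda>p. k (fst p) * H p) (t, z)\<bar> \<partial>lborel \<partial>lborel) \<le>
        (\<integral>\<^sup>+ t. \<integral>\<^sup>+ z. ennreal \<bar>k t\<bar> * ennreal (w z) \<partial>lborel \<partial>lborel)"
      using b w0 by (intro nn_integral_mono) (simp add: ennreal_mult'[symmetric] ennreal_leI)
    also have "\<dots> = (\<integral>\<^sup>+ t. ennreal \<bar>k t\<bar> \<partial>lborel) * (\<integral>\<^sup>+ z. ennreal (w z) \<partial>lborel)"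
      by (simp add: nn_integral_cmult nn_integral_multc)
    also have "\<dots> < \<infinity>"
    proof -
      have "(\<integral>\<^sup>+ t. ennreal \<bar>k t\<bar> \<partial>lborel) < \<infinity>" using k(1) by (simp add: integrable_iff_bounded)
      moreover have "(\<integral>\<^sup>+ z. ennreal (w z) \<partial>lborel) < \<infinity>" using w(1) w0 by (simp add: integrable_iff_bounded)
      ultimately show ?thesis by (simp add: ennreal_mult_less_top)
    qed
    finally show "(\<integral>\<^sup>+ t. \<integral>\<^sup>+ z. ennreal \<bar>(\<lambda>p. k (fst p) * H p) (t, z)\<bar> \<partial>lborel \<partial>lborel) < \<infinity>" .
  qed simp
  then show ?thesis by simp
qed

lemma Linf_L1_pos_joint:
  fixes H :: "real \<times> ('a::euclidean_space \<times> 'a) \<Rightarrow> real"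
  assumes H [measurable]: "H \<in> borel_measurable borel" and w: "integrable lborel w" "\<And>t z. 0 \<le> H (t, z) \<and> H (t, z) \<le> w z"
    and h: "\<And>t z. h t z = ereal (H (t, z))"
  shows "h \<in> Linf_L1_pos T"
proof -
  have [measurable]: "w \<in> borel_measurable borel" using borel_measurable_integrable[OF w(1)] by simp
  have w0: "0 \<le> w z" for z using w(2)[of 0 z] by linarith
  have hH: "h t = (\<lambda>z. ereal (H (t, z)))" for t by (rule ext) (rule h)
  have int: "integrable lborel (\<lambda>z. H (t, z))" for t
    by (rule Bochner_Integration.integrable_bound[OF w(1)]) (use w(2)[of t] w0 in auto)
  have fin: "(\<integral>\<^sup>+ z. ennreal (w z) \<partial>lborel) < \<infinity>" using w(1) w0 by (simp add: integrable_iff_bounded)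
  have "L1_norm (h t) \<le> ennreal (enn2real (\<integral>\<^sup>+ z. ennreal (w z) \<partial>lborel))" for t
  proof -
    have "L1_norm (h t) \<le> (\<integral>\<^sup>+ z. ennreal (w z) \<partial>lborel)"
      unfolding hH L1_norm_ereal using w(2) by (intro nn_integral_mono ennreal_leI) auto
    also have "\<dots> = ennreal (enn2real (\<integral>\<^sup>+ z. ennreal (w z) \<partial>lborel))" using fin by simp
    finally show ?thesis .
  qed
  moreover have "h \<in> F_T_pos T"
    using w(2) by (auto simp: F_T_pos_def F_xv_pos_def F_xv_def hH)
  moreover have "L1_strongly_measurable (time_set T) h"
    by (rule L1_strongly_measurable_joint[OF time_set_borel H int h])
  ultimately show ?thesis unfolding Linf_L1_pos_def by blast
qed

locale small_data = boltzmann ty \<gamma>2 b2 \<gamma>3 b3 \<alpha> \<beta>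
  for ty :: "'n::finite itself" and \<gamma>2 b2 \<gamma>3 b3 \<alpha> \<beta> +
  fixes R m :: real and f0r :: "(real^'n) \<times> (real^'n) \<Rightarrow> real" and f0 :: "(real^'n) phase_fun"
  assumes R: "0 \<le> R" and mR: "m \<le> R" and self_map: "2 * (R^2 * g2.\<kappa> + R^3 * g3.\<kappa>) \<le> R - m"
    and contraction: "4 * R * g2.\<kappa> + 6 * R^2 * g3.\<kappa> \<le> 1/4"
    and f0r: "f0r \<in> borel_measurable borel" "\<And>z. 0 \<le> f0r z \<and> f0r z \<le> m * Mx z"
    and f0: "AE z in lborel. f0 z = ereal (f0r z)"
begin

sublocale evolution Mx R "1/4" m netF f0r
  by (rule evolution_net[OF R mR self_map contraction f0r])

definition sol :: "real \<times> (real^'n) \<times> (real^'n) \<Rightarrow> real" where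
  "sol = (SOME F. F \<in> weighted_ball R Mx \<and> (\<forall>t z. 0 \<le> t \<longrightarrow> F (t, z) = duhamel F (t, z)))"

lemma sol: "sol \<in> weighted_ball R Mx" "0 \<le> t \<Longrightarrow> sol (t, z) = duhamel sol (t, z)"
proof -
  have "\<exists>F. F \<in> weighted_ball R Mx \<and> (\<forall>t z. 0 \<le> t \<longrightarrow> F (t, z) = duhamel F (t, z))"
    by (rule solution_exists) blast
  from someI_ex[OF this, folded sol_def] show "sol \<in> weighted_ball R Mx" "0 \<le> t \<Longrightarrow> sol (t, z) = duhamel sol (t, z)" by blast+
qed

text \<open>
  The solution in the original coordinates, with the free flow undone.
\<close>

definition flow :: "real \<Rightarrow> (real^'n) phase_fun" where
  "flow t = (\<lambda>(x, v). ereal (sol (t, x - t *\<^sub>R v, v)))"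

lemma transport_flow: "transport flow t z = ereal (sol (t, z))"
  by (cases z) (simp add: transport_def flow_def)

lemma Mx_integrable: "integrable lborel Mx" by (rule maxwellian_integrable[OF \<alpha> \<beta>])

lemma RM_finite: "(\<integral>\<^sup>+ z. ennreal (R * Mx z) \<partial>lborel) < \<infinity>"
  using nn_integral_eq_integral[OF integrable_mult_right[OF Mx_integrable, of R]] R M_pos by (simp add: less_imp_le)

lemma sol_tendsto:
  assumes X: "X \<longlonglongrightarrow> t" "\<And>i :: nat. 0 \<le> X i"
  shows "(\<lambda>i. sol (X i, z)) \<longlonglongrightarrow> sol (t, z)"
proof -
  have "Bseq X" using X(1) by (intro convergent_imp_Bseq) (auto simp: convergent_def)
  then obtain b where "\<And>i. norm (X i) \<le> b" by (auto simp: Bseq_def)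
  then have b: "X i \<le> b" for i by (metis abs_le_D1 real_norm_def)
  have t: "0 \<le> t" "t \<le> b" using LIMSEQ_le_const[OF X(1), of 0] LIMSEQ_le_const2[OF X(1), of b] X(2) b by auto
  have "(\<lambda>i. duhamel sol (X i, z)) \<longlonglongrightarrow> duhamel sol (t, z)"
    by (rule continuous_on_tendsto_compose[OF duhamel_continuous[OF sol(1), of b] X(1)]) (use t X(2) b in auto)
  then show ?thesis using sol(2) X(2) t by simp
qed

text \<open>
  Continuity in time holds at every phase point, and the Maxwellian dominates.
\<close>

lemma flow_C0: "transport flow \<in> C0_L1_pos T"
proof -
  note [measurable] = ball_measurable[OF sol(1)]
  have tf: "transport flow t = (\<lambda>z. ereal (sol (t, z)))" for t by (rule ext) (rule transport_flow)
  have L1: "transport flow t \<in> L1_xv" for t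
    unfolding tf
  proof (rule L1_xv_real)
    have "(\<integral>\<^sup>+ z. ennreal \<bar>sol (t, z)\<bar> \<partial>lborel) \<le> (\<integral>\<^sup>+ z. ennreal (R * Mx z) \<partial>lborel)"
      using ball_bounds[OF sol(1)] by (intro nn_integral_mono ennreal_leI) simp
    also note RM_finite
    finally show "(\<integral>\<^sup>+ z. ennreal \<bar>sol (t, z)\<bar> \<partial>lborel) < \<infinity>" .
  qed measurable
  have cont: "((\<lambda>s. L1_norm (\<lambda>z. transport flow s z - transport flow t z)) \<longlongrightarrow> 0) (at t within time_set T)" for t
    unfolding tendsto_at_iff_sequentially
  proof (intro allI impI)
    fix X :: "nat \<Rightarrow> real" assume X: "\<forall>i. X i \<in> time_set T - {t}" "X \<longlonglongrightarrow> t"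
    have X0: "0 \<le> X i" for i using X(1) by (auto simp: time_set_def)
    have "(\<lambda>i. \<integral>\<^sup>+ z. ennreal \<bar>sol (X i, z) - sol (t, z)\<bar> \<partial>lborel) \<longlonglongrightarrow> (\<integral>\<^sup>+ z. 0 \<partial>(lborel :: ((real^'n) \<times> (real^'n)) measure))"
    proof (rule nn_integral_dominated_convergence[where w = "\<lambda>z. ennreal (R * Mx z)"])
      show "AE z in lborel. ennreal \<bar>sol (X i, z) - sol (t, z)\<bar> \<le> ennreal (R * Mx z)" for i
      proof (rule AE_I2)
        fix z
        show "ennreal \<bar>sol (X i, z) - sol (t, z)\<bar> \<le> ennreal (R * Mx z)"
          using ball_bounds[OF sol(1), of "X i" z] ball_bounds[OF sol(1), of t z] by (intro ennreal_leI) linarith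
      qed
      show "AE z in lborel. (\<lambda>i. ennreal \<bar>sol (X i, z) - sol (t, z)\<bar>) \<longlonglongrightarrow> 0"
      proof (rule AE_I2)
        fix z
        have "(\<lambda>i. \<bar>sol (X i, z) - sol (t, z)\<bar>) \<longlonglongrightarrow> \<bar>sol (t, z) - sol (t, z)\<bar>"
          by (intro tendsto_intros sol_tendsto X X0)
        from tendsto_ennrealI[OF this] show "(\<lambda>i. ennreal \<bar>sol (X i, z) - sol (t, z)\<bar>) \<longlonglongrightarrow> 0" by simp
      qed
    qed (use RM_finite in measurable)
    then show "((\<lambda>s. L1_norm (\<lambda>z. transport flow s z - transport flow t z)) \<circ> X) \<longlonglongrightarrow> 0"
      by (simp add: o_def transport_flow L1_norm_ereal)
  qed
  have "transport flow \<in> F_T_pos T"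
    using L1 ball_bounds(1)[OF sol(1)] by (auto simp: F_T_pos_def F_xv_pos_def L1_xv_def transport_flow)
  then show ?thesis using L1 cont by (simp add: C0_L1_pos_def)
qed

lemma flow_sup_norm: "sup_norm T \<alpha> \<beta> (transport flow) \<le> ereal R"
  unfolding sup_norm_def
proof (rule SUP_least)
  fix t
  note [measurable] = ball_measurable[OF sol(1)]
  have tf: "transport flow t = (\<lambda>z. ereal (sol (t, z)))" by (rule ext) (rule transport_flow)
  have e: "\<bar>transport flow t z / ereal (Mx z)\<bar> = ereal (sol (t, z) / Mx z)" for z
    using ball_bounds(1)[OF sol(1), of t z] M_pos[of z] by (simp add: transport_flow)
  show "M_norm \<alpha> \<beta> (transport flow t) \<le> ereal R"
    unfolding M_norm_def e
  proof (rule esssup_I)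
    show "(\<lambda>z. ereal (sol (t, z) / Mx z)) \<in> borel_measurable lborel" by measurable
    show "AE z in lborel. ereal (sol (t, z) / Mx z) \<le> ereal R"
      using ball_bounds(2)[OF sol(1), of t] M_pos by (intro AE_I2) (simp add: divide_le_eq)
  qed
qed

lemma flow_weak_derivative: "has_weak_time_derivative T (transport flow) (\<lambda>t z. ereal (netF sol (t, z)))"
  unfolding has_weak_time_derivative_def
proof (intro allI impI)
  fix \<phi> assume "test_function T \<phi>"
  then obtain S where sm: "\<And>k t. (deriv ^^ k) \<phi> differentiable at t" and S: "compact S" "S \<subseteq> {t. 0 < t \<and> ereal t < T}"
    and supp: "\<And>t. t \<notin> S \<Longrightarrow> \<phi> t = 0" by (auto simp: test_function_def)
  note D = compact_support_derivative[OF sm S(1) supp]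
  have S0: "S \<subseteq> {0<..}" and SI: "S \<subseteq> time_set T" using S(2) by (auto simp: time_set_def)
  obtain c where c: "0 \<le> c" "\<And>t z. gainF sol (t, z) \<le> c * maxwellian \<alpha> (\<beta> / 2) z" "\<And>t z. lossF sol (t, z) \<le> c * maxwellian \<alpha> (\<beta> / 2) z"
    using collisionF_pointwise[OF sol(1) R] by blast
  have net: "\<bar>netF sol (t, z)\<bar> \<le> c * maxwellian \<alpha> (\<beta> / 2) z" for t z
    using c(2,3)[of t z] gainF_lossF_nonneg[OF sol(1) R, of "(t, z)"] by (simp add: netF_def)
  note k = compact_support_integrable[OF S(1) D(4) D(3)] compact_support_integrable[OF S(1) supp D(2)]
  let ?J1 = "\<lambda>z. ereal (\<integral>t. deriv \<phi> t * sol (t, z) \<partial>lborel)" and ?J2 = "\<lambda>z. ereal (\<integral>t. \<phi> t * netF sol (t, z) \<partial>lborel)"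
  have "has_L1_integral (time_set T) (\<lambda>t z. ereal (deriv \<phi> t) * transport flow t z) ?J1"
    unfolding transport_flow
  proof (rule has_L1_integral_scaled[OF time_set_borel k(1) _ ball_measurable[OF sol(1)]])
    show "deriv \<phi> t = 0" if "t \<notin> time_set T" for t using D(4) SI that by blast
    show "integrable lborel (\<lambda>z. R * Mx z)" by (rule integrable_mult_right[OF Mx_integrable])
    show "\<bar>sol (t, z)\<bar> \<le> R * Mx z" for t z using ball_bounds[OF sol(1), of t z] by simp
  qed
  moreover have "has_L1_integral (time_set T) (\<lambda>t z. ereal (\<phi> t) * ereal (netF sol (t, z))) ?J2"
  proof (rule has_L1_integral_scaled[OF time_set_borel k(2) _ gainF_lossF_measurable(3)[OF sol(1)]])
    show "\<phi> t = 0" if "t \<notin> time_set T" for t using supp SI that by blast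
    show "integrable lborel (\<lambda>z. c * maxwellian \<alpha> (\<beta> / 2) z)" using \<alpha> \<beta> by (intro integrable_mult_right maxwellian_integrable) auto
    show "\<bar>netF sol (t, z)\<bar> \<le> c * maxwellian \<alpha> (\<beta> / 2) z" for t z by (rule net)
  qed
  moreover have "?J2 z = - ?J1 z" for z
  proof -
    have "(\<integral>t. deriv \<phi> t * sol (t, z) \<partial>lborel) =
        (\<integral>t. deriv \<phi> t * (f0r z + (\<integral>s. indicator {0..t} s * netF sol (s, z) \<partial>lborel)) \<partial>lborel)"
    proof (intro Bochner_Integration.integral_cong refl)
      fix t
      show "deriv \<phi> t * sol (t, z) = deriv \<phi> t * (f0r z + (\<integral>s. indicator {0..t} s * netF sol (s, z) \<partial>lborel))"
      proof (cases "0 \<le> t")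
        case True
        then show ?thesis by (simp add: sol(2)[OF True] duhamel_def)
      next
        case False
        then have "deriv \<phi> t = 0" using D(4)[of t] S0 by force
        then show ?thesis by simp
      qed
    qed
    also have "\<dots> = - (\<integral>s. \<phi> s * netF sol (s, z) \<partial>lborel)"
      by (rule integral_by_parts_primitive[OF sm S(1) S0 supp \<Theta>_integrable[OF sol(1)]])
    finally show ?thesis by simp
  qed
  ultimately show "\<exists>J1 J2. has_L1_integral (time_set T) (\<lambda>t z. ereal (deriv \<phi> t) * transport flow t z) J1 \<and>
      has_L1_integral (time_set T) (\<lambda>t z. ereal (\<phi> t) * ereal (netF sol (t, z))) J2 \<and> (AE z in lborel. J2 z = - J1 z)"
    by (intro exI[of _ ?J1] exI[of _ ?J2]) auto
qed

theorem flow_mild_solution: "mild_solution \<gamma>2 b2 \<gamma>3 b3 \<alpha> \<beta> T f0 flow"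
proof -
  note [measurable] = ball_measurable[OF sol(1)]
  have gain: "gain_sharp \<gamma>2 b2 \<gamma>3 b3 flow t z = ereal (gainF sol (t, z))"
    and loss: "loss_sharp \<gamma>2 b2 \<gamma>3 b3 flow t z = ereal (lossF sol (t, z))" for t z
    by (rule collision_operators_everywhere[OF sol(1) R transport_flow])+
  obtain c where c: "0 \<le> c" "\<And>t z. gainF sol (t, z) \<le> c * maxwellian \<alpha> (\<beta> / 2) z" "\<And>t z. lossF sol (t, z) \<le> c * maxwellian \<alpha> (\<beta> / 2) z"
    using collisionF_pointwise[OF sol(1) R] by blast
  have w: "integrable lborel (\<lambda>z :: (real^'n) \<times> (real^'n). c * maxwellian \<alpha> (\<beta> / 2) z)"
    using \<alpha> \<beta> by (intro integrable_mult_right maxwellian_integrable) auto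
  have "flow \<in> F_T_pos T"
  proof -
    have m: "flow t \<in> borel_measurable borel" for t
    proof -
      have "(\<lambda>z :: (real^'n) \<times> (real^'n). (t, fst z - t *\<^sub>R snd z, snd z)) \<in> borel_measurable borel"
        by (intro borel_measurable_continuous_onI continuous_intros)
      from measurable_compose[OF this ball_measurable[OF sol(1)]] show ?thesis
        unfolding flow_def split_beta' by measurable
    qed
    show ?thesis using m ball_bounds(1)[OF sol(1)] by (auto simp: F_T_pos_def F_xv_pos_def F_xv_def flow_def)
  qed
  moreover have "transport flow \<in> Linf_M_pos T \<alpha> \<beta>"
    using flow_C0[of T] flow_sup_norm[of T] by (auto simp: Linf_M_pos_def C0_L1_pos_def intro: le_less_trans)
  moreover have "loss_sharp \<gamma>2 b2 \<gamma>3 b3 flow \<in> Linf_L1_pos T"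
    by (rule Linf_L1_pos_joint[OF gainF_lossF_measurable(2)[OF sol(1)] w _ loss]) (use c gainF_lossF_nonneg[OF sol(1) R] in auto)
  moreover have "gain_sharp \<gamma>2 b2 \<gamma>3 b3 flow \<in> Linf_L1_pos T"
    by (rule Linf_L1_pos_joint[OF gainF_lossF_measurable(1)[OF sol(1)] w _ gain]) (use c gainF_lossF_nonneg[OF sol(1) R] in auto)
  moreover have "AE z in lborel. transport flow 0 z = f0 z"
    using f0 by eventually_elim (simp add: transport_flow sol(2) duhamel_zero[OF sol(1)])
  ultimately show ?thesis
    using flow_C0[of T] flow_weak_derivative[of T]
    by (auto simp: mild_solution_def gain loss netF_def intro!: exI[of _ "\<lambda>t z. ereal (netF sol (t, z))"])
qed

end

section \<open>Uniqueness, and the theorem\<close>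

lemma M_norm_AE_bound:
  assumes f: "AE z in lborel. 0 \<le> f z" and n: "M_norm \<alpha> \<beta> f \<le> ereal r"
  shows "AE z in lborel. 0 \<le> f z \<and> f z \<le> ereal (r * maxwellian \<alpha> \<beta> z)"
  using f esssup_AE[of "\<lambda>z. \<bar>f z / ereal (maxwellian \<alpha> \<beta> z)\<bar>" lborel]
proof eventually_elim
  case (elim z)
  have M: "0 < maxwellian \<alpha> \<beta> z" by (simp add: maxwellian_def split_beta')
  have le: "\<bar>f z / ereal (maxwellian \<alpha> \<beta> z)\<bar> \<le> ereal r" using elim(2) n unfolding M_norm_def by (rule order_trans)
  show ?case
  proof (cases "f z")
    case (real y)
    then have "y / maxwellian \<alpha> \<beta> z \<le> r" using le M elim(1) by auto
    then show ?thesis using real elim(1) M by (simp add: divide_le_eq)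
  qed (use le M elim(1) in auto)
qed

lemma M_norm_nonneg: "0 \<le> M_norm \<alpha> \<beta> (f :: 'a::euclidean_space phase_fun)"
proof -
  have "esssup (lborel :: ('a \<times> 'a) measure) (\<lambda>z. 0 :: ereal) \<le> M_norm \<alpha> \<beta> f"
    unfolding M_norm_def by (rule esssup_mono) auto
  moreover have "esssup (lborel :: ('a \<times> 'a) measure) (\<lambda>z. 0 :: ereal) = 0" by (rule esssup_const) simp
  ultimately show ?thesis by simp
qed

text \<open>
  Truncating at the Maxwellian bound changes \<open>f\<close> only on a null set.
\<close>

lemma real_representative:
  fixes f :: "'a::euclidean_space phase_fun"
  assumes f: "f \<in> M_space_pos \<alpha> \<beta>"
  defines "m \<equiv> real_of_ereal (M_norm \<alpha> \<beta> f)"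
  shows "M_norm \<alpha> \<beta> f = ereal m" "0 \<le> m"
    "\<exists>F \<in> borel_measurable borel. (\<forall>z. 0 \<le> F z \<and> F z \<le> m * maxwellian \<alpha> \<beta> z) \<and> (AE z in lborel. f z = ereal (F z))"
proof -
  have fin: "M_norm \<alpha> \<beta> f < \<infinity>" and fm [measurable]: "f \<in> borel_measurable borel" and f0: "AE z in lborel. 0 \<le> f z"
    using f by (auto simp: M_space_pos_def M_space_def F_xv_pos_def F_xv_def)
  show n: "M_norm \<alpha> \<beta> f = ereal m" using fin M_norm_nonneg[of \<alpha> \<beta> f] unfolding m_def by (cases "M_norm \<alpha> \<beta> f") auto
  show m: "0 \<le> m" using M_norm_nonneg[of \<alpha> \<beta> f] by (simp add: n)
  have [measurable]: "(maxwellian \<alpha> \<beta> :: 'a \<times> 'a \<Rightarrow> real) \<in> borel_measurable borel"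
    unfolding maxwellian_def split_beta' by (intro borel_measurable_continuous_onI continuous_intros)
  have M: "0 \<le> m * maxwellian \<alpha> \<beta> z" for z :: "'a \<times> 'a" using m by (simp add: maxwellian_def split_beta')
  let ?F = "\<lambda>z. max 0 (min (m * maxwellian \<alpha> \<beta> z) (real_of_ereal (f z)))"
  have "AE z in lborel. 0 \<le> f z \<and> f z \<le> ereal (m * maxwellian \<alpha> \<beta> z)"
    by (rule M_norm_AE_bound[OF f0]) (simp add: n)
  then have "AE z in lborel. f z = ereal (?F z)"
  proof eventually_elim
    case (elim z)
    then show ?case by (cases "f z") (auto simp: max_def min_def)
  qed
  moreover have "?F \<in> borel_measurable borel" by measurable
  ultimately show "\<exists>F \<in> borel_measurable borel. (\<forall>z. 0 \<le> F z \<and> F z \<le> m * maxwellian \<alpha> \<beta> z) \<and> (AE z in lborel. f z = ereal (F z))"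
    using M by (intro bexI[of _ ?F]) auto
qed

context small_data
begin

text \<open>
  In the free-flow coordinates \<open>g\<close> has a jointly measurable representative
  \<open>\<Gamma>\<close> in the weighted ball. The weak equation yields its integral form, so
  \<open>\<Gamma>\<close> satisfies the same fixed point equation as \<open>sol\<close>, at first
  almost everywhere in space at each time. The contraction gives \<open>\<Gamma> = sol\<close> at
  almost every time, and inserting this in the integral form extends the equality to every time.
\<close>

theorem mild_solution_unique:
  assumes g: "mild_solution \<gamma>2 b2 \<gamma>3 b3 \<alpha> \<beta> T f0 g" and gR: "sup_norm T \<alpha> \<beta> (transport g) \<le> ereal R"
    and b: "b \<in> time_set T"
  shows "AE z in lborel. g b z = flow b z"
proof -
  let ?I = "time_set T"
  have I: "?I \<subseteq> {0..}" "\<And>s t. t \<in> ?I \<Longrightarrow> 0 \<le> s \<Longrightarrow> s \<le> t \<Longrightarrow> s \<in> ?I"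
    by (auto simp: time_set_def intro: le_less_trans[of "ereal _" "ereal _"])
  have gC: "transport g \<in> C0_L1_pos T" using g by (simp add: mild_solution_def)
  have g_meas: "transport g t \<in> borel_measurable borel" and g_pos: "AE z in lborel. 0 \<le> transport g t z"
    and g_cont: "((\<lambda>s. L1_norm (\<lambda>z. transport g s z - transport g t z)) \<longlongrightarrow> 0) (at t within ?I)" if "t \<in> ?I" for t
    using gC that by (auto simp: C0_L1_pos_def F_T_pos_def F_xv_pos_def F_xv_def)
  have g_bound: "AE z in lborel. 0 \<le> transport g t z \<and> transport g t z \<le> ereal (R * Mx z)" if t: "t \<in> ?I" for t
  proof (rule M_norm_AE_bound[OF g_pos[OF t]])
    have "M_norm \<alpha> \<beta> (transport g t) \<le> sup_norm T \<alpha> \<beta> (transport g)" unfolding sup_norm_def by (rule SUP_upper[OF t])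
    also note gR
    finally show "M_norm \<alpha> \<beta> (transport g t) \<le> ereal R" .
  qed
  have "\<exists>\<Gamma>\<in>weighted_ball R Mx. AE t in lborel. t \<in> ?I \<longrightarrow> (AE z in lborel. transport g t z = ereal (\<Gamma> (t, z)))"
    by (rule joint_representation[OF time_set_borel I Mx_integrable M_pos R g_meas g_bound g_cont])
  then obtain \<Gamma>0 where \<Gamma>0: "\<Gamma>0 \<in> weighted_ball R Mx" and g\<Gamma>0: "AE t in lborel. t \<in> ?I \<longrightarrow> (AE z in lborel. transport g t z = ereal (\<Gamma>0 (t, z)))"
    by (elim bexE)
  \<comment> \<open>Outside the time interval the solution itself is taken, so that there is nothing to compare there.\<close>
  define \<Gamma> where "\<Gamma> = (\<lambda>p. if fst p \<in> ?I then \<Gamma>0 p else sol p)"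
  have \<Gamma>: "\<Gamma> \<in> weighted_ball R Mx"
  proof -
    note [measurable] = ball_measurable[OF \<Gamma>0] ball_measurable[OF sol(1)]
    have "\<Gamma> \<in> borel_measurable borel" unfolding \<Gamma>_def by measurable
    then show ?thesis using ball_bounds[OF \<Gamma>0] ball_bounds[OF sol(1)] by (auto simp: weighted_ball_def \<Gamma>_def)
  qed
  note [measurable] = ball_measurable[OF \<Gamma>] ball_measurable[OF sol(1)] \<Theta>_measurable[OF \<Gamma>] \<Theta>_measurable[OF sol(1)]
  have g\<Gamma>: "AE t in lborel. t \<in> ?I \<longrightarrow> (AE z in lborel. transport g t z = ereal (\<Gamma> (t, z)))"
    using g\<Gamma>0 by eventually_elim (simp add: \<Gamma>_def)
  obtain h where weak: "has_weak_time_derivative T (transport g) h"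
    and eqn: "AE t in lborel. t \<in> ?I \<longrightarrow> (AE z in lborel. h t z + loss_sharp \<gamma>2 b2 \<gamma>3 b3 g t z = gain_sharp \<gamma>2 b2 \<gamma>3 b3 g t z)"
    using g unfolding mild_solution_def by blast
  have init: "AE z in lborel. transport g 0 z = f0 z" using g by (simp add: mild_solution_def)
  let ?H = "\<lambda>p. indicator ?I (fst p) * netF \<Gamma> p"
  have hH: "AE t in lborel. t \<in> ?I \<longrightarrow> (AE z in lborel. h t z = ereal (?H (t, z)))"
    using g\<Gamma> eqn
  proof eventually_elim
    case (elim t)
    show ?case
    proof
      assume t: "t \<in> ?I"
      have "AE z in lborel. transport g t z = ereal (\<Gamma> (t, z))" using elim(1) t by simp
      from collision_operators_AE[OF \<Gamma> R this]
      show "AE z in lborel. h t z = ereal (?H (t, z))"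
        using elim(2)[rule_format, OF t]
      proof eventually_elim
        case (elim z)
        then show ?case using t by (cases "h t z") (auto simp: netF_def)
      qed
    qed
  qed
  have integral_form: "AE z in lborel. transport g b z = ereal (duhamel \<Gamma> (b, z))" if b: "b \<in> ?I" for b
  proof (cases "b = 0")
    case True
    then show ?thesis using init f0 by (auto elim: eventually_elim2 simp: duhamel_zero[OF \<Gamma>])
  next
    case False
    with b have b0: "0 < b" by (auto simp: time_set_def)
    have zero: "0 \<in> ?I" by (rule I(2)[OF b]) (use b0 in auto)
    have real: "AE z in lborel. transport g t z = ereal (real_of_ereal (transport g t z))" if "t \<in> ?I" for t
      using g_bound[OF that]
    proof eventually_elim
      case (elim z)
      then show ?case by (cases "transport g t z") auto
    qed
    have "AE z in lborel. real_of_ereal (transport g b z) = real_of_ereal (transport g 0 z) + (\<integral>s. indicator {0..b} s * ?H (s, z) \<partial>lborel)"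
    proof (rule weak_solution_integral_form[OF refl Mx_integrable M_pos \<Gamma> g\<Gamma> real _ g_cont _ _ _ _ hH weak b b0])
      show "(\<lambda>z. real_of_ereal (transport g t z)) \<in> borel_measurable borel" if "t \<in> ?I" for t
        using g_meas[OF that] by measurable
      show "?H \<in> borel_measurable borel" by measurable
      show "integrable lborel (\<lambda>t. ?H (t, z))" for z
        using integrable_mult_indicator[OF _ \<Theta>_integrable[OF \<Gamma>, of z], of ?I] by simp
      have "(\<integral>\<^sup>+ t. \<integral>\<^sup>+ z. ennreal \<bar>?H (t, z)\<bar> \<partial>lborel \<partial>lborel) \<le> (\<integral>\<^sup>+ t. \<integral>\<^sup>+ z. ennreal \<bar>netF \<Gamma> (t, z)\<bar> \<partial>lborel \<partial>lborel)"
        by (intro nn_integral_mono ennreal_leI) (simp add: indicator_def)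
      also have "\<dots> = (\<integral>\<^sup>+ z. \<integral>\<^sup>+ t. ennreal \<bar>netF \<Gamma> (t, z)\<bar> \<partial>lborel \<partial>lborel)"
        by (rule nn_integral_lborel_swap[where f = "\<lambda>p. ennreal \<bar>netF \<Gamma> p\<bar>"]) measurable
      also have "\<dots> \<le> (\<integral>\<^sup>+ z. ennreal (R * Mx z) \<partial>lborel)"
      proof (rule nn_integral_mono)
        fix z
        have "(\<integral>\<^sup>+ t. ennreal \<bar>netF \<Gamma> (t, z)\<bar> \<partial>lborel) \<le> ennreal ((R - m) * Mx z)" by (rule \<Theta>_bound[OF \<Gamma>])
        also have "\<dots> \<le> ennreal (R * Mx z)" using m_nonneg M_pos[of z] by (intro ennreal_leI mult_right_mono) auto
        finally show "(\<integral>\<^sup>+ t. ennreal \<bar>netF \<Gamma> (t, z)\<bar> \<partial>lborel) \<le> ennreal (R * Mx z)" .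
      qed
      also note RM_finite
      finally show "(\<integral>\<^sup>+ t. \<integral>\<^sup>+ z. ennreal \<bar>?H (t, z)\<bar> \<partial>lborel \<partial>lborel) < \<infinity>" .
    qed auto
    then show ?thesis
      using real[OF b] init f0
    proof eventually_elim
      case (elim z)
      have "(\<integral>s. indicator {0..b} s * ?H (s, z) \<partial>lborel) = (\<integral>s. indicator {0..b} s * netF \<Gamma> (s, z) \<partial>lborel)"
        by (intro Bochner_Integration.integral_cong refl) (use I(2)[OF b] in \<open>auto simp: indicator_def\<close>)
      then have "real_of_ereal (transport g b z) = duhamel \<Gamma> (b, z)"
        using elim(1,3,4) by (simp add: duhamel_def)
      then show ?case using elim(2) by simp
    qed
  qed
  have "AE t in lborel. AE z in lborel. \<Gamma> (t, z) = sol (t, z)"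
  proof (rule solution_unique[OF sol(1) \<Gamma>])
    show "AE t in lborel. AE z in lborel. ennreal \<bar>\<Gamma> (t, z) - sol (t, z)\<bar> \<le> (\<integral>\<^sup>+ s. ennreal \<bar>netF \<Gamma> (s, z) - netF sol (s, z)\<bar> \<partial>lborel)"
      using g\<Gamma>
    proof eventually_elim
      case (elim t)
      show ?case
      proof (cases "t \<in> ?I")
        case True
        then have t: "0 \<le> t" by (auto simp: time_set_def)
        show ?thesis
          using integral_form[OF True] elim[rule_format, OF True]
        proof eventually_elim
          case (elim z)
          then have "\<Gamma> (t, z) = duhamel \<Gamma> (t, z)" by simp
          then show ?case using duhamel_diff[OF \<Gamma> sol(1), of t z] sol(2)[OF t, of z] by simp
        qed
      qed (simp add: \<Gamma>_def)
    qed
  qed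
  from \<Theta>_cong[OF \<Gamma> sol(1) this]
  have "AE z in lborel. AE s in lborel. netF \<Gamma> (s, z) = netF sol (s, z)"
  proof (subst AE_lborel_commute[symmetric])
    have "{p. netF \<Gamma> p = netF sol p} \<in> sets borel" by measurable
    then show "{p. netF \<Gamma> (fst p, snd p) = netF sol (fst p, snd p)} \<in> sets borel" by simp
  qed
  then have "AE z in lborel. transport g b z = transport flow b z"
    using integral_form[OF b]
  proof eventually_elim
    case (elim z)
    have "ennreal \<bar>duhamel \<Gamma> (b, z) - duhamel sol (b, z)\<bar> \<le> (\<integral>\<^sup>+ s. ennreal \<bar>netF \<Gamma> (s, z) - netF sol (s, z)\<bar> \<partial>lborel)"
      by (rule duhamel_diff[OF \<Gamma> sol(1)])
    also have "\<dots> = (\<integral>\<^sup>+ s. 0 \<partial>(lborel :: real measure))"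
      using elim(1) by (intro nn_integral_cong_AE) (auto elim: eventually_mono)
    finally have "duhamel \<Gamma> (b, z) = duhamel sol (b, z)" by simp
    moreover have "0 \<le> b" using b by (simp add: time_set_def)
    ultimately show ?case using elim(2) by (simp add: transport_flow sol(2))
  qed
  then have "AE z in lborel. transport g b (fst z - b *\<^sub>R snd z, snd z) = transport flow b (fst z - b *\<^sub>R snd z, snd z)"
    by (rule AE_lborel_linear_inj[rotated 2])
      (auto intro!: linearI injI simp: algebra_simps prod_eq_iff)
  then show ?thesis by eventually_elim (simp add: transport_def split_beta')
qed

end

text \<open>
  The sum of the dimensional constants of the singular and the Gaussian parts for both kinds of
  collisions, which dominates each of them; \<open>2 * sqrt pi\<close> collects the remaining
  factors.
\<close>

definition collision_constant :: "'n::finite itself \<Rightarrow> real" where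
  "collision_constant _ = (let d = real CARD('n) in 2 * sqrt pi *
     (unit_ball_vol d * d + pi powr (d / 2) + unit_ball_vol (2 * d) * (2 * d) + pi powr d))"

lemma collision_constant_pos: "0 < collision_constant TYPE('n::finite)"
proof -
  have "0 \<le> unit_ball_vol (real CARD('n)) * real CARD('n)" "0 \<le> unit_ball_vol (2 * real CARD('n)) * (2 * real CARD('n))" by simp_all
  moreover have "0 < pi powr (real CARD('n) / 2)" "0 < pi powr real CARD('n)" by simp_all
  ultimately show ?thesis unfolding collision_constant_def Let_def by (intro mult_pos_pos) (simp, simp, linarith)
qed

context boltzmann
begin

lemma collision_rates_le:
  shows "g2.\<kappa> + g3.\<kappa> \<le> K_const TYPE(real^'n) (collision_constant ty) \<gamma>2 b2 \<gamma>3 b3 \<beta> * \<alpha> powr (-1/2)"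
    and "b2_norm TYPE(real^'n) b2 + b3_norm TYPE(real^'n) b3 > 0 \<Longrightarrow> 0 < K_const TYPE(real^'n) (collision_constant ty) \<gamma>2 b2 \<gamma>3 b3 \<beta>"
proof -
  define d where "d = real CARD('n)"
  define N2 N3 where "N2 = enn2real (b2_norm TYPE(real^'n) b2)" and "N3 = enn2real (b3_norm TYPE(real^'n) b3)"
  define p2 p3 where "p2 = 1 / (d + \<gamma>2 - 1)" and "p3 = 1 / (2 * d + \<gamma>3 - 1)"
  define q2 q3 where "q2 = \<beta> powr (- d / 2)" and "q3 = \<beta> powr (- d)"
  define A1 A2 A3 A4 where "A1 = unit_ball_vol d * d" and "A2 = pi powr (d / 2)" and "A3 = unit_ball_vol (2 * d) * (2 * d)" and "A4 = pi powr d"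
  define S where "S = A1 + A2 + A3 + A4"
  have A: "0 \<le> A1" "0 \<le> A2" "0 \<le> A3" "0 \<le> A4" by (simp_all add: A1_def A2_def A3_def A4_def d_def)
  have S: "A1 \<le> S" "A2 \<le> S" "A3 \<le> S" "A4 \<le> S" "0 \<le> S" using A by (simp_all add: S_def)
  have p: "0 < p2" "0 < p3" using g2.\<gamma> g3.\<gamma> by (simp_all add: p2_def p3_def d_def)
  have q: "0 < q2" "0 < q3" using \<beta> by (simp_all add: q2_def q3_def)
  have N: "0 \<le> N2" "0 \<le> N3" by (simp_all add: N2_def N3_def)
  have K: "K_const TYPE(real^'n) (collision_constant ty) \<gamma>2 b2 \<gamma>3 b3 \<beta> = 2 * sqrt pi * S * (N2 * (q2 + p2) + N3 * (q3 + p3))"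
    unfolding K_const_def collision_constant_def Let_def
    by (simp add: S_def A1_def A2_def A3_def A4_def N2_def N3_def p2_def p3_def q2_def q3_def d_def)
  have sq: "sqrt (pi / \<alpha>) = sqrt pi * \<alpha> powr (-1/2)"
    using \<alpha> by (simp add: real_sqrt_divide powr_minus_divide powr_half_sqrt)
  have k2: "g2.\<kappa> = \<alpha> powr (-1/2) * (2 * sqrt pi * (N2 * (A1 * p2 + A2 * q2)))"
    unfolding g2.\<kappa>_def cross_bound_def sq
    by (simp add: N2_def A1_def A2_def p2_def q2_def d_def algebra_simps)
  have k3: "g3.\<kappa> = \<alpha> powr (-1/2) * (2 * sqrt pi * (N3 * (A3 * p3 + A4 * q3)))"
    unfolding g3.\<kappa>_def cross_bound_def sq
    by (simp add: N3_def A3_def A4_def p3_def q3_def d_def algebra_simps mult_2[symmetric])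
  have "N2 * (A1 * p2 + A2 * q2) + N3 * (A3 * p3 + A4 * q3) \<le> N2 * (S * p2 + S * q2) + N3 * (S * p3 + S * q3)"
    using S p q N by (intro add_mono mult_left_mono mult_right_mono) auto
  also have "\<dots> = S * (N2 * (q2 + p2) + N3 * (q3 + p3))" by (simp add: algebra_simps)
  finally have "\<alpha> powr (-1/2) * (2 * sqrt pi * (N2 * (A1 * p2 + A2 * q2) + N3 * (A3 * p3 + A4 * q3))) \<le>
      \<alpha> powr (-1/2) * (2 * sqrt pi * (S * (N2 * (q2 + p2) + N3 * (q3 + p3))))"
    by (intro mult_left_mono) simp_all
  then show "g2.\<kappa> + g3.\<kappa> \<le> K_const TYPE(real^'n) (collision_constant ty) \<gamma>2 b2 \<gamma>3 b3 \<beta> * \<alpha> powr (-1/2)"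
    unfolding K k2 k3 by (simp add: algebra_simps)
  assume "b2_norm TYPE(real^'n) b2 + b3_norm TYPE(real^'n) b3 > 0"
  then have "0 < b2_norm TYPE(real^'n) b2 \<or> 0 < b3_norm TYPE(real^'n) b3" by (metis add.right_neutral not_gr_zero)
  then have "0 < N2 \<or> 0 < N3"
    using b2 b3 by (auto simp: N2_def N3_def binary_kernel_def ternary_kernel_def enn2real_positive_iff)
  then have "0 < N2 * (q2 + p2) + N3 * (q3 + p3)"
    using N p q by (auto intro: add_pos_nonneg add_nonneg_pos)
  moreover have "0 < S" using A by (simp add: S_def A2_def add_pos_nonneg add_nonneg_pos)
  ultimately show "0 < K_const TYPE(real^'n) (collision_constant ty) \<gamma>2 b2 \<gamma>3 b3 \<beta>" unfolding K by simp
qed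

end

theorem theorem2p10:
  assumes "CARD('n::finite) \<ge> 2"
  shows "\<exists>C::real. C > 0 \<and>
    (\<forall>(\<gamma>2::real) (\<gamma>3::real) (b2 :: real \<Rightarrow> real) (b3 :: real \<times> real \<Rightarrow> real) (T::ereal) (\<alpha>::real) (\<beta>::real).
      binary_kernel TYPE(real^'n) \<gamma>2 b2 \<and> ternary_kernel TYPE(real^'n) \<gamma>3 b3 \<and>
      b2_norm TYPE(real^'n) b2 + b3_norm TYPE(real^'n) b3 > 0 \<and>
      0 < T \<and> 0 < \<alpha> \<and> 0 < \<beta> \<longrightarrow>
      (let K = K_const TYPE(real^'n) C \<gamma>2 b2 \<gamma>3 b3 \<beta> in
        0 < K \<and>
        (\<forall>f0 \<in> (M_space_pos \<alpha> \<beta> :: (real^'n) phase_fun set).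
          M_norm \<alpha> \<beta> f0 <
            ereal (\<alpha> powr (1/2) / (48 * K * (1 + \<alpha> powr (1/4) / (2 * sqrt (6 * K))))) \<longrightarrow>
          (let bound =
             (1 - sqrt (1 - 48 * K * \<alpha> powr (-1/2) * (1 + \<alpha> powr (1/4) / (2 * sqrt (6 * K))) *
                            real_of_ereal (M_norm \<alpha> \<beta> f0)))
             / (24 * K * \<alpha> powr (-1/2) * (1 + \<alpha> powr (1/4) / (2 * sqrt (6 * K))))
           in \<exists>f. mild_solution \<gamma>2 b2 \<gamma>3 b3 \<alpha> \<beta> T f0 f \<and>
                  sup_norm T \<alpha> \<beta> (transport f) \<le> ereal bound \<and>
                  (\<forall>g. mild_solution \<gamma>2 b2 \<gamma>3 b3 \<alpha> \<beta> T f0 g \<and>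
                       sup_norm T \<alpha> \<beta> (transport g) \<le> ereal bound \<longrightarrow>
                       (\<forall>t\<in>time_set T. AE z in lborel. g t z = f t z))))))"
proof (rule exI[of _ "collision_constant TYPE('n)"], intro conjI allI impI)
  show "0 < collision_constant TYPE('n)" by (rule collision_constant_pos)
  fix \<gamma>2 \<gamma>3 :: real and b2 :: "real \<Rightarrow> real" and b3 :: "real \<times> real \<Rightarrow> real" and T :: ereal and \<alpha> \<beta> :: real
  assume a: "binary_kernel TYPE(real^'n) \<gamma>2 b2 \<and> ternary_kernel TYPE(real^'n) \<gamma>3 b3 \<and>
      b2_norm TYPE(real^'n) b2 + b3_norm TYPE(real^'n) b3 > 0 \<and> 0 < T \<and> 0 < \<alpha> \<and> 0 < \<beta>"
  define K where "K = K_const TYPE(real^'n) (collision_constant TYPE('n)) \<gamma>2 b2 \<gamma>3 b3 \<beta>"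
  interpret boltzmann "TYPE('n)" \<gamma>2 b2 \<gamma>3 b3 \<alpha> \<beta>
    by (rule boltzmann.intro) (use a assms in auto)
  have K0: "0 < K" unfolding K_def using a by (intro collision_rates_le(2)) simp
  have main: "\<exists>f. mild_solution \<gamma>2 b2 \<gamma>3 b3 \<alpha> \<beta> T f0 f \<and> sup_norm T \<alpha> \<beta> (transport f) \<le> ereal R \<and>
      (\<forall>g. mild_solution \<gamma>2 b2 \<gamma>3 b3 \<alpha> \<beta> T f0 g \<and> sup_norm T \<alpha> \<beta> (transport g) \<le> ereal R \<longrightarrow>
        (\<forall>t\<in>time_set T. AE z in lborel. g t z = f t z))"
    if f0: "f0 \<in> M_space_pos \<alpha> \<beta>" and small: "M_norm \<alpha> \<beta> f0 < ereal (\<alpha> powr (1/2) / (48 * K * (1 + \<alpha> powr (1/4) / (2 * sqrt (6 * K)))))"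
      and R: "R = (1 - sqrt (1 - 48 * K * \<alpha> powr (-1/2) * (1 + \<alpha> powr (1/4) / (2 * sqrt (6 * K))) * real_of_ereal (M_norm \<alpha> \<beta> f0)))
             / (24 * K * \<alpha> powr (-1/2) * (1 + \<alpha> powr (1/4) / (2 * sqrt (6 * K))))"
    for f0 :: "(real^'n) phase_fun" and R
  proof -
    let ?m = "real_of_ereal (M_norm \<alpha> \<beta> f0)"
    note rep = real_representative[OF f0]
    have m: "?m < \<alpha> powr (1/2) / (48 * K * (1 + \<alpha> powr (1/4) / (2 * sqrt (6 * K))))"
      using small by (subst (asm) rep(1)) simp
    note radius = contraction_radius[OF K0 \<alpha> g2.\<kappa>_nonneg g3.\<kappa>_nonneg collision_rates_le(1)[folded K_def] rep(2) m, folded R]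
    from rep(3) obtain F0 where F0: "F0 \<in> borel_measurable borel" "\<And>z. 0 \<le> F0 z \<and> F0 z \<le> ?m * Mx z"
      "AE z in lborel. f0 z = ereal (F0 z)" by blast
    interpret small_data "TYPE('n)" \<gamma>2 b2 \<gamma>3 b3 \<alpha> \<beta> R ?m F0 f0
      by unfold_locales (rule radius F0)+
    show ?thesis using flow_mild_solution flow_sup_norm mild_solution_unique by blast
  qed
  show "let K = K_const TYPE(real^'n) (collision_constant TYPE('n)) \<gamma>2 b2 \<gamma>3 b3 \<beta> in
        0 < K \<and>
        (\<forall>f0 \<in> (M_space_pos \<alpha> \<beta> :: (real^'n) phase_fun set).
          M_norm \<alpha> \<beta> f0 <
            ereal (\<alpha> powr (1/2) / (48 * K * (1 + \<alpha> powr (1/4) / (2 * sqrt (6 * K))))) \<longrightarrow>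
          (let bound =
             (1 - sqrt (1 - 48 * K * \<alpha> powr (-1/2) * (1 + \<alpha> powr (1/4) / (2 * sqrt (6 * K))) *
                            real_of_ereal (M_norm \<alpha> \<beta> f0)))
             / (24 * K * \<alpha> powr (-1/2) * (1 + \<alpha> powr (1/4) / (2 * sqrt (6 * K))))
           in \<exists>f. mild_solution \<gamma>2 b2 \<gamma>3 b3 \<alpha> \<beta> T f0 f \<and>
                  sup_norm T \<alpha> \<beta> (transport f) \<le> ereal bound \<and>
                  (\<forall>g. mild_solution \<gamma>2 b2 \<gamma>3 b3 \<alpha> \<beta> T f0 g \<and>
                       sup_norm T \<alpha> \<beta> (transport g) \<le> ereal bound \<longrightarrow>
                       (\<forall>t\<in>time_set T. AE z in lborel. g t z = f t z))))"
    unfolding Let_def K_def[symmetric] using K0 main[OF _ _ refl] by blast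
qed

end
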